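(* Let $m_0$ be a Borel probability measure on $\mathcal G$ with bounded support, let the costs satisfy the standing assumptions listed in the context, and assume that $G_i[m']\in C^1(\mathbb R_+)$ for all $i\in\{1,\dots,N\}$, $m'\in\mathcal P_1(\mathcal G)$. Let $C,V>0$, let $\mu\in\mathcal P_{m_0}(\Gamma^{\rm Lip}_{C,V})$ be a relaxed equilibrium and let $(u,m)$ be the related mild solution. Then: (a) For every $i$, $u$ is locally semi-concave in $(J_i\setminus\{0\})\times(0,T)$. (b) Let $t\in[0,T)$, $x=\bar xe_i\in J_i\setminus\{0\}$, $y\in\Gamma_t^{\mu,{\rm opt}}[x]$, let $t_*=T\wedge\min\{\tau\in[t,T]:y(\tau)=0\}$, and write $y(s)=\bar y(s)e_i$ for $s\in(t,t_* )$. Then: (i) for every $s\in(t,t_* )$, $\mathcal A(y(s),s)$ is a singleton; (ii) $D_xu(x,t)$ exists if and only if $\mathcal A(x,t)$ is a singleton, and in this case $$\mathcal A(x,t)=\big(\partial_aL_i[m(t)](\bar x,\cdot)\big)^{-1}\big(\{-D_xu(x,t)\}\big)=\big\{-\partial_pH_i(\bar x,D_xu(x,t),t)\big\};$$ (iii) for all $s\in(t,t_* )$, $u(\cdot,s)$ is differentiable at $y(s)$ with $D_xu(y(s),s)=-\partial_aL_i[m(s)](\bar y(s),\bar y'(s))$.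
   Context: Junction: $N>1$ is an integer, $(e_i)$ is the canonical basis of $\mathbb R^N$, $\mathbb R_+=[0,\infty)$, $J_i=\mathbb R_+e_i$, $\mathcal G=\bigcup_{i=1}^N J_i\subset\mathbb R^N$, vertex $0$; $d(x,y)=|x-y|$ if $x,y$ lie in the same edge, $d(x,y)=|x|+|y|$ otherwise. Fix $T>0$, $p>1$. The minimum of the empty set is $+\infty$. For $x\in J_i\setminus\{0\}$, $D_xu(x,t)$ is the derivative at $|x|$ of $r\mapsto u(re_i,t)$. Trajectories: $\Gamma_t[x]$ is the set of $y\in C([t,T];\mathcal G)\cap W^{1,p}(t,T;\mathbb R^N)$ with $y(t)=x$; $\Gamma[x]=\Gamma_0[x]$; $\bar y=|y|$. For $C,V>0$: $\Gamma_C[x]=\{y\in\Gamma[x]:\|y\|_{L^\infty(0,T)}\le C,\ \|y'\|_{L^p(0,T)}\le C\}$, $\Gamma_C=\bigcup_x\Gamma_C[x]$, $\Gamma^{\rm Lip}_{C,V}=\{y\in\Gamma_C:\|y'\|_{L^\infty(0,T)}\le V\}$, with the topology of uniform convergence. Measures: $\mathcal P(X)$ is the set of Borel probability measures on $X$; $\mathcal P_1(\mathcal G)$ is the set of those on $\mathcal G$ with finite first moment, with the Kantorovich–Rubinstein distance $d_1$. $m^\mu(t)=e_t\sharp\mu$ with $e_t(y)=y(t)$. $\mathcal P_{m_0}(\Gamma_C)$ (resp. $\mathcal P_{m_0}(\Gamma^{\rm Lip}_{C,V})$) is the set of $\mu\in\mathcal P(\Gamma_C)$ (resp. $\mathcal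 P(\Gamma^{\rm Lip}_{C,V})$, viewed inside $\mathcal P(\Gamma_C)$) with $e_0\sharp\mu=m_0$. Costs: $m\mapsto L_i[m]$ is continuous from $\mathcal P_1(\mathcal G)$ to $C^1(\mathbb R_+\times\mathbb R)$ (functions of $(x,a)$; $C^1$ convergence on compact sets), $G_i\in C_b(\mathcal P_1(\mathcal G);C_b(\mathbb R_+))$, $L_*,G_*\in C_b(\mathcal P_1(\mathcal G);\mathbb R)$, where $C_b$ denotes bounded continuous functions. Standing assumptions: (1) there is $C_0>0$ with $L_i[m](x,a)\ge C_0(|a|^p-1)$ and $L_*[m]\ge-C_0$ for all $i,m,x,a$; (2) for any $r>0$ there is a modulus $\omega_r$ with $|L_i[m_1](x,a)-L_i[m_2](x,a)|\le(1+|a|^p)\omega_r(d_1(m_1,m_2))$ for all $i$, $m_1,m_2\in\mathcal P_1(\mathcal G)$, $x\in[0,r]$, $a\in\mathbb R$; (3) for any $r>0$ there is $\tilde c(r)\ge0$ with $|\partial_xL_i[m](x,a)|\le\tilde c(r)(|a|^p+1)$ and $|\partial_aL_i[m](x,a)|\le\tilde c(r)(|a|^{p-1}+1)$ for all $i,m$, $x\in[0,r]$, $a\in\mathbb R$; (4) $a\mapsto L_i[m](x,a)$ is strictly convex for all $i$, $m$, $x\in\mathbb R_+$. $L_0[m]=\min\{L_*[m],\min_iL_i[m](0,0)\}$; $L[m](y(t),y'(t))=\sum_iL_i[m](\bar y(t),\bar y'(t))\mathbf 1_{y(t)\in J_i\setminus\{0\}}+L_0[m]\mathbf 1_{y(t)=0}$;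 $G[m](x)=\sum_iG_i[m](|x|)\mathbf 1_{x\in J_i\setminus\{0\}}+\min\{G_*[m],\min_iG_i[m](0)\}\mathbf 1_{x=0}$; $J_t^\mu(x;y)=\int_t^TL[m^\mu(\tau)](y(\tau),y'(\tau))\,d\tau+G[m^\mu(T)](y(T))$ for $y\in\Gamma_t[x]$. Relaxed equilibrium: $\mu\in\mathcal P_{m_0}(\Gamma_C)$ such that every $y\in\operatorname{supp}(\mu)$ belongs, for some $x\in\operatorname{supp}(m_0)$, to $\{y\in\Gamma_C[x]:J_0^\mu(x;y)=\min_{\tilde y\in\Gamma[x]}J_0^\mu(x;\tilde y)\}$. The mild solution related to $\mu$ is $(u,m)$ with $m(t)=m^\mu(t)$, $u(x,t)=\inf_{y\in\Gamma_t[x]}J_t^\mu(x;y)$. $\Gamma_t^{\mu,{\rm opt}}[x]=\{y\in\Gamma_t[x]:J_t^\mu(x;y)=u(x,t)\}$. For $x\in J_i\setminus\{0\}$, $t\in[0,T)$: $\mathcal A(x,t)=\{z'(t)\cdot e_i:z\in\Gamma_t^{\mu,{\rm opt}}[x]\}$, where $z'(t)$ is the (right) derivative at $t$; it is well defined because optimal trajectories starting at $x\ne0$ are $C^1$ on a right neighbourhood $[t,t+\epsilon)$. $H_i(x,q,t)=\sup_{\zeta\in\mathbb R}\{-q\zeta-L_i[m(t)](x,\zeta)\}$ for $x\in\mathbb R_+$, $q\in\mathbb R$, and $\partial_pH_i$ is its derivative in the second argument. Local semi-concavity (identify $(J_i\setminus\{0\})\times(0,T)$ with $(0,\infty)\times(0,T)$):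 a function $w$ on an open set $A\subset\mathbb R^2$ is locally semi-concave if for every compact $S\subset A$ there is a nondecreasing upper semicontinuous $\omega:\mathbb R_+\to\mathbb R_+$ with $\lim_{\rho\to0^+}\omega(\rho)=0$ and $\lambda w(X)+(1-\lambda)w(Y)-w(\lambda X+(1-\lambda)Y)\le\lambda(1-\lambda)|X-Y|\,\omega(|X-Y|)$ for all $\lambda\in[0,1]$ and $X,Y$ with the segment $[X,Y]\subset S$. *)

theory Defs
  imports "HOL-Probability.Probability"
begin

definition edge :: "'n::finite \<Rightarrow> (real^'n) set" where
  "edge i = {r *\<^sub>R axis i 1 | r. r \<ge> 0}"

definition junction :: "(real^'n::finite) set" where
  "junction = (\<Union>i. edge i)"

definition jdist :: "real^'n::finite \<Rightarrow> real^'n \<Rightarrow> real" where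
  "jdist x y = (if \<exists>i. x \<in> edge i \<and> y \<in> edge i then norm (x - y) else norm x + norm y)"

text \<open>On the junction, the norm of \<open>x - y\<close> is at most \<open>jdist x y\<close>, which is at most
  \<open>sqrt 2\<close> times that norm. So the junction has the subspace topology of the ambient Euclidean
  space, and continuity of curves and boundedness of sets may be stated with the ambient norm.\<close>

abbreviation junction_top :: "(real^'n::finite) topology" where
  "junction_top \<equiv> top_of_set junction"

definition borel_of :: "'a topology \<Rightarrow> 'a measure" where
  "borel_of X = sigma (topspace X) {U. openin X U}"

definition borel_probs :: "'a topology \<Rightarrow> 'a measure set" where
  "borel_probs X = {\<mu>. sets \<mu> = sets (borel_of X) \<and> prob_space \<mu>}"

definition measure_supp :: "'a topology \<Rightarrow> 'a measure \<Rightarrow> 'a set" where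
  "measure_supp X \<mu> = {x \<in> topspace X. \<forall>U. openin X U \<longrightarrow> x \<in> U \<longrightarrow> emeasure \<mu> U > 0}"

definition P1 :: "(real^'n::finite) measure set" where
  "P1 = {m \<in> borel_probs junction_top. integrable m (\<lambda>x. jdist 0 x)}"

text \<open>The Kantorovich--Rubinstein distance, as the supremum over functions that are 1-Lipschitz
  for the junction distance. On \<open>P1\<close> the supremum is over a bounded nonempty set of reals.\<close>

definition KR_dist :: "(real^'n::finite) measure \<Rightarrow> (real^'n) measure \<Rightarrow> real" where
  "KR_dist m1 m2 =
    (SUP f\<in>{f. \<forall>x\<in>junction. \<forall>y\<in>junction. \<bar>f x - f y\<bar> \<le> jdist x y}.
       integral\<^sup>L m1 f - integral\<^sup>L m2 f)"

text \<open>\<open>g\<close> is a weak derivative of \<open>f\<close> on the open interval from \<open>t\<close> to \<open>T\<close>; the test functions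
  are the compactly supported functions of class \<open>C\<^sup>1\<close>.\<close>

definition has_weak_deriv ::
    "real \<Rightarrow> real \<Rightarrow> (real \<Rightarrow> 'a::euclidean_space) \<Rightarrow> (real \<Rightarrow> 'a) \<Rightarrow> bool" where
  "has_weak_deriv t T f g \<longleftrightarrow>
    (\<forall>\<phi> \<phi>'. (\<forall>s. (\<phi> has_real_derivative \<phi>' s) (at s)) \<and> continuous_on UNIV \<phi>' \<and>
        compact (closure {s. \<phi> s \<noteq> 0}) \<and> closure {s. \<phi> s \<noteq> 0} \<subseteq> {t<..<T} \<longrightarrow>
      integral\<^sup>L (lebesgue_on {t<..<T}) (\<lambda>s. \<phi>' s *\<^sub>R f s) =
      - integral\<^sup>L (lebesgue_on {t<..<T}) (\<lambda>s. \<phi> s *\<^sub>R g s))"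

definition in_Lp :: "real \<Rightarrow> real \<Rightarrow> real \<Rightarrow> (real \<Rightarrow> 'a::euclidean_space) \<Rightarrow> bool" where
  "in_Lp p t T f \<longleftrightarrow> f \<in> borel_measurable (lebesgue_on {t<..<T}) \<and>
     integrable (lebesgue_on {t<..<T}) (\<lambda>s. norm (f s) powr p)"

definition in_W1p :: "real \<Rightarrow> real \<Rightarrow> real \<Rightarrow> (real \<Rightarrow> 'a::euclidean_space) \<Rightarrow> bool" where
  "in_W1p p t T f \<longleftrightarrow> in_Lp p t T f \<and> (\<exists>g. in_Lp p t T g \<and> has_weak_deriv t T f g)"

text \<open>A representative of the weak derivative, which is unique up to a null set among integrable
  functions. It is only used below in ways that do not depend on the representative.\<close>

definition wderiv :: "real \<Rightarrow> real \<Rightarrow> (real \<Rightarrow> 'a::euclidean_space) \<Rightarrow> real \<Rightarrow> 'a" where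
  "wderiv t T f = (SOME g. integrable (lebesgue_on {t<..<T}) g \<and> has_weak_deriv t T f g)"

definition Lp_norm :: "real \<Rightarrow> real \<Rightarrow> real \<Rightarrow> (real \<Rightarrow> 'a::euclidean_space) \<Rightarrow> real" where
  "Lp_norm p t T f = (integral\<^sup>L (lebesgue_on {t<..<T}) (\<lambda>s. norm (f s) powr p)) powr (1 / p)"

definition Linf_norm :: "real \<Rightarrow> real \<Rightarrow> (real \<Rightarrow> 'a::euclidean_space) \<Rightarrow> ereal" where
  "Linf_norm t T f = esssup (lebesgue_on {t<..<T}) (\<lambda>s. ereal (norm (f s)))"

text \<open>A curve on \<open>{t..T}\<close> is represented by the total function that is \<open>undefined\<close> outside
  \<open>{t..T}\<close>, so that equality of curves is equality of functions.\<close>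

definition Gam :: "real \<Rightarrow> real \<Rightarrow> real \<Rightarrow> real^'n::finite \<Rightarrow> (real \<Rightarrow> real^'n) set" where
  "Gam p T t x = {y \<in> extensional {t..T}. continuous_on {t..T} y \<and> y ` {t..T} \<subseteq> junction \<and>
     in_W1p p t T y \<and> y t = x}"

definition Gam_C_at :: "real \<Rightarrow> real \<Rightarrow> real \<Rightarrow> real^'n::finite \<Rightarrow> (real \<Rightarrow> real^'n) set" where
  "Gam_C_at p T C x =
    {y \<in> Gam p T 0 x. Linf_norm 0 T y \<le> ereal C \<and> Lp_norm p 0 T (wderiv 0 T y) \<le> C}"

definition Gam_C :: "real \<Rightarrow> real \<Rightarrow> real \<Rightarrow> (real \<Rightarrow> real^'n::finite) set" where
  "Gam_C p T C = (\<Union>x\<in>junction. Gam_C_at p T C x)"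

definition Gam_Lip :: "real \<Rightarrow> real \<Rightarrow> real \<Rightarrow> real \<Rightarrow> (real \<Rightarrow> real^'n::finite) set" where
  "Gam_Lip p T C V = {y \<in> Gam_C p T C. Linf_norm 0 T (wderiv 0 T y) \<le> ereal V}"

text \<open>\<open>cfunspace\<close> is the space of bounded continuous functions with the supremum distance, so this is
  the topology of uniform convergence on \<open>S\<close>.\<close>

definition curve_top :: "real \<Rightarrow> (real \<Rightarrow> real^'n::finite) set \<Rightarrow> (real \<Rightarrow> real^'n) topology" where
  "curve_top T S = subtopology (mtopology_of (cfunspace (top_of_set {0..T}) euclidean_metric)) S"

definition flow :: "(real \<Rightarrow> real^'n::finite) measure \<Rightarrow> real \<Rightarrow> (real^'n) measure" where
  "flow \<mu> t = distr \<mu> (borel_of junction_top) (\<lambda>y. y t)"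

definition P_C ::
    "real \<Rightarrow> real \<Rightarrow> real \<Rightarrow> (real^'n::finite) measure \<Rightarrow> (real \<Rightarrow> real^'n) measure set" where
  "P_C p T C m0 = {\<mu> \<in> borel_probs (curve_top T (Gam_C p T C)). flow \<mu> 0 = m0}"

text \<open>Measures on the Lipschitz curves are viewed as measures on \<open>Gam_C\<close> by pushing them forward
  along the inclusion.\<close>

definition P_Lip ::
    "real \<Rightarrow> real \<Rightarrow> real \<Rightarrow> real \<Rightarrow> (real^'n::finite) measure \<Rightarrow> (real \<Rightarrow> real^'n) measure set" where
  "P_Lip p T C V m0 =
    {distr \<nu> (borel_of (curve_top T (Gam_C p T C))) (\<lambda>y. y) | \<nu>.
       \<nu> \<in> borel_probs (curve_top T (Gam_Lip p T C V)) \<and> flow \<nu> 0 = m0}"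

text \<open>Costs take a measure first; \<open>L i m x a\<close> and \<open>G i m x\<close> are meaningful for \<open>m \<in> P1\<close> and
  \<open>x \<ge> 0\<close> only. The \<open>x\<close>-derivative is one-sided at \<open>x = 0\<close>.\<close>

definition d_x :: "(real \<Rightarrow> real \<Rightarrow> real) \<Rightarrow> real \<Rightarrow> real \<Rightarrow> real" where
  "d_x f x a = vector_derivative (\<lambda>\<xi>. f \<xi> a) (at x within {0..})"

definition d_a :: "(real \<Rightarrow> real \<Rightarrow> real) \<Rightarrow> real \<Rightarrow> real \<Rightarrow> real" where
  "d_a f x a = deriv (f x) a"

definition C1_halfplane :: "(real \<Rightarrow> real \<Rightarrow> real) \<Rightarrow> bool" where
  "C1_halfplane f \<longleftrightarrow>
    (\<forall>x\<ge>0. \<forall>a. (\<lambda>\<xi>. f \<xi> a) differentiable (at x within {0..}) \<and> f x differentiable (at a)) \<and>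
    continuous_on ({0..} \<times> UNIV) (\<lambda>(x, a). f x a) \<and>
    continuous_on ({0..} \<times> UNIV) (\<lambda>(x, a). d_x f x a) \<and>
    continuous_on ({0..} \<times> UNIV) (\<lambda>(x, a). d_a f x a)"

definition C1_halfline :: "(real \<Rightarrow> real) \<Rightarrow> bool" where
  "C1_halfline g \<longleftrightarrow>
    (\<exists>g'. (\<forall>x\<ge>0. (g has_real_derivative g' x) (at x within {0..})) \<and> continuous_on {0..} g')"

definition continuous_into_C1 :: "((real^'n::finite) measure \<Rightarrow> real \<Rightarrow> real \<Rightarrow> real) \<Rightarrow> bool" where
  "continuous_into_C1 F \<longleftrightarrow>
    (\<forall>m\<in>P1. C1_halfplane (F m)) \<and>
    (\<forall>m\<in>P1. \<forall>K. compact K \<longrightarrow> K \<subseteq> {0..} \<times> UNIV \<longrightarrow> (\<forall>\<epsilon>>0. \<exists>\<delta>>0. \<forall>m'\<in>P1. KR_dist m m' < \<delta> \<longrightarrow>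
       (\<forall>(x, a)\<in>K. \<bar>F m' x a - F m x a\<bar> < \<epsilon> \<and> \<bar>d_x (F m') x a - d_x (F m) x a\<bar> < \<epsilon> \<and>
          \<bar>d_a (F m') x a - d_a (F m) x a\<bar> < \<epsilon>)))"

definition Cb_into_Cb :: "((real^'n::finite) measure \<Rightarrow> real \<Rightarrow> real) \<Rightarrow> bool" where
  "Cb_into_Cb F \<longleftrightarrow>
    (\<forall>m\<in>P1. continuous_on {0..} (F m)) \<and>
    (\<exists>B. \<forall>m\<in>P1. \<forall>x\<ge>0. \<bar>F m x\<bar> \<le> B) \<and>
    (\<forall>m\<in>P1. \<forall>\<epsilon>>0. \<exists>\<delta>>0. \<forall>m'\<in>P1. KR_dist m m' < \<delta> \<longrightarrow> (\<forall>x\<ge>0. \<bar>F m' x - F m x\<bar> < \<epsilon>))"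

definition Cb_into_real :: "((real^'n::finite) measure \<Rightarrow> real) \<Rightarrow> bool" where
  "Cb_into_real F \<longleftrightarrow>
    (\<exists>B. \<forall>m\<in>P1. \<bar>F m\<bar> \<le> B) \<and>
    (\<forall>m\<in>P1. \<forall>\<epsilon>>0. \<exists>\<delta>>0. \<forall>m'\<in>P1. KR_dist m m' < \<delta> \<longrightarrow> \<bar>F m' - F m\<bar> < \<epsilon>)"

definition modulus :: "(real \<Rightarrow> real) \<Rightarrow> bool" where
  "modulus \<omega> \<longleftrightarrow> (\<forall>\<rho>\<ge>0. \<omega> \<rho> \<ge> 0) \<and> mono_on {0..} \<omega> \<and> (\<omega> \<longlongrightarrow> 0) (at_right 0)"

definition strictly_convex :: "(real \<Rightarrow> real) \<Rightarrow> bool" where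
  "strictly_convex f \<longleftrightarrow>
    (\<forall>a b. \<forall>\<theta>\<in>{0<..<1}. a \<noteq> b \<longrightarrow> f (\<theta> * a + (1 - \<theta>) * b) < \<theta> * f a + (1 - \<theta>) * f b)"

definition vertex_L ::
    "('n::finite \<Rightarrow> (real^'n) measure \<Rightarrow> real \<Rightarrow> real \<Rightarrow> real) \<Rightarrow> ((real^'n) measure \<Rightarrow> real) \<Rightarrow>
     (real^'n) measure \<Rightarrow> real" where
  "vertex_L L Ls m = min (Ls m) (Min (range (\<lambda>i. L i m 0 0)))"

text \<open>Here \<open>a\<close> stands for the derivative of \<open>norm y\<close>, not for the velocity of \<open>y\<close>.\<close>

definition running_cost ::
    "('n::finite \<Rightarrow> (real^'n) measure \<Rightarrow> real \<Rightarrow> real \<Rightarrow> real) \<Rightarrow> ((real^'n) measure \<Rightarrow> real) \<Rightarrow>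
     (real^'n) measure \<Rightarrow> real^'n \<Rightarrow> real \<Rightarrow> real" where
  "running_cost L Ls m y a =
    (\<Sum>i\<in>UNIV. L i m (norm y) a * indicator (edge i - {0}) y) + vertex_L L Ls m * indicator {0} y"

definition final_cost ::
    "('n::finite \<Rightarrow> (real^'n) measure \<Rightarrow> real \<Rightarrow> real) \<Rightarrow> ((real^'n) measure \<Rightarrow> real) \<Rightarrow>
     (real^'n) measure \<Rightarrow> real^'n \<Rightarrow> real" where
  "final_cost G Gs m x =
    (\<Sum>i\<in>UNIV. G i m (norm x) * indicator (edge i - {0}) x) +
    min (Gs m) (Min (range (\<lambda>i. G i m 0))) * indicator {0} x"

definition J_cost ::
    "real \<Rightarrow> ('n::finite \<Rightarrow> (real^'n) measure \<Rightarrow> real \<Rightarrow> real \<Rightarrow> real) \<Rightarrow> ((real^'n) measure \<Rightarrow> real) \<Rightarrow>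
     ('n \<Rightarrow> (real^'n) measure \<Rightarrow> real \<Rightarrow> real) \<Rightarrow> ((real^'n) measure \<Rightarrow> real) \<Rightarrow>
     (real \<Rightarrow> real^'n) measure \<Rightarrow> real \<Rightarrow> (real \<Rightarrow> real^'n) \<Rightarrow> real" where
  "J_cost T L Ls G Gs \<mu> t y =
    integral\<^sup>L (lebesgue_on {t..T})
      (\<lambda>\<tau>. running_cost L Ls (flow \<mu> \<tau>) (y \<tau>) (wderiv t T (\<lambda>s. norm (y s)) \<tau>)) +
    final_cost G Gs (flow \<mu> T) (y T)"

definition relaxed_equilibrium ::
    "real \<Rightarrow> real \<Rightarrow> ('n::finite \<Rightarrow> (real^'n) measure \<Rightarrow> real \<Rightarrow> real \<Rightarrow> real) \<Rightarrow> ((real^'n) measure \<Rightarrow> real) \<Rightarrow>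
     ('n \<Rightarrow> (real^'n) measure \<Rightarrow> real \<Rightarrow> real) \<Rightarrow> ((real^'n) measure \<Rightarrow> real) \<Rightarrow>
     real \<Rightarrow> (real^'n) measure \<Rightarrow> (real \<Rightarrow> real^'n) measure \<Rightarrow> bool" where
  "relaxed_equilibrium p T L Ls G Gs C m0 \<mu> \<longleftrightarrow>
    \<mu> \<in> P_C p T C m0 \<and>
    (\<forall>y\<in>measure_supp (curve_top T (Gam_C p T C)) \<mu>. \<exists>x\<in>measure_supp junction_top m0.
       y \<in> Gam_C_at p T C x \<and>
       (\<forall>z\<in>Gam p T 0 x. J_cost T L Ls G Gs \<mu> 0 y \<le> J_cost T L Ls G Gs \<mu> 0 z))"

definition value_fun ::
    "real \<Rightarrow> real \<Rightarrow> ('n::finite \<Rightarrow> (real^'n) measure \<Rightarrow> real \<Rightarrow> real \<Rightarrow> real) \<Rightarrow> ((real^'n) measure \<Rightarrow> real) \<Rightarrow>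
     ('n \<Rightarrow> (real^'n) measure \<Rightarrow> real \<Rightarrow> real) \<Rightarrow> ((real^'n) measure \<Rightarrow> real) \<Rightarrow>
     (real \<Rightarrow> real^'n) measure \<Rightarrow> real^'n \<Rightarrow> real \<Rightarrow> real" where
  "value_fun p T L Ls G Gs \<mu> x t = (INF y\<in>Gam p T t x. J_cost T L Ls G Gs \<mu> t y)"

definition mild_solution ::
    "real \<Rightarrow> real \<Rightarrow> ('n::finite \<Rightarrow> (real^'n) measure \<Rightarrow> real \<Rightarrow> real \<Rightarrow> real) \<Rightarrow> ((real^'n) measure \<Rightarrow> real) \<Rightarrow>
     ('n \<Rightarrow> (real^'n) measure \<Rightarrow> real \<Rightarrow> real) \<Rightarrow> ((real^'n) measure \<Rightarrow> real) \<Rightarrow>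
     (real \<Rightarrow> real^'n) measure \<Rightarrow> (real^'n \<Rightarrow> real \<Rightarrow> real) \<Rightarrow> (real \<Rightarrow> (real^'n) measure) \<Rightarrow> bool" where
  "mild_solution p T L Ls G Gs \<mu> u m \<longleftrightarrow>
    (\<forall>t\<in>{0..T}. m t = flow \<mu> t) \<and>
    (\<forall>x\<in>junction. \<forall>t\<in>{0..T}. u x t = value_fun p T L Ls G Gs \<mu> x t)"

definition optimal_trajs ::
    "real \<Rightarrow> real \<Rightarrow> ('n::finite \<Rightarrow> (real^'n) measure \<Rightarrow> real \<Rightarrow> real \<Rightarrow> real) \<Rightarrow> ((real^'n) measure \<Rightarrow> real) \<Rightarrow>
     ('n \<Rightarrow> (real^'n) measure \<Rightarrow> real \<Rightarrow> real) \<Rightarrow> ((real^'n) measure \<Rightarrow> real) \<Rightarrow>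
     (real \<Rightarrow> real^'n) measure \<Rightarrow> real^'n \<Rightarrow> real \<Rightarrow> (real \<Rightarrow> real^'n) set" where
  "optimal_trajs p T L Ls G Gs \<mu> x t =
    {y \<in> Gam p T t x. J_cost T L Ls G Gs \<mu> t y = value_fun p T L Ls G Gs \<mu> x t}"

text \<open>The derivative within \<open>{t..T}\<close> at \<open>t\<close> is the right derivative.\<close>

definition init_velocities ::
    "real \<Rightarrow> real \<Rightarrow> ('n::finite \<Rightarrow> (real^'n) measure \<Rightarrow> real \<Rightarrow> real \<Rightarrow> real) \<Rightarrow> ((real^'n) measure \<Rightarrow> real) \<Rightarrow>
     ('n \<Rightarrow> (real^'n) measure \<Rightarrow> real \<Rightarrow> real) \<Rightarrow> ((real^'n) measure \<Rightarrow> real) \<Rightarrow>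
     (real \<Rightarrow> real^'n) measure \<Rightarrow> real^'n \<Rightarrow> real \<Rightarrow> real set" where
  "init_velocities p T L Ls G Gs \<mu> x t =
    {vector_derivative z (at t within {t..T}) \<bullet> axis i 1 | z i.
       x \<in> edge i - {0} \<and> z \<in> optimal_trajs p T L Ls G Gs \<mu> x t}"

text \<open>For continuous \<open>y\<close> the infimum is attained; inserting \<open>T\<close> covers the curves that do not
  reach the vertex (minimum of the empty set equal to infinity).\<close>

definition exit_time :: "real \<Rightarrow> real \<Rightarrow> (real \<Rightarrow> real^'n::finite) \<Rightarrow> real" where
  "exit_time T t y = Inf (insert T {\<tau> \<in> {t..T}. y \<tau> = 0})"

definition Hamiltonian ::
    "('n::finite \<Rightarrow> (real^'n) measure \<Rightarrow> real \<Rightarrow> real \<Rightarrow> real) \<Rightarrow> (real \<Rightarrow> (real^'n) measure) \<Rightarrow>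
     'n \<Rightarrow> real \<Rightarrow> real \<Rightarrow> real \<Rightarrow> real" where
  "Hamiltonian L m i x q t = (SUP \<zeta>. - q * \<zeta> - L i (m t) x \<zeta>)"

definition usc_on :: "real set \<Rightarrow> (real \<Rightarrow> real) \<Rightarrow> bool" where
  "usc_on S f \<longleftrightarrow> (\<forall>x\<in>S. \<forall>c. f x < c \<longrightarrow> (\<forall>\<^sub>F y in at x within S. f y < c))"

definition locally_semiconcave_on :: "(real \<times> real) set \<Rightarrow> (real \<times> real \<Rightarrow> real) \<Rightarrow> bool" where
  "locally_semiconcave_on A w \<longleftrightarrow>
    (\<forall>S. compact S \<longrightarrow> S \<subseteq> A \<longrightarrow>
      (\<exists>\<omega>. modulus \<omega> \<and> usc_on {0..} \<omega> \<and>
        (\<forall>\<theta>\<in>{0..1}. \<forall>X Y. closed_segment X Y \<subseteq> S \<longrightarrow>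
           \<theta> * w X + (1 - \<theta>) * w Y - w (\<theta> *\<^sub>R X + (1 - \<theta>) *\<^sub>R Y)
             \<le> \<theta> * (1 - \<theta>) * norm (X - Y) * \<omega> (norm (X - Y)))))"

end

theory Submission
  imports Defs "HOL-Complex_Analysis.Great_Picard"
begin

lemmas hk_integrable_combine = Henstock_Kurzweil_Integration.integrable_combine
  and hk_integral_add = Henstock_Kurzweil_Integration.integral_add
  and hk_integral_combine = Henstock_Kurzweil_Integration.integral_combine
  and hk_integral_cong = Henstock_Kurzweil_Integration.integral_cong
  and hk_integral_diff = Henstock_Kurzweil_Integration.integral_diff
  and hk_integral_neg = Henstock_Kurzweil_Integration.integral_neg
  and hk_integral_norm_bound_integral = Henstock_Kurzweil_Integration.integral_norm_bound_integral
  and hk_integral_restrict_Int = Henstock_Kurzweil_Integration.integral_restrict_Int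
  and hk_integral_sum = Henstock_Kurzweil_Integration.integral_sum

text \<open>
 On the support of \<open>\<mu>\<close> the curves are equicontinuous, so \<open>t \<mapsto> m(t)\<close> is continuous for the
 Kantorovich--Rubinstein distance and the problem becomes one of optimal control on the junction with
 a Lagrangian that is continuous in time. Optimal trajectories exist by the direct method. Away from
 the vertex they satisfy the Euler--Lagrange equation in du Bois-Reymond form; since \<open>\<partial>\<^sub>a L\<close> is
 strictly increasing and coercive, their velocities are bounded and equicontinuous, uniformly for
 starting points in a compact set.

 Bending an optimal trajectory over a fixed length of time shows that
 \<open>(-\<partial>\<^sub>a L, a \<partial>\<^sub>a L - L)\<close>, with \<open>a\<close> its initial velocity, is a superdifferential of \<open>u\<close>, with an
 error that is uniform on compact sets; this is (a). The concatenation of two optimal trajectories is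
 optimal, hence \<open>C\<^sup>1\<close>, so every optimal continuation from a point inside a trajectory
 has the velocity of that trajectory. If \<open>u\<close> is differentiable in space, the superdifferentials are all equal
 to the derivative, which determines the velocity. Conversely, if the initial velocity is unique, then by
 compactness the initial velocities from nearby points are close to it, and the superdifferential
 inequalities at these points bound the increments of \<open>u\<close> from below.
\<close>

section \<open>Indefinite integrals on an interval\<close>

text \<open>The running cost is discontinuous at the vertex and has growth of order p for an
  arbitrary p > 1. A curve is therefore kept as a pair of a function and an integrable density
  (\<open>primitive_on\<close>), and a.e. identities come from equality of integrals over
  subintervals. Two facts tame the vertex: a nonnegative coordinate has zero density where it
  vanishes, so velocities are tangent to the edges; and resting at the vertex costs at most
  \<open>l i t 0 0\<close> for every edge i, so lower semicontinuity survives when curves from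
  several edges converge to the vertex. Strict convexity is not quantified and the dependence on
  time is merely continuous, so the semiconcavity has a general modulus, not a linear one. It rests
  on first-order inequalities alone: the integrated Euler-Lagrange equation makes the first
  variation of a bent arc the integral of an exact derivative, of which only the value at the
  initial end remains. The constants depend only on bounds for the position, on the distance to the
  vertex and on the time left before T; this is the source of uniformity on compact sets.\<close>

lemma local_to_global_integral:
 fixes F :: "real => 'a::euclidean_space" and k :: "real => real"
 assumes ab: "a <= b" and h: "h integrable_on {a..b}" and k: "k integrable_on {a..b}"
  and loc: "!!e. e > 0 ==> EX d>0. ALL s t. a <= s --> s <= t --> t <= b --> t - s < d -->
    norm (F t - F s - integral {s..t} h) <= e * integral {s..t} k"
 shows "F b - F a = integral {a..b} h"
proof -
 \<comment> \<open>The error bound is additive over adjacent intervals: covering {a..b} by pieces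
   shorter than d keeps the factor e.\<close>
 have step: "norm (F b - F a - integral {a..b} h) <= e * integral {a..b} k" if "e > 0" for e
 proof -
  obtain d where d: "d > 0" and D: "!!s t. a <= s ==> s <= t ==> t <= b ==> t - s < d ==>
    norm (F t - F s - integral {s..t} h) <= e * integral {s..t} k"
   using loc[OF \<open>e > 0\<close>] by blast
  \<comment> \<open>Induction on the number n of pieces; the length d/2 keeps every piece strictly
    shorter than d.\<close>
  have claim: "norm (F t - F s - integral {s..t} h) <= e * integral {s..t} k"
   if "a <= s" "s <= t" "t <= b" "t - s <= real n * (d/2)" for n s t
   using that
  proof (induction n arbitrary: t)
   case 0 then show ?case using D[of s t] d by auto
  next
   case (Suc n)
   show ?case
   proof (cases "t - s < d")
    case True then show ?thesis using D Suc.prems by auto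
   next
    case False
    define r where "r = t - d/2"
    have r: "s <= r" "r <= t" "r <= b" "r - s <= real n * (d/2)" "t - r < d"
     using False d Suc.prems by (auto simp: r_def algebra_simps)
    have 1: "norm (F r - F s - integral {s..r} h) <= e * integral {s..r} k"
     using Suc.IH r Suc.prems by auto
    have 2: "norm (F t - F r - integral {r..t} h) <= e * integral {r..t} k"
     using D[of r t] r Suc.prems by auto
    have hst: "h integrable_on {s..t}" "k integrable_on {s..t}"
     using h k Suc.prems by (auto intro: integrable_on_subinterval)
    have "integral {s..r} h + integral {r..t} h = integral {s..t} h"
     "integral {s..r} k + integral {r..t} k = integral {s..t} k"
     using r hst by (auto intro!: hk_integral_combine)
    then have "F t - F s - integral {s..t} h = (F r - F s - integral {s..r} h) + (F t - F r - integral {r..t} h)"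
     "e * integral {s..t} k = e * integral {s..r} k + e * integral {r..t} k"
     by (auto simp: algebra_simps simp flip: distrib_left)
    then show ?thesis using norm_triangle_mono[OF 1 2] by metis
   qed
  qed
  obtain n :: nat where "(b - a) / (d/2) <= real n" using real_arch_simple by blast
  then show ?thesis using claim[of a b n] ab d by (simp add: field_simps)
 qed
 have "norm (F b - F a - integral {a..b} h) <= 0 + e" if "e > 0" for e
 proof -
  \<comment> \<open>The integral of k may have any value; dividing e by its absolute value plus 1
    leaves an error of at most e.\<close>
  have K: "integral {a..b} k / (abs (integral {a..b} k) + 1) <= 1" by (auto simp: divide_simps)
  have "norm (F b - F a - integral {a..b} h) <= (e / (abs (integral {a..b} k) + 1)) * integral {a..b} k"
   using step[of "e / (abs (integral {a..b} k) + 1)"] that by auto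
  also have "... = e * (integral {a..b} k / (abs (integral {a..b} k) + 1))" by simp
  also have "... <= e" using mult_left_mono[OF K, of e] that by simp
  finally show ?thesis by simp
 qed
 then have "norm (F b - F a - integral {a..b} h) <= 0" by (rule field_le_epsilon)
 then show ?thesis by simp
qed

text \<open>The sets over which g integrates to zero contain an intersection-stable generator of the
  Borel sets and are closed under complements and disjoint unions, so all Borel sets are among them,
  and uniqueness of densities applies. A Borel representative f carries the argument from
  \<open>lebesgue\<close> to \<open>lborel\<close>.\<close>

lemma AE_lebesgue_on_zero_if_integrals_zero:
 fixes g :: "real => real"
 assumes g: "g absolutely_integrable_on {a..b}"
  and z: "!!c d. a <= c ==> c <= d ==> d <= b ==> integral {c..d} g = 0"
 shows "AE x in lebesgue. x : {a..b} --> g x = 0"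
proof -
 let ?f = "%x. indicator {a..b} x *\<^sub>R g x"
 have fi: "integrable lebesgue ?f" using g by (simp add: set_integrable_def)
 obtain f where f: "f : borel_measurable lborel" "AE x in lborel. ?f x = f x"
  using completion_ex_borel_measurable_real[of ?f lborel] fi borel_measurable_integrable by blast
 have fl: "AE x in lebesgue. ?f x = f x" using f(2) by (rule AE_completion)
 have f'm: "f : borel_measurable lebesgue" using f(1) measurable_completion by blast
 have fil: "integrable lebesgue f"
  using integrable_cong_AE_imp[OF fi f'm] fl by auto
 then have fib: "integrable lborel f" using f(1) integrable_completion by blast
 have set_eq: "(LINT x:A|lborel. f x) = integral (A \<inter> {a..b}) g" if A: "A : sets borel" for A
 proof -
  have "(LINT x:A|lborel. f x) = integral\<^sup>L lebesgue (%x. indicator A x *\<^sub>R f x)"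
   unfolding set_lebesgue_integral_def using f A by (subst integral_completion) auto
  also have "... = integral\<^sup>L lebesgue (%x. indicator (A \<inter> {a..b}) x *\<^sub>R g x)"
  proof (rule integral_cong_AE)
   show "(%x. indicator A x *\<^sub>R f x) : borel_measurable lebesgue"
    using A f'm by (intro borel_measurable_scaleR borel_measurable_indicator) auto
   have "(%x. indicat_real A x *\<^sub>R ?f x) : borel_measurable lebesgue"
    using A by (intro borel_measurable_scaleR borel_measurable_indicator borel_measurable_integrable[OF fi]) auto
   then show "(%x. indicator (A \<inter> {a..b}) x *\<^sub>R g x) : borel_measurable lebesgue"
    by (simp add: indicator_inter_arith mult.assoc)
   show "AE x in lebesgue. indicator A x *\<^sub>R f x = indicator (A \<inter> {a..b}) x *\<^sub>R g x"
    using fl by eventually_elim (auto simp: indicator_def split: if_splits)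
  qed
  also have "... = integral (A \<inter> {a..b}) g"
   using set_lebesgue_integral_eq_integral(2)[of "A \<inter> {a..b}" g]
    set_integrable_subset[OF g, of "A \<inter> {a..b}"] A
   by (auto simp: set_lebesgue_integral_def)
  finally show ?thesis .
 qed
 have "(LINT x:A|lborel. f x) = (LINT x:A|lborel. 0)" if "A : sets lborel" for A
 proof -
  have Asig: "A : sigma_sets UNIV (range (%(c, d). {c..d}))"
   using that by (simp add: borel_eq_atLeastAtMost)
  have int_st: "Int_stable (range (%(c::real, d). {c..d}))"
   by (auto simp: Int_stable_def)
  have sub: "range (%(c, d). {c..d}) \<subseteq> Pow (UNIV::real set)" by auto
  from int_st sub Asig have "(LINT x:A|lborel. f x) = 0"
  proof (induction rule: sigma_sets_induct_disjoint)
   fix A :: "real set" assume "A : range (%(c, d). {c..d})"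
   then obtain c d where A: "A = {c..d}" by auto
   have AE: "A \<inter> {a..b} = {max a c..min b d}" using A by auto
   have "integral (A \<inter> {a..b}) g = 0"
    unfolding AE using z[of "max a c" "min b d"] by (cases "max a c <= min b d") auto
   then show "(LINT x:A|lborel. f x) = 0" using set_eq[of A] A by auto
  next
   show "(LINT x:{}|lborel. f x) = 0" by (simp add: set_lebesgue_integral_def)
  next
   fix A :: "real set" assume A: "A : sigma_sets UNIV (range (%(c, d). {c..d}))" and *: "(LINT x:A|lborel. f x) = 0"
   have Ab: "A : sets borel" using A by (simp add: borel_eq_atLeastAtMost)
   \<comment> \<open>The whole line has integral 0 because f vanishes a.e. outside {a..b}; this
     gives closure under complements.\<close>
   have 0: "integral\<^sup>L lborel f = 0"
    using set_eq[of UNIV] z[of a b] by (cases "a <= b") (auto simp: set_lebesgue_integral_def)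
   have sA: "set_integrable lborel A f" "set_integrable lborel (UNIV - A) f"
    unfolding set_integrable_def using fib Ab
    by (auto intro!: integrable_mult_indicator simp del: real_scaleR_def)
   have "(LINT x:A \<union> (UNIV - A)|lborel. f x) = (LINT x:A|lborel. f x) + (LINT x:(UNIV - A)|lborel. f x)"
    by (rule set_integral_Un) (use sA in auto)
   then show "(LINT x:(UNIV - A)|lborel. f x) = 0" using * 0 by (simp add: set_lebesgue_integral_def)
  next
   fix A :: "nat => real set"
   assume dis: "disjoint_family A" and A: "range A \<subseteq> sigma_sets UNIV (range (%(c, d). {c..d}))"
    and *: "!!i. (LINT x:A i|lborel. f x) = 0"
   have Ab: "A i : sets borel" for i using A by (auto simp: borel_eq_atLeastAtMost)
   have "set_integrable lborel (\<Union>i. A i) f"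
    unfolding set_integrable_def using fib Ab
    by (auto intro!: integrable_mult_indicator simp del: real_scaleR_def)
   then have "(LINT x:(\<Union>i. A i)|lborel. f x) = (\<Sum>i. (LINT x:A i|lborel. f x))"
    using Ab dis by (intro lebesgue_integral_countable_add) (auto simp: disjoint_family_on_def)
   then show "(LINT x:(\<Union>i. A i)|lborel. f x) = 0" using * by simp
  qed
  then show ?thesis by simp
 qed
 then have "AE x in lborel. f x = 0"
  using density_unique_real[OF fib, of "%_. 0"] by simp
 then have "AE x in lebesgue. f x = 0" by (rule AE_completion)
 with fl show ?thesis by eventually_elim auto
qed

lemma continuous_on_Icc_uniform:
 fixes f :: "real => 'a::real_normed_vector"
 assumes "continuous_on {a..b} f" "e > 0"
 obtains d where "d > 0" "!!x y. x : {a..b} ==> y : {a..b} ==> abs (y - x) < d ==> norm (f y - f x) < e"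
proof -
 have "uniformly_continuous_on {a..b} f" using assms(1) by (rule compact_uniformly_continuous) simp
 from uniformly_continuous_onE[OF this assms(2)] obtain d where
  "d > 0" "!!x y. x : {a..b} ==> y : {a..b} ==> dist y x < d ==> dist (f y) (f x) < e"
  by blast
 then show ?thesis by (intro that[of d]) (auto simp: dist_norm)
qed

text \<open>Absolute continuity on a closed interval, with the density as explicit data. The density
  counts only up to null sets (\<open>primitive_on_cong_AE\<close>), while f is a genuine function
  whose end values can be pasted.\<close>

definition primitive_on :: "real => real => (real => 'a::euclidean_space) => (real => 'a) => bool" where
 "primitive_on a b f g \<longleftrightarrow>
  g absolutely_integrable_on {a..b} & (ALL s:{a..b}. f s = f a + integral {a..s} g)"

lemma primitive_on_abs: "primitive_on a b f g ==> g absolutely_integrable_on {a..b}"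
 and primitive_on_eq: "primitive_on a b f g ==> a <= s ==> s <= b ==> f s = f a + integral {a..s} g"
 unfolding primitive_on_def by (blast, meson atLeastAtMost_iff)

lemma absolutely_integrable_on_sub:
 fixes g :: "real => 'a::euclidean_space"
 assumes "g absolutely_integrable_on {a..b}" "a <= c" "d <= b"
 shows "g integrable_on {c..d}" "g absolutely_integrable_on {c..d}"
 using absolutely_integrable_on_subinterval[of "{a..b}" g c d] assms
 by (simp_all add: absolutely_integrable_on_def)

lemma primitive_on_integrable:
 assumes "primitive_on a b f g" "a <= c" "d <= b"
 shows "g absolutely_integrable_on {c..d}" "g integrable_on {c..d}" "(%x. norm (g x)) integrable_on {c..d}"
proof -
 show *: "g absolutely_integrable_on {c..d}"
  using primitive_on_abs[OF assms(1)] assms(2,3) absolutely_integrable_on_subinterval[of "{a..b}" g c d] by auto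
 then show "g integrable_on {c..d}" "(%x. norm (g x)) integrable_on {c..d}"
  by (auto simp: absolutely_integrable_on_def)
qed

lemma primitive_on_diff:
 assumes "primitive_on a b f g" "a <= c" "c <= d" "d <= b"
 shows "f d - f c = integral {c..d} g"
proof -
 have "g integrable_on {a..d}" using primitive_on_integrable[OF assms(1), of a d] assms by auto
 then have "integral {a..c} g + integral {c..d} g = integral {a..d} g"
  using assms by (intro hk_integral_combine) auto
 moreover have "f d = f a + integral {a..d} g" "f c = f a + integral {a..c} g"
  using assms(2-4) by (intro primitive_on_eq[OF assms(1)]; simp)+
 ultimately show ?thesis by (simp add: algebra_simps)
qed

lemma primitive_onI:
 assumes "g absolutely_integrable_on {a..b}" "!!s. a <= s ==> s <= b ==> f s - f a = integral {a..s} g"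
 shows "primitive_on a b f g"
 unfolding primitive_on_def
proof (intro conjI ballI)
 fix s assume "s : {a..b}"
 then have "f s - f a = integral {a..s} g" using assms(2) by simp
 then show "f s = f a + integral {a..s} g" by (simp only: diff_eq_eq add.commute)
qed (rule assms(1))

lemma primitive_on_subinterval:
 assumes "primitive_on a b f g" "a <= c" "d <= b"
 shows "primitive_on c d f g"
 using assms by (intro primitive_onI primitive_on_integrable(1)[OF assms] primitive_on_diff[OF assms(1)]) auto

lemma primitive_on_continuous:
 assumes "primitive_on a b f g" shows "continuous_on {a..b} f"
proof -
 have "continuous_on {a..b} (%s. f a + integral {a..s} g)"
  using primitive_on_integrable(2)[OF assms, of a b]
  by (intro continuous_intros indefinite_integral_continuous_1) auto
 then show ?thesis
  by (rule continuous_on_eq) (metis primitive_on_eq[OF assms] atLeastAtMost_iff)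
qed

lemma primitive_on_combine:
 assumes 1: "primitive_on a b f g" and 2: "primitive_on b c f g" and "a <= b" "b <= c"
 shows "primitive_on a c f g"
proof (rule primitive_onI)
 show ac: "g absolutely_integrable_on {a..c}"
  using primitive_on_abs[OF 1] primitive_on_abs[OF 2] assms(3,4) absolutely_integrable_on_combine[of a b g c] by auto
 fix s assume s: "a <= s" "s <= c"
 show "f s - f a = integral {a..s} g"
 proof (cases "s <= b")
  case True then show ?thesis using primitive_on_diff[OF 1, of a s] s by auto
 next
  case False
  have "integral {a..b} g + integral {b..s} g = integral {a..s} g"
   using False s \<open>a <= b\<close> absolutely_integrable_on_sub[OF ac, of a s]
   by (intro hk_integral_combine) auto
  moreover have "f b - f a = integral {a..b} g" "f s - f b = integral {b..s} g"
   using primitive_on_diff[OF 1, of a b] primitive_on_diff[OF 2, of b s] False s assms by auto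
  ultimately show ?thesis by (simp add: algebra_simps)
 qed
qed

lemma primitive_on_cong_AE:
 assumes f: "primitive_on a b f g" and N: "negligible N" "!!s. s : {a..b} - N ==> g' s = g s"
  and f': "!!s. s : {a..b} ==> f' s = f s"
 shows "primitive_on a b f' g'"
proof (rule primitive_onI)
 show "g' absolutely_integrable_on {a..b}"
  by (rule absolutely_integrable_spike[OF _ N]) (rule primitive_on_abs[OF f])
 fix s assume s: "a <= s" "s <= b"
 have "integral {a..s} g = integral {a..s} g'"
  by (rule integral_spike[of N]) (use N s in auto)
 then show "f' s - f' a = integral {a..s} g'"
  using primitive_on_diff[OF f, of a s] s f'[of s] f'[of a] by simp
qed

lemma integrable_mult_const: "(f::real => real) integrable_on S ==> (%x. c * f x) integrable_on S"
 using integrable_cmul[of f S c] by simp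

text \<open>Integration by parts. Over a short interval the increment is exact with f1 frozen at the
  right end and f2 at the left end. Uniform continuity makes the error of freezing at most e times
  the integral of the norms of g1 and g2, which is what \<open>local_to_global_integral\<close> asks
  for.\<close>

lemma primitive_on_scaleR:
 fixes f2 :: "real => 'a::euclidean_space"
 assumes 1: "primitive_on a b f1 g1" and 2: "primitive_on a b f2 g2"
 shows "primitive_on a b (%s. f1 s *\<^sub>R f2 s) (%s. f1 s *\<^sub>R g2 s + g1 s *\<^sub>R f2 s)"
proof (rule primitive_onI)
 have bdd: "f1 : borel_measurable (lebesgue_on {a..b})" "bounded (f1 ` {a..b})"
  "f2 : borel_measurable (lebesgue_on {a..b})" "bounded (f2 ` {a..b})"
  using primitive_on_continuous[OF 1] primitive_on_continuous[OF 2]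
  by (auto intro!: continuous_imp_measurable_on_sets_lebesgue compact_imp_bounded compact_continuous_image)
 have flip: "bilinear (%(v::'a) (r::real). r *\<^sub>R v)" "bilinear (%(r::real) (v::'a). r *\<^sub>R v)"
  by (auto simp: bilinear_def linear_iff algebra_simps)
 have "(%s. f1 s *\<^sub>R g2 s) absolutely_integrable_on {a..b}"
  using absolutely_integrable_bounded_measurable_product[OF flip(2) bdd(1) _ bdd(2) primitive_on_abs[OF 2]]
  by auto
 moreover have "(%s. g1 s *\<^sub>R f2 s) absolutely_integrable_on {a..b}"
  using absolutely_integrable_bounded_measurable_product[OF flip(1) bdd(3) _ bdd(4) primitive_on_abs[OF 1]]
  by auto
 ultimately show abs: "(%s. f1 s *\<^sub>R g2 s + g1 s *\<^sub>R f2 s) absolutely_integrable_on {a..b}"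
  by (rule set_integral_add)
 fix s assume s: "a <= s" "s <= b"
 show "f1 s *\<^sub>R f2 s - f1 a *\<^sub>R f2 a = integral {a..s} (%s. f1 s *\<^sub>R g2 s + g1 s *\<^sub>R f2 s)"
 proof (rule local_to_global_integral[where k = "%s. norm (g1 s) + norm (g2 s)"])
  show "a <= s" by fact
  show "(%s. f1 s *\<^sub>R g2 s + g1 s *\<^sub>R f2 s) integrable_on {a..s}"
   by (rule absolutely_integrable_on_sub[OF abs]) (use s in auto)
  show "(%s. norm (g1 s) + norm (g2 s)) integrable_on {a..s}"
   using s 1 2 by (intro integrable_add primitive_on_integrable(3)) auto
  fix e :: real assume e: "e > 0"
  obtain d1 where d1: "d1 > 0" "!!x y. x : {a..b} ==> y : {a..b} ==> abs (y - x) < d1 ==> norm (f1 y - f1 x) < e"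
   using continuous_on_Icc_uniform[OF primitive_on_continuous[OF 1] e] by blast
  obtain d2 where d2: "d2 > 0" "!!x y. x : {a..b} ==> y : {a..b} ==> abs (y - x) < d2 ==> norm (f2 y - f2 x) < e"
   using continuous_on_Icc_uniform[OF primitive_on_continuous[OF 2] e] by blast
  show "EX d>0. ALL u v. a <= u --> u <= v --> v <= s --> v - u < d -->
    norm (f1 v *\<^sub>R f2 v - f1 u *\<^sub>R f2 u - integral {u..v} (%s. f1 s *\<^sub>R g2 s + g1 s *\<^sub>R f2 s))
    <= e * integral {u..v} (%s. norm (g1 s) + norm (g2 s))"
  proof (intro exI[of _ "min d1 d2"] conjI allI impI)
   show "min d1 d2 > 0" using d1 d2 by auto
   fix u v assume uv: "a <= u" "u <= v" "v <= s" "v - u < min d1 d2"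
   have g: "g1 integrable_on {u..v}" "g2 integrable_on {u..v}"
    "(%x. norm (g1 x)) integrable_on {u..v}" "(%x. norm (g2 x)) integrable_on {u..v}"
    "(%x. f1 v *\<^sub>R g2 x) integrable_on {u..v}"
    using uv s primitive_on_integrable[OF 1, of u v] primitive_on_integrable[OF 2, of u v]
     integrable_cmul[of g2 "{u..v}" "f1 v"] by auto
   have gg: "(%s. f1 s *\<^sub>R g2 s + g1 s *\<^sub>R f2 s) integrable_on {u..v}"
    by (rule absolutely_integrable_on_sub[OF abs]) (use s uv in auto)
   have "f1 v *\<^sub>R f2 v - f1 u *\<^sub>R f2 u = f1 v *\<^sub>R (f2 v - f2 u) + (f1 v - f1 u) *\<^sub>R f2 u"
    by (simp add: algebra_simps)
   also have "... = f1 v *\<^sub>R integral {u..v} g2 + integral {u..v} g1 *\<^sub>R f2 u"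
    using primitive_on_diff[OF 1, of u v] primitive_on_diff[OF 2, of u v] uv s by simp
   also have "... = integral {u..v} (%x. f1 v *\<^sub>R g2 x) + integral {u..v} (%x. g1 x *\<^sub>R f2 u)"
    using g integral_linear[of g1 "{u..v}" "%r. r *\<^sub>R f2 u"]
    by (simp add: bounded_linear_scaleR_left o_def)
   also have "... = integral {u..v} (%x. f1 v *\<^sub>R g2 x + g1 x *\<^sub>R f2 u)"
    using g integrable_linear[of g1 "{u..v}" "%r. r *\<^sub>R f2 u"]
    by (subst hk_integral_add)
     (auto simp: bounded_linear_scaleR_left o_def)
   finally have "f1 v *\<^sub>R f2 v - f1 u *\<^sub>R f2 u - integral {u..v} (%s. f1 s *\<^sub>R g2 s + g1 s *\<^sub>R f2 s)
     = integral {u..v} (%x. (f1 v *\<^sub>R g2 x + g1 x *\<^sub>R f2 u) - (f1 x *\<^sub>R g2 x + g1 x *\<^sub>R f2 x))"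
    using g gg integrable_linear[of g1 "{u..v}" "%r. r *\<^sub>R f2 u"]
    by (subst hk_integral_diff)
     (auto simp: bounded_linear_scaleR_left o_def intro!: integrable_add)
   also have "norm ... <= integral {u..v} (%x. e * (norm (g1 x) + norm (g2 x)))"
   proof (rule hk_integral_norm_bound_integral)
    show "(%x. (f1 v *\<^sub>R g2 x + g1 x *\<^sub>R f2 u) - (f1 x *\<^sub>R g2 x + g1 x *\<^sub>R f2 x)) integrable_on {u..v}"
     using g gg integrable_linear[of g1 "{u..v}" "%r. r *\<^sub>R f2 u"]
     by (intro integrable_diff[OF integrable_add gg]) (auto simp: bounded_linear_scaleR_left o_def)
    show "(%x. e * (norm (g1 x) + norm (g2 x))) integrable_on {u..v}"
     by (intro integrable_mult_const integrable_add g)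
    fix x assume x: "x : {u..v}"
    have "(f1 v *\<^sub>R g2 x + g1 x *\<^sub>R f2 u) - (f1 x *\<^sub>R g2 x + g1 x *\<^sub>R f2 x)
      = (f1 v - f1 x) *\<^sub>R g2 x + g1 x *\<^sub>R (f2 u - f2 x)" by (simp add: algebra_simps)
    also have "norm ... <= abs (f1 v - f1 x) * norm (g2 x) + abs (g1 x) * norm (f2 u - f2 x)"
     by (rule order_trans[OF norm_triangle_ineq]) simp
    also have "... <= e * norm (g2 x) + abs (g1 x) * e"
     using d1(2)[of x v] d2(2)[of x u] x uv s
     by (intro add_mono mult_right_mono mult_left_mono) (auto simp: less_imp_le)
    finally show "norm ((f1 v *\<^sub>R g2 x + g1 x *\<^sub>R f2 u) - (f1 x *\<^sub>R g2 x + g1 x *\<^sub>R f2 x))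
     <= e * (norm (g1 x) + norm (g2 x))" by (simp add: algebra_simps)
   qed
   finally show "norm (f1 v *\<^sub>R f2 v - f1 u *\<^sub>R f2 u - integral {u..v} (%s. f1 s *\<^sub>R g2 s + g1 s *\<^sub>R f2 s))
    <= e * integral {u..v} (%s. norm (g1 s) + norm (g2 s))"
    by simp
  qed
 qed
qed

lemma AE_lebesgue_negligible:
 "(AE x in lebesgue. P x) \<longleftrightarrow> (EX N. negligible N & (ALL x. x ~: N --> P x))"
proof
 assume "AE x in lebesgue. P x"
 then obtain N where "N : null_sets lebesgue" "!!x. x ~: N ==> P x"
  unfolding completion.AE_iff_null_sets by auto
 then show "EX N. negligible N & (ALL x. x ~: N --> P x)"
  by (intro exI[of _ N]) (auto simp: negligible_iff_null_sets)
next
 assume "EX N. negligible N & (ALL x. x ~: N --> P x)"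
 then obtain N where "N : null_sets lebesgue" "!!x. x ~: N ==> P x"
  by (auto simp: negligible_iff_null_sets)
 then show "AE x in lebesgue. P x" by (intro AE_I'[of N]) auto
qed

lemma dominated_convergence_AE:
 fixes f :: "nat => 'n::euclidean_space => 'm::euclidean_space"
 assumes f: "!!k. f k integrable_on S" and h: "h integrable_on S"
  and le: "!!k x. x : S ==> norm (f k x) <= h x"
  and conv: "AE x in lebesgue. x : S --> (%k. f k x) \<longlonglongrightarrow> g x"
 shows "g integrable_on S" "(%k. integral S (f k)) \<longlonglongrightarrow> integral S g"
proof -
 obtain N where N: "negligible N" "!!x. x ~: N ==> x : S ==> (%k. f k x) \<longlonglongrightarrow> g x"
  using conv unfolding AE_lebesgue_negligible by blast
 let ?f = "%k x. if x : N then 0 else f k x"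
 let ?g = "%x. if x : N then 0 else g x"
 have fi: "?f k integrable_on S" for k
  by (rule integrable_spike[OF f N(1)]) auto
 have le': "norm (?f k x) <= h x" if "x : S" for k x
  using le[OF that, of k] order_trans[OF norm_ge_zero le[OF that, of k]] by auto
 have conv': "(%k. ?f k x) \<longlonglongrightarrow> ?g x" if "x : S" for x
  using N(2)[OF _ that] by auto
 note dc = dominated_convergence[OF fi h le' conv']
 show "g integrable_on S"
  by (rule integrable_spike[OF dc(1) N(1)]) auto
 have "integral S (?f k) = integral S (f k)" for k
  by (rule integral_spike[OF N(1)]) auto
 moreover have "integral S ?g = integral S g"
  by (rule integral_spike[OF N(1)]) auto
 ultimately show "(%k. integral S (f k)) \<longlonglongrightarrow> integral S g"
  using dc(2) by simp
qed

lemma primitive_on_power: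
 fixes f :: "real => real"
 assumes f: "primitive_on a b f g"
 shows "primitive_on a b (%s. f s ^ Suc n) (%s. real (Suc n) * f s ^ n * g s)"
proof (induction n)
 case (Suc n)
 have "(%s. f s * (real (Suc n) * f s ^ n * g s) + g s * f s ^ Suc n) = (%s. real (Suc (Suc n)) * f s ^ Suc n * g s)"
  by (simp add: fun_eq_iff algebra_simps)
 then show ?case using primitive_on_scaleR[OF f Suc] by simp
qed (use f in simp)

text \<open>The powers \<open>(1 - f / M) ^ n\<close>, with \<open>M\<close> a bound of \<open>f\<close>, decrease to the indicator of the zero set.\<close>

lemma primitive_on_zero_set:
 fixes f :: "real => real"
 assumes f: "primitive_on a b f g" and f0: "!!s. s : {a..b} ==> f s >= 0"
 shows "AE s in lebesgue. s : {a..b} --> f s = 0 --> g s = 0"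
proof -
 have "bounded (f ` {a..b})" by (intro compact_imp_bounded compact_continuous_image primitive_on_continuous[OF f] compact_Icc)
 then obtain M where M: "M > 0" "ALL v:f ` {a..b}. norm v <= M" unfolding bounded_pos by blast
 define u where "u s = 1 + - 1 / M * f s" for s
 define h where "h s = (if f s = 0 then g s else 0)" for s
 have u01: "0 <= u s" "u s <= 1" "u s = 1 \<longleftrightarrow> f s = 0" if s: "s : {a..b}" for s
  using bspec[OF M(2) imageI[OF s]] f0[OF s] M(1) by (simp_all add: u_def)
 have up: "primitive_on a b u (%s. - 1 / M * g s)"
 proof (rule primitive_onI[OF set_integrable_mult_right[OF primitive_on_abs[OF f]]])
  fix s assume s: "a <= s" "s <= b"
  have "u s - u a = - 1 / M * (f s - f a)" by (simp add: u_def right_diff_distrib)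
  then show "u s - u a = integral {a..s} (%s. - 1 / M * g s)" using primitive_on_diff[OF f order_refl s] by simp
 qed
 have prim: "primitive_on a b (%s. u s ^ Suc n) (%s. - (real (Suc n) / M) * (u s ^ n * g s))" for n
  using primitive_on_power[OF up, of n] by (simp add: mult_ac)
 have "(%s. - (M / real (Suc n)) * (- (real (Suc n) / M) * (u s ^ n * g s))) absolutely_integrable_on {a..b}" for n
  by (rule set_integrable_mult_right[OF primitive_on_abs[OF prim]])
 moreover have "- (M / real (Suc n)) * (- (real (Suc n) / M) * x) = x" for n x using M(1) by simp
 ultimately have ug: "(%s. u s ^ n * g s) absolutely_integrable_on {a..b}" for n by (simp only:)
 have ptw: "(%n. u s ^ n * g s) \<longlonglongrightarrow> h s" if s: "s : {a..b}" for s
 proof (cases "f s = 0")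
  case True then show ?thesis using u01(3)[OF s] by (simp add: h_def)
 next
  case False
  then have "abs (u s) < 1" using u01[OF s] by simp
  from tendsto_mult_right[OF LIMSEQ_power_zero[of "u s"], of "g s"] this show ?thesis using False by (simp add: h_def)
 qed
 have bound: "norm (u s ^ n * g s) <= norm (g s)" if "s : {a..b}" for n s
  using mult_right_mono[OF power_le_one[OF u01(1,2)[OF that], of n], of "abs (g s)"] u01(1)[OF that] by (simp add: abs_mult)
 have h_abs: "h absolutely_integrable_on {a..b}"
  by (rule dominated_convergence_absolutely_integrable[OF ug primitive_on_integrable(3)[OF f order_refl order_refl] _ ptw])
   (simp add: h_def)
 have "AE s in lebesgue. s : {a..b} --> h s = 0"
 proof (rule AE_lebesgue_on_zero_if_integrals_zero[OF h_abs])
  fix c d assume cd: "a <= c" "c <= d" "d <= b"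
  have S: "s : {c..d} ==> s : {a..b}" for s using cd by simp
  have "(%n. integral {c..d} (%s. u s ^ n * g s)) \<longlonglongrightarrow> integral {c..d} h"
   by (rule dominated_convergence(2)[OF absolutely_integrable_on_sub(1)[OF ug cd(1,3)]
    primitive_on_integrable(3)[OF f cd(1,3)] bound[OF S] ptw[OF S]])
  \<comment> \<open>Up to the factor (n + 1) / M the integral is a difference of two powers that lie
    in [0, 1], so it is of order 1/n.\<close>
  moreover have "(%n. integral {c..d} (%s. u s ^ n * g s)) \<longlonglongrightarrow> 0"
  proof (rule Lim_null_comparison[OF always_eventually[OF allI]])
   fix n
   have "u d ^ Suc n - u c ^ Suc n = - (real (Suc n) / M) * integral {c..d} (%s. u s ^ n * g s)"
    using primitive_on_diff[OF prim cd, of n] by simp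
   moreover have "abs (u d ^ Suc n - u c ^ Suc n) <= 1"
    using power_le_one[OF u01(1,2)[OF S], of c "Suc n"] power_le_one[OF u01(1,2)[OF S], of d "Suc n"]
     zero_le_power[OF u01(1)[OF S], of c "Suc n"] zero_le_power[OF u01(1)[OF S], of d "Suc n"] cd
    by (simp add: abs_le_iff del: power_Suc)
   ultimately have "real (Suc n) / M * abs (integral {c..d} (%s. u s ^ n * g s)) <= 1" using M(1) by (simp add: abs_mult)
   then show "norm (integral {c..d} (%s. u s ^ n * g s)) <= M * inverse (real (Suc n))"
    using M(1) by (simp add: field_simps)
  next
   show "(%n. M * inverse (real (Suc n))) \<longlonglongrightarrow> 0" using tendsto_mult_left[OF LIMSEQ_inverse_real_of_nat, of M] by simp
  qed
  ultimately show "integral {c..d} h = 0" by (rule LIMSEQ_unique)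
 qed
 then show ?thesis by eventually_elim (auto simp: h_def split: if_splits)
qed

section \<open>Equi-integrable densities and compactness of curves\<close>

lemma le_add_powr:
 fixes x K p :: real
 assumes "x >= 0" "K > 0" "p > 1"
 shows "x <= K + K powr (1 - p) * x powr p"
proof (cases "x <= K")
 case True then show ?thesis by (simp add: add_increasing2)
next
 case False
 have "x = x powr (1 - p) * x powr p" using False assms by (simp flip: powr_add)
 also have "... <= K powr (1 - p) * x powr p"
  using False assms by (intro mult_right_mono powr_mono2') auto
 finally show ?thesis using assms by linarith
qed

text \<open>The condition of the Dunford-Pettis theorem. It is asked for measurable sets and not
  only for intervals because \<open>primitive_on_limit_density\<close> applies it to finite unions
  of boxes inside an open cover of a null set.\<close>

definition uniformly_integrable_seq :: "real => real => (nat => real => 'a::euclidean_space) => bool" where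
 "uniformly_integrable_seq a b g \<longleftrightarrow> (ALL n. g n absolutely_integrable_on {a..b}) &
  (ALL e>0. EX d>0. ALL n. ALL S:sets lebesgue. S \<subseteq> {a..b} --> measure lebesgue S < d --> integral S (%x. norm (g n x)) <= e)"

text \<open>The criterion of de la Vallee-Poussin for the power p. \<open>le_add_powr\<close> splits
  the integrand at height K: below it the small measure of S helps, above it the energy is
  multiplied by \<open>K powr (1 - p)\<close>, which is small for large K because p > 1.\<close>

lemma uniformly_integrable_seq_powr:
 fixes g :: "nat => real => 'a::euclidean_space"
 assumes p: "p > 1" and g: "!!n. g n absolutely_integrable_on {a..b}"
  and gp: "!!n. (%x. norm (g n x) powr p) integrable_on {a..b}"
  and M: "!!n. integral {a..b} (%x. norm (g n x) powr p) <= M"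
 shows "uniformly_integrable_seq a b g"
 unfolding uniformly_integrable_seq_def
proof (intro conjI allI impI g)
 fix e :: real assume e: "e > 0"
 have M0: "M >= 0" using M[of 0] integral_nonneg[OF gp[of 0]] by auto
 \<comment> \<open>Chosen so that c * M is at most e/2; the height K below solves
   \<open>K powr (1 - p) = c\<close>.\<close>
 obtain c where c: "c > 0" "c = e / (2 * (M + 1))" using e M0 by simp
 define K where "K = c powr (1 / (1 - p))"
 have "K > 0" using c(1) by (simp add: K_def)
 moreover have "K powr (1 - p) = c"
  unfolding K_def powr_powr using p c(1) by simp
 ultimately have K: "K > 0" "K powr (1 - p) = e / (2 * (M + 1))" unfolding c(2) by this+
 show "EX d>0. ALL n. ALL S:sets lebesgue. S \<subseteq> {a..b} --> measure lebesgue S < d --> integral S (%x. norm (g n x)) <= e"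
 proof (intro exI[of _ "e / (2 * K)"] conjI allI ballI impI)
  show "e / (2 * K) > 0" using e K by simp
  fix n S assume S: "S : sets lebesgue" "S \<subseteq> {a..b}" "measure lebesgue S < e / (2 * K)"
  have Sm: "S : lmeasurable"
   by (intro bounded_set_imp_lmeasurable[OF _ S(1)] bounded_subset[OF bounded_closed_interval S(2)])
  have gpa: "(%x. norm (g n x) powr p) absolutely_integrable_on {a..b}"
   by (rule nonnegative_absolutely_integrable_1[OF gp]) auto
  have gpS: "(%x. norm (g n x) powr p) integrable_on S"
   using set_integrable_subset[OF gpa S(1,2)] by (simp add: absolutely_integrable_on_def)
  have gS: "(%x. norm (g n x)) integrable_on S"
   using set_integrable_subset[OF g[of n] S(1,2)] by (simp add: absolutely_integrable_on_def)
  have c: "(%x. K) integrable_on S" using Sm by (rule integrable_on_const)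
  have "integral S (%x. norm (g n x)) <= integral S (%x. K + K powr (1 - p) * norm (g n x) powr p)"
   by (intro integral_le gS integrable_add c integrable_mult_const gpS le_add_powr[OF _ K(1) p]) auto
  also have "... = K * measure lebesgue S + K powr (1 - p) * integral S (%x. norm (g n x) powr p)"
  proof -
   have "integral S (%x. K) = K * measure lebesgue S"
    using lmeasure_integral[OF Sm] integral_mult_right[of S K "%x. 1"] by simp
   then show ?thesis
    using hk_integral_add[OF c integrable_mult_const[OF gpS, of "K powr (1 - p)"]]
    by simp
  qed
  also have "... <= e / 2 + K powr (1 - p) * M"
  proof (intro add_mono mult_left_mono)
   show "K * measure lebesgue S <= e / 2" using S(3) K by (simp add: field_simps)
   have "integral S (%x. norm (g n x) powr p) <= integral {a..b} (%x. norm (g n x) powr p)"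
    by (intro integral_subset_le S gpS gp) auto
   then show "integral S (%x. norm (g n x) powr p) <= M" using M[of n] by simp
  qed (use K(1) in auto)
  also have "K powr (1 - p) * M <= e / 2" using e M0 by (simp add: K field_simps)
  finally show "integral S (%x. norm (g n x)) <= e" by simp
 qed
qed

text \<open>The limit P is nondecreasing and continuous, hence the distribution function of a
  measure N. Equi-integrability makes N absolutely continuous with respect to Lebesgue measure, and
  the Radon-Nikodym density of N is a density of P.\<close>

lemma primitive_on_limit_density:
 fixes P :: "real => real"
 assumes ab: "a <= b" and Pn: "!!n. primitive_on a b (Pn n) (g n)"
  and ui: "uniformly_integrable_seq a b g" and g0: "!!n x. g n x >= 0"
  and lim: "!!s. s : {a..b} ==> (%n. Pn n s) \<longlonglongrightarrow> P s"
  and cP: "continuous_on {a..b} P"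
 obtains q where "primitive_on a b P q" "!!x. q x >= 0"
proof -
 \<comment> \<open>Clamping extends P to the whole line, constant on either side of {a..b}, so that
   \<open>interval_measure\<close> can be formed.\<close>
 define cl where "cl x = max a (min b x)" for x :: real
 have cl: "cl x : {a..b}" "x <= y ==> cl x <= cl y" "x : {a..b} ==> cl x = x" for x y
  using ab by (auto simp: cl_def)
 define F where "F x = P (cl x)" for x
 define h where "h n x = (if x : {a..b} then g n x else 0)" for n x
 have gabs: "g n absolutely_integrable_on {a..b}" for n using Pn by (rule primitive_on_abs)
 have hI: "integral {c..d} (h n) = Pn n (cl d) - Pn n (cl c)" if "c <= d" for c d n
 proof -
  have *: "Pn n (cl d) - Pn n (cl c) = integral {cl c..cl d} (g n)"
   using cl(1)[of c] cl(1)[of d] cl(2)[OF that] by (intro primitive_on_diff[OF Pn]) auto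
  have "integral {c..d} (h n) = integral ({c..d} \<inter> {a..b}) (g n)"
   unfolding h_def by (simp only: hk_integral_restrict_Int Int_commute)
  also have "... = integral {cl c..cl d} (g n)"
  proof (cases "a <= d & c <= b")
   case True
   then have "cl c = max a c" "cl d = min b d" using that ab by (auto simp: cl_def min_def max_def)
   then have "{c..d} \<inter> {a..b} = {cl c..cl d}" by auto
   then show ?thesis by (simp only:)
  next
   case False
   then have "cl c = cl d" using that ab by (auto simp: cl_def min_def max_def)
   moreover have "{c..d} \<inter> {a..b} = {}" using False by auto
   ultimately show ?thesis by simp
  qed
  finally show ?thesis using * by simp
 qed
 have habs: "h n absolutely_integrable_on S" if "S : sets lebesgue" for n S
 proof -
  have "h n absolutely_integrable_on UNIV"
   unfolding h_def using gabs absolutely_integrable_restrict_UNIV by blast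
  then show ?thesis using set_integrable_subset[of lebesgue UNIV "h n" S] that by auto
 qed
 have Fmono: "F x <= F y" if "x <= y" for x y
 proof -
  have "Pn n (cl x) <= Pn n (cl y)" for n
  proof -
   have "0 <= integral {x..y} (h n)"
    using habs[of "{x..y}" n] by (intro integral_nonneg) (auto simp: absolutely_integrable_on_def h_def g0)
   then show ?thesis using hI[OF that, of n] by simp
  qed
  then show ?thesis unfolding F_def using cl(1) by (intro LIMSEQ_le[OF lim lim]) auto
 qed
 have "continuous_on UNIV cl" unfolding cl_def by (intro continuous_intros)
 then have Fcont: "continuous_on UNIV F"
  unfolding F_def using cl(1) by (intro continuous_on_compose2[OF cP]) auto
 define N where "N = interval_measure F"
 have Icc: "emeasure N {c..d} = ennreal (F d - F c)" if "c <= d" for c d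
  unfolding N_def by (rule emeasure_interval_measure_Icc[OF that Fmono Fcont])
 have setsN: "sets N = sets lborel" by (simp add: N_def)
 \<comment> \<open>A null set lies in an open set U of measure below d. Finite unions of boxes
   exhaust U, and on each of them N is a limit of integrals of g n over a set of measure below d,
   hence at most e.\<close>
 have small: "emeasure N E <= ennreal e" if E: "E : null_sets lborel" and e: "e > 0" for E e
 proof -
  obtain d where d: "d > 0" "!!n S. S : sets lebesgue ==> S \<subseteq> {a..b} ==> measure lebesgue S < d ==>
    integral S (%x. norm (g n x)) <= e"
  proof -
   have "EX d>0. ALL n. ALL S:sets lebesgue. S \<subseteq> {a..b} --> measure lebesgue S < d --> integral S (%x. norm (g n x)) <= e"
    using ui e by (simp only: uniformly_integrable_seq_def)
   then show ?thesis using that by blast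
  qed
  have Ele: "E : sets lebesgue" "emeasure lebesgue E = 0"
   using null_setsD1[OF null_sets_completionI[OF E]] null_setsD2[OF null_sets_completionI[OF E]] by auto
  obtain U where U: "open U" "E \<subseteq> U" "(U - E) : lmeasurable" "emeasure lebesgue (U - E) < ennreal d"
   using sets_lebesgue_outer_open[OF Ele(1) d(1)] by blast
  have Us: "U : sets lebesgue" using borel_open[OF U(1)] by (simp add: sets_completionI_sets)
  have Ud: "emeasure lebesgue U < ennreal d"
  proof -
   have "U = (U - E) \<union> E" using U(2) by auto
   then have "emeasure lebesgue U <= emeasure lebesgue (U - E) + emeasure lebesgue E"
    using emeasure_subadditive[of "U - E" lebesgue E] Ele Us by auto
   then show ?thesis using U(4) Ele(2) by simp
  qed
  obtain \<D> where D: "countable \<D>" "!!X. X : \<D> ==> EX a b. X = cbox a b" "\<Union>\<D> = U"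
   using open_countable_Union_open_cbox[OF U(1)] by metis
  show ?thesis
  proof (cases "\<D> = {}")
   case True then show ?thesis using D U by auto
  next
   case False
   define A where "A n = \<Union>(from_nat_into \<D> ` {..n})" for n
   have A_ne: "from_nat_into \<D> k : \<D>" for k using from_nat_into[OF False] .
   have UA: "(\<Union>n. A n) = U"
   proof -
    have "(\<Union>n. A n) = (\<Union>n. \<Union>k\<le>n. from_nat_into \<D> k)" by (simp only: A_def image_image)
    also have "... = \<Union>(range (from_nat_into \<D>))" by blast
    finally show ?thesis using range_from_nat_into[OF False D(1)] D(3) by simp
   qed
   have AU: "A n \<subseteq> U" for n
    unfolding UA[symmetric] by (rule UN_upper) simp
   have Ab: "A n : sets borel" for n
   proof -
    have "X : sets borel" if "X : from_nat_into \<D> ` {..n}" for X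
    proof -
     obtain k where k: "X = from_nat_into \<D> k" using \<open>X : _\<close> by (elim imageE)
     have "EX a b. X = cbox a b" using D(2)[OF A_ne[of k]] unfolding k .
     then show ?thesis by (elim exE) simp
    qed
    then show ?thesis unfolding A_def by (intro sets.finite_Union) auto
   qed
   have AN: "emeasure N (A m) <= ennreal e" for m
   proof -
    \<comment> \<open>On nonoverlapping intervals the limit can be taken interval by interval, from
      the end values of \<open>Pn n\<close>.\<close>
    obtain p where p: "p division_of (A m)"
    proof -
     have 1: "finite (from_nat_into \<D> ` {..m})" by simp
     have 2: "EX a b. X = cbox a b" if "X : from_nat_into \<D> ` {..m}" for X
     proof -
      obtain k where k: "X = from_nat_into \<D> k" using \<open>X : _\<close> by (elim imageE)
      show ?thesis using D(2)[OF A_ne[of k]] k by simp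
     qed
     show ?thesis
      by (rule elementary_unions_intervals[OF 1 2]) (use that in \<open>simp_all add: A_def\<close>)
    qed
    have fp: "finite p" and pU: "\<Union>p = A m" using p by (auto simp: division_of_def)
    have pI: "EX c d. c <= d & I = {c..d}" if Ip: "I : p" for I
    proof -
     obtain c d where I: "I = cbox c d" using division_ofD(4)[OF p Ip] by (elim exE)
     moreover have "c <= d" using division_ofD(3)[OF p Ip] unfolding I by simp
     ultimately show ?thesis by (intro exI[of _ c] exI[of _ d]) simp
    qed
    define w where "w I = F (Sup I) - F (Inf I)" for I
    have w: "emeasure N I = ennreal (w I)" "0 <= w I" "(%n. integral I (h n)) \<longlonglongrightarrow> w I" if Ip: "I : p" for I
    proof -
     obtain c d where I: "c <= d" "I = {c..d}" using pI[OF Ip] by (elim exE conjE)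
     show "emeasure N I = ennreal (w I)" "0 <= w I" using I Icc[OF I(1)] Fmono[OF I(1)] by (simp_all add: w_def)
     have "(%n. integral I (h n)) = (%n. Pn n (cl d) - Pn n (cl c))" using hI[OF I(1)] I(2) by simp
     moreover have "(%n. Pn n (cl d) - Pn n (cl c)) \<longlonglongrightarrow> P (cl d) - P (cl c)"
      by (intro tendsto_diff lim cl)
     ultimately show "(%n. integral I (h n)) \<longlonglongrightarrow> w I" using I by (simp add: w_def F_def)
    qed
    have "integral (A m) (h n) <= e" for n
    proof -
     have "integral (A m) (h n) = integral (A m \<inter> {a..b}) (g n)"
      unfolding h_def by (simp only: hk_integral_restrict_Int Int_commute)
     also have "... = integral (A m \<inter> {a..b}) (%x. norm (g n x))" using g0 by simp
     also have "... <= e"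
     proof (rule d(2))
      show "A m \<inter> {a..b} : sets lebesgue" using Ab[of m] by auto
      have "emeasure lebesgue (A m \<inter> {a..b}) <= emeasure lebesgue U"
       using AU[of m] Us by (intro emeasure_mono) auto
      then have "emeasure lebesgue (A m \<inter> {a..b}) < ennreal d" using Ud by simp
      then show "measure lebesgue (A m \<inter> {a..b}) < d"
       unfolding measure_def using d(1) by (cases "emeasure lebesgue (A m \<inter> {a..b})") (auto simp: ennreal_less_iff)
     qed auto
     finally show ?thesis .
    qed
    moreover have "(%n. integral (A m) (h n)) \<longlonglongrightarrow> (\<Sum>I\<in>p. w I)"
    proof -
     have "integral (A m) (h n) = (\<Sum>I\<in>p. integral I (h n))" for n
      using habs[of "A m" n] Ab[of m] p
      by (intro integral_combine_division_topdown) (auto simp: absolutely_integrable_on_def)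
     then show ?thesis using w(3) by (simp only:) (rule tendsto_sum)
    qed
    ultimately have "(\<Sum>I\<in>p. w I) <= e"
     by (rule LIMSEQ_le_const2[rotated, OF exI, OF allI, OF impI])
    have "emeasure N (\<Union>I\<in>p. I) <= (\<Sum>I\<in>p. emeasure N I)"
    proof -
     have "I : sets N" if "I : p" for I
      using pI[OF that] unfolding setsN by (elim exE conjE) simp
     then have "(%I. I) ` p \<subseteq> sets N" by blast
     then show ?thesis by (rule emeasure_subadditive_finite[OF fp])
    qed
    also have "... = ennreal (\<Sum>I\<in>p. w I)" using w(1,2) by (simp add: sum_ennreal)
    also have "... <= ennreal e" using \<open>(\<Sum>I\<in>p. w I) <= e\<close> by (rule ennreal_leI)
    finally show ?thesis using pU by simp
   qed
   have "incseq A" unfolding A_def by (intro incseq_SucI Union_mono image_mono) simp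
   moreover have "range A \<subseteq> sets N" using Ab setsN by (simp add: image_subset_iff)
   ultimately have "(SUP n. emeasure N (A n)) = emeasure N (\<Union>n. A n)"
    by (intro SUP_emeasure_incseq)
   moreover have "(SUP n. emeasure N (A n)) <= ennreal e" by (rule SUP_least) (rule AN)
   ultimately have "emeasure N U <= ennreal e" unfolding UA by simp
   moreover have "emeasure N E <= emeasure N U"
    using U(1,2) setsN by (intro emeasure_mono) simp_all
   ultimately show ?thesis by (rule order_trans[rotated])
  qed
 qed
 have "absolutely_continuous lborel N"
  unfolding absolutely_continuous_def
 proof
  fix E :: "real set" assume E: "E : null_sets lborel"
  have "emeasure N E <= 0"
  proof (rule ennreal_le_epsilon)
   fix e :: real assume "0 < e" then show "emeasure N E <= 0 + ennreal e" using small[OF E] by simp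
  qed
  moreover have "E : sets N" using E setsN by (simp add: null_sets_def)
  ultimately show "E : null_sets N" by (intro null_setsI) simp_all
 qed
 then obtain f where f: "f : borel_measurable lborel" "density lborel f = N"
  using sigma_finite_measure.Radon_Nikodym[OF sigma_finite_lborel _ setsN] by blast
 have nnI: "(\<integral>\<^sup>+x\<in>{c..d}. f x \<partial>lborel) = ennreal (F d - F c)" if "c <= d" for c d
  using Icc[OF that] f by (subst (asm) f(2)[symmetric], subst (asm) emeasure_density) auto
 have ffin: "AE x in lborel. x : {a..b} --> f x ~= \<infinity>"
 proof -
  have "AE x in lborel. f x * indicator {a..b} x ~= \<infinity>"
   using nnI[OF ab] f(1) by (intro nn_integral_noteq_infinite) auto
  then show ?thesis by eventually_elim (auto split: split_indicator)
 qed
 \<comment> \<open>f is finite a.e. on {a..b} since its integral there is finite;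
   \<open>enn2real\<close> sends the value infinity to 0.\<close>
 define q where "q x = enn2real (f x)" for x
 have qm: "q : borel_measurable lborel" unfolding q_def using f(1) by measurable
 have q0: "q x >= 0" for x by (simp add: q_def)
 have hi: "(q has_integral (F d - F c)) {c..d}" if cd: "a <= c" "c <= d" "d <= b" for c d
 proof -
  have "(\<integral>\<^sup>+x. ennreal (q x * indicator {c..d} x) \<partial>lborel) = (\<integral>\<^sup>+x\<in>{c..d}. f x \<partial>lborel)"
  proof (rule nn_integral_cong_AE)
   show "AE x in lborel. ennreal (q x * indicator {c..d} x) = f x * indicator {c..d} x"
    using ffin
   proof eventually_elim
    case (elim x)
    then show ?case using cd by (cases "x : {c..d}") (auto simp: q_def less_top)
   qed
  qed
  also have "... = ennreal (F d - F c)" by (rule nnI[OF cd(2)])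
  finally have 1: "(\<integral>\<^sup>+x. ennreal (q x * indicator {c..d} x) \<partial>lborel) = ennreal (F d - F c)" .
  have "((%x. q x * indicator {c..d} x) has_integral (F d - F c)) UNIV"
  proof (rule nn_integral_has_integral[OF _ _ 1])
   have "q : borel_measurable borel" using qm by simp
   then show "(%x. q x * indicator {c..d} x) : borel_measurable borel"
    by (rule borel_measurable_times, intro borel_measurable_indicator) simp
   show "0 <= q x * indicator {c..d} x" for x using q0[of x] by simp
   show "0 <= F d - F c" using Fmono[OF cd(2)] by simp
  qed
  then have "((%x. if x : {c..d} then q x else 0) has_integral (F d - F c)) UNIV"
   by (rule has_integral_eq[rotated]) (simp add: indicator_def)
  then show ?thesis by (simp only: has_integral_restrict_UNIV)
 qed
 have "primitive_on a b P q"
 proof (rule primitive_onI)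
  show "q absolutely_integrable_on {a..b}"
   by (rule nonnegative_absolutely_integrable_1[OF has_integral_integrable[OF hi]]) (simp_all add: ab q0)
  fix s assume s: "a <= s" "s <= b"
  have "integral {a..s} q = F s - F a" by (rule integral_unique, rule hi) (simp_all add: s)
  moreover have "F s = P s" "F a = P a" unfolding F_def using s ab cl(3)[of s] cl(3)[of a] by simp_all
  ultimately show "P s - P a = integral {a..s} q" by simp
 qed
 then show ?thesis using q0 by (rule that)
qed

lemma primitive_on_linear:
 fixes f :: "real => 'a::euclidean_space" and h :: "'a => 'b::euclidean_space"
 assumes f: "primitive_on a b f g" and h: "bounded_linear h"
 shows "primitive_on a b (%s. h (f s)) (%s. h (g s))"
proof (rule primitive_onI)
 show "(%s. h (g s)) absolutely_integrable_on {a..b}"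
  using absolutely_integrable_linear[OF primitive_on_abs[OF f] h] by (simp add: o_def)
 fix s assume s: "a <= s" "s <= b"
 have "h (f s) - h (f a) = h (integral {a..s} g)"
  using primitive_on_diff[OF f order_refl s] linear_diff[OF bounded_linear.linear[OF h], of "f s" "f a"] by simp
 also have "... = integral {a..s} (%x. h (g x))"
  using integral_linear[OF primitive_on_integrable(2)[OF f order_refl s(2)] h] by (simp add: o_def)
 finally show "h (f s) - h (f a) = integral {a..s} (%x. h (g x))" .
qed

lemma primitive_on_add:
 assumes 1: "primitive_on a b f1 g1" and 2: "primitive_on a b f2 g2"
 shows "primitive_on a b (%s. f1 s + f2 s) (%s. g1 s + g2 s)"
proof (rule primitive_onI)
 show "(%s. g1 s + g2 s) absolutely_integrable_on {a..b}"
  by (rule set_integral_add[OF primitive_on_abs[OF 1] primitive_on_abs[OF 2]])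
 fix s assume s: "a <= s" "s <= b"
 have "integral {a..s} (%s. g1 s + g2 s) = integral {a..s} g1 + integral {a..s} g2"
  by (rule hk_integral_add)
   (rule primitive_on_integrable[OF 1 order_refl s(2)] primitive_on_integrable[OF 2 order_refl s(2)])+
 then show "f1 s + f2 s - (f1 a + f2 a) = integral {a..s} (%s. g1 s + g2 s)"
  using primitive_on_diff[OF 1 order_refl s] primitive_on_diff[OF 2 order_refl s]
  by (simp add: algebra_simps)
qed

lemma primitive_on_const: "primitive_on a b (%s. c) (%s. 0)"
 by (rule primitive_onI) simp_all

lemma primitive_on_uminus: "primitive_on a b f g ==> primitive_on a b (%s. - f s) (%s. - g s)"
 using primitive_on_linear[of a b f g uminus] by (simp add: bounded_linear_minus bounded_linear_ident)

lemma primitive_on_minus: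
 assumes "primitive_on a b f1 g1" "primitive_on a b f2 g2"
 shows "primitive_on a b (%s. f1 s - f2 s) (%s. g1 s - g2 s)"
 using primitive_on_add[OF assms(1) primitive_on_uminus[OF assms(2)]] by simp

lemma primitive_on_sum:
 assumes "finite I" "!!i. i : I ==> primitive_on a b (f i) (g i)"
 shows "primitive_on a b (%s. \<Sum>i\<in>I. f i s) (%s. \<Sum>i\<in>I. g i s)"
 using assms by (induction I) (simp_all add: primitive_on_const primitive_on_add)

lemma primitive_on_inner: "primitive_on a b f g ==> primitive_on a b (%s. f s \<bullet> v) (%s. g s \<bullet> v)"
 by (rule primitive_on_linear[OF _ bounded_linear_inner_left])

lemma primitive_on_from_components:
 fixes f :: "real => 'a::euclidean_space"
 assumes "!!i. i : Basis ==> primitive_on a b (%s. f s \<bullet> i) (g i)"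
 shows "primitive_on a b f (%s. \<Sum>i\<in>Basis. g i s *\<^sub>R i)"
proof -
 have "primitive_on a b (%s. \<Sum>i\<in>Basis. (f s \<bullet> i) *\<^sub>R i) (%s. \<Sum>i\<in>Basis. g i s *\<^sub>R i)"
  using assms by (intro primitive_on_sum primitive_on_linear[OF _ bounded_linear_scaleR_left]) simp_all
 then show ?thesis by (simp add: euclidean_representation)
qed

lemma uniformly_integrable_seq_abs: "uniformly_integrable_seq a b g ==> g n absolutely_integrable_on {a..b}"
 unfolding uniformly_integrable_seq_def by blast

lemma uniformly_integrable_seq_mono:
 fixes h :: "nat => real => 'b::euclidean_space"
 assumes g: "uniformly_integrable_seq a b g" and h: "!!n. h n absolutely_integrable_on {a..b}"
  and le: "!!n x. norm (h n x) <= c * norm (g n x)"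
 shows "uniformly_integrable_seq a b h"
 unfolding uniformly_integrable_seq_def
proof (intro conjI allI impI h)
 fix e :: real assume e: "e > 0"
 define c' where "c' = abs c + 1"
 have c': "c' > 0" by (simp add: c'_def)
 have le': "norm (h n x) <= c' * norm (g n x)" for n x
  by (rule order_trans[OF le mult_right_mono]) (simp_all add: c'_def)
 obtain d where d: "d > 0" "!!n S. S : sets lebesgue ==> S \<subseteq> {a..b} ==> measure lebesgue S < d ==>
    integral S (%x. norm (g n x)) <= e / c'"
 proof -
  have "e / c' > 0" using e c' by simp
  then have "EX d>0. ALL n. ALL S:sets lebesgue. S \<subseteq> {a..b} --> measure lebesgue S < d --> integral S (%x. norm (g n x)) <= e / c'"
   using g by (simp only: uniformly_integrable_seq_def)
  then show ?thesis using that by blast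
 qed
 show "EX d>0. ALL n. ALL S:sets lebesgue. S \<subseteq> {a..b} --> measure lebesgue S < d --> integral S (%x. norm (h n x)) <= e"
 proof (intro exI[of _ d] conjI allI ballI impI d(1))
  fix n S assume S: "S : sets lebesgue" "S \<subseteq> {a..b}" "measure lebesgue S < d"
  have hS: "(%x. norm (h n x)) integrable_on S"
   using set_integrable_subset[OF h[of n] S(1,2)] by (simp add: absolutely_integrable_on_def)
  have gS: "(%x. norm (g n x)) integrable_on S"
   using set_integrable_subset[OF uniformly_integrable_seq_abs[OF g, of n] S(1,2)]
   by (simp add: absolutely_integrable_on_def)
  have "integral S (%x. norm (h n x)) <= integral S (%x. c' * norm (g n x))"
   by (rule integral_le[OF hS integrable_mult_const[OF gS] le'])
  also have "... = c' * integral S (%x. norm (g n x))" by simp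
  also have "... <= c' * (e / c')" by (rule mult_left_mono[OF d(2)[OF S]]) (use c' in simp)
  finally show "integral S (%x. norm (h n x)) <= e" using c' by simp
 qed
qed

lemma primitive_on_norm_diff_le:
 assumes y: "primitive_on a b y g" and st: "a <= s" "s <= t" "t <= b"
 shows "norm (y t - y s) <= integral {s..t} (%x. norm (g x))"
proof -
 have "norm (y t - y s) = norm (integral {s..t} g)"
  using primitive_on_diff[OF y st] by simp
 also have "... <= integral {s..t} (%x. norm (g x))"
  by (rule hk_integral_norm_bound_integral)
   (rule primitive_on_integrable[OF y st(1,3)] order_refl)+
 finally show ?thesis .
qed

lemma uniformly_integrable_seq_equicontinuous:
 assumes y: "!!n. primitive_on a b (y n) (g n)" and g: "uniformly_integrable_seq a b g" and e: "e > 0"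
 shows "EX d>0. ALL n. ALL s:{a..b}. ALL t:{a..b}. abs (s - t) < d --> norm (y n s - y n t) <= e"
proof -
 have "EX d>0. ALL n. ALL S:sets lebesgue. S \<subseteq> {a..b} --> measure lebesgue S < d --> integral S (%x. norm (g n x)) <= e"
  using g e by (simp only: uniformly_integrable_seq_def)
 then obtain d where d: "d > 0" "!!n S. S : sets lebesgue ==> S \<subseteq> {a..b} ==> measure lebesgue S < d ==>
    integral S (%x. norm (g n x)) <= e" by blast
 have *: "norm (y n t - y n s) <= e" if st: "s : {a..b}" "t : {a..b}" "s <= t" "t - s < d" for n s t
 proof -
  have as: "a <= s" "t <= b" using st by simp_all
  have "norm (y n t - y n s) <= integral {s..t} (%x. norm (g n x))"
   by (rule primitive_on_norm_diff_le[OF y as(1) st(3) as(2)])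
  also have "... <= e"
   by (rule d(2)) (use st as in simp_all)
  finally show ?thesis .
 qed
 show ?thesis
 proof (intro exI[of _ d] conjI allI ballI impI d(1))
  fix n s t assume st: "s : {a..b}" "t : {a..b}" "abs (s - t) < d"
  show "norm (y n s - y n t) <= e"
  proof (cases "s <= t")
   case True then show ?thesis using *[OF st(1,2) True, of n] st(3) by (simp add: norm_minus_commute)
  next
   case False then show ?thesis using *[OF st(2,1), of n] st(3) by simp
  qed
 qed
qed

text \<open>Does the work of Hoelder's inequality: a large K makes the energy term small, and then a
  short interval makes the first term small.\<close>

lemma integral_norm_le_powr:
 fixes g :: "real => 'a::euclidean_space"
 assumes g: "g absolutely_integrable_on {a..b}" and gp: "(%x. norm (g x) powr p) integrable_on {a..b}"
  and p: "p > 1" and K: "K > 0" and ab: "a <= b"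
 shows "integral {a..b} (%x. norm (g x)) <= K * (b - a) + K powr (1 - p) * integral {a..b} (%x. norm (g x) powr p)"
proof -
 have gn: "(%x. norm (g x)) integrable_on {a..b}" using g by (simp add: absolutely_integrable_on_def)
 have "integral {a..b} (%x. norm (g x)) <= integral {a..b} (%x. K + K powr (1 - p) * norm (g x) powr p)"
  by (rule integral_le[OF gn integrable_add[OF integrable_const_ivl integrable_mult_const[OF gp]]])
   (rule le_add_powr[OF norm_ge_zero K p])
 also have "... = integral {a..b} (%x. K) + integral {a..b} (%x. K powr (1 - p) * norm (g x) powr p)"
  by (rule hk_integral_add[OF integrable_const_ivl integrable_mult_const[OF gp]])
 also have "... = K * (b - a) + K powr (1 - p) * integral {a..b} (%x. norm (g x) powr p)"
  using ab by simp
 finally show ?thesis .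
qed

text \<open>Weak compactness of curves with bounded energy. Arzela-Ascoli gives a uniform limit,
  which still lacks a density. Each component is a difference of two nondecreasing primitives, those
  of the positive and of the negative part of its density; if these converge too,
  \<open>primitive_on_limit_density\<close> applies to both.\<close>

lemma curve_compactness:
 fixes y :: "nat => real => 'a::euclidean_space"
 assumes ab: "a <= b" and p: "p > 1" and y: "!!n. primitive_on a b (y n) (g n)"
  and gp: "!!n. (%x. norm (g n x) powr p) integrable_on {a..b}"
  and M: "!!n. integral {a..b} (%x. norm (g n x) powr p) <= M"
  and B: "!!n. norm (y n a) <= B"
 obtains k z q where "strict_mono (k :: nat => nat)" "primitive_on a b z q"
  "!!e. e > 0 ==> EX N. ALL n x. n >= N & x : {a..b} --> norm (y (k n) x - z x) < e"
proof -
 have gabs: "g n absolutely_integrable_on {a..b}" for n by (rule primitive_on_abs[OF y])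
 have ui: "uniformly_integrable_seq a b g" by (rule uniformly_integrable_seq_powr[OF p gabs gp M])
 define h where "h i n x = max 0 (g n x \<bullet> i)" for i :: 'a and n x
 have gi: "(%x. g n x \<bullet> i) absolutely_integrable_on {a..b}" for n i
  by (rule primitive_on_abs[OF primitive_on_inner[OF y]])
 have habs: "h i n absolutely_integrable_on {a..b}" for i n
  unfolding h_def by (intro absolutely_integrable_max_1 absolutely_integrable_zero gi)
 \<comment> \<open>P collects the primitives of the positive parts of all components in one
   vector-valued curve.\<close>
 define P where "P n s = (\<Sum>i\<in>Basis. integral {a..s} (h i n) *\<^sub>R i)" for n s
 define H where "H n x = (\<Sum>i\<in>Basis. h i n x *\<^sub>R i)" for n x
 have hp: "primitive_on a b (%s. integral {a..s} (h i n)) (h i n)" for i n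
  by (rule primitive_onI[OF habs]) simp
 have HP: "primitive_on a b (P n) (H n)" for n
  unfolding P_def H_def by (intro primitive_on_sum primitive_on_linear[OF hp bounded_linear_scaleR_left]) simp
 have Hle: "norm (H n x) <= real DIM('a) * norm (g n x)" for n x
 proof -
  have "norm (H n x) <= (\<Sum>i\<in>Basis. norm (h i n x *\<^sub>R i))" unfolding H_def by (rule norm_sum)
  also have "... <= (\<Sum>i\<in>(Basis :: 'a set). norm (g n x))"
  proof (rule sum_mono)
   fix i :: 'a assume i: "i : Basis"
   have "abs (h i n x) <= abs (g n x \<bullet> i)" by (simp add: h_def)
   also have "... <= norm (g n x)" by (rule Basis_le_norm[OF i])
   finally show "norm (h i n x *\<^sub>R i) <= norm (g n x)" using i by simp
  qed
  finally show ?thesis by simp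
 qed
 have Hui: "uniformly_integrable_seq a b H"
  by (rule uniformly_integrable_seq_mono[OF ui primitive_on_abs[OF HP] Hle])
 define W where "W = 1 * (b - a) + 1 powr (1 - p) * M"
 have W: "integral {a..b} (%x. norm (g n x)) <= W" for n
  using integral_norm_le_powr[OF gabs gp p zero_less_one ab, of n] M[of n] by (simp add: W_def)
 have sub: "integral {a..s} (%x. norm (g n x)) <= W" if "s : {a..b}" for s n
 proof -
  have "integral {a..s} (%x. norm (g n x)) <= integral {a..b} (%x. norm (g n x))"
   by (rule integral_subset_le) (use that primitive_on_integrable(3)[OF y[of n], of a] in simp_all)
  then show ?thesis using W[of n] by linarith
 qed
 have yb: "norm (y n s) <= B + W" if "s : {a..b}" for n s
 proof -
  have "norm (y n s - y n a) <= W"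
   using primitive_on_norm_diff_le[OF y[of n] order_refl, of s] sub[OF that, of n] that by simp
  then show ?thesis using B[of n] norm_triangle_sub[of "y n s" "y n a"] by linarith
 qed
 have Pb: "norm (P n s) <= real DIM('a) * W" if "s : {a..b}" for n s
 proof -
  have P0: "P n a = 0" by (simp add: P_def)
  have "norm (P n s - P n a) <= integral {a..s} (%x. norm (H n x))"
   using primitive_on_norm_diff_le[OF HP[of n] order_refl, of s] that by simp
  also have "... <= integral {a..s} (%x. real DIM('a) * norm (g n x))"
   by (rule integral_le[OF primitive_on_integrable(3)[OF HP] integrable_mult_const[OF primitive_on_integrable(3)[OF y]] Hle])
    (use that in simp_all)
  also have "... = real DIM('a) * integral {a..s} (%x. norm (g n x))" by simp
  also have "... <= real DIM('a) * W" by (rule mult_left_mono[OF sub[OF that]]) simp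
  finally show ?thesis by (simp add: P0)
 qed
 \<comment> \<open>A single extraction for the pair makes y and P converge along the same
   subsequence.\<close>
 define \<Phi> where "\<Phi> n s = (y n s, P n s)" for n s
 obtain \<Psi> k where \<Psi>: "continuous_on {a..b} \<Psi>" "strict_mono (k :: nat => nat)"
  "!!e. 0 < e ==> EX N. ALL n x. n >= N & x : {a..b} --> norm (\<Phi> (k n) x - \<Psi> x) < e"
 proof (rule Arzela_Ascoli[of "{a..b}" \<Phi> "(B + W) + real DIM('a) * W"])
  show "norm (\<Phi> n x) <= (B + W) + real DIM('a) * W" if "x : {a..b}" for n x
   unfolding \<Phi>_def using norm_Pair_le[of "y n x" "P n x"] yb[OF that, of n] Pb[OF that, of n] by linarith
  show "EX d>0. ALL n y. y : {a..b} & norm (x - y) < d --> norm (\<Phi> n x - \<Phi> n y) < e"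
   if x: "x : {a..b}" and e: "0 < e" for x e
  proof -
   have e3: "e / 3 > 0" using e by simp
   obtain d1 where d1: "d1 > 0" "!!n s t. s : {a..b} ==> t : {a..b} ==> abs (s - t) < d1 ==> norm (y n s - y n t) <= e / 3"
    using uniformly_integrable_seq_equicontinuous[OF y ui e3] by blast
   obtain d2 where d2: "d2 > 0" "!!n s t. s : {a..b} ==> t : {a..b} ==> abs (s - t) < d2 ==> norm (P n s - P n t) <= e / 3"
    using uniformly_integrable_seq_equicontinuous[OF HP Hui e3] by blast
   show ?thesis
   proof (intro exI[of _ "min d1 d2"] conjI allI impI)
    show "0 < min d1 d2" using d1 d2 by simp
    fix n z assume z: "z : {a..b} & norm (x - z) < min d1 d2"
    have "norm (\<Phi> n x - \<Phi> n z) <= norm (y n x - y n z) + norm (P n x - P n z)"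
     using norm_Pair_le[of "y n x - y n z" "P n x - P n z"] by (simp add: \<Phi>_def)
    also have "... <= e / 3 + e / 3"
     using z by (intro add_mono d1(2) d2(2) x) simp_all
    finally show "norm (\<Phi> n x - \<Phi> n z) < e" using e by simp
   qed
  qed
 qed simp_all
 define z where "z s = fst (\<Psi> s)" for s
 define R where "R s = snd (\<Psi> s)" for s
 have zu: "EX N. ALL n x. n >= N & x : {a..b} --> norm (y (k n) x - z x) < e" if e: "e > 0" for e
 proof -
  obtain N where N: "!!n x. n >= N ==> x : {a..b} ==> norm (\<Phi> (k n) x - \<Psi> x) < e" using \<Psi>(3)[OF e] by blast
  have "norm (y (k n) x - z x) <= norm (\<Phi> (k n) x - \<Psi> x)" for n x
   using norm_fst_le[of "y (k n) x - fst (\<Psi> x)" "P (k n) x - snd (\<Psi> x)"]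
   by (simp add: \<Phi>_def z_def minus_prod_def)
  then show ?thesis using N by (intro exI[of _ N]) (meson le_less_trans)
 qed
 have Ru: "EX N. ALL n x. n >= N & x : {a..b} --> norm (P (k n) x - R x) < e" if e: "e > 0" for e
 proof -
  obtain N where N: "!!n x. n >= N ==> x : {a..b} ==> norm (\<Phi> (k n) x - \<Psi> x) < e" using \<Psi>(3)[OF e] by blast
  have "norm (P (k n) x - R x) <= norm (\<Phi> (k n) x - \<Psi> x)" for n x
   using norm_snd_le[of "P (k n) x - snd (\<Psi> x)" "y (k n) x - fst (\<Psi> x)"]
   by (simp add: \<Phi>_def R_def minus_prod_def)
  then show ?thesis using N by (intro exI[of _ N]) (meson le_less_trans)
 qed
 have zlim: "(%n. y (k n) s) \<longlonglongrightarrow> z s" if "s : {a..b}" for s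
  unfolding LIMSEQ_iff using zu that by meson
 have Rlim: "(%n. P (k n) s) \<longlonglongrightarrow> R s" if "s : {a..b}" for s
  unfolding LIMSEQ_iff using Ru that by meson
 have zc: "continuous_on {a..b} z" "continuous_on {a..b} R"
  unfolding z_def R_def by (intro continuous_on_fst continuous_on_snd \<Psi>(1))+
 have comp: "EX q. primitive_on a b (%s. z s \<bullet> i) q" if i: "i : Basis" for i
 proof -
  have Pi: "P n s \<bullet> i = integral {a..s} (h i n)" for n s
   using i by (simp add: P_def inner_sum_left inner_Basis if_distrib sum.delta cong: if_cong)
  have hk: "primitive_on a b (%s. P (k n) s \<bullet> i) (h i (k n))" for n
   unfolding Pi by (rule hp)
  have hle: "norm (h i n x) <= 1 * norm (g n x)" for n x
   using Basis_le_norm[OF i, of "g n x"] by (simp add: h_def)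
  have uik: "uniformly_integrable_seq a b (%n. g (k n))"
   by (rule uniformly_integrable_seq_powr[OF p gabs gp M])
  obtain q1 where q1: "primitive_on a b (%s. R s \<bullet> i) q1"
  proof (rule primitive_on_limit_density[OF ab hk, where P = "%s. R s \<bullet> i"])
   show "uniformly_integrable_seq a b (%n. h i (k n))"
    by (rule uniformly_integrable_seq_mono[OF uik habs hle])
   show "0 <= h i (k n) x" for n x by (simp add: h_def)
   show "(%n. P (k n) s \<bullet> i) \<longlonglongrightarrow> R s \<bullet> i" if "s : {a..b}" for s
    by (intro tendsto_inner Rlim[OF that] tendsto_const)
   show "continuous_on {a..b} (%s. R s \<bullet> i)" by (intro continuous_intros zc)
  qed
  \<comment> \<open>This is the negative part of the component, hence also nonnegative; its
    primitive is the difference of P and y.\<close>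
  define hm where "hm n x = h i n x - g n x \<bullet> i" for n x
  have hmk: "primitive_on a b (%s. P (k n) s \<bullet> i - y (k n) s \<bullet> i) (hm (k n))" for n
   unfolding hm_def by (rule primitive_on_minus[OF hk primitive_on_inner[OF y]])
  have hmle: "norm (hm n x) <= 1 * norm (g n x)" for n x
   using Basis_le_norm[OF i, of "g n x"] by (auto simp: h_def hm_def max_def)
  obtain q2 where q2: "primitive_on a b (%s. R s \<bullet> i - z s \<bullet> i) q2"
  proof (rule primitive_on_limit_density[OF ab hmk, where P = "%s. R s \<bullet> i - z s \<bullet> i"])
   show "uniformly_integrable_seq a b (%n. hm (k n))"
    by (rule uniformly_integrable_seq_mono[OF uik primitive_on_abs[OF hmk] hmle])
   show "0 <= hm (k n) x" for n x by (simp add: h_def hm_def)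
   show "(%n. P (k n) s \<bullet> i - y (k n) s \<bullet> i) \<longlonglongrightarrow> R s \<bullet> i - z s \<bullet> i" if "s : {a..b}" for s
    by (intro tendsto_diff tendsto_inner Rlim[OF that] zlim[OF that] tendsto_const)
   show "continuous_on {a..b} (%s. R s \<bullet> i - z s \<bullet> i)" by (intro continuous_intros zc)
  qed
  have "primitive_on a b (%s. R s \<bullet> i - (R s \<bullet> i - z s \<bullet> i)) (%s. q1 s - q2 s)"
   by (rule primitive_on_minus[OF q1 q2])
  then show ?thesis by auto
 qed
 then obtain q where q: "!!i. i : Basis ==> primitive_on a b (%s. z s \<bullet> i) (q i)" by metis
 show ?thesis by (rule that[OF \<Psi>(2) primitive_on_from_components[OF q] zu])
qed

text \<open>Approximation in a weighted mean that keeps a uniform bound. A measurable function is an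
  a.e. limit of continuous ones, truncation at B permits dominated convergence with weight w, and a
  polynomial then replaces the continuous function.\<close>

lemma approximate_by_C1:
 fixes \<beta> w :: "real => real"
 assumes \<beta>m: "\<beta> : borel_measurable (lebesgue_on {a..b})" and \<beta>B: "!!x. x : {a..b} ==> abs (\<beta> x) <= B"
  and w: "w integrable_on {a..b}" "!!x. w x >= 0" and e: "e > 0" and B: "B >= 0"
 obtains \<pi> \<pi>' where "!!x. (\<pi> has_real_derivative \<pi>' x) (at x)" "continuous_on UNIV \<pi>'"
  "!!x. x : {a..b} ==> abs (\<pi> x) <= B + 1" "integral {a..b} (%x. abs (\<beta> x - \<pi> x) * w x) < e"
proof -
 have wabs: "w absolutely_integrable_on {a..b}" by (rule nonnegative_absolutely_integrable_1[OF w])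
 have "\<beta> measurable_on {a..b}"
  using \<beta>m by (simp add: measurable_on_iff_borel_measurable)
 then obtain N \<phi> where N: "negligible N" and \<phi>c: "!!n. continuous_on UNIV (\<phi> n)"
  and \<phi>l: "!!x. x ~: N ==> (%n. \<phi> n x) \<longlonglongrightarrow> (if x : {a..b} then \<beta> x else 0)"
  unfolding measurable_on_def by blast
 define \<psi> where "\<psi> n x = max (- B) (min B (\<phi> n x))" for n x
 have \<psi>c: "continuous_on {a..b} (\<psi> n)" for n
  unfolding \<psi>_def by (intro continuous_intros continuous_on_subset[OF \<phi>c]) simp
 have \<psi>B: "abs (\<psi> n x) <= B" for n x using B by (auto simp: \<psi>_def)
 have bprod: "(%x. abs (\<beta> x - f x) * w x) integrable_on {a..b}" if f: "continuous_on {a..b} f" for f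
 proof -
  have m: "(%x. abs (\<beta> x - f x)) : borel_measurable (lebesgue_on {a..b})"
   using \<beta>m continuous_imp_measurable_on_sets_lebesgue[OF f] by (intro borel_measurable_abs borel_measurable_diff) simp_all
  have "bounded (f ` {a..b})" by (intro compact_imp_bounded compact_continuous_image f compact_Icc)
  then obtain C where C0: "ALL y:f ` {a..b}. norm y <= C" unfolding bounded_iff by blast
  have C: "abs (f x) <= C" if "x : {a..b}" for x using bspec[OF C0 imageI[OF that]] by simp
  have "bounded ((%x. abs (\<beta> x - f x)) ` {a..b})"
   unfolding bounded_iff
  proof (intro exI[of _ "B + C"] ballI)
   fix y assume "y : (%x. abs (\<beta> x - f x)) ` {a..b}"
   then obtain x where "x : {a..b}" "y = abs (\<beta> x - f x)" by blast
   then show "norm y <= B + C" using \<beta>B[of x] C[of x] by simp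
  qed
  then have "(%x. abs (\<beta> x - f x) * w x) absolutely_integrable_on {a..b}"
   by (intro absolutely_integrable_bounded_measurable_product_real m wabs) simp_all
  then show ?thesis by (simp add: absolutely_integrable_on_def)
 qed
 have "(%n. integral {a..b} (%x. abs (\<beta> x - \<psi> n x) * w x)) \<longlonglongrightarrow> integral {a..b} (%x. 0)"
 proof (rule dominated_convergence_AE(2))
  show "(%x. abs (\<beta> x - \<psi> n x) * w x) integrable_on {a..b}" for n by (rule bprod[OF \<psi>c])
  show "(%x. (2 * B) * w x) integrable_on {a..b}" by (rule integrable_mult_const[OF w(1)])
  show "norm (abs (\<beta> x - \<psi> n x) * w x) <= (2 * B) * w x" if "x : {a..b}" for n x
  proof -
   have "abs (\<beta> x - \<psi> n x) <= 2 * B" using \<beta>B[OF that] \<psi>B[of n x] by linarith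
   then have "abs (\<beta> x - \<psi> n x) * w x <= (2 * B) * w x" by (rule mult_right_mono[OF _ w(2)])
   then show ?thesis using w(2)[of x] by simp
  qed
  have "(%n. abs (\<beta> x - \<psi> n x) * w x) \<longlonglongrightarrow> 0" if "x : {a..b}" "x ~: N" for x
  proof -
   have "(%n. \<phi> n x) \<longlonglongrightarrow> \<beta> x" using \<phi>l[OF that(2)] that(1) by simp
   then have "(%n. abs (\<beta> x - \<psi> n x) * w x) \<longlonglongrightarrow> abs (\<beta> x - max (- B) (min B (\<beta> x))) * w x"
    unfolding \<psi>_def by (intro tendsto_intros)
   moreover have "max (- B) (min B (\<beta> x)) = \<beta> x" using \<beta>B[OF that(1)] by (simp add: max_def min_def abs_le_iff)
   ultimately show ?thesis by simp
  qed
  then show "AE x in lebesgue. x : {a..b} --> (%n. abs (\<beta> x - \<psi> n x) * w x) \<longlonglongrightarrow> 0"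
   unfolding AE_lebesgue_negligible using N by blast
 qed
 then have lim: "(%n. integral {a..b} (%x. abs (\<beta> x - \<psi> n x) * w x)) \<longlonglongrightarrow> 0" by simp
 have "\<forall>\<^sub>F n in sequentially. integral {a..b} (%x. abs (\<beta> x - \<psi> n x) * w x) < e / 2"
  by (rule order_tendstoD(2)[OF lim]) (use e in simp)
 then obtain n where n: "integral {a..b} (%x. abs (\<beta> x - \<psi> n x) * w x) < e / 2"
  by (auto simp: eventually_sequentially)
 define I where "I = integral {a..b} w"
 have I0: "I >= 0" unfolding I_def by (rule integral_nonneg[OF w(1)]) (rule w(2))
 \<comment> \<open>The bound 1 yields \<open>B + 1\<close> as a bound for the polynomial; the other
   bound makes its weighted error at most e/2.\<close>
 define \<eta> where "\<eta> = min 1 (e / (2 * (I + 1)))"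
 have \<eta>: "\<eta> > 0" "\<eta> <= 1" using e I0 by (simp_all add: \<eta>_def)
 have \<eta>I: "\<eta> * I <= e / 2"
 proof -
  have "\<eta> * I <= e / (2 * (I + 1)) * I" by (rule mult_right_mono) (simp_all add: \<eta>_def I0)
  also have "... <= e / 2" using e I0 by (simp add: field_simps)
  finally show ?thesis .
 qed
 obtain \<pi> where \<pi>: "real_polynomial_function \<pi>" "!!x. x : {a..b} ==> abs (\<psi> n x - \<pi> x) < \<eta>"
  using Stone_Weierstrass_real_polynomial_function[OF compact_Icc \<psi>c[of n] \<eta>(1)] by blast
 obtain \<pi>' where \<pi>': "real_polynomial_function \<pi>'" "!!x. (\<pi> has_real_derivative \<pi>' x) (at x)"
  using has_real_derivative_polynomial_function[OF \<pi>(1)] by blast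
 have c: "continuous_on S \<pi>" "continuous_on S \<pi>'" for S
  using \<pi>(1) \<pi>'(1) by (simp_all add: continuous_on_polymonial_function real_polynomial_function_eq)
 have "integral {a..b} (%x. abs (\<beta> x - \<pi> x) * w x) <= integral {a..b} (%x. abs (\<beta> x - \<psi> n x) * w x + \<eta> * w x)"
 proof (rule integral_le[OF bprod[OF c(1)] integrable_add[OF bprod[OF \<psi>c] integrable_mult_const[OF w(1)]]])
  fix x assume x: "x : {a..b}"
  have "abs (\<beta> x - \<pi> x) <= abs (\<beta> x - \<psi> n x) + \<eta>" using \<pi>(2)[OF x] by linarith
  then have "abs (\<beta> x - \<pi> x) * w x <= (abs (\<beta> x - \<psi> n x) + \<eta>) * w x" by (rule mult_right_mono[OF _ w(2)])
  then show "abs (\<beta> x - \<pi> x) * w x <= abs (\<beta> x - \<psi> n x) * w x + \<eta> * w x" by (simp add: algebra_simps)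
 qed
 also have "... = integral {a..b} (%x. abs (\<beta> x - \<psi> n x) * w x) + integral {a..b} (%x. \<eta> * w x)"
  by (rule hk_integral_add[OF bprod[OF \<psi>c] integrable_mult_const[OF w(1)]])
 also have "... < e" using n \<eta>I by (simp add: I_def)
 finally have fin: "integral {a..b} (%x. abs (\<beta> x - \<pi> x) * w x) < e" .
 have "abs (\<pi> x) <= B + 1" if "x : {a..b}" for x
  using \<pi>(2)[OF that] \<psi>B[of n x] \<eta>(2) by linarith
 then show ?thesis by (rule that[OF \<pi>'(2) c(2) _ fin])
qed

text \<open>Against a C1 multiplier the densities converge by integration by parts, since the curves
  converge uniformly. The energy bound extends this to bounded measurable \<beta>: replacing \<beta>
  by a C1 function costs an error that is small uniformly in n.\<close>

lemma weak_convergence_bounded_multiplier: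
 fixes \<beta> :: "real => real"
 assumes ab: "a <= b" and p: "p > 1"
  and y: "!!n. primitive_on a b (y n) (g n)" and z: "primitive_on a b z q"
  and gp: "!!n. (%x. norm (g n x) powr p) integrable_on {a..b}"
  and M: "!!n. integral {a..b} (%x. norm (g n x) powr p) <= M"
  and unif: "!!e. e > 0 ==> EX N. ALL n x. n >= N & x : {a..b} --> abs (y n x - z x) < e"
  and \<beta>m: "\<beta> : borel_measurable (lebesgue_on {a..b})" and \<beta>B: "!!x. x : {a..b} ==> abs (\<beta> x) <= B"
 shows "(%n. integral {a..b} (%x. \<beta> x * g n x)) \<longlonglongrightarrow> integral {a..b} (%x. \<beta> x * q x)"
proof -
 have B: "B >= 0" using \<beta>B[of a] ab by auto
 have M0: "M >= 0" using M[of 0] integral_nonneg[OF gp[of 0]] by simp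
 have mult: "(%x. f x * r x) integrable_on {a..b}" "(%x. f x * abs (r x)) integrable_on {a..b}"
  if "f : borel_measurable (lebesgue_on {a..b})" "!!x. x : {a..b} ==> abs (f x) <= C"
   "r absolutely_integrable_on {a..b}" for f r :: "real => real" and C
 proof -
  have bd: "bounded (f ` {a..b})" unfolding bounded_iff using that(2) by (intro exI[of _ C]) auto
  have "(%x. f x * r x) absolutely_integrable_on {a..b}" "(%x. f x * abs (r x)) absolutely_integrable_on {a..b}"
   by (intro absolutely_integrable_bounded_measurable_product_real that bd set_integrable_abs; simp)+
  then show "(%x. f x * r x) integrable_on {a..b}" "(%x. f x * abs (r x)) integrable_on {a..b}"
   by (simp_all add: absolutely_integrable_on_def)
 qed
 have gabs: "g n absolutely_integrable_on {a..b}" for n by (rule primitive_on_abs[OF y])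
 have qabs: "q absolutely_integrable_on {a..b}" by (rule primitive_on_abs[OF z])
 show ?thesis
  unfolding LIMSEQ_iff
 proof (intro allI impI)
  fix r :: real assume r: "r > 0"
  define e where "e = r / 4"
  have e: "e > 0" using r by (simp add: e_def)
  \<comment> \<open>\<open>2 * B + 1\<close> bounds \<open>abs (\<beta> x - \<pi> x)\<close>; with
    this c the energy part of the replacement error is at most e.\<close>
  obtain c where c: "c > 0" "(2 * B + 1) * c * M <= e"
  proof (rule that)
   show "e / ((2 * B + 1) * (M + 1)) > 0" using e B M0 by simp
   show "(2 * B + 1) * (e / ((2 * B + 1) * (M + 1))) * M <= e"
   proof -
    have "(2 * B + 1) * (e / ((2 * B + 1) * (M + 1))) * M = e * (M / (M + 1))" using B by simp
    also have "... <= e * 1" using e M0 by (intro mult_left_mono) simp_all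
    finally show ?thesis by simp
   qed
  qed
  define K where "K = c powr (1 / (1 - p))"
  have K: "K > 0" "K powr (1 - p) = c" using c p by (simp_all add: K_def powr_powr)
  \<comment> \<open>\<open>le_add_powr\<close> bounds \<open>abs (g n x - q x)\<close> by
    \<open>K + abs (q x)\<close> plus c times the energy density, so \<pi> has to approximate
    \<beta> in the mean with exactly this weight.\<close>
  have w: "(%x. K + abs (q x)) integrable_on {a..b}"
   using qabs by (intro integrable_add integrable_const_ivl) (simp add: absolutely_integrable_on_def)
  obtain \<pi> \<pi>' where \<pi>: "!!x. (\<pi> has_real_derivative \<pi>' x) (at x)" "continuous_on UNIV \<pi>'"
   "!!x. x : {a..b} ==> abs (\<pi> x) <= B + 1" "integral {a..b} (%x. abs (\<beta> x - \<pi> x) * (K + abs (q x))) < e"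
  proof -
   have "0 <= K + abs (q x)" for x using K by simp
   from approximate_by_C1[OF \<beta>m \<beta>B w this e B] show ?thesis using that by blast
  qed
  have \<pi>c: "continuous_on {a..b} \<pi>" using \<pi>(1) by (intro DERIV_continuous_on) (rule has_field_derivative_at_within)
  have \<pi>m: "\<pi> : borel_measurable (lebesgue_on {a..b})"
   by (rule continuous_imp_measurable_on_sets_lebesgue[OF \<pi>c]) simp
  have \<pi>p: "primitive_on a b \<pi> \<pi>'"
  proof (rule primitive_onI)
   show "\<pi>' absolutely_integrable_on {a..b}"
    by (intro absolutely_integrable_continuous_real continuous_on_subset[OF \<pi>(2)]) simp
   show "\<pi> s - \<pi> a = integral {a..s} \<pi>'" if "a <= s" "s <= b" for s
    by (rule integral_unique[symmetric], rule fundamental_theorem_of_calculus[OF that(1)])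
     (simp add: \<pi>(1) has_field_derivative_at_within flip: has_real_derivative_iff_has_vector_derivative)
  qed
  have dm: "(%x. \<beta> x - \<pi> x) : borel_measurable (lebesgue_on {a..b})"
   by (rule borel_measurable_diff[OF \<beta>m \<pi>m])
  have dB: "abs (\<beta> x - \<pi> x) <= 2 * B + 1" if "x : {a..b}" for x
   using \<beta>B[OF that] \<pi>(3)[OF that] by linarith
  have gq: "(%x. g n x - q x) absolutely_integrable_on {a..b}" for n
   by (rule set_integral_diff[OF gabs qabs])
  have first: "abs (integral {a..b} (%x. (\<beta> x - \<pi> x) * (g n x - q x))) <= 2 * e" for n
  proof -
   have "norm (integral {a..b} (%x. (\<beta> x - \<pi> x) * (g n x - q x)))
    <= integral {a..b} (%x. abs (\<beta> x - \<pi> x) * (K + abs (q x)) + ((2 * B + 1) * c) * norm (g n x) powr p)"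
   proof (rule hk_integral_norm_bound_integral)
    show "(%x. (\<beta> x - \<pi> x) * (g n x - q x)) integrable_on {a..b}" by (rule mult(1)[OF dm dB gq])
    show "(%x. abs (\<beta> x - \<pi> x) * (K + abs (q x)) + ((2 * B + 1) * c) * norm (g n x) powr p) integrable_on {a..b}"
    proof (rule integrable_add[OF _ integrable_mult_const[OF gp]])
     have "(%x. abs (\<beta> x - \<pi> x)) : borel_measurable (lebesgue_on {a..b})" by (rule borel_measurable_abs[OF dm])
     moreover have "\<bar>\<bar>\<beta> x - \<pi> x\<bar>\<bar> <= 2 * B + 1" if "x : {a..b}" for x using dB[OF that] by simp
     moreover have "(%x. K + abs (q x)) absolutely_integrable_on {a..b}"
      by (rule nonnegative_absolutely_integrable_1[OF w]) (use K in simp)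
     ultimately show "(%x. abs (\<beta> x - \<pi> x) * (K + abs (q x))) integrable_on {a..b}" by (rule mult(1))
    qed
    fix x assume x: "x : {a..b}"
    have g1: "abs (g n x) <= K + c * norm (g n x) powr p"
     using le_add_powr[OF abs_ge_zero K(1) p, of "g n x"] K(2) by simp
    have "norm ((\<beta> x - \<pi> x) * (g n x - q x)) = abs (\<beta> x - \<pi> x) * abs (g n x - q x)" by (simp add: abs_mult)
    also have "... <= abs (\<beta> x - \<pi> x) * ((K + abs (q x)) + c * norm (g n x) powr p)"
     using g1 by (intro mult_left_mono) linarith+
    also have "... = abs (\<beta> x - \<pi> x) * (K + abs (q x)) + abs (\<beta> x - \<pi> x) * (c * norm (g n x) powr p)"
     by (rule distrib_left)
    also have "... <= abs (\<beta> x - \<pi> x) * (K + abs (q x)) + (2 * B + 1) * (c * norm (g n x) powr p)"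
     using c by (intro add_left_mono mult_right_mono dB[OF x]) simp
    finally show "norm ((\<beta> x - \<pi> x) * (g n x - q x)) <= abs (\<beta> x - \<pi> x) * (K + abs (q x)) + ((2 * B + 1) * c) * norm (g n x) powr p"
     by (simp add: mult.assoc)
   qed
   also have "... = integral {a..b} (%x. abs (\<beta> x - \<pi> x) * (K + abs (q x))) + integral {a..b} (%x. ((2 * B + 1) * c) * norm (g n x) powr p)"
   proof (rule hk_integral_add[OF _ integrable_mult_const[OF gp]])
    have "(%x. abs (\<beta> x - \<pi> x)) : borel_measurable (lebesgue_on {a..b})" by (rule borel_measurable_abs[OF dm])
    moreover have "\<bar>\<bar>\<beta> x - \<pi> x\<bar>\<bar> <= 2 * B + 1" if "x : {a..b}" for x using dB[OF that] by simp
    moreover have "(%x. K + abs (q x)) absolutely_integrable_on {a..b}"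
     by (rule nonnegative_absolutely_integrable_1[OF w]) (use K in simp)
    ultimately show "(%x. abs (\<beta> x - \<pi> x) * (K + abs (q x))) integrable_on {a..b}" by (rule mult(1))
   qed
   also have "integral {a..b} (%x. ((2 * B + 1) * c) * norm (g n x) powr p) = ((2 * B + 1) * c) * integral {a..b} (%x. norm (g n x) powr p)"
    by (rule integral_mult_right)
   also have "... <= ((2 * B + 1) * c) * M" by (rule mult_left_mono[OF M]) (use c B in simp)
   finally show ?thesis using \<pi>(4) c(2) by simp
  qed
  have "bounded (\<pi>' ` {a..b})"
   by (intro compact_imp_bounded compact_continuous_image continuous_on_subset[OF \<pi>(2)]) simp_all
  then obtain D where D1: "ALL y:\<pi>' ` {a..b}. norm y <= D" unfolding bounded_iff by blast
  have D: "abs (\<pi>' x) <= D" if "x : {a..b}" for x using bspec[OF D1 imageI[OF that]] by simp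
  have D0: "D >= 0" using D[of a] ab by auto
  \<comment> \<open>The denominator collects the two boundary terms and the integral of the
    derivative of \<pi> against the difference of the curves; the summand 1 keeps it
    positive.\<close>
  define \<eta> where "\<eta> = e / (2 * (B + 1) + D * (b - a) + 1)"
  have den: "2 * (B + 1) + D * (b - a) + 1 > 0"
   using B D0 ab by (intro add_nonneg_pos add_nonneg_nonneg mult_nonneg_nonneg) simp_all
  have \<eta>: "\<eta> > 0" using e den by (simp add: \<eta>_def)
  obtain N where N: "!!n x. n >= N ==> x : {a..b} ==> abs (y n x - z x) < \<eta>" using unif[OF \<eta>] by blast
  have third: "abs (integral {a..b} (%x. \<pi> x * (g n x - q x))) <= e" if n: "n >= N" for n
  proof -
   have dp: "primitive_on a b (%s. y n s - z s) (%s. g n s - q s)" by (rule primitive_on_minus[OF y z])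
   have i1: "(%s. \<pi> s * (g n s - q s)) integrable_on {a..b}" by (rule mult(1)[OF \<pi>m \<pi>(3) gq])
   have i2: "(%s. \<pi>' s * (y n s - z s)) integrable_on {a..b}"
    by (intro integrable_continuous_real continuous_on_mult continuous_on_subset[OF \<pi>(2)] primitive_on_continuous[OF dp]) simp
   have "\<pi> b * (y n b - z b) - \<pi> a * (y n a - z a) = integral {a..b} (%s. \<pi> s * (g n s - q s) + \<pi>' s * (y n s - z s))"
    using primitive_on_diff[OF primitive_on_scaleR[OF \<pi>p dp] order_refl ab order_refl] by simp
   also have "... = integral {a..b} (%s. \<pi> s * (g n s - q s)) + integral {a..b} (%s. \<pi>' s * (y n s - z s))"
    by (rule hk_integral_add[OF i1 i2])
   finally have eq: "integral {a..b} (%s. \<pi> s * (g n s - q s)) =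
    \<pi> b * (y n b - z b) - \<pi> a * (y n a - z a) - integral {a..b} (%s. \<pi>' s * (y n s - z s))" by simp
   have b1: "abs (\<pi> x * (y n x - z x)) <= (B + 1) * \<eta>" if "x : {a..b}" for x
    unfolding abs_mult using \<pi>(3)[OF that] N[OF n that] B by (intro mult_mono) simp_all
   have "norm (integral {a..b} (%s. \<pi>' s * (y n s - z s))) <= integral {a..b} (%s. D * \<eta>)"
   proof (rule hk_integral_norm_bound_integral[OF i2 integrable_const_ivl])
    fix x assume x: "x : {a..b}"
    show "norm (\<pi>' x * (y n x - z x)) <= D * \<eta>"
     unfolding real_norm_def abs_mult using D[OF x] N[OF n x] D0 by (intro mult_mono) simp_all
   qed
   then have "abs (integral {a..b} (%s. \<pi>' s * (y n s - z s))) <= D * (b - a) * \<eta>" using ab by (simp add: mult_ac)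
   then have "abs (integral {a..b} (%s. \<pi> s * (g n s - q s))) <= (B + 1) * \<eta> + (B + 1) * \<eta> + D * (b - a) * \<eta>"
   proof -
    have "abs (\<pi> a * (y n a - z a)) <= (B + 1) * \<eta>" "abs (\<pi> b * (y n b - z b)) <= (B + 1) * \<eta>"
     using b1[of a] b1[of b] ab by simp_all
    then show ?thesis
     using \<open>\<bar>integral {a..b} (%s. \<pi>' s * (y n s - z s))\<bar> <= _\<close> unfolding eq by linarith
   qed
   also have "... <= (2 * (B + 1) + D * (b - a) + 1) * \<eta>" using \<eta> by (simp add: algebra_simps)
   also have "... = e" using den by (simp add: \<eta>_def)
   finally show ?thesis .
  qed
  show "EX N. ALL n>=N. norm (integral {a..b} (%x. \<beta> x * g n x) - integral {a..b} (%x. \<beta> x * q x)) < r"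
  proof (intro exI[of _ N] allI impI)
   fix n assume n: "N <= n"
   have "integral {a..b} (%x. \<beta> x * g n x) - integral {a..b} (%x. \<beta> x * q x) = integral {a..b} (%x. \<beta> x * g n x - \<beta> x * q x)"
    by (rule hk_integral_diff[OF mult(1)[OF \<beta>m \<beta>B gabs] mult(1)[OF \<beta>m \<beta>B qabs], symmetric])
   also have "... = integral {a..b} (%x. (\<beta> x - \<pi> x) * (g n x - q x) + \<pi> x * (g n x - q x))"
    by (rule arg_cong[where f = "integral {a..b}"]) (simp add: fun_eq_iff algebra_simps)
   also have "... = integral {a..b} (%x. (\<beta> x - \<pi> x) * (g n x - q x)) + integral {a..b} (%x. \<pi> x * (g n x - q x))"
    by (rule hk_integral_add[OF mult(1)[OF dm dB gq] mult(1)[OF \<pi>m \<pi>(3) gq]])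
   finally show "norm (integral {a..b} (%x. \<beta> x * g n x) - integral {a..b} (%x. \<beta> x * q x)) < r"
    using first[of n] third[OF n] r unfolding real_norm_def e_def by linarith
  qed
 qed
qed

section \<open>Weak derivatives\<close>

lemma primitive_on_C1:
 assumes "!!x. (\<phi> has_real_derivative \<phi>' x) (at x)" "continuous_on UNIV \<phi>'"
 shows "primitive_on a b \<phi> \<phi>'"
proof (rule primitive_onI)
 show "\<phi>' absolutely_integrable_on {a..b}"
  by (intro absolutely_integrable_continuous_real continuous_on_subset[OF assms(2)]) simp
 show "\<phi> s - \<phi> a = integral {a..s} \<phi>'" if "a <= s" "s <= b" for s
  by (rule integral_unique[symmetric], rule fundamental_theorem_of_calculus[OF that(1)])
   (simp add: assms(1) has_field_derivative_at_within flip: has_real_derivative_iff_has_vector_derivative)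
qed

lemma lebesgue_on_Ioo_integral:
 fixes h :: "real => 'a::euclidean_space"
 assumes "h absolutely_integrable_on {t..T}"
 shows "integral\<^sup>L (lebesgue_on {t<..<T}) h = integral {t..T} h"
proof -
 have "h absolutely_integrable_on {t<..<T}" using assms by (simp add: absolutely_integrable_on_Icc_iff_Ioo)
 then have "integrable (lebesgue_on {t<..<T}) h" by (rule absolutely_integrable_imp_integrable) simp
 then have "integral\<^sup>L (lebesgue_on {t<..<T}) h = integral {t<..<T} h"
  by (rule lebesgue_integral_eq_integral) simp
 also have "... = integral {t..T} h" by (rule integral_open_interval_real[symmetric])
 finally show ?thesis .
qed

lemma absolutely_integrable_scaleR_continuous:
 fixes h :: "real => 'a::euclidean_space" and w :: "real => real"
 assumes "h absolutely_integrable_on {a..b}" "continuous_on {a..b} w"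
 shows "(%x. w x *\<^sub>R h x) absolutely_integrable_on {a..b}"
proof (rule absolutely_integrable_bounded_measurable_product[where h = "%(r::real) (v::'a). r *\<^sub>R v" and f = w and g = h])
 show "h absolutely_integrable_on {a..b}" by (rule assms(1))
 show "bilinear (%(r::real) (v::'a). r *\<^sub>R v)" by (simp add: bilinear_def linear_iff algebra_simps)
 show "w : borel_measurable (lebesgue_on {a..b})"
  by (rule continuous_imp_measurable_on_sets_lebesgue[OF assms(2)]) simp
 show "bounded (w ` {a..b})" by (intro compact_imp_bounded compact_continuous_image assms(2) compact_Icc)
qed simp

text \<open>The product rule for \<phi> and f; the boundary terms vanish because the support of
  \<phi> lies in the open interval.\<close>

lemma primitive_on_imp_weak_deriv:
 fixes f :: "real => 'a::euclidean_space"
 assumes tT: "t <= T" and f: "primitive_on t T f g"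
 shows "has_weak_deriv t T f g"
 unfolding has_weak_deriv_def
proof (intro allI impI, elim conjE)
 fix \<phi> \<phi>' :: "real => real"
 assume d: "ALL s. (\<phi> has_real_derivative \<phi>' s) (at s)" and c: "continuous_on UNIV \<phi>'"
  and sub: "closure {s. \<phi> s ~= 0} \<subseteq> {t<..<T}"
 have \<phi>p: "primitive_on t T \<phi> \<phi>'" by (rule primitive_on_C1[OF spec[OF d] c])
 have z: "\<phi> t = 0" "\<phi> T = 0" using closure_subset[of "{s. \<phi> s ~= 0}"] sub by auto
 have fa: "f absolutely_integrable_on {t..T}"
  by (rule absolutely_integrable_continuous_real[OF primitive_on_continuous[OF f]])
 have 1: "(%s. \<phi> s *\<^sub>R g s) absolutely_integrable_on {t..T}"
  by (rule absolutely_integrable_scaleR_continuous[OF primitive_on_abs[OF f] primitive_on_continuous[OF \<phi>p]])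
 have 2: "(%s. \<phi>' s *\<^sub>R f s) absolutely_integrable_on {t..T}"
  by (rule absolutely_integrable_scaleR_continuous[OF fa continuous_on_subset[OF c]]) simp
 have "0 = integral {t..T} (%s. \<phi> s *\<^sub>R g s + \<phi>' s *\<^sub>R f s)"
  using primitive_on_diff[OF primitive_on_scaleR[OF \<phi>p f] order_refl tT order_refl] z by simp
 also have "... = integral {t..T} (%s. \<phi> s *\<^sub>R g s) + integral {t..T} (%s. \<phi>' s *\<^sub>R f s)"
  by (rule hk_integral_add) (use 1 2 in \<open>simp_all add: absolutely_integrable_on_def\<close>)
 finally show "integral\<^sup>L (lebesgue_on {t<..<T}) (%s. \<phi>' s *\<^sub>R f s) = - integral\<^sup>L (lebesgue_on {t<..<T}) (%s. \<phi> s *\<^sub>R g s)"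
  unfolding lebesgue_on_Ioo_integral[OF 1] lebesgue_on_Ioo_integral[OF 2] by (simp add: eq_neg_iff_add_eq_0 add.commute)
qed

text \<open>The tent supported in [-1, 1] with mass 1, written as a second difference of the
  positive part. Its primitive is a C1 step from 0 to 1, so the difference of two translated steps
  is an admissible test function.\<close>

definition hat :: "real => real" where
 "hat s = max 0 (s + 1) - 2 * max 0 s + max 0 (s - 1)"

definition hat_primitive :: "real => real" where
 "hat_primitive s = ((max 0 (s + 1))\<^sup>2 - 2 * (max 0 s)\<^sup>2 + (max 0 (s - 1))\<^sup>2) / 2"

lemma has_real_derivative_pos_part_square:
 "((%s. (max 0 s)\<^sup>2) has_real_derivative 2 * max 0 s) (at (s::real))"
proof (cases s "0::real" rule: linorder_cases)
 case less
 have "((%s. 0) has_real_derivative 2 * max 0 s) (at s)" using less by simp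
 then show ?thesis
  by (rule has_field_derivative_transform_within_open[of _ _ _ "{..<0}"]) (use less in simp_all)
next
 case equal
 have *: "(%h::real. abs h) \<midarrow>0\<rightarrow> 0" using tendsto_rabs[OF tendsto_ident_at, of 0 UNIV] by simp
 have ev: "ALL h::real. norm (((max 0 h)\<^sup>2 - 0) / h) <= abs h"
  by (simp add: max_def power2_eq_square)
 have "(%h::real. ((max 0 h)\<^sup>2 - 0) / h) \<midarrow>0\<rightarrow> 0"
  by (rule Lim_null_comparison[OF always_eventually[OF ev] *])
 then show ?thesis using equal by (simp add: DERIV_def)
next
 case greater
 have "((%s. s\<^sup>2) has_real_derivative 2 * max 0 s) (at s)"
  using greater by (auto intro!: derivative_eq_intros)
 then show ?thesis
  by (rule has_field_derivative_transform_within_open[of _ _ _ "{0<..}"]) (use greater in simp_all)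
qed

lemma hat_primitive_deriv: "(hat_primitive has_real_derivative hat s) (at s)"
proof -
 have 1: "((%s. (max 0 (s + c))\<^sup>2) has_real_derivative 2 * max 0 (s + c)) (at s)" for c
 proof -
  have "((%s. s + c) has_real_derivative 1) (at s)" by (auto intro!: derivative_eq_intros)
  from DERIV_chain2[where f = "%s. (max 0 s)\<^sup>2" and g = "%s. s + c", OF has_real_derivative_pos_part_square this]
  show ?thesis by simp
 qed
 have X: "((%s. ((max 0 (s + 1))\<^sup>2 - 2 * (max 0 (s + 0))\<^sup>2 + (max 0 (s + (- 1)))\<^sup>2) / 2) has_real_derivative
  (2 * max 0 (s + 1) - 2 * (2 * max 0 (s + 0)) + 2 * max 0 (s + (- 1))) / 2) (at s)"
  by (intro DERIV_cdivide DERIV_add DERIV_diff DERIV_cmult 1)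
 have eq2: "(2 * max 0 (s + 1) - 2 * (2 * max 0 (s + 0)) + 2 * max 0 (s + (- 1))) / 2 = hat s"
  by (simp add: hat_def)
 have eq1: "(%s. ((max 0 (s + 1))\<^sup>2 - 2 * (max 0 (s + 0))\<^sup>2 + (max 0 (s + (- 1)))\<^sup>2) / 2) = hat_primitive"
  by (simp add: fun_eq_iff hat_primitive_def)
 show ?thesis using X unfolding eq1 eq2 .
qed

lemma hat_nonneg: "hat s >= 0" and hat_zero: "1 <= abs s ==> hat s = 0"
 and hat_primitive_left: "s <= - 1 ==> hat_primitive s = 0"
 and hat_primitive_right: "1 <= s ==> hat_primitive s = 1"
 and hat_continuous: "continuous_on S hat"
proof -
 show "hat s >= 0" "1 <= abs s ==> hat s = 0" by (auto simp: hat_def max_def)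
 show "s <= - 1 ==> hat_primitive s = 0" by (simp add: hat_primitive_def)
 show "1 <= s ==> hat_primitive s = 1" by (simp add: hat_primitive_def power2_eq_square algebra_simps)
 show "continuous_on S hat" unfolding hat_def by (intro continuous_intros)
qed

lemma hat_scaled_deriv:
 "((%s. hat_primitive (k * (s - c))) has_real_derivative k * hat (k * (s - c))) (at s)"
proof -
 have "((%s. k * (s - c)) has_real_derivative k) (at s)" by (auto intro!: derivative_eq_intros)
 from DERIV_chain2[OF hat_primitive_deriv this] show ?thesis by (simp add: mult.commute)
qed

lemma hat_approximates:
 fixes h :: "real => 'a::euclidean_space"
 assumes h: "continuous_on {t..T} h" and c: "t < c" "c < T" and e: "e > 0"
 shows "EX K. ALL k>=K. norm (integral {t..T} (%s. (k * hat (k * (s - c))) *\<^sub>R h s) - h c) <= e"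
proof -
 obtain d where d: "d > 0" "!!x y. x : {t..T} ==> y : {t..T} ==> abs (y - x) < d ==> norm (h y - h x) < e"
  using continuous_on_Icc_uniform[OF h e] by blast
 \<comment> \<open>Within distance r of c the function h varies by less than e and the interval is
   not left; for \<open>k >= 1 / r\<close> the whole mass of the scaled tent lies there.\<close>
 define r where "r = Min {d, c - t, T - c}"
 have r: "r > 0" "r <= d" "r <= c - t" "r <= T - c" using d(1) c by (auto simp: r_def)
 show ?thesis
 proof (intro exI[of _ "1 / r"] allI impI)
  fix k assume k: "1 / r <= k"
  have k0: "k > 0" using k r(1) by (meson less_le_trans zero_less_divide_1_iff)
  have kr: "1 <= k * r" using k r(1) by (simp add: field_simps)
  have big: "1 <= k * v" if "r <= v" for v
   using mult_left_mono[OF that, of k] kr k0 by linarith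
  have wc: "continuous_on S (%s. k * hat (k * (s - c)))" for S
   by (intro continuous_intros continuous_on_compose2[OF hat_continuous[of UNIV]]) simp_all
  have "primitive_on t T (%s. hat_primitive (k * (s - c))) (%s. k * hat (k * (s - c)))"
   by (rule primitive_on_C1[OF hat_scaled_deriv wc])
  then have one: "integral {t..T} (%s. k * hat (k * (s - c))) = 1"
   using primitive_on_diff[of t T "%s. hat_primitive (k * (s - c))" "%s. k * hat (k * (s - c))" t T] c
    hat_primitive_left[of "k * (t - c)"] hat_primitive_right[of "k * (T - c)"] big[OF r(3)] big[OF r(4)]
   by (simp add: algebra_simps)
  have i1: "(%s. (k * hat (k * (s - c))) *\<^sub>R h s) integrable_on {t..T}"
   by (intro integrable_continuous_real continuous_on_scaleR wc h)
  have i2: "(%s. (k * hat (k * (s - c))) *\<^sub>R h c) integrable_on {t..T}"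
   by (intro integrable_continuous_real continuous_on_scaleR wc continuous_on_const)
  have wi: "(%s. k * hat (k * (s - c))) integrable_on {t..T}"
   by (intro integrable_continuous_real wc)
  have "integral {t..T} (%s. (k * hat (k * (s - c))) *\<^sub>R h c) = integral {t..T} (%s. k * hat (k * (s - c))) *\<^sub>R h c"
   using integral_linear[OF wi bounded_linear_scaleR_left[of "h c"]] by (simp add: o_def)
  then have "integral {t..T} (%s. (k * hat (k * (s - c))) *\<^sub>R h s) - h c =
    integral {t..T} (%s. (k * hat (k * (s - c))) *\<^sub>R h s - (k * hat (k * (s - c))) *\<^sub>R h c)"
   using hk_integral_diff[OF i1 i2] one by simp
  also have "norm ... <= integral {t..T} (%s. (k * hat (k * (s - c))) * e)"
  proof (rule hk_integral_norm_bound_integral[OF integrable_diff[OF i1 i2]])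
   show "(%s. (k * hat (k * (s - c))) * e) integrable_on {t..T}"
    by (intro integrable_continuous_real continuous_on_mult wc continuous_on_const)
   fix s assume s: "s : {t..T}"
   show "norm ((k * hat (k * (s - c))) *\<^sub>R h s - (k * hat (k * (s - c))) *\<^sub>R h c) <= (k * hat (k * (s - c))) * e"
   proof (cases "abs (s - c) < r")
    case True
    have "norm (h s - h c) <= e" using d(2)[of c s] s c True r(2) by simp
    then show ?thesis
     using hat_nonneg[of "k * (s - c)"] k0
     by (simp add: mult_left_mono mult.assoc flip: scaleR_right_diff_distrib)
   next
    case False
    then have "1 <= abs (k * (s - c))" using big[of "abs (s - c)"] k0 by (simp add: abs_mult)
    then show ?thesis by (simp add: hat_zero)
   qed
  qed
  also have "... = e" using one by simp
  finally show "norm (integral {t..T} (%s. (k * hat (k * (s - c))) *\<^sub>R h s) - h c) <= e" .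
 qed
qed

text \<open>The lemma of du Bois-Reymond. Subtracting the primitive F of g leaves a function h with
  zero weak derivative. A test function that rises near c and falls near d then shows that h takes
  the same value at c and d, up to an error that vanishes as the slopes steepen.\<close>

lemma weak_deriv_imp_primitive_on:
 fixes f :: "real => 'a::euclidean_space"
 assumes tT: "t < T" and f: "continuous_on {t..T} f" and w: "has_weak_deriv t T f g"
  and g: "integrable (lebesgue_on {t<..<T}) g"
 shows "primitive_on t T f g"
proof -
 have ga: "g absolutely_integrable_on {t..T}"
  unfolding absolutely_integrable_on_Icc_iff_Ioo
  using g by (subst set_integrable_def) (simp add: integrable_restrict_space)
 define F where "F s = integral {t..s} g" for s
 have F: "primitive_on t T F g" by (rule primitive_onI[OF ga]) (simp add: F_def)
 define h where "h s = f s - F s" for s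
 have hc: "continuous_on {t..T} h" unfolding h_def by (intro continuous_intros f primitive_on_continuous[OF F])
 have wF: "has_weak_deriv t T F g" by (rule primitive_on_imp_weak_deriv[OF less_imp_le[OF tT] F])
 have null: "integral {t..T} (%s. \<phi>' s *\<^sub>R h s) = 0"
  if \<phi>: "!!s. (\<phi> has_real_derivative \<phi>' s) (at s)" "continuous_on UNIV \<phi>'" "compact (closure {s. \<phi> s ~= 0})"
   "closure {s. \<phi> s ~= 0} \<subseteq> {t<..<T}" for \<phi> \<phi>' :: "real => real"
 proof -
  have fF: "(%s. \<phi>' s *\<^sub>R f s) absolutely_integrable_on {t..T}" "(%s. \<phi>' s *\<^sub>R F s) absolutely_integrable_on {t..T}"
   by (intro absolutely_integrable_continuous_real continuous_on_scaleR continuous_on_subset[OF \<phi>(2)]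
    f primitive_on_continuous[OF F]; simp)+
  have "integral\<^sup>L (lebesgue_on {t<..<T}) (%s. \<phi>' s *\<^sub>R f s) = integral\<^sup>L (lebesgue_on {t<..<T}) (%s. \<phi>' s *\<^sub>R F s)"
  proof -
   have c: "(ALL s. (\<phi> has_real_derivative \<phi>' s) (at s)) & continuous_on UNIV \<phi>' & compact (closure {s. \<phi> s ~= 0}) &
     closure {s. \<phi> s ~= 0} \<subseteq> {t<..<T}" using \<phi> by blast
   show ?thesis
    using mp[OF spec[OF spec[OF w[unfolded has_weak_deriv_def], of \<phi>], of \<phi>'] c]
     mp[OF spec[OF spec[OF wF[unfolded has_weak_deriv_def], of \<phi>], of \<phi>'] c] by (rule trans[OF _ sym])
  qed
  then have eq: "integral {t..T} (%s. \<phi>' s *\<^sub>R f s) = integral {t..T} (%s. \<phi>' s *\<^sub>R F s)"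
   unfolding lebesgue_on_Ioo_integral[OF fF(1)] lebesgue_on_Ioo_integral[OF fF(2)] .
  have "integral {t..T} (%s. \<phi>' s *\<^sub>R h s) = integral {t..T} (%s. \<phi>' s *\<^sub>R f s - \<phi>' s *\<^sub>R F s)"
   unfolding h_def by (simp add: scaleR_right_diff_distrib)
  also have "... = 0"
   using fF by (subst hk_integral_diff) (simp_all add: eq absolutely_integrable_on_def)
  finally show ?thesis .
 qed
 have hcd: "h c = h d" if cd: "t < c" "c < d" "d < T" for c d
 proof -
  have "norm (h c - h d) <= 0 + e" if e: "e > 0" for e
  proof -
   have e2: "e / 2 > 0" using e by simp
   have cT: "c < T" "t < d" using cd by simp_all
   obtain K1 where K1: "!!k. k >= K1 ==> norm (integral {t..T} (%s. (k * hat (k * (s - c))) *\<^sub>R h s) - h c) <= e / 2"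
    using hat_approximates[OF hc cd(1) cT(1) e2] by blast
   obtain K2 where K2: "!!k. k >= K2 ==> norm (integral {t..T} (%s. (k * hat (k * (s - d))) *\<^sub>R h s) - h d) <= e / 2"
    using hat_approximates[OF hc cT(2) cd(3) e2] by blast
   \<comment> \<open>Half the smaller distance to the ends, so that the support, contained in
     [c - r, d + r], stays inside (t, T).\<close>
   define r where "r = min (c - t) (T - d) / 2"
   have r: "r > 0" using cd by (simp add: r_def)
   define k where "k = max (max K1 K2) (1 / r)"
   have kr: "1 / r <= k" by (simp add: k_def)
   then have k0: "k > 0" using r by (meson less_le_trans zero_less_divide_1_iff)
   have kr1: "1 <= k * r" using kr r by (simp add: field_simps)
   define \<phi> where "\<phi> s = hat_primitive (k * (s - c)) - hat_primitive (k * (s - d))" for s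
   define \<phi>' where "\<phi>' s = k * hat (k * (s - c)) - k * hat (k * (s - d))" for s
   have wc: "continuous_on S (%s. k * hat (k * (s - v)))" for S v
    by (intro continuous_intros continuous_on_compose2[OF hat_continuous[of UNIV]]) simp_all
   have sub: "{s. \<phi> s ~= 0} \<subseteq> {c - r..d + r}"
   proof (rule subsetI, rule ccontr)
    fix s assume s: "s : {s. \<phi> s ~= 0}" and ns: "s ~: {c - r..d + r}"
    from ns consider "s < c - r" | "s > d + r" by fastforce
    then show False
    proof cases
     case 1
     then have "k * (s - c) <= k * (- r)" "k * (s - d) <= k * (- r)"
      using k0 cd by (intro mult_left_mono; simp)+
     then have "k * (s - c) <= - 1" "k * (s - d) <= - 1" using kr1 by simp_all
     then show False using s by (simp add: \<phi>_def hat_primitive_left)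
    next
     case 2
     then have "k * r <= k * (s - c)" "k * r <= k * (s - d)"
      using k0 cd by (intro mult_left_mono; simp)+
     then have "1 <= k * (s - c)" "1 <= k * (s - d)" using kr1 by simp_all
     then show False using s by (simp add: \<phi>_def hat_primitive_right)
    qed
   qed
   have cl: "closure {s. \<phi> s ~= 0} \<subseteq> {c - r..d + r}" by (rule closure_minimal[OF sub closed_atLeastAtMost])
   have "integral {t..T} (%s. \<phi>' s *\<^sub>R h s) = 0"
   proof (rule null[of \<phi>])
    show "(\<phi> has_real_derivative \<phi>' s) (at s)" for s
     unfolding \<phi>_def \<phi>'_def by (intro DERIV_diff hat_scaled_deriv)
    show "continuous_on UNIV \<phi>'" unfolding \<phi>'_def by (intro continuous_on_diff wc)
    show "compact (closure {s. \<phi> s ~= 0})"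
     by (simp only: compact_closure) (rule bounded_subset[OF bounded_closed_interval sub])
    have "{c - r..d + r} \<subseteq> {t<..<T}" using cd by (auto simp: r_def min_def field_simps)
    then show "closure {s. \<phi> s ~= 0} \<subseteq> {t<..<T}" using cl by blast
   qed
   moreover have "integral {t..T} (%s. \<phi>' s *\<^sub>R h s) = integral {t..T} (%s. (k * hat (k * (s - c))) *\<^sub>R h s)
     - integral {t..T} (%s. (k * hat (k * (s - d))) *\<^sub>R h s)"
    unfolding \<phi>'_def scaleR_left_diff_distrib
    by (rule hk_integral_diff)
     (intro integrable_continuous_real continuous_on_scaleR wc hc)+
   ultimately have "integral {t..T} (%s. (k * hat (k * (s - c))) *\<^sub>R h s) = integral {t..T} (%s. (k * hat (k * (s - d))) *\<^sub>R h s)"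
    by simp
   then have 1: "norm (integral {t..T} (%s. (k * hat (k * (s - c))) *\<^sub>R h s) - h d) <= e / 2"
    using K2[of k] by (simp add: k_def)
   have 2: "norm (integral {t..T} (%s. (k * hat (k * (s - c))) *\<^sub>R h s) - h c) <= e / 2"
    by (rule K1) (simp add: k_def)
   have "h c - h d = (integral {t..T} (%s. (k * hat (k * (s - c))) *\<^sub>R h s) - h d)
     - (integral {t..T} (%s. (k * hat (k * (s - c))) *\<^sub>R h s) - h c)" by simp
   also have "norm ... <= e / 2 + e / 2" by (rule order_trans[OF norm_triangle_ineq4 add_mono[OF 1 2]])
   finally show ?thesis by simp
  qed
  then have "norm (h c - h d) <= 0" by (rule field_le_epsilon)
  then show ?thesis by simp
 qed
 define m where "m = (t + T) / 2"
 have m: "t < m" "m < T" using tT by (simp_all add: m_def)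
 have hm: "h s = h m" if "s : {t<..<T}" for s
 proof -
  have st: "t < s" "s < T" using that by simp_all
  consider "s < m" | "s = m" | "m < s" by linarith
  then show ?thesis
  proof cases
   case 1 show ?thesis by (rule hcd[OF st(1) 1 m(2)])
  next
   case 2 then show ?thesis by (rule arg_cong)
  next
   case 3 show ?thesis by (rule hcd[OF m(1) 3 st(2), symmetric])
  qed
 qed
 \<comment> \<open>Test functions see the open interval only; continuity carries the constant to the
   end points.\<close>
 have hall: "h s = h m" if s: "s : {t..T}" for s
 proof -
  have cl: "closure {t<..<T} = {t..T}" using tT by simp
  show ?thesis
  proof (rule continuous_constant_on_closure[of "{t<..<T}" h "h m" s])
   show "continuous_on (closure {t<..<T}) h" unfolding cl by (rule hc)
   show "s : closure {t<..<T}" unfolding cl by (rule s)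
  qed (rule hm)
 qed
 show ?thesis
 proof (rule primitive_onI[OF ga])
  fix s assume s: "t <= s" "s <= T"
  have "h s = h m" by (rule hall) (use s in simp)
  moreover have "h t = h m" by (rule hall) (use tT in simp)
  ultimately have "h s = h t" by (rule trans[OF _ sym])
  then show "f s - f t = integral {t..s} g" by (simp add: h_def F_def diff_eq_eq)
 qed
qed

section \<open>The junction\<close>

lemma edge_iff: "x : edge i \<longleftrightarrow> 0 <= x $ i & (ALL j. j ~= i --> x $ j = 0)"
proof
 assume "x : edge i"
 then show "0 <= x $ i & (ALL j. j ~= i --> x $ j = 0)" by (auto simp: edge_def axis_def)
next
 assume x: "0 <= x $ i & (ALL j. j ~= i --> x $ j = 0)"
 have "x = (x $ i) *\<^sub>R axis i 1" unfolding vec_eq_iff using x by (simp add: axis_def)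
 then show "x : edge i" unfolding edge_def using x by blast
qed

lemma junction_iff: "x : junction \<longleftrightarrow> (EX i. x : edge i)"
 by (simp add: junction_def)

lemma scaleR_axis_nth: "(r *\<^sub>R axis i (1::real)) $ j = (if j = i then r else 0)"
 by (simp add: axis_def)

lemma axis_in_edge: "r >= 0 ==> r *\<^sub>R axis i 1 : edge i"
 unfolding edge_iff scaleR_axis_nth by simp

lemma axis_in_junction: "r >= 0 ==> r *\<^sub>R axis i 1 : junction"
 using axis_in_edge junction_iff by blast

lemma junction_nth_nonneg: "x : junction ==> 0 <= x $ i"
 unfolding junction_iff edge_iff by (metis order_refl)

lemma junction_nth_unique: "x : junction ==> x $ i > 0 ==> j ~= i ==> x $ j = 0"
 unfolding junction_iff edge_iff by (metis less_irrefl)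

lemma junction_eq_axis: "x : junction ==> x $ i > 0 ==> x = (x $ i) *\<^sub>R axis i 1"
 unfolding vec_eq_iff scaleR_axis_nth using junction_nth_unique by auto

lemma norm_scaleR_axis: "norm (r *\<^sub>R axis i (1::real)) = abs r"
 by simp

lemma junction_norm_nth: "x : junction ==> x $ i > 0 ==> norm x = x $ i"
 using junction_eq_axis[of x i] norm_scaleR_axis[of "x $ i" i] by simp

lemma junction_cases:
 assumes "x : junction"
 obtains "x = 0" | i where "x $ i > 0"
proof -
 have "x = 0" if "!!i. ~ x $ i > 0"
  unfolding vec_eq_iff using that junction_nth_nonneg[OF assms] by (simp add: le_less)
 then show ?thesis using that by blast
qed

lemma edge_minus_0_iff: "x : edge i - {0} \<longleftrightarrow> x : junction & x $ i > 0"
proof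
 assume x: "x : edge i - {0}"
 then have "x : junction" using junction_iff by blast
 moreover have "x $ i ~= 0"
 proof
  assume "x $ i = 0"
  then have "x = 0" unfolding vec_eq_iff using x by (metis DiffD1 edge_iff zero_index)
  then show False using x by simp
 qed
 ultimately show "x : junction & x $ i > 0" using junction_nth_nonneg[of x i] by simp
next
 assume x: "x : junction & x $ i > 0"
 then have "x : edge i" unfolding edge_iff using junction_nth_unique[of x i] by simp
 then show "x : edge i - {0}" using x by auto
qed

text \<open>At most one coordinate is nonzero. The linear expression gives the norm of a curve a
  density without any chain rule at the vertex, as \<open>J_cost_eq\<close> requires.\<close>

lemma junction_norm_sum:
 assumes x: "x : junction"
 shows "norm x = (\<Sum>i\<in>UNIV. x $ i)"
proof (rule junction_cases[OF x])
 assume "x = 0" then show ?thesis by simp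
next
 fix i assume i: "x $ i > 0"
 have "(\<Sum>j\<in>UNIV. x $ j) = (\<Sum>j\<in>{i}. x $ j)"
  by (rule sum.mono_neutral_right) (use junction_nth_unique[OF x i] in auto)
 then show ?thesis using junction_norm_nth[OF x i] by simp
qed

text \<open>Ensures that uniform limits of trajectories remain on the junction.\<close>

lemma closed_junction: "closed (junction :: (real^'n::finite) set)"
proof -
 have "edge i = {x :: real^'n. 0 <= x $ i} \<inter> (\<Inter>j\<in>{j. j ~= i}. {x. x $ j = 0})" for i
  by (auto simp: edge_iff)
 moreover have "closed ({x :: real^'n. 0 <= x $ i} \<inter> (\<Inter>j\<in>{j. j ~= i}. {x. x $ j = 0}))" for i
  by (intro closed_Int closed_INT ballI closed_Collect_le closed_Collect_eq continuous_intros)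
 ultimately show ?thesis unfolding junction_def by (intro closed_UN) simp_all
qed

lemma primitive_on_nth: "primitive_on a b y g ==> primitive_on a b (%s. y s $ i) (%s. g s $ i)"
 by (rule primitive_on_linear[OF _ bounded_linear_vec_nth])

lemma integral_le_AE:
 fixes f g :: "real => real"
 assumes f: "f integrable_on S" and g: "g integrable_on S"
  and le: "AE x in lebesgue. x : S --> f x <= g x"
 shows "integral S f <= integral S g"
proof -
 obtain N where N: "negligible N" "!!x. x ~: N ==> x : S ==> f x <= g x"
  using le unfolding AE_lebesgue_negligible by blast
 define f' where "f' x = (if x : N then g x else f x)" for x
 have f': "f' integrable_on S" by (rule integrable_spike[OF f N(1)]) (simp add: f'_def)
 have "integral S f = integral S f'" by (rule integral_spike[OF N(1)]) (simp add: f'_def)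
 also have "... <= integral S g" by (rule integral_le[OF f' g]) (use N(2) in \<open>auto simp: f'_def\<close>)
 finally show ?thesis .
qed

lemma integral_cong_AE_lebesgue:
 fixes f g :: "real => 'a::euclidean_space"
 assumes eq: "AE x in lebesgue. x : S --> f x = g x"
 shows "integral S f = integral S g" "f integrable_on S \<longleftrightarrow> g integrable_on S"
proof -
 obtain N where N: "negligible N" "!!x. x ~: N ==> x : S ==> f x = g x"
  using eq unfolding AE_lebesgue_negligible by blast
 show "integral S f = integral S g" by (rule integral_spike[OF N(1)]) (use N(2) in auto)
 show "f integrable_on S \<longleftrightarrow> g integrable_on S"
  using integrable_spike[OF _ N(1), of f S g] integrable_spike[OF _ N(1), of g S f] N(2) by auto
qed

lemma integrable_on_if_dominated:
 fixes f w :: "real => real"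
 assumes "f : borel_measurable (lebesgue_on {a..b})" "w integrable_on {a..b}"
  "!!x. x : {a..b} ==> abs (f x) <= w x"
 shows "f integrable_on {a..b}" "f absolutely_integrable_on {a..b}"
proof -
 show *: "f absolutely_integrable_on {a..b}"
  by (rule measurable_bounded_by_integrable_imp_absolutely_integrable[OF assms(1) _ assms(2)]) (use assms(3) in simp_all)
 then show "f integrable_on {a..b}" by (simp add: absolutely_integrable_on_def)
qed

lemma powr_sub_integrable:
 fixes f h :: "real => real"
 assumes f: "f : borel_measurable (lebesgue_on {a..b})" and h: "(%x. h x powr p) integrable_on {a..b}" and p: "p > 1"
  and le: "!!x. x : {a..b} ==> abs (f x) <= h x"
 shows "(%x. abs (f x) powr p) integrable_on {a..b}" "integral {a..b} (%x. abs (f x) powr p) <= integral {a..b} (%x. h x powr p)"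
proof -
 have m: "(%x. abs (f x) powr p) : borel_measurable (lebesgue_on {a..b})" using f by measurable
 have le': "abs (f x) powr p <= h x powr p" if "x : {a..b}" for x
  using le[OF that] p by (intro powr_mono2) simp_all
 show i: "(%x. abs (f x) powr p) integrable_on {a..b}"
  by (rule integrable_on_if_dominated(1)[OF m h]) (use le' in simp)
 show "integral {a..b} (%x. abs (f x) powr p) <= integral {a..b} (%x. h x powr p)"
  by (rule integral_le[OF i h le'])
qed

text \<open>Testing the sequence against \<open>p |b|\<^sup>p\<^sup>-\<^sup>1 sgn b\<close>, where \<open>b\<close> truncates the limit, and Young's
 inequality bound the truncations uniformly.\<close>

lemma weak_limit_powr_integrable:
 fixes q :: "real => real" and y g :: "nat => real => real"
 assumes ab: "a <= b" and p: "p > 1"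
  and y: "!!n. primitive_on a b (y n) (g n)" and z: "primitive_on a b z q"
  and gp: "!!n. (%x. abs (g n x) powr p) integrable_on {a..b}"
  and M: "!!n. integral {a..b} (%x. abs (g n x) powr p) <= M"
  and unif: "!!e. e > 0 ==> EX N. ALL n x. n >= N & x : {a..b} --> abs (y n x - z x) < e"
 shows "(%x. abs (q x) powr p) integrable_on {a..b}"
proof -
 have qm [measurable]: "q : borel_measurable (lebesgue_on {a..b})"
  by (rule absolutely_integrable_imp_borel_measurable[OF primitive_on_abs[OF z]]) simp
 define bb where "bb k x = (if (abs (q x)) <= real k then q x else 0)" for k x
 have bm [measurable]: "bb k : borel_measurable (lebesgue_on {a..b})" for k unfolding bb_def by measurable
 have bk: "abs (bb k x) <= real k" for k x by (simp add: bb_def)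
 have bpm [measurable]: "(%x. abs (bb k x) powr p) : borel_measurable (lebesgue_on {a..b})" for k by measurable
 have bpi: "(%x. abs (bb k x) powr p) integrable_on {a..b}" for k
  by (rule integrable_on_if_dominated(1)[OF bpm, where w = "%x. real k powr p"])
   (use p bk in \<open>auto intro!: powr_mono2 integrable_const_ivl\<close>)
 have bound: "integral {a..b} (%x. abs (bb k x) powr p) <= M" for k
 proof -
  define \<beta> where "\<beta> x = p * (sgn (bb k x) * abs (bb k x) powr (p - 1))" for x
  have bmk: "bb k : borel_measurable (lebesgue_on {a..b})" by (rule bm)
  have \<beta>m: "\<beta> : borel_measurable (lebesgue_on {a..b})" unfolding \<beta>_def using bmk by measurable
  have \<beta>B: "abs (\<beta> x) <= p * real k powr (p - 1)" for x
  proof -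
   have "abs (sgn (bb k x)) * abs (bb k x) powr (p - 1) <= 1 * real k powr (p - 1)"
    using p bk[of k x] by (intro mult_mono powr_mono2) (simp_all add: abs_sgn_eq)
   then show ?thesis using p by (simp add: \<beta>_def abs_mult)
  qed
  have lim: "(%n. integral {a..b} (%x. \<beta> x * g n x)) \<longlonglongrightarrow> integral {a..b} (%x. \<beta> x * q x)"
   by (rule weak_convergence_bounded_multiplier[OF ab p y z _ _ unif \<beta>m \<beta>B]) (use gp M in simp_all)
  have "\<beta> x * q x = p * abs (bb k x) powr p" for x
  proof (cases "bb k x = 0")
   case True then show ?thesis using p by (simp add: \<beta>_def)
  next
   case False
   then have q: "q x = bb k x" by (simp add: bb_def split: if_splits)
   have "abs (bb k x) powr p = abs (bb k x) powr (p - 1) * abs (bb k x)"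
   proof -
    have "abs (bb k x) powr p = abs (bb k x) powr ((p - 1) + 1)" by simp
    also have "... = abs (bb k x) powr (p - 1) * abs (bb k x) powr 1" by (rule powr_add)
    finally show ?thesis by simp
   qed
   then show ?thesis unfolding \<beta>_def q using abs_sgn[of "bb k x"] by (simp add: mult_ac)
  qed
  then have lim': "(%n. integral {a..b} (%x. \<beta> x * g n x)) \<longlonglongrightarrow> p * integral {a..b} (%x. abs (bb k x) powr p)"
   using lim by simp
  have "integral {a..b} (%x. \<beta> x * g n x) <= M + (p - 1) * integral {a..b} (%x. abs (bb k x) powr p)" for n
  proof -
   have gi: "(%x. \<beta> x * g n x) integrable_on {a..b}"
   proof -
    have "(%x. \<beta> x * g n x) absolutely_integrable_on {a..b}"
     using \<beta>B by (intro absolutely_integrable_bounded_measurable_product_real \<beta>m primitive_on_abs[OF y])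
      (auto simp: bounded_iff)
    then show ?thesis by (simp add: absolutely_integrable_on_def)
   qed
   have "integral {a..b} (%x. \<beta> x * g n x) <= integral {a..b} (%x. abs (g n x) powr p + (p - 1) * abs (bb k x) powr p)"
   proof (rule integral_le[OF gi integrable_add[OF gp integrable_mult_const[OF bpi]]])
    fix x
    have Y: "abs (g n x) * abs (bb k x) powr (p - 1) <= abs (g n x) powr p / p + (abs (bb k x) powr (p - 1)) powr (p / (p - 1)) / (p / (p - 1))"
     by (rule Youngs_inequality) (use p in \<open>auto simp: field_simps\<close>)
    have "(abs (bb k x) powr (p - 1)) powr (p / (p - 1)) = abs (bb k x) powr p" using p by (simp add: powr_powr)
    then have "p * (abs (g n x) * abs (bb k x) powr (p - 1)) <= p * (abs (g n x) powr p / p + abs (bb k x) powr p / (p / (p - 1)))"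
     using Y p by (intro mult_left_mono) simp_all
    also have "... = abs (g n x) powr p + (p - 1) * abs (bb k x) powr p" using p by (simp add: field_simps)
    finally have 1: "p * (abs (g n x) * abs (bb k x) powr (p - 1)) <= abs (g n x) powr p + (p - 1) * abs (bb k x) powr p" .
    have "\<beta> x * g n x <= abs (\<beta> x * g n x)" by simp
    also have "... <= p * (abs (g n x) * abs (bb k x) powr (p - 1))"
    proof -
     have "abs (sgn (bb k x)) * (abs (g n x) * abs (bb k x) powr (p - 1)) <= 1 * (abs (g n x) * abs (bb k x) powr (p - 1))"
      by (intro mult_right_mono) (simp_all add: abs_sgn_eq)
     then show ?thesis using p by (simp add: \<beta>_def abs_mult mult_ac)
    qed
    finally show "\<beta> x * g n x <= abs (g n x) powr p + (p - 1) * abs (bb k x) powr p" using 1 by linarith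
   qed
   also have "... = integral {a..b} (%x. abs (g n x) powr p) + (p - 1) * integral {a..b} (%x. abs (bb k x) powr p)"
    using hk_integral_add[OF gp[of n] integrable_mult_const[OF bpi[of k], of "p - 1"]] by simp
   finally show ?thesis using M[of n] by linarith
  qed
  \<comment> \<open>The coefficients p and p - 1 on the two sides leave one copy of the integral, so
    M bounds every truncation.\<close>
  then have "p * integral {a..b} (%x. abs (bb k x) powr p) <= M + (p - 1) * integral {a..b} (%x. abs (bb k x) powr p)"
   by (intro LIMSEQ_le_const2[OF lim']) simp
  then show ?thesis by (simp add: algebra_simps)
 qed
 have "(%x. abs (q x) powr p) integrable_on {a..b} &
  (%k. integral {a..b} (%x. abs (bb k x) powr p)) \<longlonglongrightarrow> integral {a..b} (%x. abs (q x) powr p)"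
 proof (rule monotone_convergence_increasing)
  show "(%x. abs (bb k x) powr p) integrable_on {a..b}" for k by (rule bpi)
  show "abs (bb k x) powr p <= abs (bb (Suc k) x) powr p" for k x
   using p by (intro powr_mono2) (auto simp: bb_def)
  show "(%k. abs (bb k x) powr p) \<longlonglongrightarrow> abs (q x) powr p" for x
  proof (rule tendsto_eventually)
   obtain K :: nat where K: "abs (q x) <= real K" using real_arch_simple by blast
   have "abs (bb k x) powr p = abs (q x) powr p" if "k >= K" for k
   proof -
    have "abs (q x) <= real k" using K that by (meson of_nat_mono order_trans)
    then show ?thesis by (simp add: bb_def)
   qed
   then show "\<forall>\<^sub>F k in sequentially. abs (bb k x) powr p = abs (q x) powr p"
    unfolding eventually_sequentially by blast
  qed
  have "0 <= integral {a..b} (%x. abs (bb k x) powr p)" for k by (rule integral_nonneg[OF bpi]) simp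
  then show "bounded (range (%k. integral {a..b} (%x. abs (bb k x) powr p)))"
   unfolding bounded_iff using bound by (intro exI[of _ M]) simp
 qed
 then show ?thesis ..
qed

section \<open>Optimal control on the junction\<close>

text \<open>The control problem that remains when the equilibrium is fixed: time takes the place of
  the measure. \<open>l0\<close> is the cost of staying at the vertex; \<open>l0_le\<close> says
  that it never exceeds the cost of rest at the inner end of an edge, and lower semicontinuity of
  the total cost hinges on it. \<open>fin\<close> is lower semicontinuous because it may drop at the
  vertex.\<close>

locale junction_control =
 fixes T p C0 Bf :: real and c :: "real => real"
  and l lx la :: "'n::finite => real => real => real => real"
  and l0 :: "real => real" and fin :: "real^'n => real"
 assumes T: "T > 0" and p: "p > 1" and C0: "C0 > 0"
  and l_cont: "!!i. continuous_on ({0..T} \<times> {0..} \<times> UNIV) (%(t, x, a). l i t x a)"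
  and lx_cont: "!!i. continuous_on ({0..T} \<times> {0..} \<times> UNIV) (%(t, x, a). lx i t x a)"
  and la_cont: "!!i. continuous_on ({0..T} \<times> {0..} \<times> UNIV) (%(t, x, a). la i t x a)"
  and lx: "!!i t x a. t : {0..T} ==> x >= 0 ==> ((%\<xi>. l i t \<xi> a) has_real_derivative lx i t x a) (at x within {0..})"
  and la: "!!i t x a. t : {0..T} ==> x >= 0 ==> (l i t x has_real_derivative la i t x a) (at a)"
  and l_lower: "!!i t x a. t : {0..T} ==> x >= 0 ==> l i t x a >= C0 * (abs a powr p - 1)"
  and c_nonneg: "!!r. c r >= 0"
  and lx_bound: "!!i t r x a. t : {0..T} ==> r > 0 ==> x : {0..r} ==> abs (lx i t x a) <= c r * (abs a powr p + 1)"
  and la_bound: "!!i t r x a. t : {0..T} ==> r > 0 ==> x : {0..r} ==> abs (la i t x a) <= c r * (abs a powr (p - 1) + 1)"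
  and l_convex: "!!i t x. t : {0..T} ==> x >= 0 ==> strictly_convex (l i t x)"
  and l0_cont: "continuous_on {0..T} l0"
  and l0_le: "!!i t. t : {0..T} ==> l0 t <= l i t 0 0"
  and l0_lower: "!!t. t : {0..T} ==> l0 t >= - C0"
  and fin_lower: "!!x. x : junction ==> fin x >= - Bf"
  and fin_upper: "!!x. x : junction ==> fin x <= Bf"
  and fin_lsc: "!!x e. x : junction ==> e > 0 ==> EX d>0. ALL z:junction. norm (z - x) < d --> fin x - e < fin z"
begin

definition rc :: "real => real^'n => real => real" where
 "rc t y a = (\<Sum>i\<in>UNIV. l i t (norm y) a * indicator (edge i - {0}) y) + l0 t * indicator {0} y"

text \<open>The derivative of the norm along the curve, by \<open>junction_norm_sum\<close>.\<close>

definition speed :: "real^'n => real" where "speed v = (\<Sum>i\<in>UNIV. v $ i)"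

definition traj :: "real => (real => real^'n) => (real => real^'n) => bool" where
 "traj t y g \<longleftrightarrow> primitive_on t T y g & (ALL s:{t..T}. y s : junction) &
  (%s. norm (g s) powr p) integrable_on {t..T}"

definition run :: "real => real => (real => real^'n) => (real => real^'n) => real" where
 "run a b y g = integral {a..b} (%s. rc s (y s) (speed (g s)))"

definition cost :: "real => (real => real^'n) => (real => real^'n) => real" where
 "cost t y g = run t T y g + fin (y T)"

section \<open>Convexity, growth and measurability of the running cost\<close>

lemma rc_zero: "rc t 0 a = l0 t"
 by (simp add: rc_def)

lemma rc_edge:
 assumes "y : junction" "y $ i > 0"
 shows "rc t y a = l i t (y $ i) a"
proof -
 have y0: "y ~= 0" using assms by auto
 have "y : edge j - {0} \<longleftrightarrow> j = i" for j
  unfolding edge_minus_0_iff using assms junction_nth_unique[OF assms, of j] by (cases "j = i") auto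
 then have ind: "indicator (edge j - {0}) y = (if j = i then 1 else (0::real))" for j
  unfolding indicator_def by simp
 have "rc t y a = (\<Sum>j\<in>UNIV. if j = i then l j t (norm y) a else 0)"
  unfolding rc_def ind using y0 by (simp add: if_distrib[of "%x. _ * x"] cong: if_cong)
 also have "... = l i t (norm y) a" by simp
 finally show ?thesis using junction_norm_nth[OF assms] by simp
qed

lemma convex_tangent:
 assumes "t : {0..T}" "x >= 0"
 shows "l i t x b + la i t x b * (a - b) <= l i t x a"
proof -
 have "convex_on UNIV (l i t x)"
 proof (rule convex_onI)
  fix s u v :: real assume s: "0 < s" "s < 1"
  show "l i t x ((1 - s) *\<^sub>R u + s *\<^sub>R v) <= (1 - s) * l i t x u + s * l i t x v"
  proof (cases "u = v")
   case False
   have "l i t x ((1 - s) * u + (1 - (1 - s)) * v) < (1 - s) * l i t x u + (1 - (1 - s)) * l i t x v"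
    by (rule l_convex[OF assms, unfolded strictly_convex_def, rule_format]) (use s False in simp_all)
   then show ?thesis by simp
  qed (simp add: algebra_simps)
 qed simp
 then have "l i t x a - l i t x b >= la i t x b * (a - b)"
  by (rule convex_on_imp_above_tangent[where A = UNIV]) (use la[OF assms] in simp_all)
 then show ?thesis by simp
qed

text \<open>At the midpoint the tangents at a and b bound l from below, while strict convexity
  bounds it strictly from above by the mean of the end values.\<close>

lemma la_strict_mono:
 assumes "t : {0..T}" "x >= 0" "a < b"
 shows "la i t x a < la i t x b"
proof -
 define m where "m = (a + b) / 2"
 have "l i t x (1/2 * a + (1 - 1/2) * b) < 1/2 * l i t x a + (1 - 1/2) * l i t x b"
  by (rule l_convex[OF assms(1,2), unfolded strictly_convex_def, rule_format]) (use assms(3) in simp_all)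
 moreover have "1/2 * a + (1 - 1/2) * b = m" by (simp add: m_def)
 ultimately have 1: "2 * l i t x m < l i t x a + l i t x b" by simp
 have 2: "l i t x a + la i t x a * (m - a) <= l i t x m" "l i t x b + la i t x b * (m - b) <= l i t x m"
  by (rule convex_tangent[OF assms(1,2)])+
 have "la i t x a * (m - a) < la i t x b * (b - m)"
  using 1 2 by (simp add: algebra_simps)
 moreover have "b - m = m - a" "m - a > 0" using assms(3) by (simp_all add: m_def field_simps)
 ultimately show ?thesis by simp
qed

lemma la_inj: "t : {0..T} ==> x >= 0 ==> la i t x a = la i t x b ==> a = b"
 using la_strict_mono[of t x a b i] la_strict_mono[of t x b a i] by (cases a b rule: linorder_cases) simp_all

lemma rc_lower:
 assumes "t : {0..T}" "y : junction"
 shows "- C0 <= rc t y a"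
proof (rule junction_cases[OF assms(2)])
 assume "y = 0" then show ?thesis using l0_lower[OF assms(1)] by (simp add: rc_zero)
next
 fix i assume i: "y $ i > 0"
 have "C0 * (abs a powr p - 1) <= rc t y a" using l_lower[OF assms(1), of "y $ i" a i] i by (simp add: rc_edge[OF assms(2) i])
 moreover have "- C0 <= C0 * (abs a powr p - 1)" using C0 by (simp add: algebra_simps)
 ultimately show ?thesis by linarith
qed

lemma compact_bound:
 fixes \<phi> :: "real => real => real => real"
 assumes "continuous_on ({0..T} \<times> {0..} \<times> UNIV) (%(t, x, a). \<phi> t x a)"
 obtains B where "B > 0" "!!t x a. t : {0..T} ==> x : {0..R} ==> abs a <= K ==> abs (\<phi> t x a) <= B"
proof -
 have "compact ((%(t, x, a). \<phi> t x a) ` ({0..T} \<times> {0..R} \<times> {-K..K}))"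
  by (rule compact_continuous_image[OF continuous_on_subset[OF assms]]) (auto intro!: compact_Times)
 then have "bounded ((%(t, x, a). \<phi> t x a) ` ({0..T} \<times> {0..R} \<times> {-K..K}))" by (rule compact_imp_bounded)
 then obtain B where B: "B > 0" "ALL y:(%(t, x, a). \<phi> t x a) ` ({0..T} \<times> {0..R} \<times> {-K..K}). norm y <= B"
  unfolding bounded_pos by blast
 show ?thesis
 proof (rule that[OF B(1)])
  fix t x a assume "t : {0..T}" "x : {0..R}" "abs a <= K"
  then have "(t, x, a) : {0..T} \<times> {0..R} \<times> {-K..K}" by auto
  from bspec[OF B(2) imageI[OF this]] show "abs (\<phi> t x a) <= B" by simp
 qed
qed

lemma compact_bound_all:
 fixes \<phi> :: "'n => real => real => real => real"
 assumes "!!i. continuous_on ({0..T} \<times> {0..} \<times> UNIV) (%(t, x, a). \<phi> i t x a)"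
 shows "EX B>0. ALL i. ALL t:{0..T}. ALL x:{0..R}. ALL a. abs a <= K --> abs (\<phi> i t x a) <= B"
proof -
 have "EX B>0. ALL t:{0..T}. ALL x:{0..R}. ALL a. abs a <= K --> abs (\<phi> i t x a) <= B" for i
 proof -
  obtain B where "B > 0" "!!t x a. t : {0..T} ==> x : {0..R} ==> abs a <= K ==> abs (\<phi> i t x a) <= B"
   by (rule compact_bound[OF assms]) (rule that)
  then show ?thesis by blast
 qed
 then obtain B where B: "!!i. B i > 0" "!!i. ALL t:{0..T}. ALL x:{0..R}. ALL a. abs a <= K --> abs (\<phi> i t x a) <= B i"
  by metis
 have le: "B i <= Max (range B)" for i by (rule Max_ge) simp_all
 have "Max (range B) > 0" using B(1)[of undefined] le[of undefined] by linarith
 moreover have "abs (\<phi> i t x a) <= Max (range B)" if "t : {0..T}" "x : {0..R}" "abs a <= K" for i t x a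
  using B(2)[of i] that le[of i] by (meson order_trans)
 ultimately show ?thesis by blast
qed

lemma compact_uniform:
 fixes \<phi> :: "real => real => real => real"
 assumes "continuous_on ({0..T} \<times> {0..} \<times> UNIV) (%(t, x, a). \<phi> t x a)" "e > 0"
 obtains d where "d > 0" "!!t x a t' x' a'. t : {0..T} ==> x : {0..R} ==> abs a <= K ==>
  t' : {0..T} ==> x' : {0..R} ==> abs a' <= K ==> abs (t' - t) < d ==> abs (x' - x) < d ==> abs (a' - a) < d ==>
  abs (\<phi> t' x' a' - \<phi> t x a) < e"
proof -
 have "uniformly_continuous_on ({0..T} \<times> {0..R} \<times> {-K..K}) (%(t, x, a). \<phi> t x a)"
  by (rule compact_uniformly_continuous[OF continuous_on_subset[OF assms(1)]]) (auto intro!: compact_Times)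
 from uniformly_continuous_onE[OF this assms(2)] obtain d where d: "d > 0"
  "!!z z'. z : {0..T} \<times> {0..R} \<times> {-K..K} ==> z' : {0..T} \<times> {0..R} \<times> {-K..K} ==> dist z' z < d ==>
   dist (case z' of (t, x, a) => \<phi> t x a) (case z of (t, x, a) => \<phi> t x a) < e" by blast
 show ?thesis
 proof (rule that[of "d / 3"])
  show "d / 3 > 0" using d(1) by simp
  fix t x a t' x' a'
  assume *: "t : {0..T}" "x : {0..R}" "abs a <= K" "t' : {0..T}" "x' : {0..R}" "abs a' <= K"
   "abs (t' - t) < d / 3" "abs (x' - x) < d / 3" "abs (a' - a) < d / 3"
  have "dist (t', x', a') (t, x, a) <= abs (t' - t) + (abs (x' - x) + abs (a' - a))"
   using norm_Pair_le[of "t' - t" "(x' - x, a' - a)"] norm_Pair_le[of "x' - x" "a' - a"]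
   by (simp add: dist_norm)
  then have "dist (t', x', a') (t, x, a) < d" using * by linarith
  then have "dist (case (t', x', a') of (t, x, a) => \<phi> t x a) (case (t, x, a) of (t, x, a) => \<phi> t x a) < e"
   using * by (intro d(2)) auto
  then show "abs (\<phi> t' x' a' - \<phi> t x a) < e" by (simp add: dist_real_def)
 qed
qed

lemma measurable_comp:
 fixes \<phi> :: "real => real => real => real"
 assumes \<phi>: "continuous_on ({0..T} \<times> {0..} \<times> UNIV) (%(t, x, a). \<phi> t x a)"
  and ab: "0 <= a" "b <= T" and r: "r : borel_measurable (lebesgue_on {a..b})" "!!s. s : {a..b} ==> r s >= 0"
  and v: "v : borel_measurable (lebesgue_on {a..b})"
 shows "(%s. \<phi> s (r s) (v s)) : borel_measurable (lebesgue_on {a..b})"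
proof -
 \<comment> \<open>Clamping time and position extends \<phi> continuously to the whole space, and
   continuity then gives Borel measurability.\<close>
 define \<Phi> where "\<Phi> z = (case (max 0 (min T (fst z)), max 0 (fst (snd z)), snd (snd z)) of (t, x, a) => \<phi> t x a)"
  for z :: "real \<times> real \<times> real"
 have "continuous_on UNIV \<Phi>"
  unfolding \<Phi>_def using T
  by (intro continuous_on_compose2[OF \<phi>, of UNIV "%z. (max 0 (min T (fst z)), max 0 (fst (snd z)), snd (snd z))"] continuous_intros) auto
 then have \<Phi>m: "\<Phi> : borel_measurable borel" by (rule borel_measurable_continuous_onI)
 have id: "(%s. s) : borel_measurable (lebesgue_on {a..b})"
  by (rule continuous_imp_measurable_on_sets_lebesgue) (simp_all add: continuous_on_id)
 have "(%s. \<Phi> (s, r s, v s)) : borel_measurable (lebesgue_on {a..b})"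
  by (rule measurable_compose[OF _ \<Phi>m]) (intro borel_measurable_Pair id r(1) v)
 moreover have eq: "\<Phi> (s, r s, v s) = \<phi> s (r s) (v s)" if "s : space (lebesgue_on {a..b})" for s
  using that ab r(2)[of s] by (simp add: \<Phi>_def)
 moreover have "(%s. \<Phi> (s, r s, v s)) : borel_measurable (lebesgue_on {a..b}) \<longleftrightarrow>
   (%s. \<phi> s (r s) (v s)) : borel_measurable (lebesgue_on {a..b})"
  by (rule measurable_cong) (rule eq)
 ultimately show ?thesis by (simp only:)
qed

lemma trajD:
 assumes "traj t y g"
 shows "primitive_on t T y g" "!!s. s : {t..T} ==> y s : junction" "(%s. norm (g s) powr p) integrable_on {t..T}"
 using assms unfolding traj_def by blast+

lemma primitive_on_measurable:
 assumes "primitive_on a b f g"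
 shows "g : borel_measurable (lebesgue_on {a..b})" "f : borel_measurable (lebesgue_on {a..b})"
proof -
 show "g : borel_measurable (lebesgue_on {a..b})"
  by (rule absolutely_integrable_imp_borel_measurable[OF primitive_on_abs[OF assms]]) simp
 show "f : borel_measurable (lebesgue_on {a..b})"
  by (rule continuous_imp_measurable_on_sets_lebesgue[OF primitive_on_continuous[OF assms]]) simp
qed

text \<open>Junction coordinates are nonnegative, so \<open>primitive_on_zero_set\<close> applies to
  each: the velocity is a.e. tangent to the current edge, and zero at almost every time spent at the
  vertex.\<close>

lemma traj_zero_AE:
 fixes y g :: "real => real^'n"
 assumes "primitive_on a b y g" "!!s. s : {a..b} ==> y s : junction"
 shows "AE s in lebesgue. s : {a..b} --> (ALL i. y s $ i = 0 --> g s $ i = 0)"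
proof -
 have "AE s in lebesgue. ALL i:UNIV. s : {a..b} --> y s $ i = 0 --> g s $ i = 0"
  by (rule AE_finite_allI[OF finite_class.finite_UNIV], rule primitive_on_zero_set[OF primitive_on_nth[OF assms(1)]])
   (rule junction_nth_nonneg[OF assms(2)])
 then show ?thesis by eventually_elim blast
qed

lemma speed_edge:
 assumes "y : junction" "y $ i > 0" "ALL j. y $ j = 0 --> v $ j = 0"
 shows "speed v = v $ i" "norm v = abs (v $ i)"
proof -
 have z: "v $ j = 0" if "j ~= i" for j using assms junction_nth_unique[OF assms(1,2) that] by blast
 have "(\<Sum>j\<in>UNIV. v $ j) = (\<Sum>j\<in>{i}. v $ j)" by (rule sum.mono_neutral_right) (use z in auto)
 then show "speed v = v $ i" by (simp add: speed_def)
 have "v = (v $ i) *\<^sub>R axis i 1" unfolding vec_eq_iff scaleR_axis_nth using z by auto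
 then have "norm v = norm ((v $ i) *\<^sub>R axis i (1::real))" by (rule arg_cong)
 then show "norm v = abs (v $ i)" by simp
qed

text \<open>At the vertex the velocity is zero, so the claim reduces there to the lower bound of
  \<open>l0\<close>.\<close>

lemma rc_lower_AE:
 assumes y: "y : junction" and z: "ALL j. y $ j = 0 --> v $ j = 0" and t: "t : {0..T}"
 shows "C0 * (norm v powr p - 1) <= rc t y (speed v)"
proof (rule junction_cases[OF y])
 assume "y = 0"
 moreover from this z have "v = 0" by (simp add: vec_eq_iff)
 ultimately show ?thesis using l0_lower[OF t] p by (simp add: rc_zero)
next
 fix i assume i: "y $ i > 0"
 show ?thesis using l_lower[OF t, of "y $ i" "v $ i" i] i speed_edge[OF y i z] by (simp add: rc_edge[OF y i])
qed

text \<open>Upper growth follows from that of the derivative: the tangent at a, evaluated at 0,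
  gives \<open>l i t x a <= l i t x 0 + la i t x a * a\<close>, and \<open>la\<close> has order p -
  1. Below, \<open>l_lower\<close> suffices.\<close>

lemma l_upper:
 assumes "R > 0"
 obtains D where "D > 0" "!!i t x a. t : {0..T} ==> x : {0..R} ==> abs (l i t x a) <= D * (abs a powr p + 1)"
proof -
 have "ALL i. EX B>0. ALL t x a. t : {0..T} --> x : {0..R} --> abs a <= 0 --> abs (l i t x a) <= B"
 proof
  fix i
  obtain B where "B > 0" "!!t x a. t : {0..T} ==> x : {0..R} ==> abs a <= 0 ==> abs (l i t x a) <= B"
   using compact_bound[OF l_cont] by metis
  then show "EX B>0. ALL t x a. t : {0..T} --> x : {0..R} --> abs a <= 0 --> abs (l i t x a) <= B" by blast
 qed
 then obtain B where B: "!!i. B i > 0" "!!i t x. t : {0..T} ==> x : {0..R} ==> abs (l i t x 0) <= B i"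
  by (metis abs_zero order_refl)
 define B' where "B' = Max (range B)"
 have B': "B i <= B'" for i unfolding B'_def by (rule Max_ge) simp_all
 \<comment> \<open>\<open>B'\<close> bounds l at velocity 0, \<open>3 * c R\<close> comes from the
   product of la with the velocity, and C0 serves the lower bound.\<close>
 define D where "D = B' + 3 * c R + C0 + 1"
 have B'0: "B' > 0" using B(1) B' by (meson less_le_trans)
 show ?thesis
 proof (rule that[of D])
  show "D > 0" using B'0 c_nonneg[of R] C0 by (simp add: D_def)
  fix i t x a assume t: "t : {0..T}" and x: "x : {0..R}"
  have x0: "x >= 0" using x by simp
  have "l i t x a + la i t x a * (0 - a) <= l i t x 0" by (rule convex_tangent[OF t x0])
  moreover have "l i t x 0 <= B'" using B(2)[OF t x, of i] B'[of i] by linarith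
  moreover have "la i t x a * a <= c R * (abs a powr (p - 1) + 1) * abs a"
  proof -
   have "la i t x a * a <= abs (la i t x a) * abs a" by (metis abs_ge_self abs_mult)
   also have "... <= c R * (abs a powr (p - 1) + 1) * abs a" by (rule mult_right_mono[OF la_bound[OF t assms x]]) simp
   finally show ?thesis .
  qed
  moreover have pp: "(abs a powr (p - 1) + 1) * abs a <= 3 * (abs a powr p + 1)"
  proof -
   have "abs a powr (p - 1) * abs a = abs a powr p"
   proof (cases "a = 0")
    case False
    have "abs a powr p = abs a powr ((p - 1) + 1)" by simp
    also have "... = abs a powr (p - 1) * abs a powr 1" by (rule powr_add)
    finally show ?thesis using False by simp
   qed simp
   moreover have "abs a <= 1 + abs a powr p" using le_add_powr[of "abs a" 1 p] p by simp
   ultimately show ?thesis by (simp add: distrib_right)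
  qed
  ultimately have up: "l i t x a <= B' + 3 * c R * (abs a powr p + 1)"
   using mult_left_mono[OF pp c_nonneg[of R]] by (simp add: algebra_simps)
  have P: "abs a powr p + 1 >= 1" by simp
  have "B' <= B' * (abs a powr p + 1)" using mult_left_mono[OF P, of B'] B'0 by simp
  then have "l i t x a <= (B' + 3 * c R) * (abs a powr p + 1)" using up by (simp add: algebra_simps)
  also have "... <= D * (abs a powr p + 1)" by (rule mult_right_mono) (use C0 P in \<open>simp_all add: D_def\<close>)
  finally have 1: "l i t x a <= D * (abs a powr p + 1)" .
  have "- (D * (abs a powr p + 1)) <= - (C0 * (abs a powr p + 1))"
   using B'0 c_nonneg[of R] P by (simp only: neg_le_iff_le) (intro mult_right_mono, simp_all add: D_def)
  also have "... <= C0 * (abs a powr p - 1)" using C0 by (simp add: algebra_simps)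
  also have "... <= l i t x a" by (rule l_lower[OF t x0])
  finally show "abs (l i t x a) <= D * (abs a powr p + 1)" using 1 by linarith
 qed
qed

lemma abs_powr_mult: "abs a powr (p - 1) * abs a = abs a powr p" for a :: real
proof (cases "a = 0")
 case False
 have "abs a powr p = abs a powr ((p - 1) + 1)" by simp
 also have "... = abs a powr (p - 1) * abs a powr 1" by (rule powr_add)
 finally show ?thesis using False by simp
qed simp

lemma abs_le_powr: "abs a <= 1 + abs a powr p" for a :: real
 using le_add_powr[of "abs a" 1 p] p by simp

lemma abs_powr_le: "abs a powr (p - 1) <= 1 + abs a powr p" for a :: real
proof (cases "abs a <= 1")
 case True
 then have "abs a powr (p - 1) <= 1 powr (p - 1)" using p by (intro powr_mono2) simp_all
 then show ?thesis by (simp add: add_increasing2)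
next
 case False
 then have "abs a powr (p - 1) <= abs a powr p" by (intro powr_mono) simp_all
 then show ?thesis by simp
qed

text \<open>There are two velocities because la is taken at a truncation b of the velocity v in
  \<open>lsc_core\<close>.\<close>

lemma la_mult_bound:
 assumes "t : {0..T}" "R > 0" "x : {0..R}" "abs b <= abs v"
 shows "abs (la i t x b) * abs v <= 3 * c R * (abs v powr p + 1)"
proof -
 have "abs b powr (p - 1) <= abs v powr (p - 1)" using assms(4) p by (intro powr_mono2) simp_all
 then have "abs (la i t x b) <= c R * (abs v powr (p - 1) + 1)"
  using la_bound[OF assms(1-3), of i b] mult_left_mono[of "abs b powr (p - 1) + 1" "abs v powr (p - 1) + 1" "c R"] c_nonneg[of R] by simp
 then have "abs (la i t x b) * abs v <= c R * (abs v powr (p - 1) + 1) * abs v" by (rule mult_right_mono) simp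
 also have "... = c R * (abs v powr p + abs v)" using abs_powr_mult[of v] by (simp add: algebra_simps)
 also have "... <= c R * (3 * (abs v powr p + 1))" using abs_le_powr[of v] by (intro mult_left_mono c_nonneg) simp
 finally show ?thesis by (simp add: mult_ac)
qed

lemma cont_seq:
 fixes \<phi> :: "real => real => real => real"
 assumes \<phi>: "continuous_on ({0..T} \<times> {0..} \<times> UNIV) (%(t, x, a). \<phi> t x a)" and t: "t : {0..T}"
  and x: "!!n. x n >= 0" "x \<longlonglongrightarrow> x'"
 shows "(%n. \<phi> t (x n) a) \<longlonglongrightarrow> \<phi> t x' a"
proof -
 have x': "x' >= 0" by (rule LIMSEQ_le_const[OF x(2)]) (use x(1) in blast)
 have "(%n. (t, x n, a)) \<longlonglongrightarrow> (t, x', a)" by (intro tendsto_intros x(2))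
 then have "(%n. (%(t, x, a). \<phi> t x a) (t, x n, a)) \<longlonglongrightarrow> (%(t, x, a). \<phi> t x a) (t, x', a)"
  by (rule continuous_on_tendsto_compose[OF \<phi>]) (use t x' x(1) in \<open>simp_all add: eventually_sequentially\<close>)
 then show ?thesis by simp
qed

lemma traj_bounded:
 assumes "primitive_on a b y g"
 obtains R where "R > 0" "!!s. s : {a..b} ==> norm (y s) <= R"
proof -
 have "bounded (y ` {a..b})"
  by (intro compact_imp_bounded compact_continuous_image primitive_on_continuous[OF assms] compact_Icc)
 then obtain R where "R > 0" "ALL v:y ` {a..b}. norm v <= R" unfolding bounded_pos by blast
 then show ?thesis using that[of R] by blast
qed

lemma nth_le_norm: "abs ((v :: real^'n) $ i) <= norm v"
 by (rule component_le_norm_cart)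

lemma speed_le: "abs (speed v) <= real CARD('n) * norm v"
proof -
 have "abs (speed v) <= (\<Sum>i\<in>UNIV. abs (v $ i))" unfolding speed_def by (rule sum_abs)
 also have "... <= (\<Sum>i\<in>(UNIV :: 'n set). norm v)" by (rule sum_mono) (rule nth_le_norm)
 finally show ?thesis by simp
qed

lemma speed_measurable: "g : borel_measurable M ==> (%s. speed (g s)) : borel_measurable M"
 unfolding speed_def
 by (intro borel_measurable_sum measurable_compose[OF _ borel_measurable_continuous_onI[OF continuous_on_component]]) (simp_all add: continuous_on_id)

lemma nth_measurable: "g : borel_measurable M ==> (%s. (g s :: real^'n) $ i) : borel_measurable M"
 by (rule measurable_compose[OF _ borel_measurable_continuous_onI[OF continuous_on_component[OF continuous_on_id]]])

lemma l0_measurable: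
 assumes "0 <= a" "b <= T"
 shows "l0 : borel_measurable (lebesgue_on {a..b})"
 by (rule continuous_imp_measurable_on_sets_lebesgue[OF continuous_on_subset[OF l0_cont]]) (use assms in auto)

lemma run_integrable:
 fixes y g :: "real => real^'n"
 assumes y: "primitive_on a b y g" and j: "!!s. s : {a..b} ==> y s : junction"
  and gp: "(%s. norm (g s) powr p) integrable_on {a..b}" and ab: "0 <= a" "b <= T"
 shows "(%s. rc s (y s) (speed (g s))) integrable_on {a..b}"
proof -
 let ?M = "lebesgue_on {a..b}"
 have gm: "g : borel_measurable ?M" and ym: "y : borel_measurable ?M" by (rule primitive_on_measurable[OF y])+
 note sm = speed_measurable[OF gm]
 have yim [measurable]: "(%s. y s $ i) : borel_measurable ?M" for i by (rule nth_measurable[OF ym])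
 have ynm [measurable]: "(%s. norm (y s)) : borel_measurable ?M" using ym by measurable
 have lm [measurable]: "(%s. l i s (y s $ i) (speed (g s))) : borel_measurable ?M" for i
  by (rule measurable_comp[OF l_cont ab yim _ sm]) (use j junction_nth_nonneg in blast)
 note l0m [measurable] = l0_measurable[OF ab]
 \<comment> \<open>The same integrand written with coordinates, a form in which measurability is
   visible.\<close>
 define r where "r s = (\<Sum>i\<in>UNIV. if y s $ i > 0 then l i s (y s $ i) (speed (g s)) else 0) + (if norm (y s) = 0 then l0 s else 0)" for s
 have rm: "r : borel_measurable ?M" unfolding r_def by measurable
 have eq: "rc s (y s) (speed (g s)) = r s" if "s : {a..b}" for s
 proof (rule junction_cases[OF j[OF that]])
  assume "y s = 0" then show ?thesis by (simp add: r_def rc_zero)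
 next
  fix i assume i: "y s $ i > 0"
  have "(if y s $ k > 0 then l k s (y s $ k) (speed (g s)) else 0) = (if k = i then l i s (y s $ i) (speed (g s)) else 0)" for k
   using i junction_nth_unique[OF j[OF that] i, of k] by (cases "k = i") simp_all
  moreover have "norm (y s) ~= 0" using i by auto
  ultimately show ?thesis by (simp add: r_def rc_edge[OF j[OF that] i])
 qed
 obtain R where R: "R > 0" "!!s. s : {a..b} ==> norm (y s) <= R" by (rule traj_bounded[OF y]) (rule that)
 obtain D where D: "D > 0" "!!i t x a. t : {0..T} ==> x : {0..R} ==> abs (l i t x a) <= D * (abs a powr p + 1)"
  by (rule l_upper[OF R(1)]) (rule that)
 have "bounded (l0 ` {0..T})" by (intro compact_imp_bounded compact_continuous_image[OF l0_cont] compact_Icc)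
 then obtain B where B: "B > 0" "ALL v:l0 ` {0..T}. norm v <= B" unfolding bounded_pos by blast
 have "(%s. (real CARD('n) * norm (g s)) powr p) integrable_on {a..b}"
  using integrable_mult_const[OF gp, of "real CARD('n) powr p"] by (simp add: powr_mult)
 from powr_sub_integrable(1)[OF sm this p speed_le]
 have "(%s. abs (speed (g s)) powr p) integrable_on {a..b}" .
 then have dom: "(%s. D * (abs (speed (g s)) powr p + 1) + B) integrable_on {a..b}"
  by (intro integrable_add integrable_mult_const integrable_const_ivl)
 have "r integrable_on {a..b}"
 proof (rule integrable_on_if_dominated(1)[OF rm dom])
  fix s assume s: "s : {a..b}"
  then have sT: "s : {0..T}" using ab by auto
  have "abs (rc s (y s) (speed (g s))) <= D * (abs (speed (g s)) powr p + 1) + B"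
  proof (rule junction_cases[OF j[OF s]])
   assume "y s = 0"
   then show ?thesis using bspec[OF B(2) imageI[OF sT]] D(1) by (simp add: rc_zero add_increasing)
  next
   fix i assume i: "y s $ i > 0"
   have "y s $ i : {0..R}" using i R(2)[OF s] nth_le_norm[of "y s" i] by simp
   then show ?thesis using D(2)[OF sT, of "y s $ i" i "speed (g s)"] B(1) by (simp add: rc_edge[OF j[OF s] i])
  qed
  then show "abs (r s) <= D * (abs (speed (g s)) powr p + 1) + B" using eq[OF s] by simp
 qed
 then show ?thesis by (rule integrable_eq) (use eq in simp)
qed

text \<open>Tonelli's argument. Convexity bounds the cost below by its tangent at a truncation of
  the limit velocity; the tangent is affine in the velocity, so weak convergence passes it to the
  limit, and the truncation is removed afterwards. At times when the limit is at the vertex the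
  curves may be on any edge, so tangents at velocity 0 on all edges are used together with
  \<open>l0_le\<close>.\<close>

lemma lsc_core:
 fixes y g :: "nat => real => real^'n" and z q :: "real => real^'n"
 assumes t: "0 <= t" "t <= T" and tr: "!!n. traj t (y n) (g n)"
  and M: "!!n. integral {t..T} (%s. norm (g n s) powr p) <= M"
  and z: "primitive_on t T z q"
  and unif: "!!e. e > 0 ==> EX N. ALL n x. n >= N & x : {t..T} --> norm (y n x - z x) < e"
  and R: "R > 0" "!!n s. s : {t..T} ==> norm (y n s) <= R"
 shows "traj t z q" and "!!e. e > 0 ==> EX N. ALL n>=N. run t T z q <= run t T (y n) (g n) + e"
proof -
 let ?M = "lebesgue_on {t..T}"
 have tT: "s : {0..T}" if "s : {t..T}" for s using that t by simp
 note yp = trajD(1)[OF tr] and yj = trajD(2)[OF tr] and gp = trajD(3)[OF tr]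
 have ylim: "(%n. y n s) \<longlonglongrightarrow> z s" if "s : {t..T}" for s
  unfolding LIMSEQ_iff using unif that by meson
 have zj: "z s : junction" if "s : {t..T}" for s
  by (rule closed_sequentially[OF closed_junction _ ylim[OF that]]) (rule yj[OF that])
 have yilim: "(%n. y n s $ i) \<longlonglongrightarrow> z s $ i" if "s : {t..T}" for s i
  by (rule tendsto_vec_nth[OF ylim[OF that]])
 have uniN: "EX N. ALL n x. n >= N & x : {t..T} --> abs (y n x $ i - z x $ i) < e" if e: "e > 0" for e i
 proof -
  obtain N where N: "!!n x. n >= N ==> x : {t..T} ==> norm (y n x - z x) < e" using unif[OF e] by blast
  have "abs (y n x $ i - z x $ i) < e" if "n >= N" "x : {t..T}" for n x
   using le_less_trans[OF nth_le_norm[of "y n x - z x" i] N[OF that]] by simp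
  then show ?thesis by blast
 qed
 have y0: "y n s $ i >= 0" if "s : {t..T}" for n s i by (rule junction_nth_nonneg[OF yj[OF that]])
 have z0: "z s $ i >= 0" if "s : {t..T}" for s i by (rule junction_nth_nonneg[OF zj[OF that]])
 have yR: "y n s $ i : {0..R}" if "s : {t..T}" for n s i
  using y0[OF that, of n i] R(2)[OF that, of n] nth_le_norm[of "y n s" i] by simp
 have zR: "z s $ i : {0..R}" if "s : {t..T}" for s i
  using z0[OF that, of i] LIMSEQ_le_const2[OF yilim[OF that, of i], of R] yR[OF that, of _ i] by auto
 have gm: "g n : borel_measurable ?M" for n by (rule primitive_on_measurable[OF yp])
 have gim: "(%s. g n s $ i) : borel_measurable ?M" for n i by (rule nth_measurable[OF gm])
 have qm: "q : borel_measurable ?M" by (rule primitive_on_measurable[OF z])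
 have qim [measurable]: "(%s. q s $ i) : borel_measurable ?M" for i by (rule nth_measurable[OF qm])
 have zm: "z : borel_measurable ?M" by (rule primitive_on_measurable[OF z])
 have zim [measurable]: "(%s. z s $ i) : borel_measurable ?M" for i by (rule nth_measurable[OF zm])
 have znm [measurable]: "(%s. norm (z s)) : borel_measurable ?M" using zm by measurable
 have yim [measurable]: "(%s. y n s $ i) : borel_measurable ?M" for n i
  by (rule nth_measurable[OF primitive_on_measurable(2)[OF yp]])
 note l0m [measurable] = l0_measurable[OF t(1) order_refl]
 have gip: "(%s. abs (g n s $ i) powr p) integrable_on {t..T}" "integral {t..T} (%s. abs (g n s $ i) powr p) <= M" for n i
  using powr_sub_integrable[OF gim gp p nth_le_norm, of n i] M[of n] by simp_all
 \<comment> \<open>Integrability of the power is shown per component; the norm follows because a.e.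
   at most one component is nonzero.\<close>
 have qip: "(%s. abs (q s $ i) powr p) integrable_on {t..T}" for i
  by (rule weak_limit_powr_integrable[OF t(2) p primitive_on_nth[OF yp] primitive_on_nth[OF z] gip(1) gip(2) uniN])
 have zAE: "AE s in lebesgue. s : {t..T} --> (ALL i. z s $ i = 0 --> q s $ i = 0)" by (rule traj_zero_AE[OF z zj])
 have yAE: "AE s in lebesgue. s : {t..T} --> (ALL i. y n s $ i = 0 --> g n s $ i = 0)" for n by (rule traj_zero_AE[OF yp yj])
 show trz: "traj t z q"
  unfolding traj_def
 proof (intro conjI ballI z zj)
  have "AE s in lebesgue. s : {t..T} --> norm (q s) powr p = (\<Sum>i\<in>UNIV. abs (q s $ i) powr p)"
   using zAE
  proof eventually_elim
   case (elim s)
   show ?case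
   proof
    assume s: "s : {t..T}"
    show "norm (q s) powr p = (\<Sum>i\<in>UNIV. abs (q s $ i) powr p)"
    proof (rule junction_cases[OF zj[OF s]])
     assume "z s = 0"
     then have "q s = 0" using elim s by (simp add: vec_eq_iff)
     then show ?thesis by simp
    next
     fix i assume i: "z s $ i > 0"
     have "abs (q s $ k) powr p = 0" if "k ~= i" for k
      using elim s junction_nth_unique[OF zj[OF s] i that] by simp
     then have "(\<Sum>k\<in>UNIV. abs (q s $ k) powr p) = (\<Sum>k\<in>{i}. abs (q s $ k) powr p)"
      by (intro sum.mono_neutral_right) auto
     moreover have "norm (q s) = abs (q s $ i)" by (rule speed_edge(2)[OF zj[OF s] i]) (use elim s in blast)
     ultimately show ?thesis by simp
    qed
   qed
  qed
  then show "(%s. norm (q s) powr p) integrable_on {t..T}"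
   by (rule iffD2[OF integral_cong_AE_lebesgue(2)]) (intro integrable_sum qip finite)
 qed
 \<comment> \<open>The truncation keeps the multipliers \<open>la\<close> bounded for fixed k, as
   weak convergence needs.\<close>
 define b where "b k i s = (if (abs (q s $ i)) <= real k then q s $ i else 0)" for k :: nat and i s
 have bm [measurable]: "b k i : borel_measurable ?M" for k i unfolding b_def by measurable
 have bk: "abs (b k i s) <= real k" and bq: "abs (b k i s) <= abs (q s $ i)" for k i s by (simp_all add: b_def)
 \<comment> \<open>On an edge only the component along the edge of the limit is tested; at the
   vertex all components are.\<close>
 define W where "W i s = (if z s $ i > 0 | norm (z s) = 0 then 1 else (0::real))" for i s
 have Wm [measurable]: "W i : borel_measurable ?M" for i unfolding W_def by measurable
 have W01: "abs (W i s) <= 1" for i s by (simp add: W_def)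
 define \<beta> where "\<beta> k n i s = W i s * la i s (y n s $ i) (b k i s)" for k n i s
 define \<beta>z where "\<beta>z k i s = W i s * la i s (z s $ i) (b k i s)" for k i s
 have lay [measurable]: "(%s. la i s (y n s $ i) (b k i s)) : borel_measurable ?M" for i n k
  by (rule measurable_comp[OF la_cont t(1) order_refl yim y0 bm])
 have laz [measurable]: "(%s. la i s (z s $ i) (b k i s)) : borel_measurable ?M" for i k
  by (rule measurable_comp[OF la_cont t(1) order_refl zim z0 bm])
 have ly [measurable]: "(%s. l i s (y n s $ i) (b k i s)) : borel_measurable ?M" for i n k
  by (rule measurable_comp[OF l_cont t(1) order_refl yim y0 bm])
 have lz [measurable]: "(%s. l i s (z s $ i) (b k i s)) : borel_measurable ?M" for i k
  by (rule measurable_comp[OF l_cont t(1) order_refl zim z0 bm])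
 have ly0 [measurable]: "(%s. l i s (y n s $ i) 0) : borel_measurable ?M" for i n
  by (rule measurable_comp[OF l_cont t(1) order_refl yim y0]) simp_all
 have \<beta>m: "\<beta> k n i : borel_measurable ?M" for k n i unfolding \<beta>_def by measurable
 have \<beta>zm: "\<beta>z k i : borel_measurable ?M" for k i unfolding \<beta>z_def by measurable
 \<comment> \<open>The tangent bound without its velocity term. At the vertex the sum pays for edges
   on which the cost at velocity 0 is below l0; it vanishes in the limit by \<open>l0_le\<close>.
   The value - C0 covers curves that are still off the edge of the limit.\<close>
 define Uy where "Uy k n s = (if norm (z s) = 0 then l0 s - (\<Sum>j\<in>UNIV. max 0 (l0 s - l j s (y n s $ j) 0))
  else (\<Sum>i\<in>UNIV. if z s $ i > 0 then (if y n s $ i > 0 then l i s (y n s $ i) (b k i s) - la i s (y n s $ i) (b k i s) * b k i s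
   else - C0) else 0))" for k n s
 define Uz where "Uz k s = (if norm (z s) = 0 then l0 s
  else (\<Sum>i\<in>UNIV. if z s $ i > 0 then l i s (z s $ i) (b k i s) - la i s (z s $ i) (b k i s) * b k i s else 0))" for k s
 have Uym: "Uy k n : borel_measurable ?M" for k n unfolding Uy_def by measurable
 have Uzm: "Uz k : borel_measurable ?M" for k unfolding Uz_def by measurable
 have zcase: "(\<Sum>k\<in>UNIV. if z s $ k > 0 then f k else 0) = f i" if s: "s : {t..T}" and i: "z s $ i > 0" for s i and f :: "'n => real"
 proof -
  have "(if z s $ k > 0 then f k else 0) = (if k = i then f i else 0)" for k
   using i junction_nth_unique[OF zj[OF s] i, of k] by (cases "k = i") simp_all
  then show ?thesis by simp
 qed
 have Wcase: "W k s = (if k = i then 1 else 0)" if s: "s : {t..T}" and i: "z s $ i > 0" for s i k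
  using i junction_nth_unique[OF zj[OF s] i, of k] by (cases "k = i") (auto simp: W_def)
 have below: "AE s in lebesgue. s : {t..T} --> Uy k n s + (\<Sum>i\<in>UNIV. \<beta> k n i s * g n s $ i) <= rc s (y n s) (speed (g n s))" for k n
  using zAE yAE[of n]
 proof eventually_elim
  case (elim s)
  show ?case
  proof
   assume s: "s : {t..T}"
   have g0: "ALL i. y n s $ i = 0 --> g n s $ i = 0" using elim s by blast
   show "Uy k n s + (\<Sum>i\<in>UNIV. \<beta> k n i s * g n s $ i) <= rc s (y n s) (speed (g n s))"
   proof (rule junction_cases[OF zj[OF s]])
    assume z0: "z s = 0"
    then have "q s = 0" using elim s by (simp add: vec_eq_iff)
    then have b0: "b k i s = 0" for i by (simp add: b_def)
    have W1: "W i s = 1" for i using z0 by (simp add: W_def)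
    have \<beta>0: "\<beta> k n i s = la i s (y n s $ i) 0" for i by (simp add: \<beta>_def W1 b0)
    have Ule: "Uy k n s <= l0 s - max 0 (l0 s - l j s (y n s $ j) 0)" for j
     using z0 member_le_sum[of j UNIV "%j. max 0 (l0 s - l j s (y n s $ j) 0)"] by (simp add: Uy_def)
    show ?thesis
    proof (rule junction_cases[OF yj[OF s, of n]])
     assume y0: "y n s = 0"
     have "(\<Sum>i\<in>UNIV. \<beta> k n i s * g n s $ i) = 0" using g0 y0 by simp
     then show ?thesis using Ule[of undefined] by (simp add: y0 rc_zero)
    next
     fix j assume j: "y n s $ j > 0"
     have "\<beta> k n i s * g n s $ i = (if i = j then la j s (y n s $ j) 0 * g n s $ j else 0)" for i
      using g0 junction_nth_unique[OF yj[OF s] j, of i] \<beta>0 by (cases "i = j") simp_all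
     then have "(\<Sum>i\<in>UNIV. \<beta> k n i s * g n s $ i) = la j s (y n s $ j) 0 * g n s $ j" by simp
     moreover have "l j s (y n s $ j) 0 + la j s (y n s $ j) 0 * (g n s $ j - 0) <= l j s (y n s $ j) (g n s $ j)"
      by (rule convex_tangent[OF tT[OF s] y0[OF s]])
     ultimately show ?thesis using Ule[of j] by (simp add: rc_edge[OF yj[OF s] j] speed_edge(1)[OF yj[OF s] j g0])
    qed
   next
    fix i assume i: "z s $ i > 0"
    have nz: "norm (z s) ~= 0" using i by auto
    have "\<beta> k n j s * g n s $ j = (if j = i then la i s (y n s $ i) (b k i s) * g n s $ i else 0)" for j
     by (simp add: \<beta>_def Wcase[OF s i])
    then have \<beta>s: "(\<Sum>i\<in>UNIV. \<beta> k n i s * g n s $ i) = la i s (y n s $ i) (b k i s) * g n s $ i" by simp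
    have U: "Uy k n s = (if y n s $ i > 0 then l i s (y n s $ i) (b k i s) - la i s (y n s $ i) (b k i s) * b k i s else - C0)"
     using nz by (simp add: Uy_def zcase[OF s i])
    show ?thesis
    proof (cases "y n s $ i > 0")
     case True
     have "l i s (y n s $ i) (b k i s) + la i s (y n s $ i) (b k i s) * (g n s $ i - b k i s) <= l i s (y n s $ i) (g n s $ i)"
      by (rule convex_tangent[OF tT[OF s] y0[OF s]])
     then show ?thesis using True
      unfolding U \<beta>s by (simp add: rc_edge[OF yj[OF s] True] speed_edge(1)[OF yj[OF s] True g0] right_diff_distrib)
    next
     case False
     then have "g n s $ i = 0" using g0 y0[OF s, of n i] by simp
     then show ?thesis using rc_lower[OF tT[OF s] yj[OF s, of n], of "speed (g n s)"] False by (simp add: U \<beta>s)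
    qed
   qed
  qed
 qed
 obtain B0 where B0: "B0 > 0" "!!s. s : {t..T} ==> abs (l0 s) <= B0"
 proof -
  have "bounded (l0 ` {0..T})" by (intro compact_imp_bounded compact_continuous_image[OF l0_cont] compact_Icc)
  then obtain B where B: "B > 0" "ALL v:l0 ` {0..T}. norm v <= B" unfolding bounded_pos by blast
  have "abs (l0 s) <= B" if "s : {t..T}" for s using bspec[OF B(2) imageI[OF tT[OF that]]] by simp
  then show ?thesis using that[OF B(1)] by blast
 qed
 obtain D where D: "D > 0" "!!i t x a. t : {0..T} ==> x : {0..R} ==> abs (l i t x a) <= D * (abs a powr p + 1)"
  by (rule l_upper[OF R(1)]) (rule that)
 have qabs: "(%s. q s $ i) absolutely_integrable_on {t..T}" for i by (rule primitive_on_abs[OF primitive_on_nth[OF z]])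
 have lim: "EX N. ALL n>=N. integral {t..T} (%s. Uz k s + (\<Sum>i\<in>UNIV. \<beta>z k i s * q s $ i)) <= run t T (y n) (g n) + e"
  if e: "e > 0" for k e
 proof -
  obtain Bl where Bl: "Bl > 0" "ALL i. ALL t:{0..T}. ALL x:{0..R}. ALL a. abs a <= real k --> abs (l i t x a) <= Bl"
   using compact_bound_all[of l R "real k", OF l_cont] by blast
  obtain Ba where Ba: "Ba > 0" "ALL i. ALL t:{0..T}. ALL x:{0..R}. ALL a. abs a <= real k --> abs (la i t x a) <= Ba"
   using compact_bound_all[of la R "real k", OF la_cont] by blast
  have Bl': "abs (l i s x a) <= Bl" if "s : {t..T}" "x : {0..R}" "abs a <= real k" for i s x a
   using Bl(2) tT[OF that(1)] that by blast
  have Ba': "abs (la i s x a) <= Ba" if "s : {t..T}" "x : {0..R}" "abs a <= real k" for i s x a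
   using Ba(2) tT[OF that(1)] that by blast
  have \<beta>B: "abs (\<beta> k n i s) <= Ba" if "s : {t..T}" for n i s
   using Ba'[OF that yR[OF that] bk, of i n i i] Ba(1) by (simp add: \<beta>_def W_def)
  have \<beta>zB: "abs (\<beta>z k i s) <= Ba" if "s : {t..T}" for i s
   using Ba'[OF that zR[OF that] bk, of i i i] Ba(1) by (simp add: \<beta>z_def W_def)
  define Cst where "Cst = B0 + real CARD('n) * (B0 + Bl) + real CARD('n) * (Bl + Ba * real k + C0)"
  have UyB: "abs (Uy k n s) <= Cst" if s: "s : {t..T}" for n s
  proof (cases "norm (z s) = 0")
   case True
   have "abs (\<Sum>j\<in>UNIV. max 0 (l0 s - l j s (y n s $ j) 0)) <= (\<Sum>j\<in>UNIV. abs (max 0 (l0 s - l j s (y n s $ j) 0)))" by (rule sum_abs)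
   also have "... <= (\<Sum>j\<in>(UNIV :: 'n set). B0 + Bl)"
   proof (rule sum_mono)
    fix j
    have "abs (l j s (y n s $ j) 0) <= Bl" by (rule Bl'[OF s yR[OF s]]) simp
    then have "l0 s - l j s (y n s $ j) 0 <= B0 + Bl" using B0(2)[OF s] by linarith
    then show "abs (max 0 (l0 s - l j s (y n s $ j) 0)) <= B0 + Bl" using B0(1) Bl(1) by simp
   qed
   finally have "abs (\<Sum>j\<in>UNIV. max 0 (l0 s - l j s (y n s $ j) 0)) <= real CARD('n) * (B0 + Bl)" by simp
   moreover have "0 <= real CARD('n) * (Bl + Ba * real k + C0)" using Bl(1) Ba(1) C0 by simp
   ultimately show ?thesis using True B0(2)[OF s] by (simp add: Uy_def Cst_def)
  next
   case False
   have "abs (Uy k n s) <= (\<Sum>i\<in>UNIV. abs (if z s $ i > 0 then (if y n s $ i > 0 then l i s (y n s $ i) (b k i s) - la i s (y n s $ i) (b k i s) * b k i s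
     else - C0) else 0))"
    unfolding Uy_def using False sum_abs by simp
   also have "... <= (\<Sum>i\<in>(UNIV :: 'n set). Bl + Ba * real k + C0)"
   proof (rule sum_mono)
    fix i
    have 1: "abs (l i s (y n s $ i) (b k i s)) <= Bl" by (rule Bl'[OF s yR[OF s] bk])
    have "abs (la i s (y n s $ i) (b k i s)) * abs (b k i s) <= Ba * real k"
     by (rule mult_mono[OF Ba'[OF s yR[OF s] bk] bk]) (use Ba(1) in simp_all)
    then have "abs (la i s (y n s $ i) (b k i s) * b k i s) <= Ba * real k" by (simp add: abs_mult)
    then have "abs (l i s (y n s $ i) (b k i s) - la i s (y n s $ i) (b k i s) * b k i s) <= Bl + Ba * real k" using 1 by linarith
    moreover have "0 <= Ba * real k" using Ba(1) by simp
    ultimately show "abs (if z s $ i > 0 then (if y n s $ i > 0 then l i s (y n s $ i) (b k i s) - la i s (y n s $ i) (b k i s) * b k i s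
     else - C0) else 0) <= Bl + Ba * real k + C0" using Bl(1) C0 by simp
   qed
   finally have "abs (Uy k n s) <= real CARD('n) * (Bl + Ba * real k + C0)" by simp
   moreover have "0 <= real CARD('n) * (B0 + Bl)" using Bl(1) B0(1) by simp
   ultimately show ?thesis using B0(1) by (simp add: Cst_def)
  qed
  have Uyi: "Uy k n integrable_on {t..T}" for n
   by (rule integrable_on_if_dominated(1)[OF Uym integrable_const_ivl UyB])
  have Ulim: "(%n. Uy k n s) \<longlonglongrightarrow> Uz k s" if s: "s : {t..T}" for s
  proof (rule junction_cases[OF zj[OF s]])
   assume z0': "z s = 0"
   have "(%n. l0 s - (\<Sum>j\<in>UNIV. max 0 (l0 s - l j s (y n s $ j) 0))) \<longlonglongrightarrow> l0 s - (\<Sum>j\<in>UNIV. max 0 (l0 s - l j s (z s $ j) 0))"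
    by (intro tendsto_intros cont_seq[OF l_cont tT[OF s]] y0[OF s] yilim[OF s])
   moreover have "max 0 (l0 s - l j s (z s $ j) 0) = 0" for j using l0_le[OF tT[OF s], of j] z0' by simp
   ultimately show ?thesis using z0' by (simp add: Uy_def Uz_def)
  next
   fix i assume i: "z s $ i > 0"
   then have nz: "norm (z s) ~= 0" by auto
   have L: "(%n. l i s (y n s $ i) (b k i s) - la i s (y n s $ i) (b k i s) * b k i s) \<longlonglongrightarrow>
     l i s (z s $ i) (b k i s) - la i s (z s $ i) (b k i s) * b k i s"
    by (intro tendsto_intros cont_seq[OF l_cont tT[OF s]] cont_seq[OF la_cont tT[OF s]] y0[OF s] yilim[OF s])
   have ev: "\<forall>\<^sub>F n in sequentially. y n s $ i > 0" by (rule order_tendstoD(1)[OF yilim[OF s] i])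
   have "\<forall>\<^sub>F n in sequentially. l i s (y n s $ i) (b k i s) - la i s (y n s $ i) (b k i s) * b k i s = Uy k n s"
    using ev by eventually_elim (use nz in \<open>simp add: Uy_def zcase[OF s i]\<close>)
   from Lim_transform_eventually[OF L this] show ?thesis using nz by (simp add: Uz_def zcase[OF s i])
  qed
  have UI: "Uz k integrable_on {t..T}" "(%n. integral {t..T} (Uy k n)) \<longlonglongrightarrow> integral {t..T} (Uz k)"
  proof -
   have "norm (Uy k n s) <= Cst" if "s : {t..T}" for n s using UyB[OF that] by simp
   note dc = dominated_convergence[OF Uyi integrable_const_ivl this Ulim]
   show "Uz k integrable_on {t..T}" by (rule dc(1))
   show "(%n. integral {t..T} (Uy k n)) \<longlonglongrightarrow> integral {t..T} (Uz k)" by (rule dc(2))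
  qed
  have gabs: "(%s. g n s $ i) absolutely_integrable_on {t..T}" for n i
   by (rule primitive_on_abs[OF primitive_on_nth[OF yp]])
  have mul: "(%s. f s * h s) integrable_on {t..T}"
   if "f : borel_measurable ?M" "!!s. s : {t..T} ==> abs (f s) <= C" "h absolutely_integrable_on {t..T}" for f h :: "real => real" and C
  proof -
   have "bounded (f ` {t..T})" unfolding bounded_iff using that(2) by (intro exI[of _ C]) auto
   then have "(%s. f s * h s) absolutely_integrable_on {t..T}"
    by (intro absolutely_integrable_bounded_measurable_product_real that(1,3)) simp_all
   then show ?thesis by (simp add: absolutely_integrable_on_def)
  qed
  have bgi: "(%s. \<beta> k n i s * g n s $ i) integrable_on {t..T}" for n i by (rule mul[OF \<beta>m \<beta>B gabs])
  have bzgi: "(%s. \<beta>z k i s * g n s $ i) integrable_on {t..T}" for n i by (rule mul[OF \<beta>zm \<beta>zB gabs])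
  have bzqi: "(%s. \<beta>z k i s * q s $ i) integrable_on {t..T}" for i by (rule mul[OF \<beta>zm \<beta>zB qabs])
  \<comment> \<open>The multipliers depend on n through the position. They converge uniformly to
    those of the limit, which are handled by weak convergence; the L1 bound Wc controls the
    difference.\<close>
  have \<beta>lim: "(%n. integral {t..T} (%s. \<beta> k n i s * g n s $ i)) \<longlonglongrightarrow> integral {t..T} (%s. \<beta>z k i s * q s $ i)" for i
  proof -
   have w: "(%n. integral {t..T} (%s. \<beta>z k i s * g n s $ i)) \<longlonglongrightarrow> integral {t..T} (%s. \<beta>z k i s * q s $ i)"
    by (rule weak_convergence_bounded_multiplier[OF t(2) p primitive_on_nth[OF yp] primitive_on_nth[OF z] _ _ uniN \<beta>zm \<beta>zB])
     (use gip in simp_all)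
   define Wc where "Wc = 1 * (T - t) + 1 powr (1 - p) * M"
   have Wc: "integral {t..T} (%s. abs (g n s $ i)) <= Wc" for n
    using integral_norm_le_powr[OF gabs[of n i] _ p zero_less_one t(2)] gip[of n i] by (simp add: Wc_def)
   have "(%n. integral {t..T} (%s. (\<beta> k n i s - \<beta>z k i s) * g n s $ i)) \<longlonglongrightarrow> 0"
    unfolding LIMSEQ_iff
   proof (intro allI impI)
    fix r :: real assume r: "r > 0"
    define r' where "r' = r / (abs Wc + 1)"
    have r': "r' > 0" using r by (simp add: r'_def)
    obtain d where d: "d > 0" "!!t x a t' x' a'. t : {0..T} ==> x : {0..R} ==> abs a <= real k ==>
     t' : {0..T} ==> x' : {0..R} ==> abs a' <= real k ==> abs (t' - t) < d ==> abs (x' - x) < d ==> abs (a' - a) < d ==>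
     abs (la i t' x' a' - la i t x a) < r'"
     by (rule compact_uniform[OF la_cont r']) (rule that)
    obtain N where N: "!!n x. n >= N ==> x : {t..T} ==> abs (y n x $ i - z x $ i) < d" using uniN[OF d(1)] by blast
    show "EX N. ALL n>=N. norm (integral {t..T} (%s. (\<beta> k n i s - \<beta>z k i s) * g n s $ i) - 0) < r"
    proof (intro exI[of _ N] allI impI)
     fix n assume n: "N <= n"
     have db: "abs (\<beta> k n i s - \<beta>z k i s) <= r'" if s: "s : {t..T}" for s
     proof -
      have "abs (la i s (y n s $ i) (b k i s) - la i s (z s $ i) (b k i s)) < r'"
       by (rule d(2)[OF tT[OF s] zR[OF s] bk tT[OF s] yR[OF s] bk]) (use d(1) N[OF n s] in simp_all)
      moreover have "\<beta> k n i s - \<beta>z k i s = W i s * (la i s (y n s $ i) (b k i s) - la i s (z s $ i) (b k i s))"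
       by (simp add: \<beta>_def \<beta>z_def right_diff_distrib)
      ultimately show ?thesis using r' by (simp add: W_def)
     qed
     have i1: "(%s. (\<beta> k n i s - \<beta>z k i s) * g n s $ i) integrable_on {t..T}"
      by (rule mul[OF borel_measurable_diff[OF \<beta>m \<beta>zm] db gabs])
     have gi: "(%s. abs (g n s $ i)) integrable_on {t..T}" using gabs[of n i] by (simp add: absolutely_integrable_on_def)
     have "norm (integral {t..T} (%s. (\<beta> k n i s - \<beta>z k i s) * g n s $ i)) <= integral {t..T} (%s. r' * abs (g n s $ i))"
     proof (rule hk_integral_norm_bound_integral[OF i1 integrable_mult_const[OF gi]])
      fix s assume "s : {t..T}"
      from mult_right_mono[OF db[OF this], of "abs (g n s $ i)"]
      show "norm ((\<beta> k n i s - \<beta>z k i s) * g n s $ i) <= r' * abs (g n s $ i)" by (simp add: abs_mult)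
     qed
     also have "... = r' * integral {t..T} (%s. abs (g n s $ i))" by simp
     also have "... <= r' * abs Wc" by (rule mult_left_mono) (use Wc[of n] r' in simp_all)
     also have "... < r' * (abs Wc + 1)" using r' by simp
     also have "... = r" by (simp add: r'_def)
     finally show "norm (integral {t..T} (%s. (\<beta> k n i s - \<beta>z k i s) * g n s $ i) - 0) < r" by simp
    qed
   qed
   from tendsto_add[OF this w]
   have "(%n. integral {t..T} (%s. (\<beta> k n i s - \<beta>z k i s) * g n s $ i) + integral {t..T} (%s. \<beta>z k i s * g n s $ i))
    \<longlonglongrightarrow> integral {t..T} (%s. \<beta>z k i s * q s $ i)" by simp
   moreover have "integral {t..T} (%s. (\<beta> k n i s - \<beta>z k i s) * g n s $ i) + integral {t..T} (%s. \<beta>z k i s * g n s $ i) =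
    integral {t..T} (%s. \<beta> k n i s * g n s $ i)" for n
   proof -
    have "(%s. (\<beta> k n i s - \<beta>z k i s) * g n s $ i) = (%s. \<beta> k n i s * g n s $ i - \<beta>z k i s * g n s $ i)"
     by (simp add: left_diff_distrib)
    then show ?thesis
     using hk_integral_diff[OF bgi[of n i] bzgi[of i n]] by simp
   qed
   ultimately show ?thesis by simp
  qed
  have bi: "(%s. \<Sum>i\<in>UNIV. \<beta> k n i s * g n s $ i) integrable_on {t..T}" for n
   by (intro integrable_sum finite mul[OF \<beta>m \<beta>B gabs])
  have bzi: "(%s. \<Sum>i\<in>UNIV. \<beta>z k i s * q s $ i) integrable_on {t..T}"
   by (intro integrable_sum finite mul[OF \<beta>zm \<beta>zB qabs])
  define F where "F n = integral {t..T} (%s. Uy k n s + (\<Sum>i\<in>UNIV. \<beta> k n i s * g n s $ i))" for n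
  define Fz where "Fz = integral {t..T} (%s. Uz k s + (\<Sum>i\<in>UNIV. \<beta>z k i s * q s $ i))"
  have "integral {t..T} (%s. \<Sum>i\<in>UNIV. \<beta> k n i s * g n s $ i) = (\<Sum>i\<in>UNIV. integral {t..T} (%s. \<beta> k n i s * g n s $ i))" for n
   by (rule hk_integral_sum[OF finite]) (rule bgi)
  then have F: "F n = integral {t..T} (Uy k n) + (\<Sum>i\<in>UNIV. integral {t..T} (%s. \<beta> k n i s * g n s $ i))" for n
   unfolding F_def using hk_integral_add[OF Uyi[of n] bi[of n]] by simp
  have "integral {t..T} (%s. \<Sum>i\<in>UNIV. \<beta>z k i s * q s $ i) = (\<Sum>i\<in>UNIV. integral {t..T} (%s. \<beta>z k i s * q s $ i))"
   by (rule hk_integral_sum[OF finite]) (rule bzqi)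
  then have Fz: "Fz = integral {t..T} (Uz k) + (\<Sum>i\<in>UNIV. integral {t..T} (%s. \<beta>z k i s * q s $ i))"
   unfolding Fz_def using hk_integral_add[OF UI(1) bzi] by simp
  have "F \<longlonglongrightarrow> Fz" unfolding F[abs_def] Fz by (intro tendsto_add UI(2) tendsto_sum \<beta>lim)
  then have "\<forall>\<^sub>F n in sequentially. Fz - e < F n" by (rule order_tendstoD(1)) (use e in simp)
  moreover have "F n <= run t T (y n) (g n)" for n
   unfolding F_def run_def
   by (rule integral_le_AE[OF integrable_add[OF Uyi bi] run_integrable[OF yp yj gp t(1) order_refl] below])
  ultimately have "\<forall>\<^sub>F n in sequentially. Fz <= run t T (y n) (g n) + e"
   by (elim eventually_mono) (smt (verit))
  then show ?thesis unfolding Fz_def eventually_sequentially .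
 qed
 show "EX N. ALL n>=N. run t T z q <= run t T (y n) (g n) + e" if e: "e > 0" for e
 proof -
  \<comment> \<open>\<open>D + 3 * c R\<close> for the part without velocity and another
    \<open>3 * c R\<close> for the velocity term, independently of k.\<close>
  define E where "E = D + 6 * c R"
  define w where "w s = B0 + (\<Sum>i\<in>UNIV. E * (abs (q s $ i) powr p + 1))" for s
  have wi: "w integrable_on {t..T}"
   unfolding w_def by (intro integrable_add integrable_const_ivl integrable_sum finite integrable_mult_const qip)
  define V where "V k s = Uz k s + (\<Sum>i\<in>UNIV. \<beta>z k i s * q s $ i)" for k s
  have Vm: "V k : borel_measurable ?M" for k
   unfolding V_def by (intro borel_measurable_add Uzm borel_measurable_sum borel_measurable_times \<beta>zm qim)
  have Vb: "abs (V k s) <= w s" if s: "s : {t..T}" for k s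
  proof -
   have la1: "abs (la i s (z s $ i) (b k i s)) * abs (q s $ i) <= 3 * c R * (abs (q s $ i) powr p + 1)" for i
    by (rule la_mult_bound[OF tT[OF s] R(1) zR[OF s] bq])
   have 1: "abs (\<beta>z k i s * q s $ i) <= 3 * c R * (abs (q s $ i) powr p + 1)" for i
    using la1[of i] c_nonneg[of R] by (simp add: \<beta>z_def W_def abs_mult)
   have 2: "abs (if z s $ i > 0 then l i s (z s $ i) (b k i s) - la i s (z s $ i) (b k i s) * b k i s else 0)
    <= (D + 3 * c R) * (abs (q s $ i) powr p + 1)" for i
   proof -
    have "abs (l i s (z s $ i) (b k i s)) <= D * (abs (b k i s) powr p + 1)" by (rule D(2)[OF tT[OF s] zR[OF s]])
    also have "... <= D * (abs (q s $ i) powr p + 1)"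
     using D(1) powr_mono2[OF _ _ bq[of k i s], of p] p by (intro mult_left_mono) simp_all
    finally have a: "abs (l i s (z s $ i) (b k i s)) <= D * (abs (q s $ i) powr p + 1)" .
    have "abs (la i s (z s $ i) (b k i s)) * abs (b k i s) <= abs (la i s (z s $ i) (b k i s)) * abs (q s $ i)"
     by (rule mult_left_mono[OF bq]) simp
    then have "abs (la i s (z s $ i) (b k i s) * b k i s) <= 3 * c R * (abs (q s $ i) powr p + 1)"
     using la1[of i] by (simp add: abs_mult)
    then have "abs (l i s (z s $ i) (b k i s) - la i s (z s $ i) (b k i s) * b k i s) <= (D + 3 * c R) * (abs (q s $ i) powr p + 1)"
     using a unfolding distrib_right by linarith
    moreover have "0 <= (D + 3 * c R) * (abs (q s $ i) powr p + 1)" using D(1) c_nonneg[of R] by simp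
    ultimately show ?thesis by simp
   qed
   have 3: "abs (Uz k s) <= B0 + (\<Sum>i\<in>UNIV. (D + 3 * c R) * (abs (q s $ i) powr p + 1))"
   proof (cases "norm (z s) = 0")
    case True
    have "0 <= (\<Sum>i\<in>UNIV. (D + 3 * c R) * (abs (q s $ i) powr p + 1))"
     using D(1) c_nonneg[of R] by (intro sum_nonneg mult_nonneg_nonneg) simp_all
    then show ?thesis using True B0(2)[OF s] by (simp add: Uz_def)
   next
    case False
    have "abs (\<Sum>i\<in>UNIV. if z s $ i > 0 then l i s (z s $ i) (b k i s) - la i s (z s $ i) (b k i s) * b k i s else 0)
     <= (\<Sum>i\<in>UNIV. (D + 3 * c R) * (abs (q s $ i) powr p + 1))"
     by (rule order_trans[OF sum_abs]) (rule sum_mono[OF 2])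
    then show ?thesis using False B0(1) by (simp add: Uz_def)
   qed
   have 4: "abs (\<Sum>i\<in>UNIV. \<beta>z k i s * q s $ i) <= (\<Sum>i\<in>UNIV. 3 * c R * (abs (q s $ i) powr p + 1))"
    by (rule order_trans[OF sum_abs]) (rule sum_mono[OF 1])
   have "(\<Sum>i\<in>UNIV. (D + 3 * c R) * (abs (q s $ i) powr p + 1)) + (\<Sum>i\<in>UNIV. 3 * c R * (abs (q s $ i) powr p + 1))
    = (\<Sum>i\<in>UNIV. E * (abs (q s $ i) powr p + 1))"
    unfolding sum.distrib[symmetric] by (rule sum.cong) (simp_all add: E_def algebra_simps)
   then show ?thesis using 3 4 unfolding V_def w_def by linarith
  qed
  have Vi: "V k integrable_on {t..T}" for k by (rule integrable_on_if_dominated(1)[OF Vm wi Vb])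
  \<comment> \<open>Once k exceeds the norm of q, the tangent is taken at q itself, where it touches
    the cost.\<close>
  have Vlim: "AE s in lebesgue. s : {t..T} --> (%k. V k s) \<longlonglongrightarrow> rc s (z s) (speed (q s))"
   using zAE
  proof eventually_elim
   case (elim s)
   show ?case
   proof
    assume s: "s : {t..T}"
    have q0: "ALL i. z s $ i = 0 --> q s $ i = 0" using elim s by blast
    obtain K :: nat where K: "norm (q s) <= real K" using real_arch_simple by blast
    have "V k s = rc s (z s) (speed (q s))" if k: "k >= K" for k
    proof -
     have bq': "b k i s = q s $ i" for i
     proof -
      have "abs (q s $ i) <= real k" using nth_le_norm[of "q s" i] K k by linarith
      then show ?thesis by (simp add: b_def)
     qed
     show ?thesis
     proof (rule junction_cases[OF zj[OF s]])
      assume z0': "z s = 0"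
      then have "q s $ i = 0" for i using q0 by simp
      then show ?thesis using z0' by (simp add: V_def Uz_def rc_zero)
     next
      fix i assume i: "z s $ i > 0"
      then have nz: "norm (z s) ~= 0" by auto
      have "\<beta>z k j s * q s $ j = (if j = i then la i s (z s $ i) (q s $ i) * q s $ i else 0)" for j
       by (simp add: \<beta>z_def Wcase[OF s i] bq')
      then have "(\<Sum>j\<in>UNIV. \<beta>z k j s * q s $ j) = la i s (z s $ i) (q s $ i) * q s $ i" by simp
      then show ?thesis
       using nz by (simp add: V_def Uz_def zcase[OF s i] bq' rc_edge[OF zj[OF s] i] speed_edge(1)[OF zj[OF s] i q0])
     qed
    qed
    then show "(%k. V k s) \<longlonglongrightarrow> rc s (z s) (speed (q s))"
     by (intro tendsto_eventually) (auto simp: eventually_sequentially)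
   qed
  qed
  have "(%k. integral {t..T} (V k)) \<longlonglongrightarrow> integral {t..T} (%s. rc s (z s) (speed (q s)))"
   by (rule dominated_convergence_AE(2)[OF Vi wi _ Vlim]) (use Vb in simp)
  then have "\<forall>\<^sub>F k in sequentially. run t T z q - e / 2 < integral {t..T} (V k)"
   unfolding run_def by (rule order_tendstoD(1)) (use e in simp)
  then obtain k where k: "run t T z q - e / 2 < integral {t..T} (V k)" unfolding eventually_sequentially by blast
  have e2: "e / 2 > 0" using e by simp
  obtain N where N: "ALL n>=N. integral {t..T} (V k) <= run t T (y n) (g n) + e / 2"
   using lim[OF e2, of k] unfolding V_def by blast
  have "run t T z q <= run t T (y n) (g n) + e" if "n >= N" for n
   using spec[OF N, of n] that k by linarith
  then show ?thesis by blast
 qed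
qed

section \<open>Pasting of trajectories, dynamic programming and existence of minimisers\<close>

definition ptraj :: "real => real => (real => real^'n) => (real => real^'n) => bool" where
 "ptraj a b y g \<longleftrightarrow> primitive_on a b y g & (ALL s:{a..b}. y s : junction) &
  (%s. norm (g s) powr p) integrable_on {a..b}"

lemma traj_iff_ptraj: "traj t y g \<longleftrightarrow> ptraj t T y g"
 by (simp only: traj_def ptraj_def)

lemma ptrajD:
 assumes "ptraj a b y g"
 shows "primitive_on a b y g" "!!s. s : {a..b} ==> y s : junction" "(%s. norm (g s) powr p) integrable_on {a..b}"
 using assms unfolding ptraj_def by blast+

lemma ptrajI:
 assumes "primitive_on a b y g" "!!s. s : {a..b} ==> y s : junction" "(%s. norm (g s) powr p) integrable_on {a..b}"
 shows "ptraj a b y g"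
 using assms unfolding ptraj_def by blast

lemma ptraj_zero_AE: "ptraj a b y g ==> AE s in lebesgue. s : {a..b} --> (ALL i. y s $ i = 0 --> g s $ i = 0)"
 by (rule traj_zero_AE[OF ptrajD(1,2)])

lemma ptraj_sub:
 assumes "ptraj a b y g" "a <= a'" "b' <= b"
 shows "ptraj a' b' y g"
proof (rule ptrajI)
 show "primitive_on a' b' y g" by (rule primitive_on_subinterval[OF ptrajD(1)[OF assms(1)] assms(2,3)])
 show "y s : junction" if "s : {a'..b'}" for s using ptrajD(2)[OF assms(1), of s] that assms by simp
 show "(%s. norm (g s) powr p) integrable_on {a'..b'}"
  by (rule integrable_on_subinterval[OF ptrajD(3)[OF assms(1)]]) (use assms in auto)
qed

lemma ptraj_run_integrable:
 assumes "ptraj a b y g" "0 <= a" "b <= T"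
 shows "(%s. rc s (y s) (speed (g s))) integrable_on {a..b}"
 by (rule run_integrable[OF ptrajD(1)[OF assms(1)] ptrajD(2)[OF assms(1)] ptrajD(3)[OF assms(1)] assms(2,3)])

lemma run_combine:
 assumes "ptraj a d y g" "0 <= a" "d <= T" "a <= b" "b <= d"
 shows "run a d y g = run a b y g + run b d y g"
 unfolding run_def
 by (rule hk_integral_combine[symmetric, OF assms(4,5) ptraj_run_integrable[OF assms(1-3)]])

definition paste :: "real => (real => 'a) => (real => 'a) => real => 'a" where
 "paste b y z s = (if s <= b then y s else z s)"

lemma ptraj_cong:
 assumes y: "ptraj a b y g" and eq: "!!s. s : {a..b} ==> y' s = y s"
  and N: "negligible N" "!!s. s : {a..b} - N ==> g' s = g s"
 shows "ptraj a b y' g'" "run a b y' g' = run a b y g"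
proof -
 show "ptraj a b y' g'"
 proof (rule ptrajI)
  show "primitive_on a b y' g'" by (rule primitive_on_cong_AE[OF ptrajD(1)[OF y] N eq])
  show "y' s : junction" if "s : {a..b}" for s using ptrajD(2)[OF y that] eq[OF that] by simp
  show "(%s. norm (g' s) powr p) integrable_on {a..b}"
   by (rule integrable_spike[OF ptrajD(3)[OF y] N(1)]) (use N(2) in simp)
 qed
 show "run a b y' g' = run a b y g"
  unfolding run_def by (rule integral_spike[OF N(1)]) (use N(2) eq in simp)
qed

lemma paste_ptraj:
 assumes y: "ptraj a b y g" and z: "ptraj b d z h" and m: "y b = z b" and ab: "a <= b" "b <= d" "0 <= a" "d <= T"
 shows "ptraj a d (paste b y z) (paste b g h)"
  "run a d (paste b y z) (paste b g h) = run a b y g + run b d z h"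
proof -
 have 1: "ptraj a b (paste b y z) (paste b g h)" "run a b (paste b y z) (paste b g h) = run a b y g"
  by (rule ptraj_cong[OF y _ negligible_empty]; simp add: paste_def)+
 \<comment> \<open>At the instant b the pasted density takes its value from g, not from h; a single
   point is negligible.\<close>
 have 2: "ptraj b d (paste b y z) (paste b g h)" "run b d (paste b y z) (paste b g h) = run b d z h"
  by (rule ptraj_cong[OF z _ negligible_sing[of b]]; auto simp: paste_def m)+
 show 3: "ptraj a d (paste b y z) (paste b g h)"
 proof (rule ptrajI)
  show "primitive_on a d (paste b y z) (paste b g h)"
   by (rule primitive_on_combine[OF ptrajD(1)[OF 1(1)] ptrajD(1)[OF 2(1)] ab(1,2)])
  show "paste b y z s : junction" if "s : {a..d}" for s
   using ptrajD(2)[OF 1(1), of s] ptrajD(2)[OF 2(1), of s] that by (cases "s <= b") simp_all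
  show "(%s. norm (paste b g h s) powr p) integrable_on {a..d}"
   by (rule hk_integrable_combine[OF ab(1,2) ptrajD(3)[OF 1(1)] ptrajD(3)[OF 2(1)]])
 qed
 show "run a d (paste b y z) (paste b g h) = run a b y g + run b d z h"
  using run_combine[OF 3 ab(3,4,1,2)] 1(2) 2(2) by simp
qed

lemma ptraj_const: "x : junction ==> ptraj a b (%s. x) (%s. 0)"
proof (rule ptrajI[OF primitive_on_const])
 show "(%s. norm (0 :: real^'n) powr p) integrable_on {a..b}" by (rule integrable_const_ivl)
qed

lemma energy_bound:
 assumes y: "traj t y g" and t: "0 <= t" "t <= T"
 shows "integral {t..T} (%s. norm (g s) powr p) <= (cost t y g + Bf + C0 * T) / C0"
proof -
 have y': "ptraj t T y g" using y by (simp add: traj_iff_ptraj)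
 note gi = ptrajD(3)[OF y']
 have "integral {t..T} (%s. C0 * norm (g s) powr p + (- C0)) <= run t T y g"
  unfolding run_def
 proof (rule integral_le_AE)
  show "(%s. C0 * norm (g s) powr p + (- C0)) integrable_on {t..T}"
   by (intro integrable_add integrable_mult_const gi integrable_const_ivl)
  show "(%s. rc s (y s) (speed (g s))) integrable_on {t..T}" by (rule ptraj_run_integrable[OF y' t(1) order_refl])
  show "AE s in lebesgue. s : {t..T} --> C0 * norm (g s) powr p + (- C0) <= rc s (y s) (speed (g s))"
   using ptraj_zero_AE[OF y']
  proof eventually_elim
   case (elim s)
   show ?case
   proof
    assume s: "s : {t..T}"
    have "C0 * (norm (g s) powr p - 1) <= rc s (y s) (speed (g s))"
     by (rule rc_lower_AE[OF ptrajD(2)[OF y' s]]) (use elim s t in auto)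
    then show "C0 * norm (g s) powr p + (- C0) <= rc s (y s) (speed (g s))" by (simp add: right_diff_distrib)
   qed
  qed
 qed
 moreover have "integral {t..T} (%s. C0 * norm (g s) powr p + (- C0)) = C0 * integral {t..T} (%s. norm (g s) powr p) - C0 * (T - t)"
  using hk_integral_add[OF integrable_mult_const[OF gi, of C0] integrable_const_ivl[of "- C0"]] t by simp
 moreover have "- Bf <= fin (y T)" by (rule fin_lower[OF ptrajD(2)[OF y']]) (use t in simp)
 moreover have "C0 * (T - t) <= C0 * T" using C0 t by simp
 ultimately have "C0 * integral {t..T} (%s. norm (g s) powr p) <= cost t y g + Bf + C0 * T"
  unfolding cost_def by linarith
 then show ?thesis using C0 by (simp add: field_simps)
qed

lemma cost_lower:
 assumes y: "traj t y g" and t: "0 <= t" "t <= T"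
 shows "- (Bf + C0 * T) <= cost t y g"
proof -
 have "0 <= integral {t..T} (%s. norm (g s) powr p)" by (rule integral_nonneg[OF trajD(3)[OF y]]) simp
 then have "0 <= (cost t y g + Bf + C0 * T) / C0" using energy_bound[OF y t] by linarith
 then show ?thesis using C0 by (simp add: zero_le_divide_iff)
qed

lemma traj_compactness:
 fixes y g :: "nat => real => real^'n"
 assumes t: "0 <= t" "t <= T" and tr: "!!n. traj t (y n) (g n)" and B: "!!n. norm (y n t) <= B"
  and C: "!!n. cost t (y n) (g n) <= C"
 obtains k z q where "strict_mono (k :: nat => nat)" "traj t z q"
  "!!e. e > 0 ==> EX N. ALL n x. n >= N & x : {t..T} --> norm (y (k n) x - z x) < e"
  "!!e. e > 0 ==> EX N. ALL n>=N. cost t z q <= cost t (y (k n)) (g (k n)) + e"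
proof -
 define M where "M = (C + Bf + C0 * T) / C0"
 have M: "integral {t..T} (%s. norm (g n s) powr p) <= M" for n
 proof -
  have "(cost t (y n) (g n) + Bf + C0 * T) / C0 <= M" unfolding M_def
   by (rule divide_right_mono) (use C[of n] C0 in simp_all)
  then show ?thesis using energy_bound[OF tr[of n] t] by linarith
 qed
 obtain k z q where k: "strict_mono (k :: nat => nat)" and z: "primitive_on t T z q"
  and unif: "!!e. e > 0 ==> EX N. ALL n x. n >= N & x : {t..T} --> norm (y (k n) x - z x) < e"
  by (rule curve_compactness[OF t(2) p trajD(1)[OF tr] trajD(3)[OF tr] M B]) (rule that)
 obtain R0 where R0: "R0 > 0" "!!s. s : {t..T} ==> norm (z s) <= R0" by (rule traj_bounded[OF z]) (rule that)
 \<comment> \<open>Dropping finitely many curves puts the others within distance 1 of z, which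
   provides the common bound that \<open>lsc_core\<close> asks for.\<close>
 obtain N0 where N0: "!!n x. n >= N0 ==> x : {t..T} ==> norm (y (k n) x - z x) < 1" using unif[OF zero_less_one] by blast
 define y' where "y' n = y (k (n + N0))" for n
 define g' where "g' n = g (k (n + N0))" for n
 have tr': "traj t (y' n) (g' n)" for n unfolding y'_def g'_def by (rule tr)
 have M': "integral {t..T} (%s. norm (g' n s) powr p) <= M" for n unfolding g'_def by (rule M)
 have unif': "EX N. ALL n x. n >= N & x : {t..T} --> norm (y' n x - z x) < e" if e: "e > 0" for e
 proof -
  obtain N where "!!n x. n >= N ==> x : {t..T} ==> norm (y (k n) x - z x) < e" using unif[OF e] by blast
  then show ?thesis unfolding y'_def by (intro exI[of _ N]) simp
 qed
 have R1: "R0 + 1 > 0" using R0(1) by simp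
 have yR: "norm (y' n s) <= R0 + 1" if s: "s : {t..T}" for n s
  using N0[of "n + N0" s] R0(2)[OF s] s norm_triangle_sub[of "y' n s" "z s"] unfolding y'_def by simp
 have lsc1: "traj t z q" by (rule lsc_core(1)[OF t tr' M' z unif' R1 yR])
 have lsc2: "EX N. ALL n>=N. run t T z q <= run t T (y' n) (g' n) + e" if "e > 0" for e
  by (rule lsc_core(2)[OF t tr' M' z unif' R1 yR that])
 have zT: "z T : junction" by (rule trajD(2)[OF lsc1]) (use t in simp)
 have cost: "EX N. ALL n>=N. cost t z q <= cost t (y (k n)) (g (k n)) + e" if e: "e > 0" for e
 proof -
  have e2: "e / 2 > 0" using e by simp
  obtain N1 where N1: "!!n. n >= N1 ==> run t T z q <= run t T (y' n) (g' n) + e / 2" using lsc2[OF e2] by blast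
  obtain d where d: "d > 0" "!!v. v : junction ==> norm (v - z T) < d ==> fin (z T) - e / 2 < fin v"
   using fin_lsc[OF zT e2] by blast
  obtain N2 where N2: "!!n x. n >= N2 ==> x : {t..T} ==> norm (y' n x - z x) < d" using unif'[OF d(1)] by blast
  have "cost t z q <= cost t (y (k n)) (g (k n)) + e" if n: "n >= N1 + N2 + N0" for n
  proof -
   define m where "m = n - N0"
   have m: "m >= N1" "m >= N2" "m + N0 = n" using n by (simp_all add: m_def)
   have TT: "T : {t..T}" using t by simp
   have "run t T z q <= run t T (y' m) (g' m) + e / 2" by (rule N1[OF m(1)])
   moreover have "fin (z T) - e / 2 < fin (y' m T)" by (rule d(2)[OF trajD(2)[OF tr' TT] N2[OF m(2) TT]])
   ultimately show ?thesis unfolding cost_def y'_def g'_def m(3) by linarith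
  qed
  then show ?thesis by blast
 qed
 show ?thesis by (rule that[OF k lsc1 unif cost])
qed

definition opt :: "real => (real => real^'n) => (real => real^'n) => bool" where
 "opt t y g \<longleftrightarrow> traj t y g & (ALL z h. traj t z h --> z t = y t --> cost t y g <= cost t z h)"

definition val :: "real^'n => real => real" where
 "val x t = Inf {cost t y g | y g. traj t y g & y t = x}"

lemma exists_opt:
 assumes t: "0 <= t" "t <= T" and x: "x : junction"
 obtains y g where "opt t y g" "y t = x"
proof -
 let ?S = "{cost t y g | y g. traj t y g & y t = x}"
 have ne: "?S ~= {}" using ptraj_const[OF x, of t T] unfolding traj_iff_ptraj by blast
 have bb: "bdd_below ?S" unfolding bdd_below_def using cost_lower[OF _ t] by blast
 have "EX yg. ALL n. traj t (fst (yg n)) (snd (yg n)) & fst (yg n) t = x &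
  cost t (fst (yg n)) (snd (yg n)) < Inf ?S + inverse (real (Suc n))"
 proof (rule choice, rule allI)
  fix n
  have "Inf ?S < Inf ?S + inverse (real (Suc n))" by simp
  from cInf_lessD[OF ne this] obtain y g where "traj t y g" "y t = x" "cost t y g < Inf ?S + inverse (real (Suc n))" by blast
  then show "EX yg. traj t (fst yg) (snd yg) & fst yg t = x & cost t (fst yg) (snd yg) < Inf ?S + inverse (real (Suc n))"
   by (intro exI[of _ "(y, g)"]) simp
 qed
 then obtain yg where yg0: "ALL n. traj t (fst (yg n)) (snd (yg n)) & fst (yg n) t = x &
  cost t (fst (yg n)) (snd (yg n)) < Inf ?S + inverse (real (Suc n))" ..
 define y where "y n = fst (yg n)" for n :: nat
 define g where "g n = snd (yg n)" for n :: nat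
 have yg: "traj t (y n) (g n)" "y n t = x" "cost t (y n) (g n) < Inf ?S + inverse (real (Suc n))" for n
  using yg0 unfolding y_def g_def by blast+
 have B: "norm (y n t) <= norm x" for n by (simp add: yg(2))
 have C: "cost t (y n) (g n) <= Inf ?S + 1" for n
  using yg(3)[of n] le_imp_inverse_le[of 1 "real (Suc n)"] by simp
 obtain k z q where k: "strict_mono (k :: nat => nat)" and z: "traj t z q"
  and unif: "!!e. e > 0 ==> EX N. ALL n x. n >= N & x : {t..T} --> norm (y (k n) x - z x) < e"
  and c: "!!e. e > 0 ==> EX N. ALL n>=N. cost t z q <= cost t (y (k n)) (g (k n)) + e"
  by (rule traj_compactness[OF t yg(1) B C]) (rule that)
 have zt: "z t = x"
 proof -
  have "(%n. y (k n) t) \<longlonglongrightarrow> z t" unfolding LIMSEQ_iff using unif t by (meson atLeastAtMost_iff order_refl)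
  moreover have "(%n. y (k n) t) \<longlonglongrightarrow> x" by (simp add: yg(2))
  ultimately show ?thesis by (rule LIMSEQ_unique)
 qed
 have "cost t z q <= Inf ?S + e" if e: "e > 0" for e
 proof -
  have e2: "e / 2 > 0" using e by simp
  obtain N where N: "!!n. n >= N ==> cost t z q <= cost t (y (k n)) (g (k n)) + e / 2" using c[OF e2] by blast
  obtain N' where N': "inverse (real (Suc N')) < e / 2" using reals_Archimedean[OF e2] by blast
  define n where "n = N + N'"
  have "N' <= k n" using seq_suble[OF k, of n] by (simp add: n_def)
  then have "inverse (real (Suc (k n))) <= inverse (real (Suc N'))" by (intro le_imp_inverse_le) simp_all
  then have "inverse (real (Suc (k n))) < e / 2" using N' by linarith
  moreover have "cost t z q <= cost t (y (k n)) (g (k n)) + e / 2" by (rule N) (simp add: n_def)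
  ultimately show ?thesis using yg(3)[of "k n"] by linarith
 qed
 then have le: "cost t z q <= Inf ?S" by (rule field_le_epsilon)
 have "opt t z q"
  unfolding opt_def
 proof (intro conjI allI impI z)
  fix z' h assume "traj t z' h" "z' t = z t"
  then have "cost t z' h : ?S" using zt by blast
  from cInf_lower[OF this bb] show "cost t z q <= cost t z' h" using le by linarith
 qed
 then show ?thesis using zt by (rule that)
qed

lemma val_opt:
 assumes "opt t y g"
 shows "val (y t) t = cost t y g"
 unfolding val_def
proof (rule cInf_eq_minimum)
 show "cost t y g : {cost t ya g |ya g. traj t ya g & ya t = y t}" using assms unfolding opt_def by blast
 show "cost t y g <= r" if "r : {cost t ya g |ya g. traj t ya g & ya t = y t}" for r
  using that assms unfolding opt_def by blast
qed

lemma val_le: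
 assumes "traj t y g" "0 <= t" "t <= T"
 shows "val (y t) t <= cost t y g"
proof -
 have "y t : junction" by (rule trajD(2)[OF assms(1)]) (use assms in simp)
 then obtain z h where z: "opt t z h" "z t = y t" by (rule exists_opt[OF assms(2,3)]) (rule that)
 have "val (y t) t = cost t z h" using val_opt[OF z(1)] z(2) by simp
 also have "... <= cost t y g" using z assms(1) unfolding opt_def by simp
 finally show ?thesis .
qed

lemma optI:
 assumes y: "traj t y g" "cost t y g <= val (y t) t" and t: "0 <= t" "t <= T"
 shows "opt t y g"
 unfolding opt_def
proof (intro conjI allI impI y(1))
 fix z h assume "traj t z h" "z t = y t"
 then show "cost t y g <= cost t z h" using val_le[of t z h] y(2) t by simp
qed

text \<open>The competitor is the given arc pasted with a minimiser issued from its end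
  point.\<close>

lemma dp_le:
 assumes y: "ptraj t s y g" and ts: "0 <= t" "t <= s" "s <= T"
 shows "val (y t) t <= run t s y g + val (y s) s"
proof -
 have "y s : junction" by (rule ptrajD(2)[OF y]) (use ts in simp)
 moreover have s0: "0 <= s" using ts by simp
 ultimately obtain z h where z: "opt s z h" "z s = y s"
  using exists_opt[OF s0 ts(3)] by blast
 have zt: "ptraj s T z h" using z(1) unfolding opt_def traj_iff_ptraj by blast
 note pa = paste_ptraj[OF y zt z(2)[symmetric] ts(2,3,1) order_refl]
 have T1: "traj t (paste s y z) (paste s g h)" unfolding traj_iff_ptraj by (rule pa(1))
 have "t <= T" using ts by simp
 from val_le[OF T1 ts(1) this]
 have "val (y t) t <= cost t (paste s y z) (paste s g h)" using ts by (simp add: paste_def)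
 moreover have "fin (paste s y z T) = fin (z T)" using z(2) ts(3) by (cases "s = T") (simp_all add: paste_def)
 ultimately show ?thesis using pa(2) val_opt[OF z(1)] z(2) by (simp add: cost_def)
qed

lemma opt_traj: "opt t y g ==> traj t y g" "opt t y g ==> ptraj t T y g"
 unfolding opt_def traj_iff_ptraj by blast+

text \<open>If the tail of a minimiser could be improved, pasting would improve the whole;
  \<open>dp_le\<close> expresses this.\<close>

lemma opt_restrict:
 assumes y: "opt t y g" and ts: "0 <= t" "t <= s" "s <= T"
 shows "opt s y g" "val (y t) t = run t s y g + val (y s) s"
proof -
 note yt = opt_traj(2)[OF y]
 have ys: "traj s y g" unfolding traj_iff_ptraj by (rule ptraj_sub[OF yt ts(2) order_refl])
 have "val (y t) t = run t s y g + cost s y g"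
  using val_opt[OF y] run_combine[OF yt ts(1) order_refl ts(2,3)] by (simp add: cost_def)
 moreover have "val (y t) t <= run t s y g + val (y s) s"
  by (rule dp_le[OF ptraj_sub[OF yt order_refl ts(3)] ts])
 ultimately have le: "cost s y g <= val (y s) s" by linarith
 have s0: "0 <= s" using ts by simp
 show "opt s y g" by (rule optI[OF ys le s0 ts(3)])
 from val_opt[OF this] show "val (y t) t = run t s y g + val (y s) s"
  using \<open>val (y t) t = run t s y g + cost s y g\<close> by simp
qed

text \<open>The value splits along y at time s, so every minimiser issued from \<open>y s\<close>
  can replace the rest of y. The uniqueness of velocities inside a trajectory rests on this.\<close>

lemma opt_concat:
 assumes y: "opt t y g" and z: "opt s z h" and m: "z s = y s" and ts: "0 <= t" "t <= s" "s <= T"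
 shows "opt t (paste s y z) (paste s g h)"
proof (rule optI)
 note pa = paste_ptraj[OF ptraj_sub[OF opt_traj(2)[OF y] order_refl ts(3)] opt_traj(2)[OF z] m[symmetric] ts(2,3,1) order_refl]
 show "traj t (paste s y z) (paste s g h)" unfolding traj_iff_ptraj by (rule pa(1))
 have "fin (paste s y z T) = fin (z T)" using m ts(3) by (cases "s = T") (simp_all add: paste_def)
 then have "cost t (paste s y z) (paste s g h) = run t s y g + cost s z h" using pa(2) by (simp add: cost_def)
 also have "... = val (y t) t" using val_opt[OF z] m opt_restrict(2)[OF y ts] by simp
 finally show "cost t (paste s y z) (paste s g h) <= val (paste s y z t) t" using ts by (simp add: paste_def)
qed (use ts in simp_all)

text \<open>Reduces variations to one dimension: away from the vertex a competitor is just a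
  positive function on one edge.\<close>

lemma edge_ptraj:
 assumes r: "primitive_on a b r v" and r0: "!!s. s : {a..b} ==> r s > 0" and v: "(%s. abs (v s) powr p) integrable_on {a..b}"
 shows "ptraj a b (%s. r s *\<^sub>R axis i 1) (%s. v s *\<^sub>R axis i 1)"
  "run a b (%s. r s *\<^sub>R axis i 1) (%s. v s *\<^sub>R axis i 1) = integral {a..b} (%s. l i s (r s) (v s))"
proof -
 have j: "r s *\<^sub>R axis i 1 : junction" if "s : {a..b}" for s
  by (rule axis_in_junction) (use r0[OF that] in simp)
 show "ptraj a b (%s. r s *\<^sub>R axis i 1) (%s. v s *\<^sub>R axis i 1)"
 proof (rule ptrajI[OF _ j])
  show "primitive_on a b (%s. r s *\<^sub>R axis i 1) (%s. v s *\<^sub>R axis i 1)"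
   by (rule primitive_on_linear[OF r bounded_linear_scaleR_left])
  show "(%s. norm (v s *\<^sub>R axis i (1::real)) powr p) integrable_on {a..b}" using v by (simp only: norm_scaleR_axis)
 qed
 show "run a b (%s. r s *\<^sub>R axis i 1) (%s. v s *\<^sub>R axis i 1) = integral {a..b} (%s. l i s (r s) (v s))"
  unfolding run_def
 proof (rule hk_integral_cong)
  fix s assume s: "s : {a..b}"
  have n: "(r s *\<^sub>R axis i (1::real)) $ i = r s" by (simp only: scaleR_axis_nth if_True refl)
  have "speed (v s *\<^sub>R axis i 1) = v s" unfolding speed_def scaleR_axis_nth by simp
  then show "rc s (r s *\<^sub>R axis i 1) (speed (v s *\<^sub>R axis i 1)) = l i s (r s) (v s)"
   using rc_edge[OF j[OF s], of i s "v s"] r0[OF s] unfolding n by simp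
 qed
qed

lemma ptraj_edge:
 assumes y: "ptraj a b y g" and r0: "!!s. s : {a..b} ==> y s $ i > 0"
 shows "(%s. abs (g s $ i) powr p) integrable_on {a..b}" "s : {a..b} ==> y s = (y s $ i) *\<^sub>R axis i 1"
  "run a b y g = integral {a..b} (%s. l i s (y s $ i) (g s $ i))"
proof -
 show "(%s. abs (g s $ i) powr p) integrable_on {a..b}"
  by (rule powr_sub_integrable(1)[OF nth_measurable[OF primitive_on_measurable(1)[OF ptrajD(1)[OF y]]] ptrajD(3)[OF y] p nth_le_norm])
 show "s : {a..b} ==> y s = (y s $ i) *\<^sub>R axis i 1" using junction_eq_axis[OF ptrajD(2)[OF y]] r0 by blast
 have "AE s in lebesgue. s : {a..b} --> rc s (y s) (speed (g s)) = l i s (y s $ i) (g s $ i)"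
  using ptraj_zero_AE[OF y]
 proof eventually_elim
  case (elim s)
  show ?case
  proof
   assume s: "s : {a..b}"
   show "rc s (y s) (speed (g s)) = l i s (y s $ i) (g s $ i)"
    unfolding rc_edge[OF ptrajD(2)[OF y s] r0[OF s]]
    by (subst speed_edge(1)[OF ptrajD(2)[OF y s] r0[OF s]]) (use elim s in simp_all)
  qed
 qed
 then show "run a b y g = integral {a..b} (%s. l i s (y s $ i) (g s $ i))"
  unfolding run_def by (rule integral_cong_AE_lebesgue(1))
qed

end

section \<open>Regularity of optimal trajectories\<close>

text \<open>The derivative is taken within S, so that S may be the half-line ending at the vertex,
  and x and y come in either order.\<close>

lemma MVT_segment_within:
 fixes f :: "real => real"
 assumes f: "!!x. x : S ==> (f has_real_derivative f' x) (at x within S)" and S: "closed_segment x y \<subseteq> S"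
 shows "EX z:closed_segment x y. f y - f x = (y - x) * f' z"
proof -
 have *: "EX z:closed_segment x y. f y - f x = (y - x) * f' z" if xy: "x < y" and S: "closed_segment x y \<subseteq> S" for x y
 proof -
  have seg: "closed_segment x y = {x..y}" using xy by (simp add: closed_segment_eq_real_ivl)
  have "EX z:{x<..<y}. f y - f x = f' z * (y - x)"
  proof (rule mvt_simple[OF xy])
   fix z assume "x <= z" "z <= y"
   then have "(f has_real_derivative f' z) (at z within {x..y})"
    using S unfolding seg by (intro has_field_derivative_subset[OF f]) auto
   then show "(f has_derivative (*) (f' z)) (at z within {x..y})" by (simp add: has_field_derivative_def)
  qed
  then obtain z where "z : {x<..<y}" "f y - f x = f' z * (y - x)" by blast
  then show ?thesis unfolding seg by (intro bexI[of _ z]) simp_all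
 qed
 consider "x < y" | "x = y" | "y < x" by linarith
 then show ?thesis
 proof cases
  case 1 then show ?thesis by (rule *[OF _ S])
 next
  case 2 then show ?thesis by simp
 next
  case 3
  obtain z where z: "z : closed_segment y x" "f x - f y = (x - y) * f' z"
   using *[OF 3] S by (auto simp: closed_segment_commute)
  have "f y - f x = (y - x) * f' z" using z(2) by (simp add: algebra_simps)
  then show ?thesis using z(1) by (intro bexI[of _ z]) (simp_all add: closed_segment_commute)
 qed
qed

section \<open>First variation, Euler-Lagrange equation and uniform bounds on velocities\<close>

context junction_control
begin

lemma powr_add_bound: "abs (x + y) powr p <= 2 powr p * (abs x powr p + abs y powr p)" for x y :: real
proof -
 define m where "m = max (abs x) (abs y)"
 have "abs (x + y) powr p <= (2 * m) powr p" using p by (intro powr_mono2) (simp_all add: m_def)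
 also have "... = 2 powr p * m powr p" by (rule powr_mult)
 also have "... <= 2 powr p * (abs x powr p + abs y powr p)" by (intro mult_left_mono) (simp_all add: m_def max_def)
 finally show ?thesis .
qed

text \<open>The increment is taken along the path (x, a), (x, a'), (x', a'), so one-variable mean
  values suffice.\<close>

lemma l_mvt:
 assumes t: "t : {0..T}" and x: "x >= 0" "x' >= 0"
 shows "EX \<xi>:closed_segment x x'. EX \<eta>:closed_segment a a'.
  l i t x' a' - l i t x a = lx i t \<xi> a' * (x' - x) + la i t x \<eta> * (a' - a)"
proof -
 have sub: "closed_segment x x' \<subseteq> {0..}" using x by (auto simp: closed_segment_eq_real_ivl)
 have der: "((%\<xi>. l i t \<xi> a') has_real_derivative lx i t \<xi> a') (at \<xi> within {0..})" if "\<xi> : {0..}" for \<xi>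
  by (rule lx[OF t]) (use that in simp)
 obtain \<xi> where \<xi>: "\<xi> : closed_segment x x'" "l i t x' a' - l i t x a' = (x' - x) * lx i t \<xi> a'"
  using MVT_segment_within[OF der sub] by blast
 obtain \<eta> where \<eta>: "\<eta> : closed_segment a a'" "l i t x a' - l i t x a = (a' - a) * la i t x \<eta>"
  using MVT_segment_within[of UNIV "l i t x" "la i t x", OF la[OF t x(1)]] by blast
 have "l i t x' a' - l i t x a = lx i t \<xi> a' * (x' - x) + la i t x \<eta> * (a' - a)"
  using \<xi>(2) \<eta>(2) by (simp add: mult.commute)
 then show ?thesis using \<xi>(1) \<eta>(1) by blast
qed

lemma cont_seq2:
 fixes \<phi> :: "real => real => real => real"
 assumes \<phi>: "continuous_on ({0..T} \<times> {0..} \<times> UNIV) (%(t, x, a). \<phi> t x a)" and t: "t : {0..T}"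
  and x: "!!n. x n >= 0" "x \<longlonglongrightarrow> x'" and a: "a \<longlonglongrightarrow> a'"
 shows "(%n. \<phi> t (x n) (a n)) \<longlonglongrightarrow> \<phi> t x' a'"
proof -
 have x': "x' >= 0" by (rule LIMSEQ_le_const[OF x(2)]) (use x(1) in blast)
 have "(%n. (t, x n, a n)) \<longlonglongrightarrow> (t, x', a')" by (intro tendsto_intros x(2) a)
 then have "(%n. (%(t, x, a). \<phi> t x a) (t, x n, a n)) \<longlonglongrightarrow> (%(t, x, a). \<phi> t x a) (t, x', a')"
  by (rule continuous_on_tendsto_compose[OF \<phi>]) (use t x' x(1) in \<open>simp_all add: eventually_sequentially\<close>)
 then show ?thesis by simp
qed

lemma segment_dist: "z : closed_segment x y ==> abs (z - x) <= abs (y - x)" for x y z :: real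
 by (auto simp: closed_segment_eq_real_ivl split: if_splits)

lemma arc_integrable:
 assumes ab: "0 <= a" "b <= T" and r: "r : borel_measurable (lebesgue_on {a..b})" "!!s. s : {a..b} ==> r s : {0..R}" "R > 0"
  and v: "v : borel_measurable (lebesgue_on {a..b})" and vp: "(%s. abs (v s) powr p) integrable_on {a..b}"
 shows "(%s. l i s (r s) (v s)) integrable_on {a..b}" "(%s. lx i s (r s) (v s)) absolutely_integrable_on {a..b}"
  "(%s. la i s (r s) (v s)) absolutely_integrable_on {a..b}"
  "a <= b ==> integral {a..b} (%s. abs (lx i s (r s) (v s))) <= c R * (integral {a..b} (%s. abs (v s) powr p) + 2 * (b - a))"
  "a <= b ==> integral {a..b} (%s. abs (la i s (r s) (v s))) <= c R * (integral {a..b} (%s. abs (v s) powr p) + 2 * (b - a))"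
proof -
 have r0: "r s >= 0" if "s : {a..b}" for s using r(2)[OF that] by simp
 have sT: "s : {0..T}" if "s : {a..b}" for s using that ab by simp
 obtain D where D: "D > 0" "!!i t x a. t : {0..T} ==> x : {0..R} ==> abs (l i t x a) <= D * (abs a powr p + 1)"
  by (rule l_upper[OF r(3)]) (rule that)
 have dom: "(%s. C * (abs (v s) powr p + C')) integrable_on {a..b}" for C C'
  by (intro integrable_mult_const integrable_add vp integrable_const_ivl)
 show "(%s. l i s (r s) (v s)) integrable_on {a..b}"
  by (rule integrable_on_if_dominated(1)[OF measurable_comp[OF l_cont ab r(1) r0 v] dom D(2)[OF sT r(2)]])
 have lxb: "abs (lx i s (r s) (v s)) <= c R * (abs (v s) powr p + 2)" if "s : {a..b}" for s
 proof -
  have "c R * (abs (v s) powr p + 1) <= c R * (abs (v s) powr p + 2)" by (rule mult_left_mono[OF _ c_nonneg]) simp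
  then show ?thesis using lx_bound[OF sT[OF that] r(3) r(2)[OF that], of i "v s"] by linarith
 qed
 have lab: "abs (la i s (r s) (v s)) <= c R * (abs (v s) powr p + 2)" if "s : {a..b}" for s
 proof -
  have "c R * (abs (v s) powr (p - 1) + 1) <= c R * (abs (v s) powr p + 2)"
   by (rule mult_left_mono[OF _ c_nonneg]) (use abs_powr_le[of "v s"] in simp)
  then show ?thesis using la_bound[OF sT[OF that] r(3) r(2)[OF that], of i "v s"] by linarith
 qed
 show x: "(%s. lx i s (r s) (v s)) absolutely_integrable_on {a..b}"
  by (rule integrable_on_if_dominated(2)[OF measurable_comp[OF lx_cont ab r(1) r0 v] dom lxb])
 show y: "(%s. la i s (r s) (v s)) absolutely_integrable_on {a..b}"
  by (rule integrable_on_if_dominated(2)[OF measurable_comp[OF la_cont ab r(1) r0 v] dom lab])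
 have eq: "integral {a..b} (%s. c R * (abs (v s) powr p + 2)) = c R * (integral {a..b} (%s. abs (v s) powr p) + 2 * (b - a))" if "a <= b"
  using hk_integral_add[OF vp integrable_const_ivl[of 2]] that by simp
 show "integral {a..b} (%s. abs (lx i s (r s) (v s))) <= c R * (integral {a..b} (%s. abs (v s) powr p) + 2 * (b - a))" if "a <= b"
  unfolding eq[OF that, symmetric] by (rule integral_le[OF _ dom lxb]) (use x in \<open>simp add: absolutely_integrable_on_def\<close>)
 show "integral {a..b} (%s. abs (la i s (r s) (v s))) <= c R * (integral {a..b} (%s. abs (v s) powr p) + 2 * (b - a))" if "a <= b"
  unfolding eq[OF that, symmetric] by (rule integral_le[OF _ dom lab]) (use y in \<open>simp add: absolutely_integrable_on_def\<close>)
qed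

lemma perturbed_powr:
 fixes v w :: "real => real"
 assumes v: "v : borel_measurable (lebesgue_on {a..b})" "(%s. abs (v s) powr p) integrable_on {a..b}"
  and w: "w : borel_measurable (lebesgue_on {a..b})" "!!s. s : {a..b} ==> abs (w s) <= B"
 shows "(%s. abs (v s + w s) powr p) integrable_on {a..b}"
proof (rule integrable_on_if_dominated(1))
 show "(%s. abs (v s + w s) powr p) : borel_measurable (lebesgue_on {a..b})" using v(1) w(1) by measurable
 show "(%s. 2 powr p * (abs (v s) powr p + B powr p)) integrable_on {a..b}"
  by (intro integrable_mult_const integrable_add v(2) integrable_const_ivl)
 fix s assume s: "s : {a..b}"
 have "abs (w s) powr p <= B powr p" using w(2)[OF s] p by (intro powr_mono2) simp_all
 then have "2 powr p * (abs (v s) powr p + abs (w s) powr p) <= 2 powr p * (abs (v s) powr p + B powr p)" by (intro mult_left_mono) simp_all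
 then have "abs (v s + w s) powr p <= 2 powr p * (abs (v s) powr p + B powr p)"
  using powr_add_bound[of "v s" "w s"] by linarith
 then show "\<bar>\<bar>v s + w s\<bar> powr p\<bar> <= 2 powr p * (\<bar>v s\<bar> powr p + B powr p)" by simp
qed

text \<open>Only h > 0 is compared, so an inequality results; \<open>euler_lagrange\<close> applies
  it to \<phi> and to its negative. The mean value formula bounds the difference quotients by the
  energy density of v, which permits dominated convergence.\<close>

lemma first_variation_nonneg:
 assumes ab: "0 <= a" "b <= T" and r: "primitive_on a b r v" and x0: "x0 > 0"
  and rb: "!!s. s : {a..b} ==> x0 <= r s & r s <= R"
  and vp: "(%s. abs (v s) powr p) integrable_on {a..b}"
  and \<phi>: "primitive_on a b \<phi> \<psi>" "!!s. abs (\<psi> s) <= B" "!!s. s : {a..b} ==> abs (\<phi> s) <= x0 / 2"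
  and min: "!!h. 0 < h ==> h <= 1 ==> integral {a..b} (%s. l i s (r s) (v s)) <= integral {a..b} (%s. l i s (r s + h * \<phi> s) (v s + h * \<psi> s))"
 shows "0 <= integral {a..b} (%s. lx i s (r s) (v s) * \<phi> s + la i s (r s) (v s) * \<psi> s)"
proof (cases "a <= b")
 case False then show ?thesis by simp
next
 case True
 have R: "R >= x0" using rb[of a] True by auto
 define R' where "R' = R + x0"
 have R': "R' > 0" using R x0 by (simp add: R'_def)
 have B0: "B >= 0" using \<phi>(2)[of 0] by linarith
 have sT: "s : {0..T}" if "s : {a..b}" for s using that ab by simp
 note vm = primitive_on_measurable(1)[OF r] and rm = primitive_on_measurable(2)[OF r]
 note \<psi>m = primitive_on_measurable(1)[OF \<phi>(1)] and \<phi>m = primitive_on_measurable(2)[OF \<phi>(1)]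
 define h where "h n = inverse (real (Suc n))" for n
 have h: "0 < h n" "h n <= 1" for n using le_imp_inverse_le[of 1 "real (Suc n)"] by (simp_all add: h_def)
 have hlim: "h \<longlonglongrightarrow> 0" unfolding h_def by (rule LIMSEQ_inverse_real_of_nat)
 \<comment> \<open>Dominates \<open>abs (v s + w) powr p\<close> for all shifts w bounded by B,
   hence for all intermediate velocities of the mean value formula.\<close>
 define W where "W s = 2 powr p * (abs (v s) powr p + B powr p)" for s
 have hr: "r s + h n * \<phi> s : {0..R'}" if s: "s : {a..b}" for s n
 proof -
  have "abs (h n * \<phi> s) <= 1 * (x0 / 2)" unfolding abs_mult using h[of n] \<phi>(3)[OF s] by (intro mult_mono) simp_all
  then have 1: "abs (h n * \<phi> s) <= x0 / 2" by simp
  show ?thesis using 1 rb[OF s] x0 unfolding R'_def atLeastAtMost_iff abs_le_iff by (intro conjI; linarith)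
 qed
 have hp: "abs (h n * \<psi> s) <= B" for n s
  using mult_mono[OF h(2)[of n] \<phi>(2)[of s]] h(1)[of n] by (simp add: abs_mult)
 have Wv: "abs (v s + w) powr p <= W s" if "abs w <= B" for s w
 proof -
  have "abs w powr p <= B powr p" using that p by (intro powr_mono2) simp_all
  then have "2 powr p * (abs (v s) powr p + abs w powr p) <= W s" unfolding W_def by (intro mult_left_mono) simp_all
  then show ?thesis using powr_add_bound[of "v s" w] by linarith
 qed
 define Q where "Q n s = (l i s (r s + h n * \<phi> s) (v s + h n * \<psi> s) - l i s (r s) (v s)) / h n" for n s
 have hm: "(%s. r s + h n * \<phi> s) : borel_measurable (lebesgue_on {a..b})"
  "(%s. v s + h n * \<psi> s) : borel_measurable (lebesgue_on {a..b})"
  "(%s. h n * \<psi> s) : borel_measurable (lebesgue_on {a..b})" for n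
  by (intro borel_measurable_add borel_measurable_times borel_measurable_const rm \<phi>m vm \<psi>m)+
 have i1: "(%s. l i s (r s + h n * \<phi> s) (v s + h n * \<psi> s)) integrable_on {a..b}" for n
  by (rule arc_integrable(1)[OF ab hm(1) hr R' hm(2) perturbed_powr[OF vm vp hm(3) hp]])
 have rR: "r s : {0..R'}" if "s : {a..b}" for s using rb[OF that] x0 by (simp add: R'_def)
 have i2: "(%s. l i s (r s) (v s)) integrable_on {a..b}"
  by (rule arc_integrable(1)[OF ab rm rR R' vm vp])
 have Qi: "Q n integrable_on {a..b}" for n
  using integrable_mult_const[OF integrable_diff[OF i1[of n] i2], of "inverse (h n)"]
  by (simp add: Q_def[abs_def] divide_inverse mult.commute)
 have Q0: "0 <= integral {a..b} (Q n)" for n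
 proof -
  have "integral {a..b} (Q n) = inverse (h n) * integral {a..b} (%s. l i s (r s + h n * \<phi> s) (v s + h n * \<psi> s) - l i s (r s) (v s))"
   by (simp add: Q_def[abs_def] divide_inverse mult.commute[of _ "inverse (h n)"])
  moreover have "integral {a..b} (%s. l i s (r s + h n * \<phi> s) (v s + h n * \<psi> s) - l i s (r s) (v s)) >= 0"
   using hk_integral_diff[OF i1[of n] i2] min[OF h] by simp
  ultimately show ?thesis using h(1)[of n] by simp
 qed
 have ex: "EX \<xi> \<eta>. abs (\<xi> - r s) <= abs (h n * \<phi> s) & abs (\<eta> - v s) <= abs (h n * \<psi> s) & \<xi> : {0..R'} &
   Q n s = lx i s \<xi> (v s + h n * \<psi> s) * \<phi> s + la i s (r s) \<eta> * \<psi> s" if s: "s : {a..b}" for n s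
 proof -
  have r0: "r s >= 0" "r s + h n * \<phi> s >= 0" using rR[OF s] hr[OF s, of n] by simp_all
  obtain \<xi> \<eta> where \<xi>: "\<xi> : closed_segment (r s) (r s + h n * \<phi> s)" "\<eta> : closed_segment (v s) (v s + h n * \<psi> s)"
   "l i s (r s + h n * \<phi> s) (v s + h n * \<psi> s) - l i s (r s) (v s) =
    lx i s \<xi> (v s + h n * \<psi> s) * (r s + h n * \<phi> s - r s) + la i s (r s) \<eta> * (v s + h n * \<psi> s - v s)"
   using l_mvt[OF sT[OF s] r0] by blast
  have "\<xi> : {0..R'}" using \<xi>(1) rR[OF s] hr[OF s, of n] by (auto simp: closed_segment_eq_real_ivl split: if_splits)
  moreover have "Q n s = lx i s \<xi> (v s + h n * \<psi> s) * \<phi> s + la i s (r s) \<eta> * \<psi> s"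
   unfolding Q_def \<xi>(3) using h(1)[of n] by (simp add: field_simps)
  moreover have "abs (\<xi> - r s) <= abs (h n * \<phi> s)" "abs (\<eta> - v s) <= abs (h n * \<psi> s)"
   using segment_dist[OF \<xi>(1)] segment_dist[OF \<xi>(2)] by simp_all
  ultimately show ?thesis by blast
 qed
 define dom where "dom s = c R' * (W s + 1) * (x0 / 2) + c R' * (W s + 2) * B" for s
 have domi: "dom integrable_on {a..b}"
 proof -
  have "W integrable_on {a..b}" unfolding W_def by (intro integrable_mult_const integrable_add vp integrable_const_ivl)
  then have "(%s. (c R' * (x0 / 2)) * (W s + 1) + (c R' * B) * (W s + 2)) integrable_on {a..b}"
   by (intro integrable_add integrable_mult_const integrable_const_ivl)
  then show ?thesis unfolding dom_def by (simp add: mult_ac)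
 qed
 have Qb: "norm (Q n s) <= dom s" if s: "s : {a..b}" for n s
 proof -
  obtain \<xi> \<eta> where \<xi>: "abs (\<eta> - v s) <= abs (h n * \<psi> s)" "\<xi> : {0..R'}"
   "Q n s = lx i s \<xi> (v s + h n * \<psi> s) * \<phi> s + la i s (r s) \<eta> * \<psi> s" using ex[OF s, of n] by blast
  have "abs (lx i s \<xi> (v s + h n * \<psi> s)) <= c R' * (abs (v s + h n * \<psi> s) powr p + 1)" by (rule lx_bound[OF sT[OF s] R' \<xi>(2)])
  also have "... <= c R' * (W s + 1)" by (rule mult_left_mono[OF _ c_nonneg]) (use Wv[OF hp] in simp)
  finally have 1: "abs (lx i s \<xi> (v s + h n * \<psi> s) * \<phi> s) <= c R' * (W s + 1) * (x0 / 2)"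
   unfolding abs_mult by (rule mult_mono[OF _ \<phi>(3)[OF s]]) (simp_all add: W_def c_nonneg)
  have "abs (\<eta> - v s) <= B" using \<xi>(1) hp[of n s] by linarith
  then have "abs (v s + (\<eta> - v s)) powr p <= W s" by (rule Wv)
  then have "abs \<eta> powr p <= W s" by simp
  then have \<eta>: "abs \<eta> powr (p - 1) + 1 <= W s + 2" using abs_powr_le[of \<eta>] by linarith
  have "abs (la i s (r s) \<eta>) <= c R' * (abs \<eta> powr (p - 1) + 1)" by (rule la_bound[OF sT[OF s] R' rR[OF s]])
  also have "... <= c R' * (W s + 2)" by (rule mult_left_mono[OF \<eta> c_nonneg])
  finally have 2: "abs (la i s (r s) \<eta> * \<psi> s) <= c R' * (W s + 2) * B"
   unfolding abs_mult by (rule mult_mono[OF _ \<phi>(2)]) (simp_all add: W_def c_nonneg)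
  show ?thesis unfolding \<xi>(3) dom_def real_norm_def using 1 2 by linarith
 qed
 have Qlim: "(%n. Q n s) \<longlonglongrightarrow> lx i s (r s) (v s) * \<phi> s + la i s (r s) (v s) * \<psi> s" if s: "s : {a..b}" for s
 proof -
  have "EX \<xi> . ALL n. EX \<eta>. abs (\<xi> n - r s) <= abs (h n * \<phi> s) & abs (\<eta> - v s) <= abs (h n * \<psi> s) & \<xi> n : {0..R'} &
   Q n s = lx i s (\<xi> n) (v s + h n * \<psi> s) * \<phi> s + la i s (r s) \<eta> * \<psi> s"
   by (rule choice, rule allI, rule ex[OF s])
  then obtain \<xi> where "ALL n. EX \<eta>. abs (\<xi> n - r s) <= abs (h n * \<phi> s) & abs (\<eta> - v s) <= abs (h n * \<psi> s) & \<xi> n : {0..R'} &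
   Q n s = lx i s (\<xi> n) (v s + h n * \<psi> s) * \<phi> s + la i s (r s) \<eta> * \<psi> s" ..
  from choice[OF this] obtain \<eta> where \<xi>: "!!n. abs (\<xi> n - r s) <= abs (h n * \<phi> s)" "!!n. abs (\<eta> n - v s) <= abs (h n * \<psi> s)"
   "!!n. \<xi> n : {0..R'}" "!!n. Q n s = lx i s (\<xi> n) (v s + h n * \<psi> s) * \<phi> s + la i s (r s) (\<eta> n) * \<psi> s" by blast
  have h0: "(%n. abs (h n * y)) \<longlonglongrightarrow> 0" for y
   using tendsto_rabs[OF tendsto_mult_right[OF hlim, of y]] by simp
  have "(%n. \<xi> n - r s) \<longlonglongrightarrow> 0"
   by (rule Lim_null_comparison[OF always_eventually[OF allI] h0[of "\<phi> s"]]) (use \<xi>(1) in simp)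
  then have \<xi>l: "\<xi> \<longlonglongrightarrow> r s" by (simp add: LIM_zero_iff)
  have "(%n. \<eta> n - v s) \<longlonglongrightarrow> 0"
   by (rule Lim_null_comparison[OF always_eventually[OF allI] h0[of "\<psi> s"]]) (use \<xi>(2) in simp)
  then have \<eta>l: "\<eta> \<longlonglongrightarrow> v s" by (simp add: LIM_zero_iff)
  have vl: "(%n. v s + h n * \<psi> s) \<longlonglongrightarrow> v s"
   using tendsto_add[OF tendsto_const[of "v s"] tendsto_mult_right[OF hlim, of "\<psi> s"]] by simp
  have \<xi>0: "\<xi> n >= 0" for n using \<xi>(3)[of n] by simp
  have r0: "r s >= 0" using rR[OF s] by simp
  show ?thesis unfolding \<xi>(4)
   by (intro tendsto_add tendsto_mult_right cont_seq2[OF lx_cont sT[OF s] \<xi>0 \<xi>l vl]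
    cont_seq2[OF la_cont sT[OF s] r0 tendsto_const \<eta>l])
 qed
 have "(%n. integral {a..b} (Q n)) \<longlonglongrightarrow> integral {a..b} (%s. lx i s (r s) (v s) * \<phi> s + la i s (r s) (v s) * \<psi> s)"
  by (rule dominated_convergence(2)[OF Qi domi Qb Qlim])
 then show ?thesis by (rule LIMSEQ_le_const) (use Q0 in blast)
qed

text \<open>The test functions are the integrals of indicators of intervals corrected to mean zero, which
 gives the Euler--Lagrange equation in the integrated form of du Bois-Reymond.\<close>

lemma euler_lagrange:
 assumes ab: "0 <= a" "a < b" "b <= T" and r: "primitive_on a b r v" and x0: "x0 > 0"
  and rb: "!!s. s : {a..b} ==> x0 <= r s & r s <= R"
  and vp: "(%s. abs (v s) powr p) integrable_on {a..b}"
  and min: "!!\<phi> \<psi> B. primitive_on a b \<phi> \<psi> ==> \<phi> a = 0 ==> \<phi> b = 0 ==> (!!s. abs (\<psi> s) <= B) ==>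
   (!!s. s : {a..b} ==> abs (\<phi> s) <= x0 / 2) ==>
   integral {a..b} (%s. l i s (r s) (v s)) <= integral {a..b} (%s. l i s (r s + \<phi> s) (v s + \<psi> s))"
 shows "EX k. AE s in lebesgue. s : {a..b} --> la i s (r s) (v s) = k + integral {a..s} (%\<sigma>. lx i \<sigma> (r \<sigma>) (v \<sigma>))"
proof -
 have ab': "a <= b" using ab by simp
 have R: "R > 0" using rb[of a] x0 ab by auto
 have rR: "r s : {0..R}" if "s : {a..b}" for s using rb[OF that] x0 by simp
 note vm = primitive_on_measurable(1)[OF r] and rm = primitive_on_measurable(2)[OF r]
 note arc = arc_integrable[OF ab(1,3) rm rR R vm vp]
 define LX where "LX s = lx i s (r s) (v s)" for s
 define LA where "LA s = la i s (r s) (v s)" for s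
 have LXa: "LX absolutely_integrable_on {a..b}" unfolding LX_def by (rule arc(2))
 have LAa: "LA absolutely_integrable_on {a..b}" unfolding LA_def by (rule arc(3))
 have zero: "integral {a..b} (%s. LX s * \<phi> s + LA s * \<psi> s) = 0"
  if \<phi>: "primitive_on a b \<phi> \<psi>" "\<phi> a = 0" "\<phi> b = 0" "!!s. abs (\<psi> s) <= B" "!!s. s : {a..b} ==> abs (\<phi> s) <= x0 / 2" for \<phi> \<psi> B
 proof -
  have sc: "integral {a..b} (%s. l i s (r s) (v s)) <= integral {a..b} (%s. l i s (r s + h * \<phi> s) (v s + h * \<psi> s))"
   if h: "abs h <= 1" for h
  proof (rule min)
   show "primitive_on a b (%s. h * \<phi> s) (%s. h * \<psi> s)" by (rule primitive_on_linear[OF \<phi>(1) bounded_linear_mult_right])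
   show "h * \<phi> a = 0" "h * \<phi> b = 0" using \<phi>(2,3) by simp_all
   show "abs (h * \<psi> s) <= B" for s
    using mult_mono[OF h \<phi>(4)[of s]] by (simp add: abs_mult)
   show "abs (h * \<phi> s) <= x0 / 2" if "s : {a..b}" for s
    using mult_mono[OF h \<phi>(5)[OF that]] by (simp add: abs_mult)
  qed
  have 1: "0 <= integral {a..b} (%s. lx i s (r s) (v s) * \<phi> s + la i s (r s) (v s) * \<psi> s)"
   by (rule first_variation_nonneg[OF ab(1,3) r x0 rb vp \<phi>(1,4,5)]) (use sc in simp_all)
  have 2: "0 <= integral {a..b} (%s. lx i s (r s) (v s) * (- \<phi> s) + la i s (r s) (v s) * (- \<psi> s))"
  proof (rule first_variation_nonneg[OF ab(1,3) r x0 rb vp primitive_on_uminus[OF \<phi>(1)]])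
   show "abs (- \<psi> s) <= B" for s using \<phi>(4)[of s] by simp
   show "abs (- \<phi> s) <= x0 / 2" if "s : {a..b}" for s using \<phi>(5)[OF that] by simp
   show "integral {a..b} (%s. l i s (r s) (v s)) <= integral {a..b} (%s. l i s (r s + h * - \<phi> s) (v s + h * - \<psi> s))"
    if "0 < h" "h <= 1" for h using sc[of "- h"] that by simp
  qed
  have "integral {a..b} (%s. lx i s (r s) (v s) * (- \<phi> s) + la i s (r s) (v s) * (- \<psi> s))
    = integral {a..b} (%s. - (LX s * \<phi> s + LA s * \<psi> s))"
   by (simp add: LX_def LA_def)
  also have "... = - integral {a..b} (%s. LX s * \<phi> s + LA s * \<psi> s)"
   by (rule hk_integral_neg)
  finally have "0 <= - integral {a..b} (%s. LX s * \<phi> s + LA s * \<psi> s)" using 2 by simp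
  then show ?thesis using 1 unfolding LX_def LA_def by linarith
 qed
 define \<Lambda> where "\<Lambda> s = integral {a..s} LX" for s
 have \<Lambda>p: "primitive_on a b \<Lambda> LX" by (rule primitive_onI[OF LXa]) (simp add: \<Lambda>_def)
 \<comment> \<open>The aim is that w equals its mean m almost everywhere.\<close>
 define w where "w s = LA s - \<Lambda> s" for s
 have \<Lambda>a: "\<Lambda> absolutely_integrable_on {a..b}" by (rule absolutely_integrable_continuous_real[OF primitive_on_continuous[OF \<Lambda>p]])
 have wa: "w absolutely_integrable_on {a..b}" unfolding w_def by (rule set_integral_diff[OF LAa \<Lambda>a])
 define m where "m = integral {a..b} w / (b - a)"
 have key: "integral {p'..q'} (%s. w s - m) = 0" if pq: "a <= p'" "p' <= q'" "q' <= b" for p' q'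
 proof -
  define \<theta> where "\<theta> = (q' - p') / (b - a)"
  have \<theta>: "0 <= \<theta>" "\<theta> <= 1" using pq ab by (simp_all add: \<theta>_def divide_simps)
  define \<psi> where "\<psi> s = (if s : {p'..q'} then 1 else 0) - \<theta>" for s
  have \<psi>1: "abs (\<psi> s) <= 1" for s using \<theta> by (simp add: \<psi>_def)
  have ind: "(%s. if s : {p'..q'} then 1 else (0::real)) : borel_measurable (lebesgue_on {a..b})"
   by (rule measurable_restrict_space1, rule measurable_completion) measurable
  have \<psi>m: "\<psi> : borel_measurable (lebesgue_on {a..b})" unfolding \<psi>_def
   by (intro borel_measurable_diff ind borel_measurable_const)
  have \<psi>a: "\<psi> absolutely_integrable_on {a..b}"
   by (rule integrable_on_if_dominated(2)[OF \<psi>m integrable_const_ivl \<psi>1])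
  define \<phi> where "\<phi> s = integral {a..s} \<psi>" for s
  have \<phi>p: "primitive_on a b \<phi> \<psi>" by (rule primitive_onI[OF \<psi>a]) (simp add: \<phi>_def)
  have split: "integral {a..b} (%s. f s * \<psi> s) = integral {p'..q'} f - \<theta> * integral {a..b} f"
   if f: "f absolutely_integrable_on {a..b}" for f
  proof -
   have fi: "f integrable_on {a..b}" "f integrable_on {p'..q'}"
    using absolutely_integrable_on_sub(1)[OF f order_refl order_refl] absolutely_integrable_on_sub(1)[OF f pq(1,3)] .
   have sub: "{p'..q'} \<inter> {a..b} = {p'..q'}" using pq by auto
   have i1: "(%s. if s : {p'..q'} then f s else 0) integrable_on {a..b}"
    unfolding integrable_restrict_Int sub by (rule fi(2))
   have "(%s. f s * \<psi> s) = (%s. (if s : {p'..q'} then f s else 0) - \<theta> * f s)"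
    by (auto simp: \<psi>_def algebra_simps)
   then have "integral {a..b} (%s. f s * \<psi> s) = integral {a..b} (%s. if s : {p'..q'} then f s else 0) - integral {a..b} (%s. \<theta> * f s)"
    using hk_integral_diff[OF i1 integrable_mult_const[OF fi(1)]] by simp
   also have "integral {a..b} (%s. if s : {p'..q'} then f s else 0) = integral {p'..q'} f"
    unfolding hk_integral_restrict_Int sub ..
   finally show ?thesis by simp
  qed
  have "\<phi> b = integral {a..b} (%s. 1 * \<psi> s)" by (simp add: \<phi>_def)
  also have "... = integral {p'..q'} (%s. 1) - \<theta> * integral {a..b} (%s. 1)" by (rule split) simp
  also have "... = 0" using pq ab by (simp add: \<theta>_def)
  finally have \<phi>b: "\<phi> b = 0" .
  have \<phi>a: "\<phi> a = 0" by (simp add: \<phi>_def)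
  have \<phi>le: "abs (\<phi> s) <= b - a" if s: "s : {a..b}" for s
  proof -
   have "norm (\<phi> s - \<phi> a) <= integral {a..s} (%x. norm (\<psi> x))"
    using primitive_on_norm_diff_le[OF \<phi>p order_refl] s by simp
   also have "... <= integral {a..s} (%x. 1)"
    by (rule integral_le[OF primitive_on_integrable(3)[OF \<phi>p] integrable_const_ivl]) (use s \<psi>1 in simp_all)
   finally show ?thesis using s \<phi>a by simp
  qed
  \<comment> \<open>\<phi> is bounded by b - a; this scale makes the test function at most x0/2, as
    the minimality assumption allows.\<close>
  define \<kappa> where "\<kappa> = x0 / (2 * (b - a))"
  have \<kappa>: "\<kappa> > 0" using x0 ab by (simp add: \<kappa>_def)
  have "integral {a..b} (%s. LX s * (\<kappa> * \<phi> s) + LA s * (\<kappa> * \<psi> s)) = 0"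
  proof (rule zero)
   show "primitive_on a b (%s. \<kappa> * \<phi> s) (%s. \<kappa> * \<psi> s)" by (rule primitive_on_linear[OF \<phi>p bounded_linear_mult_right])
   show "\<kappa> * \<phi> a = 0" "\<kappa> * \<phi> b = 0" using \<phi>a \<phi>b by simp_all
   show "abs (\<kappa> * \<psi> s) <= \<kappa> * 1" for s unfolding abs_mult using \<kappa> \<psi>1[of s] by (intro mult_mono) simp_all
   show "abs (\<kappa> * \<phi> s) <= x0 / 2" if "s : {a..b}" for s
   proof -
    have "abs (\<kappa> * \<phi> s) <= \<kappa> * (b - a)" unfolding abs_mult using \<kappa> \<phi>le[OF that] by (intro mult_mono) simp_all
    moreover have "\<kappa> * (b - a) = x0 / 2"
    proof -
     have half: "d ~= 0 ==> x0 / (2 * d) * d = x0 / 2" for d by simp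
     show ?thesis unfolding \<kappa>_def by (rule half) (use ab in simp)
    qed
    ultimately show ?thesis by linarith
   qed
  qed
  moreover have "(%s. LX s * (\<kappa> * \<phi> s) + LA s * (\<kappa> * \<psi> s)) = (%s. \<kappa> * (LX s * \<phi> s + LA s * \<psi> s))"
   by (simp add: algebra_simps)
  ultimately have A: "integral {a..b} (%s. LX s * \<phi> s + LA s * \<psi> s) = 0" using \<kappa> by simp
  have bmul: "(%s. f s * \<psi> s) integrable_on {a..b}" if "f absolutely_integrable_on {a..b}" for f
  proof -
   have "(%s. \<psi> s * f s) absolutely_integrable_on {a..b}"
    using \<psi>1 by (intro absolutely_integrable_bounded_measurable_product_real \<psi>m that) (auto simp: bounded_iff)
   then show ?thesis by (simp add: absolutely_integrable_on_def mult.commute)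
  qed
  have LX\<phi>: "(%s. LX s * \<phi> s) integrable_on {a..b}"
   using absolutely_integrable_scaleR_continuous[OF LXa primitive_on_continuous[OF \<phi>p]]
   by (simp add: absolutely_integrable_on_def mult.commute)
  have "0 = integral {a..b} (%s. \<Lambda> s * \<psi> s + LX s * \<phi> s)"
   using primitive_on_diff[OF primitive_on_scaleR[OF \<Lambda>p \<phi>p] order_refl ab' order_refl] \<phi>a \<phi>b by simp
  also have "... = integral {a..b} (%s. \<Lambda> s * \<psi> s) + integral {a..b} (%s. LX s * \<phi> s)"
   by (rule hk_integral_add[OF bmul[OF \<Lambda>a] LX\<phi>])
  finally have B: "integral {a..b} (%s. LX s * \<phi> s) = - integral {a..b} (%s. \<Lambda> s * \<psi> s)" by simp
  have "integral {a..b} (%s. LX s * \<phi> s) + integral {a..b} (%s. LA s * \<psi> s) = 0"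
   using hk_integral_add[OF LX\<phi> bmul[OF LAa]] A by simp
  then have "integral {a..b} (%s. LA s * \<psi> s) - integral {a..b} (%s. \<Lambda> s * \<psi> s) = 0" using B by simp
  moreover have "integral {a..b} (%s. w s * \<psi> s) = integral {a..b} (%s. LA s * \<psi> s) - integral {a..b} (%s. \<Lambda> s * \<psi> s)"
   unfolding w_def left_diff_distrib by (rule hk_integral_diff[OF bmul[OF LAa] bmul[OF \<Lambda>a]])
  ultimately have "integral {p'..q'} w = \<theta> * integral {a..b} w" using split[OF wa] by simp
  also have "... = m * (q' - p')" by (simp add: \<theta>_def m_def)
  finally have "integral {p'..q'} w = m * (q' - p')" .
  moreover have "integral {p'..q'} (%s. w s - m) = integral {p'..q'} w - integral {p'..q'} (%s. m)"
   by (rule hk_integral_diff[OF absolutely_integrable_on_sub(1)[OF wa pq(1,3)] integrable_const_ivl])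
  ultimately show ?thesis using pq by simp
 qed
 have wm: "(%s. w s - m) absolutely_integrable_on {a..b}" by (intro set_integral_diff(1) wa absolutely_integrable_on_const) simp
 have "AE s in lebesgue. s : {a..b} --> w s - m = 0"
  by (rule AE_lebesgue_on_zero_if_integrals_zero[OF wm key])
 then have "AE s in lebesgue. s : {a..b} --> la i s (r s) (v s) = m + integral {a..s} (%\<sigma>. lx i \<sigma> (r \<sigma>) (v \<sigma>))"
  by eventually_elim (auto simp: w_def LA_def \<Lambda>_def LX_def[abs_def])
 then show ?thesis by blast
qed

text \<open>The tangent at a, evaluated at velocity 0, bounds \<open>la i t x a * a\<close> below by
  \<open>l i t x a - l i t x 0\<close>, which has growth of order p; the argument for - a is the
  same.\<close>

lemma la_coercive:
 assumes R: "R > 0" and P: "P >= 0"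
 obtains K where "K >= 1" "!!i t x a. t : {0..T} ==> x : {0..R} ==> K <= a ==> P < la i t x a & la i t x (- a) < - P"
proof -
 obtain D where D: "D > 0" "!!i t x a. t : {0..T} ==> x : {0..R} ==> abs (l i t x a) <= D * (abs a powr p + 1)"
  by (rule l_upper[OF R]) (rule that)
 \<comment> \<open>For a at least K0 the term \<open>C0 * a powr (p - 1)\<close> is at least P + C0
   + D + 1, while C0 + D is what the estimate loses.\<close>
 define Q where "Q = (P + C0 + D + 1) / C0"
 have Q: "Q > 0" using P C0 D(1) by (simp add: Q_def)
 define K0 where "K0 = Q powr (1 / (p - 1))"
 define K where "K = max 1 K0"
 show ?thesis
 proof (rule that[of K])
  show "K >= 1" by (simp add: K_def)
  fix i t x a assume t: "t : {0..T}" and x: "x : {0..R}" and a: "K <= a"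
  have a1: "a >= 1" and aK: "a >= K0" using a by (simp_all add: K_def)
  have x0: "x >= 0" using x by simp
  have "K0 powr (p - 1) = Q" unfolding K0_def powr_powr using p Q by simp
  moreover have "K0 powr (p - 1) <= a powr (p - 1)" using aK p by (intro powr_mono2) (simp_all add: K0_def)
  ultimately have "(P + C0 + D + 1) / C0 <= a powr (p - 1)" by (simp add: Q_def)
  then have ap: "P + C0 + D + 1 <= C0 * a powr (p - 1)" using C0 by (simp add: field_simps)
  have app: "a powr p = a powr (p - 1) * a" using abs_powr_mult[of a] a1 by simp
  have l0': "l i t x 0 <= D" using D(2)[OF t x, of i 0] by simp
  have CDa: "(C0 + D) * 1 <= (C0 + D) * a" using a1 C0 D(1) by (intro mult_left_mono) simp_all
  have "(C0 * a powr (p - 1) - C0 - D) * a <= C0 * (a powr p - 1) - D"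
   using CDa unfolding app by (simp add: algebra_simps)
  also have "... <= l i t x a - l i t x 0" using l_lower[OF t x0, of a i] l0' a1 by simp
  also have "... <= la i t x a * a" using convex_tangent[OF t x0, of i a 0] by simp
  finally have 1: "C0 * a powr (p - 1) - C0 - D <= la i t x a" using a1 by simp
  have "(C0 * a powr (p - 1) - C0 - D) * a <= C0 * (a powr p - 1) - D"
   using CDa unfolding app by (simp add: algebra_simps)
  also have "... <= l i t x (- a) - l i t x 0" using l_lower[OF t x0, of "- a" i] l0' a1 by simp
  also have "... <= (- la i t x (- a)) * a" using convex_tangent[OF t x0, of i "- a" 0] by simp
  finally have 2: "C0 * a powr (p - 1) - C0 - D <= - la i t x (- a)" by (rule mult_right_le_imp_le) (use a1 in simp)
  show "P < la i t x a & la i t x (- a) < - P" using 1 2 ap by linarith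
 qed
qed

text \<open>Coercivity bounds the solutions of \<open>la i t x a = \<pi>\<close>, and with the
  intermediate value theorem it yields one. Existence is what defines the velocity of an optimal arc
  at every time and the maximiser in the Hamiltonian.\<close>

lemma la_bounded_inverse:
 assumes R: "R > 0" and P: "P >= 0"
 obtains K where "K >= 1" "!!i t x a. t : {0..T} ==> x : {0..R} ==> abs (la i t x a) <= P ==> abs a <= K"
  "!!i t x \<pi>. t : {0..T} ==> x : {0..R} ==> abs \<pi> <= P ==> EX a. la i t x a = \<pi>"
proof -
 obtain K where K: "K >= 1" "!!i t x a. t : {0..T} ==> x : {0..R} ==> K <= a ==> P < la i t x a & la i t x (- a) < - P"
  by (rule la_coercive[OF assms]) (rule that)
 show ?thesis
 proof (rule that[OF K(1)])
  fix i t x a assume t: "t : {0..T}" "x : {0..R}" and la: "abs (la i t x a) <= P"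
  show "abs a <= K"
  proof (rule ccontr)
   assume "~ abs a <= K"
   then consider "K <= a" | "K <= - a" by linarith
   then show False
   proof cases
    case 1 then show False using K(2)[OF t 1, of i] la by linarith
   next
    case 2
    have "la i t x (- (- a)) < - P" using K(2)[OF t 2, of i] by blast
    then show False using la by simp
   qed
  qed
 next
  fix i t x \<pi> assume t: "t : {0..T}" "x : {0..R}" and \<pi>: "abs \<pi> <= P"
  have c: "continuous_on {- K..K} (la i t x)"
  proof -
   have "continuous_on {- K..K} (%a. (%(t, x, a). la i t x a) (t, x, a))"
    by (rule continuous_on_compose2[OF la_cont]) (use t in \<open>auto intro!: continuous_intros\<close>)
   then show ?thesis by simp
  qed
  have "EX a>=- K. a <= K & la i t x a = \<pi>"
   by (rule IVT'[OF _ _ _ c]) (use K(2)[OF t order_refl, of i] \<pi> K(1) in linarith)+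
  then show "EX a. la i t x a = \<pi>" by blast
 qed
qed

text \<open>Uniform continuity of the inverse of la in the velocity. By strict monotonicity la gains
  a positive amount over a step e, by compactness a uniform one, and a small change of time and
  position cannot undo it.\<close>

lemma la_modulus:
 assumes e: "e > 0" and R: "R > 0" and K: "K >= 0"
 obtains d where "d > 0" "!!t x a t' x' a'. t : {0..T} ==> x : {0..R} ==> abs a <= K ==>
  t' : {0..T} ==> x' : {0..R} ==> abs a' <= K ==> abs (t' - t) < d ==> abs (x' - x) < d ==> abs (la i t' x' a' - la i t x a) < d ==>
  abs (a' - a) < e"
proof -
 define S where "S = {0..T} \<times> {0..R} \<times> {- K..K}"
 define gap where "gap z = (case z of (t, x, a) => la i t x (a + e) - la i t x a)" for z :: "real \<times> real \<times> real"
 have "compact S" unfolding S_def by (intro compact_Times compact_Icc)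
 moreover have "S ~= {}" using T R K by (auto simp: S_def)
 moreover have "continuous_on S gap"
 proof -
  have "continuous_on S (%z. (%(t, x, a). la i t x a) (fst z, fst (snd z), snd (snd z) + e))"
   by (rule continuous_on_compose2[OF la_cont]) (auto intro!: continuous_intros simp: S_def)
  moreover have "continuous_on S (%(t, x, a). la i t x a)"
   by (rule continuous_on_subset[OF la_cont]) (auto simp: S_def)
  ultimately have "continuous_on S (%z. (%(t, x, a). la i t x a) (fst z, fst (snd z), snd (snd z) + e) - (%(t, x, a). la i t x a) z)"
   by (rule continuous_on_diff)
  then show ?thesis by (simp add: gap_def case_prod_beta)
 qed
 ultimately obtain z0 where z0: "z0 : S" "!!z. z : S ==> gap z0 <= gap z"
  using continuous_attains_inf[of S gap] by auto
 define \<mu> where "\<mu> = gap z0"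
 have \<mu>: "\<mu> > 0"
 proof -
  obtain t x a where z: "z0 = (t, x, a)" by (cases z0)
  have "la i t x a < la i t x (a + e)" by (rule la_strict_mono) (use z0(1) z e in \<open>auto simp: S_def\<close>)
  then show ?thesis by (simp add: \<mu>_def gap_def z)
 qed
 have gap: "la i t x a + \<mu> <= la i t x (a + e)" if "t : {0..T}" "x : {0..R}" "abs a <= K" for t x a
 proof -
  have "(t, x, a) : S" using that by (auto simp: S_def)
  from z0(2)[OF this] show ?thesis by (simp add: \<mu>_def gap_def)
 qed
 have \<mu>3: "\<mu> / 3 > 0" using \<mu> by simp
 \<comment> \<open>The velocity range is enlarged to K + e because la is also compared at a +
   e.\<close>
 obtain d where d: "d > 0" "!!t x a t' x' a'. t : {0..T} ==> x : {0..R} ==> abs a <= K + e ==>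
  t' : {0..T} ==> x' : {0..R} ==> abs a' <= K + e ==> abs (t' - t) < d ==> abs (x' - x) < d ==> abs (a' - a) < d ==>
  abs (la i t' x' a' - la i t x a) < \<mu> / 3"
  by (rule compact_uniform[OF la_cont \<mu>3]) (rule that)
 have half: "a' < a + e" if *: "t : {0..T}" "x : {0..R}" "abs a <= K" "t' : {0..T}" "x' : {0..R}" "abs a' <= K"
  "abs (t' - t) < d" "abs (x' - x) < d" "abs (la i t' x' a' - la i t x a) < \<mu> / 3" for t x a t' x' a'
 proof (rule ccontr)
  assume "~ a' < a + e"
  then have ge: "a + e <= a'" by simp
  have x'0: "x' >= 0" using * by simp
  have "la i t' x' (a + e) <= la i t' x' a'"
   using la_strict_mono[OF *(4) x'0, of "a + e" a' i] ge by (cases "a + e = a'") simp_all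
  moreover have "abs (la i t' x' (a + e) - la i t x (a + e)) < \<mu> / 3"
   by (rule d(2)) (use * e d(1) in \<open>simp_all add: abs_le_iff\<close>)
  ultimately show False using gap[OF *(1-3)] *(9) \<mu> by linarith
 qed
 show ?thesis
 proof (rule that[of "min d (\<mu> / 3)"])
  show "min d (\<mu> / 3) > 0" using d(1) \<mu>3 by simp
  fix t x a t' x' a'
  assume *: "t : {0..T}" "x : {0..R}" "abs a <= K" "t' : {0..T}" "x' : {0..R}" "abs a' <= K"
   "abs (t' - t) < min d (\<mu> / 3)" "abs (x' - x) < min d (\<mu> / 3)" "abs (la i t' x' a' - la i t x a) < min d (\<mu> / 3)"
  have "a' < a + e" by (rule half[OF *(1-6)]) (use *(7-9) in simp_all)
  moreover have "a < a' + e" by (rule half[OF *(4-6) *(1-3)]) (use *(7-9) in \<open>simp_all add: abs_minus_commute\<close>)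
  ultimately show "abs (a' - a) < e" by linarith
 qed
qed

text \<open>An arc on edge i away from the vertex with continuous velocity v that satisfies the
  Euler-Lagrange equation in integrated form. The bounds are part of the notion because every
  modulus below depends on them alone.\<close>

definition el_arc :: "'n => real => real => real => real => real => (real => real) => (real => real) => bool" where
 "el_arc i a b x0 R K r v \<longleftrightarrow> primitive_on a b r v & continuous_on {a..b} v &
  (ALL s:{a..b}. x0 <= r s & r s <= R & abs (v s) <= K) &
  primitive_on a b (%s. la i s (r s) (v s)) (%s. lx i s (r s) (v s))"

lemma lipschitz_bound:
 fixes f g :: "real => real"
 assumes f: "primitive_on a b f g" and g: "!!s. s : {a..b} ==> abs (g s) <= C" and s: "s : {a..b}" "s' : {a..b}"
 shows "abs (f s' - f s) <= C * abs (s' - s)"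
proof -
 have *: "abs (f s' - f s) <= C * (s' - s)" if "s : {a..b}" "s' : {a..b}" "s <= s'" for s s'
 proof -
  have as: "a <= s" "s' <= b" using that by simp_all
  have "norm (f s' - f s) <= integral {s..s'} (%x. norm (g x))" by (rule primitive_on_norm_diff_le[OF f as(1) that(3) as(2)])
  also have "... <= integral {s..s'} (%x. C)"
   by (rule integral_le[OF primitive_on_integrable(3)[OF f as] integrable_const_ivl]) (use g as in simp)
  finally show ?thesis using that by (simp add: mult.commute)
 qed
 show ?thesis using *[OF s] *[OF s(2,1)] by (cases "s <= s'") (simp_all add: abs_minus_commute)
qed

text \<open>Along an Euler-Lagrange arc position and \<open>la\<close> are Lipschitz in time with
  these constants; hence its velocity has a modulus of continuity that is common to all arcs with
  the same bounds.\<close>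

lemma la_lipschitz_modulus:
 assumes e: "e > 0" and R: "R > 0" and K: "K >= 0"
 obtains d where "d > 0" "!!t x a t' x' a'. t : {0..T} ==> x : {0..R} ==> abs a <= K ==>
  t' : {0..T} ==> x' : {0..R} ==> abs a' <= K ==> abs (t' - t) < d ==> abs (x' - x) <= K * abs (t' - t) ==>
  abs (la i t' x' a' - la i t x a) <= c R * (K powr p + 1) * abs (t' - t) ==> abs (a' - a) < e"
proof -
 obtain d where d: "d > 0" "!!t x a t' x' a'. t : {0..T} ==> x : {0..R} ==> abs a <= K ==>
  t' : {0..T} ==> x' : {0..R} ==> abs a' <= K ==> abs (t' - t) < d ==> abs (x' - x) < d ==> abs (la i t' x' a' - la i t x a) < d ==>
  abs (a' - a) < e"
  by (rule la_modulus[OF assms]) (rule that)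
 define C where "C = 1 + K + c R * (K powr p + 1)"
 have cK: "c R * (K powr p + 1) >= 0" using c_nonneg[of R] by simp
 have C: "C > 0" using K cK by (simp add: C_def)
 show ?thesis
 proof (rule that[of "d / C"])
  show "d / C > 0" using d(1) C by simp
  fix t x a t' x' a'
  assume *: "t : {0..T}" "x : {0..R}" "abs a <= K" "t' : {0..T}" "x' : {0..R}" "abs a' <= K"
   and t: "abs (t' - t) < d / C" and x: "abs (x' - x) <= K * abs (t' - t)"
   and l: "abs (la i t' x' a' - la i t x a) <= c R * (K powr p + 1) * abs (t' - t)"
  have Ct: "C * abs (t' - t) < d" using t C by (simp add: field_simps)
  have "1 * abs (t' - t) <= C * abs (t' - t)" "K * abs (t' - t) <= C * abs (t' - t)"
   "c R * (K powr p + 1) * abs (t' - t) <= C * abs (t' - t)"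
   using K cK by (intro mult_right_mono; simp add: C_def)+
  then show "abs (a' - a) < e" by (intro d(2)[OF *]) (use Ct x l in linarith)+
 qed
qed

text \<open>The energy bound keeps the curve near its starting point for a time \<delta>. There the
  Euler-Lagrange equation holds; averaging bounds its constant, and coercivity of la turns this into
  a bound on the velocity. The quantities \<delta> and K do not depend on the trajectory.\<close>

lemma optimal_regular:
 assumes x0: "x0 > 0" and R: "R >= x0" and \<tau>0: "\<tau>0 > 0"
 obtains \<delta> K where "\<delta> > 0" "\<delta> <= \<tau>0" "K >= 1"
  "!!t y g. opt t y g ==> 0 <= t ==> t + \<tau>0 <= T ==> x0 <= y t $ i ==> y t $ i <= R ==>
   EX v. el_arc i t (t + \<delta>) (x0 / 2) (R + x0) K (%s. y s $ i) v"
proof -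
 have R0: "R > 0" "R + x0 > 0" using x0 R by simp_all
 obtain D where D: "D > 0" "!!i t x a. t : {0..T} ==> x : {0..R} ==> abs (l i t x a) <= D * (abs a powr p + 1)"
  by (rule l_upper[OF R0(1)]) (rule that)
 \<comment> \<open>An optimal curve costs no more than resting at its starting point, that is at
   most \<open>D * T + Bf\<close>; \<open>energy_bound\<close> turns this into M.\<close>
 define M where "M = abs ((D * T + 2 * Bf + C0 * T) / C0)"
 have M0: "M >= 0" by (simp add: M_def)
 \<comment> \<open>The displacement in time \<delta> is at most K1 * \<delta> + c' * M, hence x0/2:
   half of the distance to the vertex is kept.\<close>
 obtain c' where c': "c' > 0" "c' * M <= x0 / 4"
 proof (rule that)
  show "x0 / (4 * (M + 1)) > 0" using x0 M0 by simp
  have "x0 / (4 * (M + 1)) * M = x0 / 4 * (M / (M + 1))" by simp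
  also have "... <= x0 / 4 * 1" using x0 M0 by (intro mult_left_mono) simp_all
  finally show "x0 / (4 * (M + 1)) * M <= x0 / 4" by simp
 qed
 define K1 where "K1 = c' powr (1 / (1 - p))"
 have K1: "K1 > 0" "K1 powr (1 - p) = c'" using c' p by (simp_all add: K1_def powr_powr)
 define \<delta> where "\<delta> = min \<tau>0 (x0 / (4 * K1))"
 have \<delta>: "\<delta> > 0" "\<delta> <= \<tau>0" "K1 * \<delta> <= x0 / 4"
 proof -
  show "\<delta> > 0" "\<delta> <= \<tau>0" using \<tau>0 x0 K1 by (simp_all add: \<delta>_def)
  have "K1 * \<delta> <= K1 * (x0 / (4 * K1))" using K1 by (intro mult_left_mono) (simp_all add: \<delta>_def)
  then show "K1 * \<delta> <= x0 / 4" using K1 by simp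
 qed
 \<comment> \<open>Bounds the integrals of both abs lx and abs la along the arc.\<close>
 define M3 where "M3 = c (R + x0) * (M + 2 * \<delta>)"
 have M3: "M3 >= 0" unfolding M3_def using c_nonneg M0 \<delta>(1) by simp
 \<comment> \<open>Averaging over an interval of length \<delta> bounds the constant of the
   Euler-Lagrange equation by \<open>M3 / \<delta> + M3\<close>; the last M3 bounds the integral of
   lx.\<close>
 define P where "P = (M3 / \<delta> + M3) + M3"
 have P: "P >= 0" using M3 \<delta>(1) by (simp add: P_def)
 obtain K where K: "K >= 1" "!!i t x a. t : {0..T} ==> x : {0..R + x0} ==> abs (la i t x a) <= P ==> abs a <= K"
  "!!i t x \<pi>. t : {0..T} ==> x : {0..R + x0} ==> abs \<pi> <= P ==> EX a. la i t x a = \<pi>"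
  by (rule la_bounded_inverse[OF R0(2) P]) (rule that)
 show ?thesis
 proof (rule that[OF \<delta>(1,2) K(1)])
  fix t y g assume y: "opt t y g" and t: "0 <= t" "t + \<tau>0 <= T" and yt: "x0 <= y t $ i" "y t $ i <= R"
  note yp = opt_traj(2)[OF y]
  have tT: "t <= T" "t + \<delta> <= T" "t <= t + \<delta>" "t < t + \<delta>" using t \<tau>0 \<delta> by simp_all
  have ytj: "y t : junction" by (rule ptrajD(2)[OF yp]) (use tT in simp)
  have yti: "y t $ i > 0" using x0 yt by simp
  have energy: "integral {t..T} (%s. norm (g s) powr p) <= M"
  proof -
   have pc: "primitive_on t T (%s. y t $ i) (%s. 0)" by (rule primitive_on_const)
   have i0: "(%s. abs (0 :: real) powr p) integrable_on {t..T}" by (rule integrable_const_ivl)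
   note ec = edge_ptraj[OF pc yti i0, of i]
   have "traj t (%s. (y t $ i) *\<^sub>R axis i 1) (%s. 0 *\<^sub>R axis i 1)" unfolding traj_iff_ptraj by (rule ec(1))
   then have "cost t y g <= cost t (%s. (y t $ i) *\<^sub>R axis i 1) (%s. 0 *\<^sub>R axis i 1)"
    using y junction_eq_axis[OF ytj yti] unfolding opt_def by simp
   also have "... <= D * T + Bf"
   proof -
    have "integral {t..T} (%s. l i s (y t $ i) 0) <= integral {t..T} (%s. D)"
    proof (rule integral_le[OF _ integrable_const_ivl])
     show "(%s. l i s (y t $ i) 0) integrable_on {t..T}"
      by (rule arc_integrable(1)[OF t(1) order_refl _ _ R0(1) _ i0]) (use yt yti in simp_all)
     show "l i s (y t $ i) 0 <= D" if "s : {t..T}" for s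
      using D(2)[of s "y t $ i" i 0] that t yt yti by simp
    qed
    also have "... <= D * T" using D(1) t tT by simp
    finally have "run t T (%s. (y t $ i) *\<^sub>R axis i 1) (%s. 0 *\<^sub>R axis i 1) <= D * T" unfolding ec(2) .
    moreover have "fin ((y t $ i) *\<^sub>R axis i 1) <= Bf" by (rule fin_upper[OF axis_in_junction]) (use yti in simp)
    ultimately show ?thesis unfolding cost_def by linarith
   qed
   finally have "(cost t y g + Bf + C0 * T) / C0 <= (D * T + 2 * Bf + C0 * T) / C0"
    using C0 by (intro divide_right_mono) simp_all
   then show ?thesis using energy_bound[OF opt_traj(1)[OF y] t(1) tT(1)] unfolding M_def by linarith
  qed
  have near: "abs (y s $ i - y t $ i) <= x0 / 2" if s: "s : {t..t + \<delta>}" for s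
  proof -
   have st: "t <= s" "s <= T" using s tT by simp_all
   note ys = ptraj_sub[OF yp order_refl st(2)]
   have "norm (y s - y t) <= integral {t..s} (%x. norm (g x))"
    by (rule primitive_on_norm_diff_le[OF ptrajD(1)[OF ys] order_refl st(1) order_refl])
   also have "... <= K1 * (s - t) + K1 powr (1 - p) * integral {t..s} (%x. norm (g x) powr p)"
    by (rule integral_norm_le_powr[OF primitive_on_abs[OF ptrajD(1)[OF ys]] ptrajD(3)[OF ys] p K1(1) st(1)])
   also have "... <= x0 / 4 + x0 / 4"
   proof (rule add_mono)
    have "K1 * (s - t) <= K1 * \<delta>" using s K1 by (intro mult_left_mono) simp_all
    then show "K1 * (s - t) <= x0 / 4" using \<delta>(3) by linarith
    have "integral {t..s} (%x. norm (g x) powr p) <= integral {t..T} (%x. norm (g x) powr p)"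
     by (rule integral_subset_le[OF _ ptrajD(3)[OF ys] ptrajD(3)[OF yp]]) (use st in simp_all)
    then have "K1 powr (1 - p) * integral {t..s} (%x. norm (g x) powr p) <= c' * M"
     unfolding K1(2) using energy c' by (intro mult_left_mono) linarith+
    then show "K1 powr (1 - p) * integral {t..s} (%x. norm (g x) powr p) <= x0 / 4" using c'(2) by linarith
   qed
   finally show ?thesis using nth_le_norm[of "y s - y t" i] by simp
  qed
  define r where "r s = y s $ i" for s
  define w where "w s = g s $ i" for s
  have rb: "x0 / 2 <= r s & r s <= R + x0" if "s : {t..t + \<delta>}" for s
   using near[OF that] yt x0 unfolding r_def by linarith
  have rpos: "y s $ i > 0" if "s : {t..t + \<delta>}" for s using rb[OF that] x0 unfolding r_def by linarith
  have rR: "r s : {0..R + x0}" if "s : {t..t + \<delta>}" for s using rb[OF that] x0 by simp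
  note yd = ptraj_sub[OF yp order_refl tT(2)]
  have rp: "primitive_on t (t + \<delta>) r w" unfolding r_def w_def by (rule primitive_on_nth[OF ptrajD(1)[OF yd]])
  note edge = ptraj_edge[OF yd rpos]
  have wp: "(%s. abs (w s) powr p) integrable_on {t..t + \<delta>}" unfolding w_def by (rule edge(1))
  note wm = primitive_on_measurable(1)[OF rp] and rm = primitive_on_measurable(2)[OF rp]
  have wM: "integral {t..t + \<delta>} (%s. abs (w s) powr p) <= M"
  proof -
   have "integral {t..t + \<delta>} (%s. abs (w s) powr p) <= integral {t..t + \<delta>} (%s. norm (g s) powr p)"
    unfolding w_def by (rule powr_sub_integrable(2)[OF wm[unfolded w_def] ptrajD(3)[OF yd] p nth_le_norm])
   also have "... <= integral {t..T} (%x. norm (g x) powr p)"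
    by (rule integral_subset_le[OF _ ptrajD(3)[OF yd] ptrajD(3)[OF yp]]) (use tT in simp_all)
   finally show ?thesis using energy by linarith
  qed
  have "EX k. AE s in lebesgue. s : {t..t + \<delta>} --> la i s (r s) (w s) = k + integral {t..s} (%\<sigma>. lx i \<sigma> (r \<sigma>) (w \<sigma>))"
  proof (rule euler_lagrange[OF t(1) tT(4,2) rp _ rb wp])
   show "x0 / 2 > 0" using x0 by simp
   fix \<phi> \<psi> B
   assume \<phi>: "primitive_on t (t + \<delta>) \<phi> \<psi>" "\<phi> t = 0" "\<phi> (t + \<delta>) = 0" "!!s. abs (\<psi> s) <= B"
    "!!s. s : {t..t + \<delta>} ==> abs (\<phi> s) <= x0 / 2 / 2"
   have pos: "r s + \<phi> s > 0" if "s : {t..t + \<delta>}" for s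
    using rb[OF that] \<phi>(5)[OF that] x0 by linarith
   note ep = edge_ptraj[OF primitive_on_add[OF rp \<phi>(1)] pos perturbed_powr[OF wm wp primitive_on_measurable(1)[OF \<phi>(1)] \<phi>(4)], of i]
   have end1: "(r t + \<phi> t) *\<^sub>R axis i 1 = y t" using junction_eq_axis[OF ytj yti] \<phi>(2) by (simp add: r_def)
   have end2: "(r (t + \<delta>) + \<phi> (t + \<delta>)) *\<^sub>R axis i 1 = y (t + \<delta>)"
    using edge(2)[of "t + \<delta>"] \<delta>(1) \<phi>(3) by (simp add: r_def)
   have "val (y t) t <= run t (t + \<delta>) (%s. (r s + \<phi> s) *\<^sub>R axis i 1) (%s. (w s + \<psi> s) *\<^sub>R axis i 1) + val (y (t + \<delta>)) (t + \<delta>)"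
    using dp_le[OF ep(1) t(1) tT(3,2)] unfolding end1 end2 .
   moreover have "val (y t) t = run t (t + \<delta>) y g + val (y (t + \<delta>)) (t + \<delta>)"
    by (rule opt_restrict(2)[OF y t(1) tT(3,2)])
   ultimately show "integral {t..t + \<delta>} (%s. l i s (r s) (w s)) <= integral {t..t + \<delta>} (%s. l i s (r s + \<phi> s) (w s + \<psi> s))"
    using ep(2) edge(3) unfolding r_def w_def by linarith
  qed
  then obtain k where k: "AE s in lebesgue. s : {t..t + \<delta>} --> la i s (r s) (w s) = k + integral {t..s} (%\<sigma>. lx i \<sigma> (r \<sigma>) (w \<sigma>))"
   by blast
  have arc2: "(%s. lx i s (r s) (w s)) absolutely_integrable_on {t..t + \<delta>}"
   by (rule arc_integrable(2)[OF t(1) tT(2) rm rR R0(2) wm wp])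
  have arc3: "(%s. la i s (r s) (w s)) absolutely_integrable_on {t..t + \<delta>}"
   by (rule arc_integrable(3)[OF t(1) tT(2) rm rR R0(2) wm wp])
  have arc4: "integral {t..t + \<delta>} (%s. abs (lx i s (r s) (w s))) <= c (R + x0) * (integral {t..t + \<delta>} (%s. abs (w s) powr p) + 2 * (t + \<delta> - t))"
   by (rule arc_integrable(4)[OF t(1) tT(2) rm rR R0(2) wm wp tT(3)])
  have arc5: "integral {t..t + \<delta>} (%s. abs (la i s (r s) (w s))) <= c (R + x0) * (integral {t..t + \<delta>} (%s. abs (w s) powr p) + 2 * (t + \<delta> - t))"
   by (rule arc_integrable(5)[OF t(1) tT(2) rm rR R0(2) wm wp tT(3)])
  define \<Lambda> where "\<Lambda> s = integral {t..s} (%\<sigma>. lx i \<sigma> (r \<sigma>) (w \<sigma>))" for s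
  have \<Lambda>p: "primitive_on t (t + \<delta>) \<Lambda> (%s. lx i s (r s) (w s))" by (rule primitive_onI[OF arc2]) (simp add: \<Lambda>_def)
  have M3': "c (R + x0) * (integral {t..t + \<delta>} (%s. abs (w s) powr p) + 2 * (t + \<delta> - t)) <= M3"
   unfolding M3_def by (rule mult_left_mono[OF _ c_nonneg]) (use wM in simp)
  have \<Lambda>b: "abs (\<Lambda> s) <= M3" if s: "s : {t..t + \<delta>}" for s
  proof -
   have st: "t <= s" "s <= t + \<delta>" using s by simp_all
   have "norm (\<Lambda> s - \<Lambda> t) <= integral {t..s} (%s. norm (lx i s (r s) (w s)))"
    by (rule primitive_on_norm_diff_le[OF \<Lambda>p order_refl st])
   also have "... <= integral {t..t + \<delta>} (%s. norm (lx i s (r s) (w s)))"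
    by (rule integral_subset_le) (use st primitive_on_integrable(3)[OF \<Lambda>p order_refl] in simp_all)
   finally show ?thesis using arc4 M3' by (simp add: \<Lambda>_def)
  qed
  have kb: "abs k <= M3 / \<delta> + M3"
  proof -
   have "integral {t..t + \<delta>} (%s. abs k) <= integral {t..t + \<delta>} (%s. abs (la i s (r s) (w s)) + M3)"
   proof (rule integral_le_AE[OF integrable_const_ivl])
    show "(%s. abs (la i s (r s) (w s)) + M3) integrable_on {t..t + \<delta>}"
     using arc3 by (intro integrable_add integrable_const_ivl) (simp add: absolutely_integrable_on_def)
    show "AE s in lebesgue. s : {t..t + \<delta>} --> abs k <= abs (la i s (r s) (w s)) + M3"
     using k
    proof eventually_elim
     case (elim s)
     show ?case
     proof
      assume s: "s : {t..t + \<delta>}"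
      have "la i s (r s) (w s) = k + \<Lambda> s" using elim s unfolding \<Lambda>_def by blast
      then show "abs k <= abs (la i s (r s) (w s)) + M3" using \<Lambda>b[OF s] by linarith
     qed
    qed
   qed
   also have "... = integral {t..t + \<delta>} (%s. abs (la i s (r s) (w s))) + integral {t..t + \<delta>} (%s. M3)"
    by (rule hk_integral_add[OF _ integrable_const_ivl])
     (use arc3 in \<open>simp add: absolutely_integrable_on_def\<close>)
   also have "... <= M3 + M3 * \<delta>" using arc5 M3' \<delta>(1) by (simp add: mult.commute)
   finally have "abs k * \<delta> <= M3 + M3 * \<delta>" using \<delta>(1) by (simp add: mult.commute)
   then have "abs k <= (M3 + M3 * \<delta>) / \<delta>" using \<delta>(1) by (simp add: field_simps)
   also have "... = M3 / \<delta> + M3" using \<delta>(1) by (simp add: add_divide_distrib)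
   finally show ?thesis .
  qed
  have Pb: "abs (k + \<Lambda> s) <= P" if "s : {t..t + \<delta>}" for s
   using kb \<Lambda>b[OF that] unfolding P_def by linarith
  have sT: "s : {0..T}" if "s : {t..t + \<delta>}" for s using that t tT by simp
  \<comment> \<open>The density w satisfies the equation only a.e.; solving the equation at every
    time gives the continuous representative.\<close>
  define v where "v s = (SOME a. la i s (r s) a = k + \<Lambda> s)" for s
  have v: "la i s (r s) (v s) = k + \<Lambda> s" if "s : {t..t + \<delta>}" for s
   unfolding v_def by (rule someI_ex) (rule K(3)[OF sT[OF that] rR[OF that] Pb[OF that]])
  have vK: "abs (v s) <= K" if "s : {t..t + \<delta>}" for s
   using K(2)[OF sT[OF that] rR[OF that], of i "v s"] Pb[OF that] unfolding v[OF that] by blast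
  have r0: "r s >= 0" if "s : {t..t + \<delta>}" for s using rR[OF that] by simp
  have "AE s in lebesgue. s : {t..t + \<delta>} --> v s = w s"
   using k
  proof eventually_elim
   case (elim s)
   show ?case
   proof
    assume s: "s : {t..t + \<delta>}"
    have "la i s (r s) (w s) = k + \<Lambda> s" using elim s unfolding \<Lambda>_def by blast
    then have "la i s (r s) (v s) = la i s (r s) (w s)" using v[OF s] by simp
    then show "v s = w s" by (rule la_inj[OF sT[OF s] r0[OF s]])
   qed
  qed
  then obtain N where N: "negligible N" "!!s. s : {t..t + \<delta>} - N ==> v s = w s"
   unfolding AE_lebesgue_negligible by blast
  have rv: "primitive_on t (t + \<delta>) r v" by (rule primitive_on_cong_AE[OF rp N]) simp_all
  have lv: "primitive_on t (t + \<delta>) (%s. la i s (r s) (v s)) (%s. lx i s (r s) (v s))"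
  proof -
   have "primitive_on t (t + \<delta>) (%s. k + \<Lambda> s) (%s. 0 + lx i s (r s) (w s))"
    by (rule primitive_on_add[OF primitive_on_const \<Lambda>p])
   then show ?thesis by (rule primitive_on_cong_AE[OF _ N(1)]) (use N(2) v in simp_all)
  qed
  have lxK: "abs (lx i s (r s) (v s)) <= c (R + x0) * (K powr p + 1)" if s: "s : {t..t + \<delta>}" for s
  proof -
   have "abs (v s) powr p <= K powr p" using vK[OF s] p by (intro powr_mono2) simp_all
   then have "c (R + x0) * (abs (v s) powr p + 1) <= c (R + x0) * (K powr p + 1)" by (intro mult_left_mono c_nonneg) simp
   then show ?thesis using lx_bound[OF sT[OF s] R0(2) rR[OF s], of i "v s"] by linarith
  qed
  have "continuous_on {t..t + \<delta>} v"
   unfolding continuous_on_iff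
  proof (intro ballI allI impI)
   fix s and e :: real assume s: "s : {t..t + \<delta>}" and e: "e > 0"
   have K0: "K >= 0" using K(1) by simp
   obtain d where d: "d > 0" "!!t x a t' x' a'. t : {0..T} ==> x : {0..R + x0} ==> abs a <= K ==>
    t' : {0..T} ==> x' : {0..R + x0} ==> abs a' <= K ==> abs (t' - t) < d ==> abs (x' - x) <= K * abs (t' - t) ==>
    abs (la i t' x' a' - la i t x a) <= c (R + x0) * (K powr p + 1) * abs (t' - t) ==> abs (a' - a) < e"
    by (rule la_lipschitz_modulus[OF e R0(2) K0]) (rule that)
   show "EX d>0. ALL s':{t..t + \<delta>}. dist s' s < d --> dist (v s') (v s) < e"
   proof (intro exI[of _ d] conjI ballI impI d(1))
    fix s' assume s': "s' : {t..t + \<delta>}" and ds: "dist s' s < d"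
    have "abs (v s' - v s) < e"
     by (rule d(2)[OF sT[OF s] rR[OF s] vK[OF s] sT[OF s'] rR[OF s'] vK[OF s'] _
      lipschitz_bound[OF rv vK s s'] lipschitz_bound[OF lv lxK s s']]) (use ds in \<open>simp add: dist_real_def\<close>)
    then show "dist (v s') (v s) < e" by (simp add: dist_real_def)
   qed
  qed
  then have "el_arc i t (t + \<delta>) (x0 / 2) (R + x0) K r v"
   unfolding el_arc_def using rv lv rb vK by blast
  then show "EX v. el_arc i t (t + \<delta>) (x0 / 2) (R + x0) K (%s. y s $ i) v" unfolding r_def[abs_def] by blast
 qed
qed

lemma el_arcD:
 assumes "el_arc i a b x0 R K r v"
 shows "primitive_on a b r v" "continuous_on {a..b} v" "!!s. s : {a..b} ==> x0 <= r s"
  "!!s. s : {a..b} ==> r s <= R" "!!s. s : {a..b} ==> abs (v s) <= K"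
  "primitive_on a b (%s. la i s (r s) (v s)) (%s. lx i s (r s) (v s))"
 using assms unfolding el_arc_def by blast+

lemma el_arc_lipschitz:
 assumes arc: "el_arc i a b x0 R K r v" and ab: "0 <= a" "b <= T" and x0: "x0 > 0" "R > 0" and s: "s : {a..b}" "s' : {a..b}"
 shows "abs (r s' - r s) <= K * abs (s' - s)"
  "abs (la i s' (r s') (v s') - la i s (r s) (v s)) <= c R * (K powr p + 1) * abs (s' - s)"
proof -
 show "abs (r s' - r s) <= K * abs (s' - s)" by (rule lipschitz_bound[OF el_arcD(1)[OF arc] el_arcD(5)[OF arc] s])
 show "abs (la i s' (r s') (v s') - la i s (r s) (v s)) <= c R * (K powr p + 1) * abs (s' - s)"
 proof (rule lipschitz_bound[OF el_arcD(6)[OF arc] _ s])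
  fix s assume s: "s : {a..b}"
  have sT: "s : {0..T}" using s ab by simp
  have rR: "r s : {0..R}" using el_arcD(3,4)[OF arc s] x0 by simp
  have "abs (v s) powr p <= K powr p" using el_arcD(5)[OF arc s] p by (intro powr_mono2) simp_all
  then have "c R * (abs (v s) powr p + 1) <= c R * (K powr p + 1)" by (intro mult_left_mono c_nonneg) simp
  then show "abs (lx i s (r s) (v s)) <= c R * (K powr p + 1)" using lx_bound[OF sT x0(2) rR, of i "v s"] by linarith
 qed
qed

lemma el_arc_modulus:
 assumes e: "e > 0" and x0: "x0 > 0" "R > 0" and K: "K >= 0"
 obtains d where "d > 0" "!!a b r v s s'. el_arc i a b x0 R K r v ==> 0 <= a ==> b <= T ==> s : {a..b} ==> s' : {a..b} ==>
  abs (s' - s) < d ==> abs (v s' - v s) < e"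
proof -
 obtain d where d: "d > 0" "!!t x a t' x' a'. t : {0..T} ==> x : {0..R} ==> abs a <= K ==>
  t' : {0..T} ==> x' : {0..R} ==> abs a' <= K ==> abs (t' - t) < d ==> abs (x' - x) <= K * abs (t' - t) ==>
  abs (la i t' x' a' - la i t x a) <= c R * (K powr p + 1) * abs (t' - t) ==> abs (a' - a) < e"
  by (rule la_lipschitz_modulus[OF e x0(2) K]) (rule that)
 show ?thesis
 proof (rule that[OF d(1)])
  fix a b r v s s'
  assume arc: "el_arc i a b x0 R K r v" and ab: "0 <= a" "b <= T" and s: "s : {a..b}" "s' : {a..b}" and ds: "abs (s' - s) < d"
  have sT: "\<sigma> : {0..T}" "r \<sigma> : {0..R}" if "\<sigma> : {a..b}" for \<sigma>
   using that ab el_arcD(3,4)[OF arc that] x0 by simp_all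
  show "abs (v s' - v s) < e"
   by (rule d(2)[OF sT[OF s(1)] el_arcD(5)[OF arc s(1)] sT[OF s(2)] el_arcD(5)[OF arc s(2)] ds
    el_arc_lipschitz[OF arc ab x0 s]])
 qed
qed

end

section \<open>The value function\<close>

lemma primitive_on_unique_AE:
 fixes f :: "real => real"
 assumes 1: "primitive_on a b f g" and 2: "primitive_on a b f g'"
 shows "AE s in lebesgue. s : {a..b} --> g s = g' s"
proof -
 have m: "primitive_on a b (%s. f s - f s) (%s. g s - g' s)" by (rule primitive_on_minus[OF 1 2])
 have "AE s in lebesgue. s : {a..b} --> g s - g' s = 0"
 proof (rule AE_lebesgue_on_zero_if_integrals_zero[OF primitive_on_integrable(1)[OF m order_refl order_refl]])
  fix u w assume u: "a <= u" "u <= w" "w <= b"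
  show "integral {u..w} (%s. g s - g' s) = 0" using primitive_on_diff[OF m u] by simp
 qed
 then show ?thesis by eventually_elim simp
qed

section \<open>Superdifferentials of the value function\<close>

context junction_control
begin

lemma el_arc_sub:
 assumes "el_arc i a b x0 R K r v" "a <= a'" "b' <= b"
 shows "el_arc i a' b' x0 R K r v"
 unfolding el_arc_def
proof (intro conjI ballI)
 have sub: "{a'..b'} \<subseteq> {a..b}" using assms by simp
 show "primitive_on a' b' r v" by (rule primitive_on_subinterval[OF el_arcD(1)[OF assms(1)] assms(2,3)])
 show "primitive_on a' b' (%s. la i s (r s) (v s)) (%s. lx i s (r s) (v s))"
  by (rule primitive_on_subinterval[OF el_arcD(6)[OF assms(1)] assms(2,3)])
 show "continuous_on {a'..b'} v" by (rule continuous_on_subset[OF el_arcD(2)[OF assms(1)] sub])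
 fix s assume "s : {a'..b'}"
 then have s: "s : {a..b}" using sub by blast
 show "x0 <= r s" "r s <= R" "abs (v s) <= K" by (rule el_arcD(3-5)[OF assms(1) s])+
qed

lemma continuous_powr_integrable:
 fixes v :: "real => real"
 assumes "continuous_on {a..b} v"
 shows "(%s. abs (v s) powr p) integrable_on {a..b}"
 using p by (intro integrable_continuous_real continuous_on_powr' continuous_on_rabs continuous_on_const assms) simp_all

lemma run_el_arc:
 assumes y: "ptraj a b y g" and arc: "el_arc i a b x0 R K (%s. y s $ i) v" and x0: "x0 > 0"
 shows "run a b y g = integral {a..b} (%s. l i s (y s $ i) (v s))"
proof -
 have pos: "y s $ i > 0" if "s : {a..b}" for s using el_arcD(3)[OF arc that] x0 by linarith
 have "run a b y g = integral {a..b} (%s. l i s (y s $ i) (g s $ i))" by (rule ptraj_edge(3)[OF y pos])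
 also have "... = integral {a..b} (%s. l i s (y s $ i) (v s))"
 proof (rule integral_cong_AE_lebesgue)
  show "AE s in lebesgue. s : {a..b} --> l i s (y s $ i) (g s $ i) = l i s (y s $ i) (v s)"
   using primitive_on_unique_AE[OF primitive_on_nth[OF ptrajD(1)[OF y]] el_arcD(1)[OF arc]]
   by eventually_elim simp
 qed
 finally show ?thesis .
qed

text \<open>The competitor starts at distance h from the optimal arc and returns to it linearly at
  time t + \<delta>. By the Euler-Lagrange equation the first-order change of cost is the boundary
  term at t, and uniform continuity of lx and la bounds the rest.\<close>

lemma superdifferential_space:
 assumes x0: "x0 > 0" and R: "R > 0" and K: "K >= 0" and \<delta>: "\<delta> > 0" and \<epsilon>: "\<epsilon> > 0"
 obtains \<rho> where "\<rho> > 0" "!!t b y g v h. opt t y g ==> 0 <= t ==> t + \<delta> <= b ==> b <= T ==>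
  el_arc i t b x0 R K (%s. y s $ i) v ==> abs h < \<rho> ==>
  val ((y t $ i + h) *\<^sub>R axis i 1) t <= val (y t) t - la i t (y t $ i) (v t) * h + \<epsilon> * abs h"
proof -
 \<comment> \<open>The error density is e times the sum of abs h and abs h / \<delta>; over a time
   \<delta> this makes e * (\<delta> + 1) * abs h.\<close>
 define e where "e = \<epsilon> / (\<delta> + 1)"
 have e: "e > 0" "e * (\<delta> + 1) = \<epsilon>" using \<epsilon> \<delta> by (simp_all add: e_def)
 obtain d1 where d1: "d1 > 0" "!!t x a t' x' a'. t : {0..T} ==> x : {0..R + x0} ==> abs a <= K + 1 ==>
  t' : {0..T} ==> x' : {0..R + x0} ==> abs a' <= K + 1 ==> abs (t' - t) < d1 ==> abs (x' - x) < d1 ==> abs (a' - a) < d1 ==>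
  abs (lx i t' x' a' - lx i t x a) < e"
  by (rule compact_uniform[OF lx_cont e(1)]) (rule that)
 obtain d2 where d2: "d2 > 0" "!!t x a t' x' a'. t : {0..T} ==> x : {0..R + x0} ==> abs a <= K + 1 ==>
  t' : {0..T} ==> x' : {0..R + x0} ==> abs a' <= K + 1 ==> abs (t' - t) < d2 ==> abs (x' - x) < d2 ==> abs (a' - a) < d2 ==>
  abs (la i t' x' a' - la i t x a) < e"
  by (rule compact_uniform[OF la_cont e(1)]) (rule that)
 define d where "d = min 1 (min d1 d2)"
 have d: "d > 0" "d <= 1" "d <= d1" "d <= d2" using d1(1) d2(1) by (simp_all add: d_def)
 define \<rho> where "\<rho> = min (x0 / 2) (min d (d * \<delta>))"
 have \<rho>: "\<rho> > 0" "\<rho> <= x0 / 2" "\<rho> <= d" "\<rho> <= d * \<delta>" using x0 d(1) \<delta> by (simp_all add: \<rho>_def)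
 show ?thesis
 proof (rule that[OF \<rho>(1)])
  fix t b y g v h
  assume y: "opt t y g" and t: "0 <= t" "t + \<delta> <= b" "b <= T"
   and arc0: "el_arc i t b x0 R K (%s. y s $ i) v" and h: "abs h < \<rho>"
  define r where "r s = y s $ i" for s
  have tT: "t + \<delta> <= T" "t <= t + \<delta>" "t : {t..t + \<delta>}" "t + \<delta> : {t..t + \<delta>}" using t \<delta> by simp_all
  have arc: "el_arc i t (t + \<delta>) x0 R K r v" unfolding r_def[abs_def] by (rule el_arc_sub[OF arc0 order_refl t(2)])
  note yp = ptraj_sub[OF opt_traj(2)[OF y] order_refl tT(1)]
  have run1: "run t (t + \<delta>) y g = integral {t..t + \<delta>} (%s. l i s (r s) (v s))"
   unfolding r_def by (rule run_el_arc[OF yp arc[unfolded r_def[abs_def]] x0])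
  define \<psi> where "\<psi> = - h / \<delta>"
  define \<phi> where "\<phi> s = h + \<psi> * (s - t)" for s
  have \<psi>: "abs \<psi> = abs h / \<delta>" "abs \<psi> < d"
  proof -
   show "abs \<psi> = abs h / \<delta>" using \<delta> by (simp add: \<psi>_def)
   moreover have "abs h / \<delta> < d" using h \<rho>(4) \<delta> by (simp only: pos_divide_less_eq)
   ultimately show "abs \<psi> < d" by simp
  qed
  have \<phi>b: "abs (\<phi> s) <= abs h" if s: "s : {t..t + \<delta>}" for s
  proof -
   have eq: "\<phi> s = h * (1 - (s - t) / \<delta>)" by (simp add: \<phi>_def \<psi>_def algebra_simps diff_divide_distrib)
   have q: "0 <= (s - t) / \<delta>" "(s - t) / \<delta> <= 1" using s \<delta> by simp_all
   then have "abs (1 - (s - t) / \<delta>) <= 1" by linarith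
   then have "abs h * abs (1 - (s - t) / \<delta>) <= abs h * 1" by (rule mult_left_mono) simp
   then show ?thesis unfolding eq abs_mult by simp
  qed
  have \<phi>0: "\<phi> t = h" "\<phi> (t + \<delta>) = 0" using \<delta> by (simp_all add: \<phi>_def \<psi>_def)
  have \<phi>p: "primitive_on t (t + \<delta>) \<phi> (%s. \<psi>)"
   unfolding \<phi>_def[abs_def] by (rule primitive_on_C1) (auto intro!: derivative_eq_intros)
  have rb: "x0 <= r s" "r s <= R" "abs (v s) <= K" if "s : {t..t + \<delta>}" for s by (rule el_arcD(3-5)[OF arc that])+
  have pos: "r s + \<phi> s > 0" if "s : {t..t + \<delta>}" for s
   using rb(1)[OF that] \<phi>b[OF that] h \<rho>(2) x0 by linarith
  have vc: "continuous_on {t..t + \<delta>} (%s. v s + \<psi>)" by (intro continuous_on_add el_arcD(2)[OF arc] continuous_on_const)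
  have ep1: "ptraj t (t + \<delta>) (%s. (r s + \<phi> s) *\<^sub>R axis i 1) (%s. (v s + \<psi>) *\<^sub>R axis i 1)"
   by (rule edge_ptraj(1)[OF primitive_on_add[OF el_arcD(1)[OF arc] \<phi>p] pos continuous_powr_integrable[OF vc]])
  have ep2: "run t (t + \<delta>) (%s. (r s + \<phi> s) *\<^sub>R axis i 1) (%s. (v s + \<psi>) *\<^sub>R axis i 1) =
   integral {t..t + \<delta>} (%s. l i s (r s + \<phi> s) (v s + \<psi>))"
   by (rule edge_ptraj(2)[OF primitive_on_add[OF el_arcD(1)[OF arc] \<phi>p] pos continuous_powr_integrable[OF vc]])
  have ypos: "y s $ i > 0" if "s : {t..t + \<delta>}" for s using rb(1)[OF that] x0 unfolding r_def by linarith
  have end2: "(r (t + \<delta>) + \<phi> (t + \<delta>)) *\<^sub>R axis i 1 = y (t + \<delta>)"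
   using ptraj_edge(2)[OF yp ypos tT(4)] \<phi>0 by (simp add: r_def)
  have "val ((r t + h) *\<^sub>R axis i 1) t <= integral {t..t + \<delta>} (%s. l i s (r s + \<phi> s) (v s + \<psi>)) + val (y (t + \<delta>)) (t + \<delta>)"
   using dp_le[OF ep1 t(1) tT(2,1)] unfolding end2 \<phi>0(1) ep2 .
  moreover have "val (y t) t = integral {t..t + \<delta>} (%s. l i s (r s) (v s)) + val (y (t + \<delta>)) (t + \<delta>)"
   using opt_restrict(2)[OF y t(1) tT(2,1)] unfolding run1 .
  moreover have "integral {t..t + \<delta>} (%s. l i s (r s + \<phi> s) (v s + \<psi>)) <=
   integral {t..t + \<delta>} (%s. l i s (r s) (v s)) - la i t (r t) (v t) * h + \<epsilon> * abs h"
  proof -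
   have R0: "R + x0 > 0" using R x0 by simp
   have sT: "s : {0..T}" if "s : {t..t + \<delta>}" for s using that t by simp
   have rR: "r s : {0..R + x0}" if "s : {t..t + \<delta>}" for s using rb(1,2)[OF that] x0 by simp
   have rR': "r s + \<phi> s : {0..R + x0}" if "s : {t..t + \<delta>}" for s
    using rb(2)[OF that] pos[OF that] \<phi>b[OF that] h \<rho>(2) x0 by simp
   note vm = primitive_on_measurable(1)[OF el_arcD(1)[OF arc]] and rm = primitive_on_measurable(2)[OF el_arcD(1)[OF arc]]
   have i1: "(%s. l i s (r s) (v s)) integrable_on {t..t + \<delta>}"
    by (rule arc_integrable(1)[OF t(1) tT(1) rm rR R0 vm continuous_powr_integrable[OF el_arcD(2)[OF arc]]])
   have i2: "(%s. l i s (r s + \<phi> s) (v s + \<psi>)) integrable_on {t..t + \<delta>}"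
    by (rule arc_integrable(1)[OF t(1) tT(1) primitive_on_measurable(2)[OF primitive_on_add[OF el_arcD(1)[OF arc] \<phi>p]] rR' R0
     primitive_on_measurable(1)[OF primitive_on_add[OF el_arcD(1)[OF arc] \<phi>p]] continuous_powr_integrable[OF vc]])
   \<comment> \<open>The first-order change of the integrand is the density of \<phi> times la along
     the arc. As \<phi> vanishes at t + \<delta>, only the value at t is left.\<close>
   define q where "q s = \<phi> s * lx i s (r s) (v s) + \<psi> * la i s (r s) (v s)" for s
   have qp: "primitive_on t (t + \<delta>) (%s. \<phi> s * la i s (r s) (v s)) q"
    using primitive_on_scaleR[OF \<phi>p el_arcD(6)[OF arc]] unfolding q_def[abs_def] by simp
   have qi: "q integrable_on {t..t + \<delta>}" by (rule primitive_on_integrable(2)[OF qp order_refl order_refl])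
   have qv: "integral {t..t + \<delta>} q = - la i t (r t) (v t) * h"
    using primitive_on_diff[OF qp order_refl tT(2) order_refl] by (simp add: \<phi>0 mult.commute)
   have pt: "l i s (r s + \<phi> s) (v s + \<psi>) <= l i s (r s) (v s) + q s + e * (abs h + abs h / \<delta>)" if s: "s : {t..t + \<delta>}" for s
   proof -
    have r0: "r s >= 0" "r s + \<phi> s >= 0" using rR[OF s] rR'[OF s] by simp_all
    obtain \<xi> \<eta> where \<xi>: "\<xi> : closed_segment (r s) (r s + \<phi> s)" and \<eta>: "\<eta> : closed_segment (v s) (v s + \<psi>)"
     and eq: "l i s (r s + \<phi> s) (v s + \<psi>) - l i s (r s) (v s) =
      lx i s \<xi> (v s + \<psi>) * (r s + \<phi> s - r s) + la i s (r s) \<eta> * (v s + \<psi> - v s)"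
     using l_mvt[OF sT[OF s] r0, of "v s" "v s + \<psi>" i] by blast
    have \<xi>d: "abs (\<xi> - r s) <= abs h" using segment_dist[OF \<xi>] \<phi>b[OF s] by simp
    have \<eta>d: "abs (\<eta> - v s) <= abs \<psi>" using segment_dist[OF \<eta>] by simp
    have \<xi>R: "\<xi> : {0..R + x0}" using \<xi> rR[OF s] rR'[OF s] by (auto simp: closed_segment_eq_real_ivl split: if_splits)
    have vb: "abs (v s) <= K + 1" "abs (v s + \<psi>) <= K + 1" "abs \<eta> <= K + 1"
     using rb(3)[OF s] \<psi>(2) d(2) \<eta>d by linarith+
    have hd: "abs h < d" using h \<rho>(3) by linarith
    have z: "abs (s - s) < d1" "abs (s - s) < d2" "abs (r s - r s) < d2" using d1(1) d2(1) by simp_all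
    have a1: "abs (\<xi> - r s) < d1" "abs (v s + \<psi> - v s) < d1" "abs (\<eta> - v s) < d2"
     using \<xi>d hd \<psi>(2) \<eta>d d(3,4) by linarith+
    have 1: "abs (lx i s \<xi> (v s + \<psi>) - lx i s (r s) (v s)) < e"
     by (rule d1(2)[OF sT[OF s] rR[OF s] vb(1) sT[OF s] \<xi>R vb(2) z(1) a1(1,2)])
    have 2: "abs (la i s (r s) \<eta> - la i s (r s) (v s)) < e"
     by (rule d2(2)[OF sT[OF s] rR[OF s] vb(1) sT[OF s] rR[OF s] vb(3) z(2,3) a1(3)])
    have "abs (lx i s \<xi> (v s + \<psi>) - lx i s (r s) (v s)) * abs (\<phi> s) <= e * abs h"
     using 1 \<phi>b[OF s] e(1) by (intro mult_mono) simp_all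
    then have 3: "(lx i s \<xi> (v s + \<psi>) - lx i s (r s) (v s)) * \<phi> s <= e * abs h" unfolding abs_mult[symmetric] by linarith
    have "abs (la i s (r s) \<eta> - la i s (r s) (v s)) * abs \<psi> <= e * (abs h / \<delta>)"
     unfolding \<psi>(1) using 2 e(1) \<delta> by (intro mult_mono) simp_all
    then have 4: "(la i s (r s) \<eta> - la i s (r s) (v s)) * \<psi> <= e * (abs h / \<delta>)" unfolding abs_mult[symmetric] by linarith
    show ?thesis using eq 3 4 by (simp add: q_def algebra_simps)
   qed
   have "integral {t..t + \<delta>} (%s. l i s (r s + \<phi> s) (v s + \<psi>)) <=
    integral {t..t + \<delta>} (%s. l i s (r s) (v s) + q s + e * (abs h + abs h / \<delta>))"
    by (rule integral_le[OF i2 integrable_add[OF integrable_add[OF i1 qi] integrable_const_ivl] pt])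
   also have "... = integral {t..t + \<delta>} (%s. l i s (r s) (v s)) + integral {t..t + \<delta>} q + e * (abs h + abs h / \<delta>) * \<delta>"
    using hk_integral_add[OF integrable_add[OF i1 qi] integrable_const_ivl[of "e * (abs h + abs h / \<delta>)"]]
     hk_integral_add[OF i1 qi] \<delta> by (simp add: mult.commute)
   also have "e * (abs h + abs h / \<delta>) * \<delta> = e * (\<delta> + 1) * abs h" using \<delta> by (simp add: field_simps)
   also have "... = \<epsilon> * abs h" unfolding e(2) ..
   finally show ?thesis unfolding qv by linarith
  qed
  ultimately show "val ((y t $ i + h) *\<^sub>R axis i 1) t <= val (y t) t - la i t (y t $ i) (v t) * h + \<epsilon> * abs h"
   unfolding r_def by linarith
 qed
qed

text \<open>A shift in time is reduced to the spatial inequality. For \<tau> >= 0 follow the optimal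
  curve up to t + \<tau> and compare there; for \<tau> < 0 move with the constant velocity
  \<open>v t\<close> until time t and compare then. Both give the time slope
  \<open>v t * la - l\<close>.\<close>

lemma superdifferential:
 assumes x0: "x0 > 0" and R: "R > 0" and K: "K >= 0" and \<delta>: "\<delta> > 0" and \<epsilon>: "\<epsilon> > 0"
 obtains \<rho> where "\<rho> > 0" "!!t b y g v h \<tau>. opt t y g ==> 0 <= t ==> t + \<delta> <= b ==> b <= T ==>
  el_arc i t b x0 R K (%s. y s $ i) v ==> abs h < \<rho> ==> abs \<tau> < \<rho> ==> 0 <= t + \<tau> ==>
  val ((y t $ i + h) *\<^sub>R axis i 1) (t + \<tau>) <= val (y t) t - la i t (y t $ i) (v t) * h +
   (v t * la i t (y t $ i) (v t) - l i t (y t $ i) (v t)) * \<tau> + \<epsilon> * (abs h + abs \<tau>)"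
proof -
 obtain B where B: "B > 0" "!!t x a. t : {0..T} ==> x : {0..R} ==> abs a <= K ==> abs (la i t x a) <= B"
  by (rule compact_bound[OF la_cont]) (rule that)
 \<comment> \<open>The errors come from the spatial inequality and the drift of la (e1), the
   linearisation of the curve (e2) and the variation of l, the last two being given a third of
   \<epsilon> each.\<close>
 define e1 where "e1 = \<epsilon> / (6 * (K + 1))"
 have K1: "K + 1 ~= 0" using K by simp
 have e1: "e1 > 0" "2 * e1 * (K + 1) = \<epsilon> / 3" using \<epsilon> K K1 by (simp_all add: e1_def divide_simps del: distrib_left_numeral)
 define e2 where "e2 = \<epsilon> / (3 * B)"
 have e2: "e2 > 0" "B * e2 = \<epsilon> / 3" using \<epsilon> B by (simp_all add: e2_def)
 have e3: "\<epsilon> / 3 > 0" using \<epsilon> by simp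
 have e1K: "2 * e1 * K + 2 * e1 = \<epsilon> / 3" using e1(2) by (simp add: algebra_simps)
 have e1K': "0 <= e1 * K" using e1(1) K by simp
 \<comment> \<open>After a forward shift by less than \<delta>/2 an arc of length \<delta>/2 is
   still left for the spatial inequality.\<close>
 have \<delta>2: "\<delta> / 2 > 0" using \<delta> by simp
 obtain \<rho>1 where \<rho>1: "\<rho>1 > 0" "!!t b y g v h. opt t y g ==> 0 <= t ==> t + \<delta> / 2 <= b ==> b <= T ==>
  el_arc i t b x0 R K (%s. y s $ i) v ==> abs h < \<rho>1 ==>
  val ((y t $ i + h) *\<^sub>R axis i 1) t <= val (y t) t - la i t (y t $ i) (v t) * h + e1 * abs h"
  by (rule superdifferential_space[OF x0 R K \<delta>2 e1(1)]) (rule that)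
 obtain d1 where d1: "d1 > 0" "!!t x a t' x' a'. t : {0..T} ==> x : {0..R + x0} ==> abs a <= K ==>
  t' : {0..T} ==> x' : {0..R + x0} ==> abs a' <= K ==> abs (t' - t) < d1 ==> abs (x' - x) < d1 ==> abs (a' - a) < d1 ==>
  abs (l i t' x' a' - l i t x a) < \<epsilon> / 3"
  by (rule compact_uniform[OF l_cont e3]) (rule that)
 have e4: "min e2 d1 > 0" using e2(1) d1(1) by simp
 obtain d2 where d2: "d2 > 0" "!!a b r v s s'. el_arc i a b x0 R K r v ==> 0 <= a ==> b <= T ==> s : {a..b} ==> s' : {a..b} ==>
  abs (s' - s) < d2 ==> abs (v s' - v s) < min e2 d1"
  by (rule el_arc_modulus[OF e4 x0 R K]) (rule that)
 define Cx where "Cx = c R * (K powr p + 1)"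
 have Cx: "Cx >= 0" using c_nonneg[of R] by (simp add: Cx_def)
 \<comment> \<open>Shifts below \<rho> leave half of the arc, change the velocity by less than e2
   and d1 and la by at most e1, and keep the displaced points within \<rho>1, d1 and x0/2.\<close>
 define \<rho> where "\<rho> = min (min (\<delta> / 2) d2) (min (e1 / (Cx + 1)) (min \<rho>1 (min d1 (x0 / 2)) / (1 + K)))"
 have \<rho>: "\<rho> > 0" "\<rho> <= \<delta> / 2" "\<rho> <= d2" "Cx * \<rho> <= e1" "\<rho> + K * \<rho> <= min \<rho>1 (min d1 (x0 / 2))"
 proof -
  show "\<rho> > 0" using \<delta> d2(1) e1(1) Cx \<rho>1(1) d1(1) x0 K by (simp add: \<rho>_def)
  show "\<rho> <= \<delta> / 2" "\<rho> <= d2" unfolding \<rho>_def by linarith+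
  have "\<rho> <= e1 / (Cx + 1)" "\<rho> <= min \<rho>1 (min d1 (x0 / 2)) / (1 + K)"
   unfolding \<rho>_def by (meson min.cobounded1 min.cobounded2 order_trans)+
  then have "\<rho> * (Cx + 1) <= e1" and 2: "\<rho> * (1 + K) <= min \<rho>1 (min d1 (x0 / 2))" using Cx K by (simp_all only: pos_le_divide_eq)
  then show "Cx * \<rho> <= e1" using \<open>\<rho> > 0\<close> by (simp add: algebra_simps)
  show "\<rho> + K * \<rho> <= min \<rho>1 (min d1 (x0 / 2))" using 2 by (simp only: distrib_left mult_1_right mult.commute[of K])
 qed
 show ?thesis
 proof (rule that[OF \<rho>(1)])
  fix t b y g v h \<tau>
  assume y: "opt t y g" and t: "0 <= t" "t + \<delta> <= b" "b <= T"
   and arc: "el_arc i t b x0 R K (%s. y s $ i) v" and h: "abs h < \<rho>" and \<tau>: "abs \<tau> < \<rho>" "0 <= t + \<tau>"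
  define r where "r s = y s $ i" for s
  define a where "a = v t"
  define \<pi> where "\<pi> = la i t (r t) a"
  define \<Lambda> where "\<Lambda> = l i t (r t) a"
  have tb: "t : {t..b}" "t : {0..T}" using t \<delta> by simp_all
  have rb: "x0 <= r s" "r s <= R" "abs (v s) <= K" if "s : {t..b}" for s unfolding r_def by (rule el_arcD(3-5)[OF arc that])+
  have aK: "abs a <= K" unfolding a_def by (rule rb(3)[OF tb(1)])
  have rt: "r t : {0..R}" "r t : {0..R + x0}" using rb(1,2)[OF tb(1)] x0 by simp_all
  have \<pi>B: "abs \<pi> <= B" unfolding \<pi>_def by (rule B(2)[OF tb(2) rt(1) aK])
  have K\<tau>: "K * abs \<tau> <= K * \<rho>" using \<tau>(1) K by (intro mult_left_mono) simp_all
  have small: "abs h + K * abs \<tau> < \<rho>1" "abs h + K * abs \<tau> < d1" "abs h + K * abs \<tau> < x0 / 2" "abs \<tau> < d1"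
   using h \<tau>(1) K\<tau> \<rho>(5) mult_nonneg_nonneg[OF K less_imp_le[OF \<rho>(1)]] by linarith+
  have err: "e1 * (abs h + K * abs \<tau>) = e1 * abs h + e1 * K * abs \<tau>" by (simp add: distrib_left)
  have total: "2 * e1 * abs h + 2 * e1 * K * abs \<tau> + \<epsilon> / 3 * abs \<tau> + B * e2 * abs \<tau> <= \<epsilon> * (abs h + abs \<tau>)"
  proof -
   have "2 * e1 * abs h <= \<epsilon> * abs h" by (rule mult_right_mono) (use e1K e1K' e3 in linarith)+
   moreover have "(2 * e1 * K + \<epsilon> / 3 + B * e2) * abs \<tau> <= \<epsilon> * abs \<tau>"
    by (rule mult_right_mono) (use e1K e1(1) e2(2) in linarith)+
   ultimately show ?thesis by (simp only: distrib_left distrib_right)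
  qed
  have nn: "0 <= e1 * abs h" "0 <= e1 * K * abs \<tau>" "0 <= B * e2 * abs \<tau>" using e1 e2 B K by simp_all
  consider "\<tau> >= 0" | "\<tau> < 0" by linarith
  then have "val ((r t + h) *\<^sub>R axis i 1) (t + \<tau>) <= val (y t) t - \<pi> * h + (a * \<pi> - \<Lambda>) * \<tau> + \<epsilon> * (abs h + abs \<tau>)"
  proof cases
   case 1
   define t' where "t' = t + \<tau>"
   have t': "t <= t'" "t' <= T" "0 <= t'" "t' + \<delta> / 2 <= b" "t' : {t..b}" "t' - t = \<tau>" "t' <= b"
    using 1 \<tau> t \<rho>(2) \<delta> by (simp_all add: t'_def)
   define \<pi>' where "\<pi>' = la i t' (r t') (v t')"
   \<comment> \<open>The displacement of the target from the curve at time t'; to first order it is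
     h - a * \<tau>.\<close>
   define h' where "h' = r t + h - r t'"
   have sub: "s : {t..b}" "abs (s - t) <= \<tau>" "abs (s - t) < d2" "s : {0..T}" if "s : {t..t'}" for s
    using that t' t \<tau> \<rho>(3) 1 by simp_all
   have rL: "abs (r s - r t) <= K * abs (s - t)" if "s : {t..b}" for s
    unfolding r_def by (rule el_arc_lipschitz(1)[OF arc t(1,3) x0 R tb(1) that])
   have vm: "abs (v s - a) < min e2 d1" if s: "s : {t..t'}" for s
    unfolding a_def by (rule d2(2)[OF arc t(1,3) tb(1) sub(1)[OF s] sub(3)[OF s]])
   have rlin: "abs (r t' - r t - a * \<tau>) <= e2 * \<tau>"
   proof -
    have "primitive_on t t' (%s. r s - a * s) (%s. v s - a)"
     unfolding r_def[abs_def]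
     by (intro primitive_on_minus primitive_on_subinterval[OF el_arcD(1)[OF arc]] primitive_on_C1)
      (use t' in \<open>auto intro!: derivative_eq_intros\<close>)
    from lipschitz_bound[OF this, of e2 t t'] have "abs ((r t' - a * t') - (r t - a * t)) <= e2 * abs (t' - t)"
     using vm t'(1) by (simp add: less_imp_le)
    moreover have "(r t' - a * t') - (r t - a * t) = r t' - r t - a * \<tau>" unfolding t'_def by (simp add: algebra_simps)
    ultimately show ?thesis using 1 t'(6) by simp
   qed
   have h'b: "abs h' <= abs h + K * abs \<tau>" using rL[OF t'(5)] unfolding h'_def t'(6) by linarith
   have E: "val ((y t' $ i + h') *\<^sub>R axis i 1) t' <= val (y t') t' - la i t' (y t' $ i) (v t') * h' + e1 * abs h'"
    by (rule \<rho>1(2)[OF opt_restrict(1)[OF y t(1) t'(1,2)] t'(3,4) t(3) el_arc_sub[OF arc t'(1) order_refl]]) (use h'b small(1) in linarith)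
   have E: "val ((r t + h) *\<^sub>R axis i 1) t' <= val (y t') t' - \<pi>' * h' + e1 * abs h'"
    using E unfolding \<pi>'_def h'_def r_def by simp
   have "val (y t) t = run t t' y g + val (y t') t'" by (rule opt_restrict(2)[OF y t(1) t'(1,2)])
   moreover have arc': "el_arc i t t' x0 R K (%s. y s $ i) v" by (rule el_arc_sub[OF arc order_refl t'(7)])
   have "run t t' y g = integral {t..t'} (%s. l i s (r s) (v s))"
    unfolding r_def by (rule run_el_arc[OF ptraj_sub[OF opt_traj(2)[OF y] order_refl t'(2)] arc' x0])
   moreover have "(\<Lambda> - \<epsilon> / 3) * \<tau> <= integral {t..t'} (%s. l i s (r s) (v s))"
   proof -
    have i1: "(%s. l i s (y s $ i) (v s)) integrable_on {t..t'}"
     by (rule arc_integrable(1)[OF t(1) t'(2) primitive_on_measurable(2)[OF el_arcD(1)[OF arc']] _ R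
      primitive_on_measurable(1)[OF el_arcD(1)[OF arc']] continuous_powr_integrable[OF el_arcD(2)[OF arc']]])
      (use rb(1,2)[OF sub(1)] x0 in \<open>fastforce simp: r_def\<close>)
    have "integral {t..t'} (%s. \<Lambda> - \<epsilon> / 3) <= integral {t..t'} (%s. l i s (r s) (v s))"
    proof (rule integral_le[OF integrable_const_ivl])
     show "(%s. l i s (r s) (v s)) integrable_on {t..t'}" unfolding r_def by (rule i1)
     fix s assume s: "s : {t..t'}"
     have "r s : {0..R + x0}" using rb(1,2)[OF sub(1)[OF s]] x0 by simp
     moreover have "abs (r s - r t) < d1"
     proof -
      have "K * abs (s - t) <= K * abs \<tau>" using sub(2)[OF s] K by (intro mult_left_mono) simp_all
      then show ?thesis using rL[OF sub(1)[OF s]] small(2) by linarith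
     qed
     moreover have "abs (s - t) < d1" using sub(2)[OF s] small(4) by linarith
     moreover have "abs (v s - a) < d1" using vm[OF s] by simp
     ultimately have "abs (l i s (r s) (v s) - l i t (r t) a) < \<epsilon> / 3"
      by (intro d1(2)[OF tb(2) rt(2) aK sub(4)[OF s] _ rb(3)[OF sub(1)[OF s]]])
     then show "\<Lambda> - \<epsilon> / 3 <= l i s (r s) (v s)" unfolding \<Lambda>_def by linarith
    qed
    then show ?thesis using t'(1,6) by (simp add: mult.commute)
   qed
   moreover have "abs ((\<pi>' - \<pi>) * h') <= e1 * (abs h + K * abs \<tau>)"
   proof -
    have "abs (\<pi>' - \<pi>) <= Cx * abs (t' - t)" unfolding \<pi>'_def \<pi>_def a_def r_def Cx_def by (rule el_arc_lipschitz(2)[OF arc t(1,3) x0 R tb(1) t'(5)])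
    also have "... <= Cx * \<rho>" using t'(6) \<tau>(1) Cx by (intro mult_left_mono) simp_all
    finally have "abs (\<pi>' - \<pi>) <= e1" using \<rho>(4) by linarith
    then show ?thesis unfolding abs_mult using h'b e1(1) by (intro mult_mono) simp_all
   qed
   moreover have "abs (\<pi> * (r t' - r t - a * \<tau>)) <= B * e2 * abs \<tau>"
    unfolding abs_mult mult.assoc using rlin \<pi>B B(1) 1 by (intro mult_mono) simp_all
   moreover have "e1 * abs h' <= e1 * (abs h + K * abs \<tau>)" using h'b e1(1) by (intro mult_left_mono) simp_all
   moreover have "\<pi>' * h' = (\<pi>' - \<pi>) * h' + \<pi> * h - \<pi> * (r t' - r t - a * \<tau>) - a * \<pi> * \<tau>"
    unfolding h'_def by (simp add: algebra_simps)
   moreover have "(\<Lambda> - \<epsilon> / 3) * \<tau> = \<Lambda> * \<tau> - \<epsilon> / 3 * abs \<tau>" "(a * \<pi> - \<Lambda>) * \<tau> = a * \<pi> * \<tau> - \<Lambda> * \<tau>"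
    using 1 by (simp_all add: left_diff_distrib)
   ultimately show ?thesis using E err total unfolding t'_def by linarith
  next
   case 2
   define t' where "t' = t + \<tau>"
   have t': "t' <= t" "0 <= t'" "t <= T" "t - t' = abs \<tau>" "t - t' = - \<tau>" using 2 \<tau> t \<delta> by (simp_all add: t'_def)
   \<comment> \<open>The straight competitor reaches the displacement h + a * abs \<tau> at time t,
     where the spatial inequality applies.\<close>
   define q where "q s = r t + h + a * (s - t')" for s
   have aS: "abs (a * (s - t')) <= K * abs \<tau>" if "s : {t'..t}" for s
    unfolding abs_mult using aK K that t'(4) by (intro mult_mono) simp_all
   have qd: "abs (q s - r t) <= abs h + K * abs \<tau>" if "s : {t'..t}" for s using aS[OF that] unfolding q_def by linarith
   have qpos: "q s > 0" if "s : {t'..t}" for s using qd[OF that] small(3) rb(1)[OF tb(1)] x0 by linarith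
   have qR: "q s : {0..R + x0}" if "s : {t'..t}" for s
    using qd[OF that] small(3) rb(2)[OF tb(1)] x0 qpos[OF that] by simp
   have qp: "primitive_on t' t q (%s. a)"
    unfolding q_def[abs_def] by (rule primitive_on_C1) (auto intro!: derivative_eq_intros)
   have ai: "(%s. abs a powr p) integrable_on {t'..t}" by (rule integrable_const_ivl)
   have ep1: "ptraj t' t (%s. q s *\<^sub>R axis i 1) (%s. a *\<^sub>R axis i 1)" by (rule edge_ptraj(1)[OF qp qpos ai])
   have ep2: "run t' t (%s. q s *\<^sub>R axis i 1) (%s. a *\<^sub>R axis i 1) = integral {t'..t} (%s. l i s (q s) a)"
    by (rule edge_ptraj(2)[OF qp qpos ai])
   have q0: "q t' = r t + h" "q t = r t + (h + a * abs \<tau>)" using t'(4) by (simp_all add: q_def)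
   have "val ((r t + h) *\<^sub>R axis i 1) t' <= integral {t'..t} (%s. l i s (q s) a) + val ((r t + (h + a * abs \<tau>)) *\<^sub>R axis i 1) t"
    using dp_le[OF ep1 t'(2,1,3)] unfolding ep2 q0 .
   moreover have "val ((y t $ i + (h + a * \<bar>\<tau>\<bar>)) *\<^sub>R axis i 1) t <= val (y t) t - la i t (y t $ i) (v t) * (h + a * \<bar>\<tau>\<bar>) + e1 * \<bar>h + a * \<bar>\<tau>\<bar>\<bar>"
   proof (rule \<rho>1(2)[OF y t(1) _ t(3) arc])
    show "t + \<delta> / 2 <= b" using t(2) \<delta> by simp
    show "\<bar>h + a * \<bar>\<tau>\<bar>\<bar> < \<rho>1" using qd[of t] q0(2) t'(1) small(1) by simp
   qed
   moreover have "e1 * \<bar>h + a * \<bar>\<tau>\<bar>\<bar> <= e1 * (\<bar>h\<bar> + K * \<bar>\<tau>\<bar>)"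
    using qd[of t] q0(2) t'(1) e1(1) by (intro mult_left_mono) simp_all
   moreover have "integral {t'..t} (%s. l i s (q s) a) <= (\<Lambda> + \<epsilon> / 3) * abs \<tau>"
   proof -
    have R0: "R + x0 > 0" using R x0 by simp
    have "integral {t'..t} (%s. l i s (q s) a) <= integral {t'..t} (%s. \<Lambda> + \<epsilon> / 3)"
    proof (rule integral_le[OF _ integrable_const_ivl])
     show "(%s. l i s (q s) a) integrable_on {t'..t}"
      by (rule arc_integrable(1)[OF t'(2,3) primitive_on_measurable(2)[OF qp] qR R0 primitive_on_measurable(1)[OF qp] ai])
     fix s assume s: "s : {t'..t}"
     have sT: "s : {0..T}" "abs (s - t) < d1" using s t' small(4) by simp_all
     have "abs (l i s (q s) a - l i t (r t) a) < \<epsilon> / 3"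
      by (rule d1(2)[OF tb(2) rt(2) aK sT(1) qR[OF s] aK sT(2)]) (use qd[OF s] small(2) d1(1) in simp_all)
     then show "l i s (q s) a <= \<Lambda> + \<epsilon> / 3" unfolding \<Lambda>_def by linarith
    qed
    then show ?thesis using t'(1,4) by (simp add: mult.commute)
   qed
   moreover have "\<pi> * (h + a * abs \<tau>) = \<pi> * h - a * \<pi> * \<tau>" "(\<Lambda> + \<epsilon> / 3) * abs \<tau> = - \<Lambda> * \<tau> + \<epsilon> / 3 * abs \<tau>"
    "(a * \<pi> - \<Lambda>) * \<tau> = a * \<pi> * \<tau> - \<Lambda> * \<tau>" using 2 by (simp_all add: algebra_simps)
   ultimately show ?thesis using err total nn unfolding t'_def \<pi>_def a_def r_def by linarith
  qed
  then show "val ((y t $ i + h) *\<^sub>R axis i 1) (t + \<tau>) <= val (y t) t - la i t (y t $ i) (v t) * h +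
   (v t * la i t (y t $ i) (v t) - l i t (y t $ i) (v t)) * \<tau> + \<epsilon> * (abs h + abs \<tau>)"
   unfolding \<pi>_def \<Lambda>_def a_def r_def .
 qed
qed

end

text \<open>The modulus is the infimum over e of e + B * r / \<rho> e. For r < \<rho> e the first
  term is large enough, otherwise the second is at least B. An infimum of nondecreasing affine
  functions is nondecreasing and upper semicontinuous.\<close>

lemma modulus_from_scales:
 fixes \<rho> :: "real => real"
 assumes \<rho>: "!!e. e > 0 ==> \<rho> e > 0" and B: "B >= 0"
 obtains \<omega> where "modulus \<omega>" "usc_on {0..} \<omega>"
  "!!r x. r >= 0 ==> x <= B ==> ALL e>0. r < \<rho> e --> x <= e ==> x <= \<omega> r"
proof -
 define F where "F r e = e + B * r / \<rho> e" for r e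
 define \<omega> where "\<omega> r = (INF e\<in>{0<..}. F r e)" for r
 have ne: "{0<..} ~= ({} :: real set)" using zero_less_one by blast
 have F0: "0 <= F r e" if "r >= 0" "e > 0" for r e
  using that B \<rho>[OF that(2)] by (simp add: F_def)
 have bdd: "bdd_below (F r ` {0<..})" if "r >= 0" for r
  by (rule bdd_belowI[of _ 0]) (use F0[OF that] in auto)
 have le: "\<omega> r <= F r e" if "r >= 0" "e > 0" for r e
  unfolding \<omega>_def by (rule cINF_lower[OF bdd[OF that(1)]]) (use that(2) in simp)
 have ge: "x <= \<omega> r" if "!!e. e > 0 ==> x <= F r e" for x r
  unfolding \<omega>_def by (rule cINF_greatest[OF ne]) (use that in simp)
 have \<omega>0: "0 <= \<omega> r" if "r >= 0" for r by (rule ge) (rule F0[OF that])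
 have mono: "\<omega> r <= \<omega> s" if "0 <= r" "r <= s" for r s
 proof (rule ge)
  fix e :: real assume e: "e > 0"
  have "F r e <= F s e"
   unfolding F_def using that B \<rho>[OF e] by (intro add_left_mono divide_right_mono mult_left_mono) simp_all
  then show "\<omega> r <= F s e" using le[OF that(1) e] by linarith
 qed
 show ?thesis
 proof (rule that)
  have "(\<omega> \<longlongrightarrow> 0) (at_right 0)"
   unfolding tendsto_iff
  proof (intro allI impI)
   fix e :: real assume e: "e > 0"
   have e2: "e / 2 > 0" using e by simp
   have "((%r. F r (e / 2)) \<longlongrightarrow> F 0 (e / 2)) (at_right 0)"
    unfolding F_def by (intro tendsto_intros) (use \<rho>[OF e2] in simp)
   then have "\<forall>\<^sub>F r in at_right 0. F r (e / 2) < e" by (rule order_tendstoD(2)) (use e in \<open>simp add: F_def\<close>)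
   moreover have "\<forall>\<^sub>F r in at_right (0::real). r > 0" by (rule eventually_at_right_less)
   ultimately show "\<forall>\<^sub>F r in at_right 0. dist (\<omega> r) 0 < e"
   proof eventually_elim
    case (elim r)
    have r0: "r >= 0" using elim by simp
    show ?case using le[OF r0 e2] \<omega>0[OF r0] elim(1) by simp
   qed
  qed
  then show "modulus \<omega>" unfolding modulus_def by (intro conjI mono_onI) (use \<omega>0 mono in simp_all)
  show "usc_on {0..} \<omega>"
   unfolding usc_on_def
  proof (intro ballI allI impI)
   fix x c :: real assume x: "x : {0..}" and c: "\<omega> x < c"
   obtain e where e: "e > 0" "F x e < c"
    using c cINF_less_iff[OF ne bdd, of x c] x unfolding \<omega>_def by auto
   have "((%r. F r e) \<longlongrightarrow> F x e) (at x within {0..})"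
    unfolding F_def by (intro tendsto_intros) (use \<rho>[OF e(1)] in simp)
   then have "\<forall>\<^sub>F r in at x within {0..}. F r e < c" by (rule order_tendstoD(2)) (rule e(2))
   moreover have "\<forall>\<^sub>F r in at x within {0..}. r : {0..}" by (simp add: eventually_at_filter)
   ultimately show "\<forall>\<^sub>F r in at x within {0..}. \<omega> r < c"
   proof eventually_elim
    case (elim r)
    then show ?case using le[of r e] e(1) by simp
   qed
  qed
  fix r x assume r: "r >= 0" and x: "x <= B" "ALL e>0. r < \<rho> e --> x <= e"
  show "x <= \<omega> r"
  proof (rule ge)
   fix e :: real assume e: "e > 0"
   show "x <= F r e"
   proof (cases "r < \<rho> e")
    case True
    have "0 <= B * r / \<rho> e" using B r \<rho>[OF e] by simp
    moreover have "x <= e" using x(2) e True by blast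
    ultimately show ?thesis unfolding F_def by linarith
   next
    case False
    have "B * 1 <= B * (r / \<rho> e)" by (rule mult_left_mono[OF _ B]) (use False \<rho>[OF e] in simp)
    then show ?thesis using x(1) e unfolding F_def by simp
   qed
  qed
 qed
qed

text \<open>The inequalities from the base point Z between X and Y are added with weights \<theta>
  and 1 - \<theta>. The linear terms cancel, and each error contributes one half of the right-hand
  side.\<close>

lemma semiconcave_if_uniform_superdifferential:
 fixes w :: "'a::real_inner => real"
 assumes W: "!!X. X : S ==> abs (w X) <= W" and Q: "!!Z. Z : S ==> norm (q Z) <= Q"
  and sup: "!!e. e > 0 ==> EX \<rho>>0. ALL X:S. ALL Z:S. norm (X - Z) < \<rho> --> w X <= w Z + q Z \<bullet> (X - Z) + e * norm (X - Z)"
 shows "EX \<omega>. modulus \<omega> & usc_on {0..} \<omega> & (ALL \<theta>:{0..1}. ALL X Y. closed_segment X Y \<subseteq> S -->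
  \<theta> * w X + (1 - \<theta>) * w Y - w (\<theta> *\<^sub>R X + (1 - \<theta>) *\<^sub>R Y) <= \<theta> * (1 - \<theta>) * norm (X - Y) * \<omega> (norm (X - Y)))"
proof -
 have "ALL e. EX \<rho>. e > 0 --> \<rho> > 0 & (ALL X:S. ALL Z:S. norm (X - Z) < \<rho> --> w X <= w Z + q Z \<bullet> (X - Z) + e * norm (X - Z))"
  using sup by blast
 from choice[OF this] obtain \<rho> where \<rho>0: "ALL e. e > 0 --> \<rho> e > 0 &
  (ALL X:S. ALL Z:S. norm (X - Z) < \<rho> e --> w X <= w Z + q Z \<bullet> (X - Z) + e * norm (X - Z))" by blast
 have \<rho>: "\<rho> e > 0" if "e > 0" for e using \<rho>0 that by blast
 have \<rho>s: "w X <= w Z + q Z \<bullet> (X - Z) + e * norm (X - Z)" if "e > 0" "X : S" "Z : S" "norm (X - Z) < \<rho> e" for e X Z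
  using \<rho>0 that by blast
 \<comment> \<open>Bounds the normalised error G: by 1 at distances below \<rho> 1, and by the
   bounds of w and of q at larger ones.\<close>
 define B where "B = 1 + 2 * abs W / \<rho> 1 + abs Q"
 have \<rho>1: "\<rho> 1 > 0" by (rule \<rho>) simp
 have B: "B >= 1" using \<rho>1 by (simp add: B_def)
 have \<rho>h: "\<rho> (e / 2) > 0" if "e > 0" for e by (rule \<rho>) (use that in simp)
 have B2: "2 * B >= 0" using B by simp
 \<comment> \<open>The modulus controls twice the normalised error, hence the scales \<rho> (e / 2)
   and the bound 2 * B.\<close>
 obtain \<omega> where \<omega>: "modulus \<omega>" "usc_on {0..} \<omega>"
  "!!r x. r >= 0 ==> x <= 2 * B ==> ALL e>0. r < \<rho> (e / 2) --> x <= e ==> x <= \<omega> r"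
  by (rule modulus_from_scales[of "%e. \<rho> (e / 2)", OF \<rho>h B2], assumption) (rule that)
 have "mono_on {0..} \<omega>" using \<omega>(1) unfolding modulus_def by blast
 then have \<omega>m: "\<omega> r <= \<omega> s" if "0 <= r" "r <= s" for r s
  by (rule mono_onD) (use that in simp_all)
 have key: "w X - w Z <= q Z \<bullet> (X - Z) + norm (X - Z) * (\<omega> (norm (X - Z)) / 2)" if X: "X : S" and Z: "Z : S" for X Z
 proof (cases "X = Z")
  case False
  define n where "n = norm (X - Z)"
  have n: "n > 0" using False by (simp add: n_def)
  define G where "G = (w X - w Z - q Z \<bullet> (X - Z)) / n"
  have "2 * G <= \<omega> n"
  proof (rule \<omega>(3))
   show "n >= 0" using n by simp
   show "2 * G <= 2 * B"
   proof (cases "n < \<rho> 1")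
    case True
    have "w X - w Z - q Z \<bullet> (X - Z) <= 1 * n" using \<rho>s[OF zero_less_one X Z] True unfolding n_def by simp
    then have "G <= 1" using n by (simp add: G_def)
    then show ?thesis using B by simp
   next
    case False
    have "abs (q Z \<bullet> (X - Z)) <= norm (q Z) * n" unfolding n_def by (rule Cauchy_Schwarz_ineq2)
    also have "... <= abs Q * n" using Q[OF Z] n by (intro mult_right_mono) simp_all
    finally have "w X - w Z - q Z \<bullet> (X - Z) <= 2 * abs W + abs Q * n" using W[OF X] W[OF Z] by linarith
    then have "G <= (2 * abs W + abs Q * n) / n" unfolding G_def using n by (intro divide_right_mono) simp_all
    also have "... = 2 * abs W / n + abs Q" using n by (simp add: add_divide_distrib)
    also have "2 * abs W / n <= 2 * abs W / \<rho> 1" using False n \<rho>1 by (intro divide_left_mono mult_pos_pos) simp_all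
    finally show ?thesis unfolding B_def by simp
   qed
   show "ALL e>0. n < \<rho> (e / 2) --> 2 * G <= e"
   proof (intro allI impI)
   fix e :: real assume e: "e > 0" "n < \<rho> (e / 2)"
   have "e / 2 > 0" using e by simp
   from \<rho>s[OF this X Z] e(2) have "w X - w Z - q Z \<bullet> (X - Z) <= e / 2 * n" unfolding n_def by simp
   then have "G <= e / 2" unfolding G_def using n by (simp only: pos_divide_le_eq)
   then show "2 * G <= e" by simp
   qed
  qed
  then have "n * G <= n * (\<omega> n / 2)" using n by (intro mult_left_mono) simp_all
  moreover have "n * G = w X - w Z - q Z \<bullet> (X - Z)" using n by (simp add: G_def)
  ultimately show ?thesis unfolding n_def by linarith
 qed simp
 show ?thesis
 proof (intro exI[of _ \<omega>] conjI \<omega>(1,2) ballI allI impI)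
  fix \<theta> :: real and X Y assume \<theta>: "\<theta> : {0..1}" and seg: "closed_segment X Y \<subseteq> S"
  define Z where "Z = \<theta> *\<^sub>R X + (1 - \<theta>) *\<^sub>R Y"
  have "Z : closed_segment X Y" unfolding closed_segment_def Z_def
   using \<theta> by (intro CollectI exI[of _ "1 - \<theta>"]) simp
  then have S: "X : S" "Y : S" "Z : S" using seg by auto
  define n where "n = norm (X - Y)"
  have XZ: "X - Z = (1 - \<theta>) *\<^sub>R (X - Y)" and YZ: "Y - Z = (- \<theta>) *\<^sub>R (X - Y)"
   by (simp_all add: Z_def algebra_simps)
  have nX: "norm (X - Z) = (1 - \<theta>) * n" and nY: "norm (Y - Z) = \<theta> * n" using \<theta> unfolding XZ YZ n_def by simp_all
  have n0: "n >= 0" by (simp add: n_def)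
  have le1: "(1 - \<theta>) * n <= n" "\<theta> * n <= n" using \<theta> n0 by (simp_all add: mult_left_le_one_le)
  have o1: "\<omega> ((1 - \<theta>) * n) <= \<omega> n" "\<omega> (\<theta> * n) <= \<omega> n" by (rule \<omega>m; use \<theta> n0 le1 in simp)+
  have 1: "w X - w Z <= (1 - \<theta>) * (q Z \<bullet> (X - Y)) + (1 - \<theta>) * n * (\<omega> n / 2)"
  proof -
   have "(1 - \<theta>) * n * (\<omega> ((1 - \<theta>) * n) / 2) <= (1 - \<theta>) * n * (\<omega> n / 2)" using o1 \<theta> n0 by (intro mult_left_mono) simp_all
   then show ?thesis using key[OF S(1,3)] unfolding nX unfolding XZ by simp
  qed
  have 2: "w Y - w Z <= - \<theta> * (q Z \<bullet> (X - Y)) + \<theta> * n * (\<omega> n / 2)"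
  proof -
   have "\<theta> * n * (\<omega> (\<theta> * n) / 2) <= \<theta> * n * (\<omega> n / 2)" using o1 \<theta> n0 by (intro mult_left_mono) simp_all
   then show ?thesis using key[OF S(2,3)] unfolding nY unfolding YZ by simp
  qed
  have 3: "\<theta> * (w X - w Z) <= \<theta> * ((1 - \<theta>) * (q Z \<bullet> (X - Y)) + (1 - \<theta>) * n * (\<omega> n / 2))"
   using 1 \<theta> by (intro mult_left_mono) simp_all
  have 4: "(1 - \<theta>) * (w Y - w Z) <= (1 - \<theta>) * (- \<theta> * (q Z \<bullet> (X - Y)) + \<theta> * n * (\<omega> n / 2))"
   using 2 \<theta> by (intro mult_left_mono) simp_all
  have "\<theta> * w X + (1 - \<theta>) * w Y - w Z = \<theta> * (w X - w Z) + (1 - \<theta>) * (w Y - w Z)" by (simp add: algebra_simps)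
  also have "... <= \<theta> * ((1 - \<theta>) * (q Z \<bullet> (X - Y)) + (1 - \<theta>) * n * (\<omega> n / 2)) +
   (1 - \<theta>) * (- \<theta> * (q Z \<bullet> (X - Y)) + \<theta> * n * (\<omega> n / 2))" by (rule add_mono[OF 3 4])
  also have "... = \<theta> * (1 - \<theta>) * n * \<omega> n" by (simp add: algebra_simps)
  finally show "\<theta> * w X + (1 - \<theta>) * w Y - w (\<theta> *\<^sub>R X + (1 - \<theta>) *\<^sub>R Y) <= \<theta> * (1 - \<theta>) * norm (X - Y) * \<omega> (norm (X - Y))"
   unfolding Z_def n_def .
 qed
qed

lemma has_real_derivativeI_eps:
 fixes f :: "real => real"
 assumes "!!e. e > 0 ==> EX \<rho>>0. ALL h. abs h < \<rho> --> abs (f (x + h) - f x - D * h) <= e * abs h"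
 shows "(f has_real_derivative D) (at x)"
 unfolding has_field_derivative_def has_derivative_within_alt
proof (intro conjI allI impI)
 show "bounded_linear ((*) D)" by (rule bounded_linear_mult_right)
 fix e :: real assume "e > 0"
 then obtain \<rho> where \<rho>: "\<rho> > 0" "!!h. abs h < \<rho> ==> abs (f (x + h) - f x - D * h) <= e * abs h" using assms by blast
 show "EX d>0. ALL y:UNIV. norm (y - x) < d --> norm (f y - f x - D * (y - x)) <= e * norm (y - x)"
  by (intro exI[of _ \<rho>] conjI \<rho>(1) ballI impI) (use \<rho>(2)[of "y - x" for y] in simp)
qed

text \<open>An upper inequality suffices because the increments h and - h force opposite
  inequalities between D and q.\<close>

lemma derivative_eq_superdifferential:
 fixes f :: "real => real"
 assumes D: "(f has_real_derivative D) (at x)"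
  and q: "!!e. e > 0 ==> EX \<rho>>0. ALL h. abs h < \<rho> --> f (x + h) <= f x + q * h + e * abs h"
 shows "D = q"
proof -
 have "abs (D - q) <= 0 + e" if e: "e > 0" for e
 proof -
  have e2: "e / 2 > 0" using e by simp
  obtain \<rho> where \<rho>: "\<rho> > 0" "!!h. abs h < \<rho> ==> f (x + h) <= f x + q * h + e / 2 * abs h" using q[OF e2] by blast
  obtain d where d: "d > 0" "!!y. norm (y - x) < d ==> norm (f y - f x - D * (y - x)) <= e / 2 * norm (y - x)"
   using D e2 unfolding has_field_derivative_def has_derivative_within_alt by blast
  define h where "h = min \<rho> d / 2"
  have h: "h > 0" "abs h < \<rho>" "abs h < d" "abs (- h) < \<rho>" "abs (- h) < d" using \<rho>(1) d(1) by (simp_all add: h_def min_def)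
  have "abs (f (x + h) - f x - D * h) <= e / 2 * h" "abs (f (x - h) - f x + D * h) <= e / 2 * h"
   using d(2)[of "x + h"] d(2)[of "x - h"] h by simp_all
  moreover have "f (x + h) <= f x + q * h + e / 2 * h" "f (x - h) <= f x - q * h + e / 2 * h"
   using \<rho>(2)[OF h(2)] \<rho>(2)[OF h(4)] h(1) by simp_all
  ultimately have "(D - q) * h <= e * h" "(q - D) * h <= e * h" by (simp_all only: left_diff_distrib)
  then show ?thesis using h(1) by simp
 qed
 then have "abs (D - q) <= 0" by (rule field_le_epsilon)
 then show ?thesis by simp
qed

section \<open>Semiconcavity, initial velocities and differentiability in space\<close>

context junction_control
begin

text \<open>From above the competitor rests at its starting point; from below
  \<open>cost_lower\<close> applies.\<close>

lemma val_bounded: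
 assumes R: "R > 0"
 obtains W where "!!i x t. 0 < x ==> x <= R ==> 0 <= t ==> t <= T ==> abs (val (x *\<^sub>R axis i 1) t) <= W"
proof -
 obtain D where D: "D > 0" "!!i t x a. t : {0..T} ==> x : {0..R} ==> abs (l i t x a) <= D * (abs a powr p + 1)"
  by (rule l_upper[OF R]) (rule that)
 show ?thesis
 proof (rule that[of "D * T + C0 * T + abs Bf"])
  fix i x t assume x: "0 < x" "x <= R" and t: "0 <= t" "t <= T"
  have i0: "(%s. abs (0 :: real) powr p) integrable_on {t..T}" by (rule integrable_const_ivl)
  have tr: "traj t (%s. x *\<^sub>R axis i 1) (%s. 0 *\<^sub>R axis i 1)"
   unfolding traj_iff_ptraj by (rule edge_ptraj(1)[OF primitive_on_const x(1) i0])
  have run: "run t T (%s. x *\<^sub>R axis i 1) (%s. 0 *\<^sub>R axis i 1) = integral {t..T} (%s. l i s x 0)"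
   by (rule edge_ptraj(2)[OF primitive_on_const x(1) i0])
  have "integral {t..T} (%s. l i s x 0) <= integral {t..T} (%s. D)"
  proof (rule integral_le[OF _ integrable_const_ivl])
   show "(%s. l i s x 0) integrable_on {t..T}"
    by (rule arc_integrable(1)[OF t(1) order_refl _ _ R _ i0]) (use x in simp_all)
   show "l i s x 0 <= D" if "s : {t..T}" for s using D(2)[of s x i 0] that t x by simp
  qed
  also have "... <= D * T" using D(1) t by simp
  finally have "run t T (%s. x *\<^sub>R axis i 1) (%s. 0 *\<^sub>R axis i 1) <= D * T" unfolding run .
  moreover have "fin (x *\<^sub>R axis i 1) <= Bf" by (rule fin_upper[OF axis_in_junction]) (use x in simp)
  ultimately have up: "val (x *\<^sub>R axis i 1) t <= D * T + Bf" using val_le[OF tr t] unfolding cost_def by linarith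
  have xj: "x *\<^sub>R axis i 1 : junction" by (rule axis_in_junction) (use x in simp)
  obtain y g where y: "opt t y g" "y t = x *\<^sub>R axis i 1" by (rule exists_opt[OF t xj]) (rule that)
  have "- (Bf + C0 * T) <= val (x *\<^sub>R axis i 1) t"
   using cost_lower[OF opt_traj(1)[OF y(1)] t] val_opt[OF y(1)] y(2) by simp
  moreover have "0 <= D * T" "0 <= C0 * T" using D(1) C0 T by simp_all
  ultimately show "abs (val (x *\<^sub>R axis i 1) t) <= D * T + C0 * T + abs Bf" using up by linarith
 qed
qed

lemma val_semiconcave: "locally_semiconcave_on ({0<..} \<times> {0<..<T}) (%(r, t). val (r *\<^sub>R axis i 1) t)"
 unfolding locally_semiconcave_on_def
proof (intro allI impI)
 fix S :: "(real \<times> real) set" assume S: "compact S" "S \<subseteq> {0<..} \<times> {0<..<T}"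
 \<comment> \<open>A compact set in the open strip keeps a positive distance from the vertex and
   from time T, as \<open>optimal_regular\<close> needs.\<close>
 obtain x0 R \<tau>0 where b: "x0 > 0" "R >= x0" "\<tau>0 > 0" "!!x t. (x, t) : S ==> x0 <= x & x <= R & 0 <= t & t + \<tau>0 <= T"
 proof (cases "S = {}")
  case True
  then show ?thesis by (intro that[of 1 1 1]) simp_all
 next
  case False
  have c: "continuous_on S fst" "continuous_on S snd" by (intro continuous_intros)+
  obtain Z1 where Z1: "Z1 : S" "ALL Z:S. fst Z1 <= fst Z" using continuous_attains_inf[OF S(1) False c(1)] by blast
  obtain Z2 where Z2: "Z2 : S" "ALL Z:S. fst Z <= fst Z2" using continuous_attains_sup[OF S(1) False c(1)] by blast
  obtain Z3 where Z3: "Z3 : S" "ALL Z:S. snd Z <= snd Z3" using continuous_attains_sup[OF S(1) False c(2)] by blast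
  show ?thesis
  proof (rule that[of "fst Z1" "fst Z2" "T - snd Z3"])
   show "fst Z1 > 0" "T - snd Z3 > 0" using subsetD[OF S(2) Z1(1)] subsetD[OF S(2) Z3(1)] by (simp_all add: mem_Times_iff)
   show "fst Z1 <= fst Z2" using Z1 Z2 by blast
   fix x t assume xt: "(x, t) : S"
   have "fst Z1 <= x" "x <= fst Z2" "t <= snd Z3" using Z1(2) Z2(2) Z3(2) xt by force+
   moreover have "0 < t" using xt S(2) by auto
   ultimately show "fst Z1 <= x & x <= fst Z2 & 0 <= t & t + (T - snd Z3) <= T" by simp
  qed
 qed
 have R0: "R > 0" "R + x0 > 0" "x0 / 2 > 0" using b(1,2) by simp_all
 obtain \<delta> K where \<delta>: "\<delta> > 0" "\<delta> <= \<tau>0" "K >= 1"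
  "!!t y g. opt t y g ==> 0 <= t ==> t + \<tau>0 <= T ==> x0 <= y t $ i ==> y t $ i <= R ==>
   EX v. el_arc i t (t + \<delta>) (x0 / 2) (R + x0) K (%s. y s $ i) v"
  by (rule optimal_regular[OF b(1-3), where i = i]) (rule that)
 have K0: "K >= 0" using \<delta>(3) by simp
 \<comment> \<open>One minimiser is chosen for each point; its initial velocity fixes the slope q,
   and the bounds on its arc are common to all of S.\<close>
 have "ALL Z. EX a. Z : S --> (EX y g v. opt (snd Z) y g & y (snd Z) = fst Z *\<^sub>R axis i 1 & v (snd Z) = a &
  el_arc i (snd Z) (snd Z + \<delta>) (x0 / 2) (R + x0) K (%s. y s $ i) v)"
 proof
  fix Z :: "real \<times> real"
  obtain x t where Z: "Z = (x, t)" by (cases Z)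
  show "EX a. Z : S --> (EX y g v. opt (snd Z) y g & y (snd Z) = fst Z *\<^sub>R axis i 1 & v (snd Z) = a &
   el_arc i (snd Z) (snd Z + \<delta>) (x0 / 2) (R + x0) K (%s. y s $ i) v)"
  proof (cases "Z : S")
   case True
   have xt: "x0 <= x" "x <= R" "0 <= t" "t + \<tau>0 <= T" "t <= T" using b(3) b(4)[of x t] True Z by simp_all
   have xj: "x *\<^sub>R axis i 1 : junction" by (rule axis_in_junction) (use xt b(1) in simp)
   obtain y g where y: "opt t y g" "y t = x *\<^sub>R axis i 1" by (rule exists_opt[OF xt(3,5) xj]) (rule that)
   have "EX v. el_arc i t (t + \<delta>) (x0 / 2) (R + x0) K (%s. y s $ i) v"
    by (rule \<delta>(4)[OF y(1) xt(3,4)]) (use y(2) xt in \<open>simp_all add: scaleR_axis_nth\<close>)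
   then show ?thesis unfolding Z fst_conv snd_conv using y by blast
  qed blast
 qed
 from choice[OF this] obtain a where a: "!!Z. Z : S ==> EX y g v. opt (snd Z) y g & y (snd Z) = fst Z *\<^sub>R axis i 1 & v (snd Z) = a Z &
  el_arc i (snd Z) (snd Z + \<delta>) (x0 / 2) (R + x0) K (%s. y s $ i) v" by blast
 define q where "q Z = (- la i (snd Z) (fst Z) (a Z),
  a Z * la i (snd Z) (fst Z) (a Z) - l i (snd Z) (fst Z) (a Z))" for Z
 obtain W where W: "!!i x t. 0 < x ==> x <= R ==> 0 <= t ==> t <= T ==> abs (val (x *\<^sub>R axis i 1) t) <= W"
  by (rule val_bounded[OF R0(1)]) (rule that)
 obtain B1 where B1: "B1 > 0" "!!t x a. t : {0..T} ==> x : {0..R} ==> abs a <= K ==> abs (la i t x a) <= B1"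
  by (rule compact_bound[OF la_cont]) (rule that)
 obtain B2 where B2: "B2 > 0" "!!t x a. t : {0..T} ==> x : {0..R} ==> abs a <= K ==> abs (l i t x a) <= B2"
  by (rule compact_bound[OF l_cont]) (rule that)
 show "EX \<omega>. modulus \<omega> & usc_on {0..} \<omega> & (ALL \<theta>:{0..1}. ALL X Y. closed_segment X Y \<subseteq> S -->
  \<theta> * (case X of (r, t) => val (r *\<^sub>R axis i 1) t) + (1 - \<theta>) * (case Y of (r, t) => val (r *\<^sub>R axis i 1) t) -
  (case \<theta> *\<^sub>R X + (1 - \<theta>) *\<^sub>R Y of (r, t) => val (r *\<^sub>R axis i 1) t) <= \<theta> * (1 - \<theta>) * norm (X - Y) * \<omega> (norm (X - Y)))"
 proof (rule semiconcave_if_uniform_superdifferential[where w = "%(r, t). val (r *\<^sub>R axis i 1) t" and W = W and q = q and Q = "B1 + (K * B1 + B2)"])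
  fix X assume X: "X : S"
  obtain x t where XX: "X = (x, t)" by (cases X)
  have xt: "x0 <= x" "x <= R" "0 <= t" "t + \<tau>0 <= T" using b(4)[of x t] X XX by simp_all
  show "abs (case X of (r, t) => val (r *\<^sub>R axis i 1) t) <= W" unfolding XX prod.case by (rule W) (use xt b(1,3) in simp_all)
  obtain y g v where y: "opt (snd X) y g" "v (snd X) = a X" "el_arc i (snd X) (snd X + \<delta>) (x0 / 2) (R + x0) K (%s. y s $ i) v"
   using a[OF X] by blast
  have aK: "abs (a X) <= K" using el_arcD(5)[OF y(3), of "snd X"] y(2) \<delta>(1) by simp
  have tR: "t : {0..T}" "x : {0..R}" using xt b(1,3) by simp_all
  have l1: "abs (la i t x (a X)) <= B1" "abs (l i t x (a X)) <= B2" by (rule B1(2)[OF tR aK], rule B2(2)[OF tR aK])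
  have "abs (a X * la i t x (a X)) <= K * B1" unfolding abs_mult using aK l1(1) B1(1) K0 by (intro mult_mono) simp_all
  then have "abs (a X * la i t x (a X) - l i t x (a X)) <= K * B1 + B2" using l1(2) by linarith
  then have "norm (- la i t x (a X)) + norm (a X * la i t x (a X) - l i t x (a X)) <= B1 + (K * B1 + B2)" using l1(1) by simp
  then show "norm (q X) <= B1 + (K * B1 + B2)"
   using norm_Pair_le[of "- la i t x (a X)" "a X * la i t x (a X) - l i t x (a X)"] unfolding q_def XX fst_conv snd_conv by linarith
 next
  fix e :: real assume "e > 0"
  then have e: "e / 2 > 0" by simp
  obtain \<rho> where \<rho>: "\<rho> > 0" "!!t b y g v h \<tau>. opt t y g ==> 0 <= t ==> t + \<delta> <= b ==> b <= T ==>
   el_arc i t b (x0 / 2) (R + x0) K (%s. y s $ i) v ==> abs h < \<rho> ==> abs \<tau> < \<rho> ==> 0 <= t + \<tau> ==>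
   val ((y t $ i + h) *\<^sub>R axis i 1) (t + \<tau>) <= val (y t) t - la i t (y t $ i) (v t) * h +
    (v t * la i t (y t $ i) (v t) - l i t (y t $ i) (v t)) * \<tau> + e / 2 * (abs h + abs \<tau>)"
   by (rule superdifferential[OF R0(3,2) K0 \<delta>(1) e]) (rule that)
  show "EX \<rho>>0. ALL X:S. ALL Z:S. norm (X - Z) < \<rho> -->
   (case X of (r, t) => val (r *\<^sub>R axis i 1) t) <= (case Z of (r, t) => val (r *\<^sub>R axis i 1) t) + q Z \<bullet> (X - Z) + e * norm (X - Z)"
  proof (intro exI[of _ \<rho>] conjI \<rho>(1) ballI impI)
   fix X Z assume X: "X : S" and Z: "Z : S" and n: "norm (X - Z) < \<rho>"
   obtain x t x' t' where XX: "X = (x', t')" "Z = (x, t)" by (cases X, cases Z)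
   define h where "h = x' - x"
   define \<tau> where "\<tau> = t' - t"
   have XZ: "X - Z = (h, \<tau>)" by (simp add: XX h_def \<tau>_def)
   have ht: "abs h <= norm (X - Z)" "abs \<tau> <= norm (X - Z)" using norm_fst_le[of h \<tau>] norm_snd_le[of \<tau> h] unfolding XZ by simp_all
   have xt: "x0 <= x" "0 <= t" "t + \<tau>0 <= T" "0 <= t'" using b(4)[of x t] b(4)[of x' t'] X Z XX by simp_all
   obtain y g v where y: "opt t y g" "y t = x *\<^sub>R axis i 1" "v t = a Z"
    "el_arc i t (t + \<delta>) (x0 / 2) (R + x0) K (%s. y s $ i) v"
    using a[OF Z] unfolding XX(2) fst_conv snd_conv by blast
   have yx: "y t $ i = x" unfolding y(2) scaleR_axis_nth by simp
   have "val ((y t $ i + h) *\<^sub>R axis i 1) (t + \<tau>) <= val (y t) t - la i t (y t $ i) (v t) * h +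
    (v t * la i t (y t $ i) (v t) - l i t (y t $ i) (v t)) * \<tau> + e / 2 * (abs h + abs \<tau>)"
    by (rule \<rho>(2)[OF y(1) xt(2) order_refl _ y(4)]) (use ht n xt \<delta>(2) in \<open>simp_all add: \<tau>_def\<close>)
   moreover have "e / 2 * (abs h + abs \<tau>) <= e / 2 * (2 * norm (X - Z))" using ht e by (intro mult_left_mono) simp_all
   moreover have "q Z \<bullet> (X - Z) = - la i t x (a Z) * h + (a Z * la i t x (a Z) - l i t x (a Z)) * \<tau>"
    unfolding XZ unfolding q_def XX by simp
   ultimately have "val ((x + h) *\<^sub>R axis i 1) (t + \<tau>) <= val (x *\<^sub>R axis i 1) t + q Z \<bullet> (X - Z) + e * norm (X - Z)"
    unfolding yx unfolding y(2,3) by simp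
   moreover have "x + h = x'" "t + \<tau> = t'" by (simp_all add: h_def \<tau>_def)
   ultimately have "val (x' *\<^sub>R axis i 1) t' <= val (x *\<^sub>R axis i 1) t + q Z \<bullet> (X - Z) + e * norm (X - Z)"
    by (simp only:)
   moreover have "(case X of (r, t) => val (r *\<^sub>R axis i 1) t) = val (x' *\<^sub>R axis i 1) t'"
    "(case Z of (r, t) => val (r *\<^sub>R axis i 1) t) = val (x *\<^sub>R axis i 1) t" unfolding XX by simp_all
   ultimately show "(case X of (r, t) => val (r *\<^sub>R axis i 1) t) <= (case Z of (r, t) => val (r *\<^sub>R axis i 1) t) + q Z \<bullet> (X - Z) + e * norm (X - Z)"
    by (simp only:)
  qed
 qed
qed

lemma el_arc_deriv:
 assumes arc: "el_arc i a b x0 R K r v" and s: "s : {a..b}"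
 shows "(r has_real_derivative v s) (at s within {a..b})"
proof -
 have "((%s. r a + integral {a..s} v) has_real_derivative 0 + v s) (at s within {a..b})"
  by (intro DERIV_add DERIV_const integral_has_real_derivative[OF el_arcD(2)[OF arc] s])
 then have "((%s. r a + integral {a..s} v) has_real_derivative v s) (at s within {a..b})" by simp
 then show ?thesis
  by (rule has_field_derivative_transform_within[OF _ zero_less_one s]) (rule primitive_on_eq[OF el_arcD(1)[OF arc], symmetric]; simp)
qed

lemma el_arc_linear:
 assumes arc: "el_arc i a b x0 R K r v" and s: "s : {a..b}" and e: "!!\<sigma>. \<sigma> : {a..s} ==> abs (v \<sigma> - v a) <= e"
 shows "abs (r s - r a - v a * (s - a)) <= e * (s - a)"
proof -
 have sb: "a <= s" "s <= b" using s by simp_all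
 have "primitive_on a s (%s. r s - v a * s) (%s. v s - v a)"
  by (intro primitive_on_minus primitive_on_subinterval[OF el_arcD(1)[OF arc] order_refl sb(2)] primitive_on_C1)
   (auto intro!: derivative_eq_intros)
 from lipschitz_bound[OF this e, of a s] have "abs ((r s - v a * s) - (r a - v a * a)) <= e * abs (s - a)" using sb by simp
 moreover have "(r s - v a * s) - (r a - v a * a) = r s - r a - v a * (s - a)" by (simp add: algebra_simps)
 ultimately show ?thesis using sb by simp
qed

text \<open>Near t the curve lies on edge i, and the derivatives at t within {t..b} and within
  {t..T} are the same right derivative.\<close>

lemma el_arc_vel:
 assumes y: "ptraj t T y g" and arc: "el_arc i t b x0 R K (%s. y s $ i) v" and tb: "t < b" "b <= T" and x0: "x0 > 0"
 shows "(y has_vector_derivative v t *\<^sub>R axis i 1) (at t within {t..T})"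
proof -
 have t: "t : {t..b}" using tb by simp
 have pos: "y s $ i > 0" if "s : {t..b}" for s using el_arcD(3)[OF arc that] x0 by linarith
 have j: "y s = (y s $ i) *\<^sub>R axis i 1" if "s : {t..b}" for s
  by (rule junction_eq_axis[OF ptrajD(2)[OF y] pos[OF that]]) (use that tb in simp)
 have "((%s. (y s $ i) *\<^sub>R axis i 1) has_vector_derivative v t *\<^sub>R axis i 1) (at t within {t..b})"
  using bounded_linear.has_vector_derivative[OF bounded_linear_scaleR_left
   el_arc_deriv[OF arc t, unfolded has_real_derivative_iff_has_vector_derivative]] .
 then have "(y has_vector_derivative v t *\<^sub>R axis i 1) (at t within {t..b})"
  by (rule has_vector_derivative_transform[OF t, rotated]) (rule j)
 then show ?thesis using tb by (simp add: at_within_Icc_at_right)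
qed

definition vels :: "'n => real => real => real set" where
 "vels i x t = {a. EX y g. opt t y g & y t = x *\<^sub>R axis i 1 &
  (y has_vector_derivative a *\<^sub>R axis i 1) (at t within {t..T})}"

lemma axis_vel_unique:
 assumes "(y has_vector_derivative a *\<^sub>R axis i (1::real)) (at t within {t..T})"
  "(y has_vector_derivative b *\<^sub>R axis i (1::real)) (at t within {t..T})" "t < T"
 shows "a = b"
proof -
 have "at t within {t..T} ~= bot" using assms(3) by (simp add: at_within_Icc_at_right)
 from vector_derivative_unique_within[OF this assms(1,2)]
 have "(a *\<^sub>R axis i (1::real)) $ i = (b *\<^sub>R axis i 1) $ i" by simp
 then show ?thesis by (simp add: scaleR_axis_nth)
qed

text \<open>One \<delta> and one K serve all starting points in [x/2, 3x/2] at time t: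
  \<open>optimal_regular\<close> is applied to [x/2, 2x] and its bound 5x/2 is rounded up to
  3x.\<close>

lemma local_arcs:
 assumes t: "0 <= t" "t < T" and x: "x > 0"
 obtains \<delta> K where "\<delta> > 0" "t + \<delta> <= T" "K >= 1"
  "!!h y g. abs h <= x / 2 ==> opt t y g ==> y t = (x + h) *\<^sub>R axis i 1 ==>
   EX v. el_arc i t (t + \<delta>) (x / 4) (3 * x) K (%s. y s $ i) v"
proof -
 have c: "x / 2 > 0" "2 * x >= x / 2" "T - t > 0" using x t by simp_all
 obtain \<delta> K where \<delta>: "\<delta> > 0" "\<delta> <= T - t" "K >= 1"
  "!!s y g. opt s y g ==> 0 <= s ==> s + (T - t) <= T ==> x / 2 <= y s $ i ==> y s $ i <= 2 * x ==>
   EX v. el_arc i s (s + \<delta>) (x / 2 / 2) (2 * x + x / 2) K (%s. y s $ i) v"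
  by (rule optimal_regular[OF c, where i = i]) (rule that)
 show ?thesis
 proof (rule that[OF \<delta>(1) _ \<delta>(3)])
  show "t + \<delta> <= T" using \<delta>(2) by simp
  fix h y g assume h: "abs h <= x / 2" and y: "opt t y g" "y t = (x + h) *\<^sub>R axis i 1"
  have yi: "y t $ i = x + h" unfolding y(2) scaleR_axis_nth by simp
  have "EX v. el_arc i t (t + \<delta>) (x / 2 / 2) (2 * x + x / 2) K (%s. y s $ i) v"
   by (rule \<delta>(4)[OF y(1) t(1)]) (use yi h in \<open>simp_all add: abs_le_iff\<close>)
  then obtain v where v: "el_arc i t (t + \<delta>) (x / 2 / 2) (2 * x + x / 2) K (%s. y s $ i) v" by blast
  have "x / 4 <= y s $ i & y s $ i <= 3 * x & abs (v s) <= K" if "s : {t..t + \<delta>}" for s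
   using el_arcD(3-5)[OF v that] x by simp
  then have "el_arc i t (t + \<delta>) (x / 4) (3 * x) K (%s. y s $ i) v"
   unfolding el_arc_def using el_arcD(1,2,6)[OF v] by blast
  then show "EX v. el_arc i t (t + \<delta>) (x / 4) (3 * x) K (%s. y s $ i) v" by blast
 qed
qed

lemma vels_nonempty:
 assumes t: "0 <= t" "t < T" and x: "x > 0"
 shows "vels i x t ~= {}"
proof -
 obtain \<delta> K where \<delta>: "\<delta> > 0" "t + \<delta> <= T" "K >= 1"
  "!!h y g. abs h <= x / 2 ==> opt t y g ==> y t = (x + h) *\<^sub>R axis i 1 ==>
   EX v. el_arc i t (t + \<delta>) (x / 4) (3 * x) K (%s. y s $ i) v"
  by (rule local_arcs[OF t x, where i = i]) (rule that)
 have xj: "x *\<^sub>R axis i 1 : junction" by (rule axis_in_junction) (use x in simp)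
 obtain y g where y: "opt t y g" "y t = x *\<^sub>R axis i 1" by (rule exists_opt[OF t(1) less_imp_le[OF t(2)] xj]) (rule that)
 obtain v where v: "el_arc i t (t + \<delta>) (x / 4) (3 * x) K (%s. y s $ i) v" using \<delta>(4)[of 0 y g] y x by auto
 have "(y has_vector_derivative v t *\<^sub>R axis i 1) (at t within {t..T})"
  by (rule el_arc_vel[OF opt_traj(2)[OF y(1)] v]) (use \<delta> x in simp_all)
 then show ?thesis unfolding vels_def using y by blast
qed

text \<open>Each optimal trajectory contributes its own slope, so different initial velocities
  produce a corner of the value function.\<close>

lemma vels_superdifferential:
 assumes t: "0 <= t" "t < T" and x: "x > 0" and a: "a : vels i x t" and e: "e > 0"
 shows "EX \<rho>>0. ALL h. abs h < \<rho> --> val ((x + h) *\<^sub>R axis i 1) t <= val (x *\<^sub>R axis i 1) t + - la i t x a * h + e * abs h"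
proof -
 obtain \<delta> K where \<delta>: "\<delta> > 0" "t + \<delta> <= T" "K >= 1"
  "!!h y g. abs h <= x / 2 ==> opt t y g ==> y t = (x + h) *\<^sub>R axis i 1 ==>
   EX v. el_arc i t (t + \<delta>) (x / 4) (3 * x) K (%s. y s $ i) v"
  by (rule local_arcs[OF t x, where i = i]) (rule that)
 obtain y g where y: "opt t y g" "y t = x *\<^sub>R axis i 1" "(y has_vector_derivative a *\<^sub>R axis i 1) (at t within {t..T})"
  using a unfolding vels_def by blast
 obtain v where v: "el_arc i t (t + \<delta>) (x / 4) (3 * x) K (%s. y s $ i) v" using \<delta>(4)[of 0 y g] y x by auto
 have c: "x / 4 > 0" "3 * x > 0" "K >= 0" "t < t + \<delta>" using x \<delta> by simp_all
 have av: "v t = a" by (rule axis_vel_unique[OF el_arc_vel[OF opt_traj(2)[OF y(1)] v c(4) \<delta>(2) c(1)] y(3) t(2)])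
 have yi: "y t $ i = x" unfolding y(2) scaleR_axis_nth by simp
 obtain \<rho> where \<rho>: "\<rho> > 0" "!!t b y g v h. opt t y g ==> 0 <= t ==> t + \<delta> <= b ==> b <= T ==>
  el_arc i t b (x / 4) (3 * x) K (%s. y s $ i) v ==> abs h < \<rho> ==>
  val ((y t $ i + h) *\<^sub>R axis i 1) t <= val (y t) t - la i t (y t $ i) (v t) * h + e * abs h"
  by (rule superdifferential_space[OF c(1-3) \<delta>(1) e]) (rule that)
 show ?thesis
  using \<rho>(1) \<rho>(2)[OF y(1) t(1) order_refl \<delta>(2) v, unfolded yi av, unfolded y(2)] by (intro exI[of _ \<rho>]) simp
qed

lemma la_eq_if_differentiable:
 assumes t: "0 <= t" "t < T" and x: "x > 0" and a: "a : vels i x t"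
  and D: "((%r. val (r *\<^sub>R axis i 1) t) has_real_derivative D) (at x)"
 shows "la i t x a = - D"
 using derivative_eq_superdifferential[OF D vels_superdifferential[OF t x a]] by simp

text \<open>Otherwise minimisers from points tending to x have velocities away from a0. A
  subsequence converges uniformly to a minimiser from x, whose velocity is a0 by uniqueness, and
  equicontinuity of the velocities along the arcs carries uniform convergence over to initial
  velocities.\<close>

lemma vel_stability:
 assumes t: "0 <= t" "t < T" and x: "x > 0" and a0: "vels i x t = {a0}" and e: "e > 0"
  and \<delta>: "\<delta> > 0" "t + \<delta> <= T" "K >= 1"
  "!!h y g. abs h <= x / 2 ==> opt t y g ==> y t = (x + h) *\<^sub>R axis i 1 ==>
   EX v. el_arc i t (t + \<delta>) (x / 4) (3 * x) K (%s. y s $ i) v"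
 shows "EX d>0. ALL h y g v. abs h < d --> opt t y g --> y t = (x + h) *\<^sub>R axis i 1 -->
  el_arc i t (t + \<delta>) (x / 4) (3 * x) K (%s. y s $ i) v --> abs (v t - a0) < e"
proof (rule ccontr)
 assume neg: "~ ?thesis"
 have ex: "ALL n. EX h y g v. abs h < min (x / 2) (1 / real (Suc n)) & opt t y g & y t = (x + h) *\<^sub>R axis i 1 &
  el_arc i t (t + \<delta>) (x / 4) (3 * x) K (%s. y s $ i) v & abs (v t - a0) >= e"
 proof
  fix n
  have "min (x / 2) (1 / real (Suc n)) > 0" using x by simp
  then have "EX h y g v. abs h < min (x / 2) (1 / real (Suc n)) & opt t y g & y t = (x + h) *\<^sub>R axis i 1 &
  el_arc i t (t + \<delta>) (x / 4) (3 * x) K (%s. y s $ i) v & ~ abs (v t - a0) < e"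
   using neg by blast
  then show "EX h y g v. abs h < min (x / 2) (1 / real (Suc n)) & opt t y g & y t = (x + h) *\<^sub>R axis i 1 &
  el_arc i t (t + \<delta>) (x / 4) (3 * x) K (%s. y s $ i) v & abs (v t - a0) >= e"
   unfolding not_less .
 qed
 obtain h where "ALL n. EX y g v. abs (h n) < min (x / 2) (1 / real (Suc n)) & opt t y g & y t = (x + h n) *\<^sub>R axis i 1 &
  el_arc i t (t + \<delta>) (x / 4) (3 * x) K (%s. y s $ i) v & abs (v t - a0) >= e" using choice[OF ex] by blast
 from choice[OF this] obtain y where "ALL n. EX g v. abs (h n) < min (x / 2) (1 / real (Suc n)) & opt t (y n) g & y n t = (x + h n) *\<^sub>R axis i 1 &
  el_arc i t (t + \<delta>) (x / 4) (3 * x) K (%s. y n s $ i) v & abs (v t - a0) >= e" by blast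
 from choice[OF this] obtain g where "ALL n. EX v. abs (h n) < min (x / 2) (1 / real (Suc n)) & opt t (y n) (g n) & y n t = (x + h n) *\<^sub>R axis i 1 &
  el_arc i t (t + \<delta>) (x / 4) (3 * x) K (%s. y n s $ i) v & abs (v t - a0) >= e" by blast
 from choice[OF this] obtain v where "ALL n. abs (h n) < min (x / 2) (1 / real (Suc n)) & opt t (y n) (g n) & y n t = (x + h n) *\<^sub>R axis i 1 &
  el_arc i t (t + \<delta>) (x / 4) (3 * x) K (%s. y n s $ i) (v n) & abs (v n t - a0) >= e" by blast
 then have hn: "abs (h n) < x / 2" "abs (h n) < 1 / real (Suc n)" and yn: "opt t (y n) (g n)" "y n t = (x + h n) *\<^sub>R axis i 1"
  and vn: "el_arc i t (t + \<delta>) (x / 4) (3 * x) K (%s. y n s $ i) (v n)" and vne: "abs (v n t - a0) >= e" for n by simp_all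
 have tT: "t <= T" "t : {t..T}" using t by simp_all
 have c: "x / 4 > 0" "3 * x > 0" "K >= 0" "t < t + \<delta>" "2 * x > 0" using x \<delta> by simp_all
 obtain W where W: "!!i x' t. 0 < x' ==> x' <= 2 * x ==> 0 <= t ==> t <= T ==> abs (val (x' *\<^sub>R axis i 1) t) <= W"
  by (rule val_bounded[OF c(5)]) (rule that)
 have cb: "cost t (y n) (g n) <= W" for n
 proof -
  have "abs (val ((x + h n) *\<^sub>R axis i 1) t) <= W" by (rule W[OF _ _ t(1) tT(1)]) (use hn(1)[of n] x in \<open>simp_all add: abs_less_iff\<close>)
  then show ?thesis using val_opt[OF yn(1)[of n]] unfolding yn(2) by linarith
 qed
 have nb: "norm (y n t) <= 2 * x" for n unfolding yn(2) norm_scaleR_axis using hn(1)[of n] x by linarith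
 obtain k :: "nat => nat" and z q where k: "strict_mono k" and z: "traj t z q"
  and unif: "!!e. e > 0 ==> EX N. ALL n x. n >= N & x : {t..T} --> norm (y (k n) x - z x) < e"
  and lim: "!!e. e > 0 ==> EX N. ALL n>=N. cost t z q <= cost t (y (k n)) (g (k n)) + e"
  by (rule traj_compactness[OF t(1) tT(1) opt_traj(1)[OF yn(1)] nb cb]) (rule that)
 have small: "EX N. ALL n>=N. abs (h (k n)) < e" if e: "e > 0" for e
 proof -
  obtain N where N: "1 / real (Suc N) < e" using reals_Archimedean[OF e] by (auto simp: inverse_eq_divide)
  have "abs (h (k n)) < e" if n: "n >= N" for n
  proof -
   have "N <= k n" using seq_suble[OF k, of n] n by simp
   then have "1 / real (Suc (k n)) <= 1 / real (Suc N)" by (intro divide_left_mono) simp_all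
   then show ?thesis using hn(2)[of "k n"] N by linarith
  qed
  then show ?thesis by blast
 qed
 have zt: "z t = x *\<^sub>R axis i 1"
 proof -
  have "norm (z t - x *\<^sub>R axis i 1) <= 0 + e" if e: "e > 0" for e
  proof -
   have e2: "e / 2 > 0" using e by simp
   obtain N1 where N1: "ALL n x. n >= N1 & x : {t..T} --> norm (y (k n) x - z x) < e / 2" using unif[OF e2] by blast
   obtain N2 where N2: "ALL n>=N2. abs (h (k n)) < e / 2" using small[OF e2] by blast
   define n where "n = max N1 N2"
   have "norm (y (k n) t - z t) < e / 2" using N1 tT(2) unfolding n_def by simp
   moreover have "norm (y (k n) t - x *\<^sub>R axis i 1) < e / 2"
   proof -
    have "y (k n) t - x *\<^sub>R axis i 1 = h (k n) *\<^sub>R axis i 1" unfolding yn(2) by (simp add: scaleR_left_distrib)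
    then show ?thesis using N2 unfolding n_def by simp
   qed
   moreover have "norm (z t - x *\<^sub>R axis i 1) <= norm (y (k n) t - z t) + norm (y (k n) t - x *\<^sub>R axis i 1)"
    by (metis norm_minus_commute norm_triangle_sub norm_triangle_ineq4 add.commute diff_diff_eq2 diff_add_cancel norm_triangle_le norm_triangle_ineq order_refl)
   ultimately show ?thesis by linarith
  qed
  then have "norm (z t - x *\<^sub>R axis i 1) <= 0" by (rule field_le_epsilon)
  then show ?thesis by simp
 qed
 \<comment> \<open>The limit is optimal: the superdifferential at x bounds the values at nearby
   points by a quantity tending to the value at x, and the cost is lower semicontinuous.\<close>
 have "cost t z q <= val (z t) t + e" if e: "e > 0" for e
 proof -
  have a0': "a0 : vels i x t" using a0 by simp
  define P where "P = abs (la i t x a0)"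
  have P: "P >= 0" by (simp add: P_def)
  obtain \<rho> where \<rho>: "\<rho> > 0" "!!h. abs h < \<rho> ==> val ((x + h) *\<^sub>R axis i 1) t <= val (x *\<^sub>R axis i 1) t + - la i t x a0 * h + 1 * abs h"
   using vels_superdifferential[OF t x a0' zero_less_one] by blast
  have e': "e / 2 > 0" "min \<rho> (e / (2 * (P + 1))) > 0" using e \<rho>(1) P by simp_all
  obtain N1 where N1: "ALL n>=N1. cost t z q <= cost t (y (k n)) (g (k n)) + e / 2" using lim[OF e'(1)] by blast
  obtain N2 where N2: "ALL n>=N2. abs (h (k n)) < min \<rho> (e / (2 * (P + 1)))" using small[OF e'(2)] by blast
  define n where "n = max N1 N2"
  have hk: "abs (h (k n)) < \<rho>" "abs (h (k n)) < e / (2 * (P + 1))" using N2 unfolding n_def by simp_all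
  have "cost t z q <= val ((x + h (k n)) *\<^sub>R axis i 1) t + e / 2"
   using N1 val_opt[OF yn(1)[of "k n"]] unfolding n_def yn(2) by simp
  also have "val ((x + h (k n)) *\<^sub>R axis i 1) t <= val (x *\<^sub>R axis i 1) t + - la i t x a0 * h (k n) + 1 * abs (h (k n))"
   by (rule \<rho>(2)[OF hk(1)])
  also have "- la i t x a0 * h (k n) <= P * abs (h (k n))" unfolding P_def abs_mult[symmetric] by simp
  finally have "cost t z q <= val (x *\<^sub>R axis i 1) t + (P + 1) * abs (h (k n)) + e / 2" by (simp add: distrib_right)
  moreover have "(P + 1) * abs (h (k n)) <= e / 2"
  proof -
   have "(P + 1) * abs (h (k n)) <= (P + 1) * (e / (2 * (P + 1)))" using hk(2) P by (intro mult_left_mono) simp_all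
   also have "... = e / 2" using P by (simp add: divide_simps)
   finally show ?thesis .
  qed
  ultimately show ?thesis unfolding zt by linarith
 qed
 then have "cost t z q <= val (z t) t" by (rule field_le_epsilon)
 then have zo: "opt t z q" by (rule optI[OF z _ t(1) tT(1)])
 obtain w where w: "el_arc i t (t + \<delta>) (x / 4) (3 * x) K (%s. z s $ i) w" using \<delta>(4)[of 0 z q] zo zt x by auto
 have "w t : vels i x t"
  unfolding vels_def using zo zt el_arc_vel[OF opt_traj(2)[OF zo] w c(4) \<delta>(2) c(1)] by blast
 then have wa: "w t = a0" using a0 by simp
 have e4: "e / 4 > 0" using e by simp
 obtain d where d: "d > 0" "!!a b r v s s'. el_arc i a b (x / 4) (3 * x) K r v ==> 0 <= a ==> b <= T ==> s : {a..b} ==> s' : {a..b} ==>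
  abs (s' - s) < d ==> abs (v s' - v s) < e / 4"
  by (rule el_arc_modulus[OF e4 c(1-3)]) (rule that)
 \<comment> \<open>During a time \<eta> the mean velocity differs from the initial one by at most
   e/4, so it suffices that the curves are within e/8 * \<eta> of each other at both ends.\<close>
 define \<eta> where "\<eta> = min \<delta> d / 2"
 have \<eta>: "\<eta> > 0" "\<eta> < d" "t + \<eta> : {t..t + \<delta>}" "t + \<eta> : {t..T}" using \<delta>(1,2) d(1) by (auto simp: \<eta>_def min_def)
 have lin: "abs (r (t + \<eta>) - r t - v t * \<eta>) <= e / 4 * \<eta>" if arc: "el_arc i t (t + \<delta>) (x / 4) (3 * x) K r v" for r v
 proof -
  have tt: "t : {t..t + \<delta>}" using \<delta>(1) by simp
  have "abs (r (t + \<eta>) - r t - v t * (t + \<eta> - t)) <= e / 4 * (t + \<eta> - t)"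
  proof (rule el_arc_linear[OF arc \<eta>(3)])
   fix \<sigma> assume \<sigma>: "\<sigma> : {t..t + \<eta>}"
   have "abs (v \<sigma> - v t) < e / 4" by (rule d(2)[OF arc t(1) \<delta>(2) tt]) (use \<sigma> \<eta>(2,3) in simp_all)
   then show "abs (v \<sigma> - v t) <= e / 4" by simp
  qed
  then show ?thesis by simp
 qed
 have e8: "e / 8 * \<eta> > 0" using e \<eta>(1) by simp
 obtain n where n: "!!s. s : {t..T} ==> norm (y (k n) s - z s) < e / 8 * \<eta>" using unif[OF e8] by blast
 have nn: "abs (y (k n) s $ i - z s $ i) < e / 8 * \<eta>" if "s : {t..T}" for s
  using n[OF that] nth_le_norm[of "y (k n) s - z s" i] by simp
 have "abs ((v (k n) t - w t) * \<eta>) < e * \<eta>"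
  using lin[OF vn[of "k n"]] lin[OF w] nn[OF tT(2)] nn[OF \<eta>(4)] mult_pos_pos[OF e \<eta>(1)]
  unfolding left_diff_distrib by linarith
 then have "abs (v (k n) t - w t) < e" unfolding abs_mult using \<eta>(1) by simp
 then show False using vne[of "k n"] wa by simp
qed

text \<open>The upper estimate is the superdifferential at x. The lower one is the superdifferential
  at x + h, evaluated with increment - h; its slope is close to that at x by
  \<open>vel_stability\<close>.\<close>

lemma differentiable_if_vels_singleton:
 assumes t: "0 <= t" "t < T" and x: "x > 0" and a0: "vels i x t = {a0}"
 shows "((%r. val (r *\<^sub>R axis i 1) t) has_real_derivative - la i t x a0) (at x)"
proof (rule has_real_derivativeI_eps)
 fix e :: real assume e: "e > 0"
 obtain \<delta> K where \<delta>: "\<delta> > 0" "t + \<delta> <= T" "K >= 1"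
  "!!h y g. abs h <= x / 2 ==> opt t y g ==> y t = (x + h) *\<^sub>R axis i 1 ==>
   EX v. el_arc i t (t + \<delta>) (x / 4) (3 * x) K (%s. y s $ i) v"
  by (rule local_arcs[OF t x, where i = i]) (rule that)
 have c: "x / 4 > 0" "3 * x > 0" "K >= 0" "e / 2 > 0" "t : {0..T}" "t <= T" "t : {t..t + \<delta>}" using x \<delta> e t by simp_all
 obtain \<rho> where \<rho>: "\<rho> > 0" "!!t b y g v h. opt t y g ==> 0 <= t ==> t + \<delta> <= b ==> b <= T ==>
  el_arc i t b (x / 4) (3 * x) K (%s. y s $ i) v ==> abs h < \<rho> ==>
  val ((y t $ i + h) *\<^sub>R axis i 1) t <= val (y t) t - la i t (y t $ i) (v t) * h + e / 2 * abs h"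
  by (rule superdifferential_space[OF c(1-3) \<delta>(1) c(4)]) (rule that)
 obtain d where d: "d > 0" "!!t x' a t' x'' a'. t : {0..T} ==> x' : {0..3 * x} ==> abs a <= K ==>
  t' : {0..T} ==> x'' : {0..3 * x} ==> abs a' <= K ==> abs (t' - t) < d ==> abs (x'' - x') < d ==> abs (a' - a) < d ==>
  abs (la i t' x'' a' - la i t x' a) < e / 2"
  by (rule compact_uniform[OF la_cont c(4)]) (rule that)
 obtain d' where d': "d' > 0" "!!h y g v. abs h < d' ==> opt t y g ==> y t = (x + h) *\<^sub>R axis i 1 ==>
  el_arc i t (t + \<delta>) (x / 4) (3 * x) K (%s. y s $ i) v ==> abs (v t - a0) < d"
 proof -
  have "EX d'>0. ALL h y g v. abs h < d' --> opt t y g --> y t = (x + h) *\<^sub>R axis i 1 -->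
   el_arc i t (t + \<delta>) (x / 4) (3 * x) K (%s. y s $ i) v --> abs (v t - a0) < d"
   by (rule vel_stability[OF t x a0 d(1) \<delta>])
  then show ?thesis using that by blast
 qed
 obtain \<rho>1 where \<rho>1: "\<rho>1 > 0" "!!h. abs h < \<rho>1 ==> val ((x + h) *\<^sub>R axis i 1) t <= val (x *\<^sub>R axis i 1) t + - la i t x a0 * h + e * abs h"
  using vels_superdifferential[OF t x _ e, of a0 i] a0 by blast
 have aK: "abs a0 <= K"
 proof -
  have xj: "x *\<^sub>R axis i 1 : junction" by (rule axis_in_junction) (use x in simp)
  obtain y g where y: "opt t y g" "y t = x *\<^sub>R axis i 1" by (rule exists_opt[OF t(1) c(6) xj]) (rule that)
  obtain v where v: "el_arc i t (t + \<delta>) (x / 4) (3 * x) K (%s. y s $ i) v" using \<delta>(4)[of 0 y g] y x by auto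
  have "v t : vels i x t"
   unfolding vels_def using y el_arc_vel[OF opt_traj(2)[OF y(1)] v _ \<delta>(2) c(1)] \<delta>(1) by auto
  then show ?thesis using a0 el_arcD(5)[OF v c(7)] by simp
 qed
 show "EX \<rho>>0. ALL h. abs h < \<rho> --> abs (val ((x + h) *\<^sub>R axis i 1) t - val (x *\<^sub>R axis i 1) t - - la i t x a0 * h) <= e * abs h"
 proof (intro exI conjI allI impI)
  show "min (min \<rho> \<rho>1) (min (x / 2) (min d d')) > 0" using \<rho>(1) \<rho>1(1) x d(1) d'(1) by simp
  fix h assume "abs h < min (min \<rho> \<rho>1) (min (x / 2) (min d d'))"
  then have h: "abs h < \<rho>1" "abs (- h) < \<rho>" "abs h < x / 2" "abs h < d" "abs h < d'" "abs h <= x / 2" by simp_all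
  have xj: "(x + h) *\<^sub>R axis i 1 : junction" by (rule axis_in_junction) (use x h(3) in \<open>simp add: abs_less_iff\<close>)
  obtain y g where y: "opt t y g" "y t = (x + h) *\<^sub>R axis i 1" by (rule exists_opt[OF t(1) c(6) xj]) (rule that)
  obtain v where v: "el_arc i t (t + \<delta>) (x / 4) (3 * x) K (%s. y s $ i) v" using \<delta>(4)[OF h(6) y] by blast
  have yi: "y t $ i = x + h" unfolding y(2) scaleR_axis_nth by simp
  have "val ((y t $ i + - h) *\<^sub>R axis i 1) t <= val (y t) t - la i t (y t $ i) (v t) * - h + e / 2 * abs (- h)"
   by (rule \<rho>(2)[OF y(1) t(1) order_refl \<delta>(2) v h(2)])
  then have 1: "val (x *\<^sub>R axis i 1) t <= val ((x + h) *\<^sub>R axis i 1) t + la i t (x + h) (v t) * h + e / 2 * abs h"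
   unfolding yi unfolding y(2) by simp
  have xh: "x : {0..3 * x}" "x + h : {0..3 * x}" unfolding atLeastAtMost_iff using h(3) x by linarith+
  have "abs (la i t (x + h) (v t) - la i t x a0) < e / 2"
   by (rule d(2)[OF c(5) xh(1) aK c(5) xh(2) el_arcD(5)[OF v c(7)] _ _ d'(2)[OF h(5) y v]])
    (use h(4) d(1) in simp_all)
  then have "abs (la i t (x + h) (v t) - la i t x a0) * abs h <= e / 2 * abs h" by (intro mult_right_mono) simp_all
  then have "la i t (x + h) (v t) * h - la i t x a0 * h <= e / 2 * abs h" unfolding abs_mult[symmetric] left_diff_distrib by linarith
  then show "abs (val ((x + h) *\<^sub>R axis i 1) t - val (x *\<^sub>R axis i 1) t - - la i t x a0 * h) <= e * abs h"
   using 1 \<rho>1(2)[OF h(1)] by (simp add: abs_le_iff)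
 qed
qed

text \<open>Every slope coming from an initial velocity equals the derivative, and la is injective
  in the velocity.\<close>

lemma vels_eq_if_differentiable:
 assumes t: "0 <= t" "t < T" and x: "x > 0"
  and D: "((%r. val (r *\<^sub>R axis i 1) t) has_real_derivative D) (at x)"
 shows "vels i x t = {a. la i t x a = - D}" "EX a. vels i x t = {a}"
proof -
 have tT: "t : {0..T}" "x >= 0" using t x by simp_all
 obtain a where a: "a : vels i x t" using vels_nonempty[OF t x, of i] by blast
 have la: "la i t x b = - D" if "b : vels i x t" for b by (rule la_eq_if_differentiable[OF t x that D])
 have eq: "b = a" if "la i t x b = - D" for b by (rule la_inj[OF tT, where i = i]) (use that la[OF a] in simp)
 show "vels i x t = {a. la i t x a = - D}" using la eq a by blast
 show "EX a. vels i x t = {a}" using la eq a by blast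
qed

text \<open>An envelope argument. The maximiser b q solves \<open>la i t x (b q) = - q\<close>.
  Testing each supremum with the other's maximiser puts the increment of H between - a * h and - b
  (D + h) * h, and b is continuous by \<open>la_modulus\<close>.\<close>

lemma hamiltonian_deriv:
 assumes t: "t : {0..T}" and x: "x >= 0" and a: "la i t x a = - D"
 shows "((%q. SUP \<zeta>. - q * \<zeta> - l i t x \<zeta>) has_real_derivative - a) (at D)"
proof -
 have R: "x + 1 > 0" "x : {0..x + 1}" using x by simp_all
 have "EX b. la i t x b = - q" for q
 proof -
  have P: "abs q >= 0" "abs (- q) <= abs q" by simp_all
  obtain K where "K >= 1" "!!i t x' a. t : {0..T} ==> x' : {0..x + 1} ==> abs (la i t x' a) <= abs q ==> abs a <= K"
   "!!i t x' \<pi>. t : {0..T} ==> x' : {0..x + 1} ==> abs \<pi> <= abs q ==> EX a. la i t x' a = \<pi>"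
   by (rule la_bounded_inverse[OF R(1) P(1)]) (rule that)
  from this(3)[OF t R(2) P(2)] show ?thesis by blast
 qed
 then have "ALL q. EX b. la i t x b = - q" by blast
 from choice[OF this] obtain b where b: "!!q. la i t x (b q) = - q" by blast
 have bD: "b D = a" by (rule la_inj[OF t x, where i = i]) (simp add: a b)
 define H where "H q = (SUP \<zeta>. - q * \<zeta> - l i t x \<zeta>)" for q
 have max: "- q * \<zeta> - l i t x \<zeta> <= - q * b q - l i t x (b q)" for q \<zeta>
  using convex_tangent[OF t x, of i "b q" \<zeta>] unfolding b by (simp add: algebra_simps)
 have H: "H q = - q * b q - l i t x (b q)" for q
  unfolding H_def by (rule cSup_eq_maximum) (use max in auto)
 have Hle: "- q * \<zeta> - l i t x \<zeta> <= H q" for q \<zeta> unfolding H by (rule max)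
 have "(H has_real_derivative - a) (at D)"
 proof (rule has_real_derivativeI_eps)
  fix e :: real assume e: "e > 0"
  have P: "abs D + 1 >= 0" by simp
  obtain K where K: "K >= 1" "!!i t x' a. t : {0..T} ==> x' : {0..x + 1} ==> abs (la i t x' a) <= abs D + 1 ==> abs a <= K"
   "!!i t x' \<pi>. t : {0..T} ==> x' : {0..x + 1} ==> abs \<pi> <= abs D + 1 ==> EX a. la i t x' a = \<pi>"
   by (rule la_bounded_inverse[OF R(1) P]) (rule that)
  have K0: "K >= 0" using K(1) by simp
  have bK: "abs (b q) <= K" if "abs (q - D) < 1" for q
   by (rule K(2)[OF t R(2), of i]) (use that in \<open>simp add: b\<close>)
  obtain d where d: "d > 0" "!!t x' a t' x'' a'. t : {0..T} ==> x' : {0..x + 1} ==> abs a <= K ==>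
   t' : {0..T} ==> x'' : {0..x + 1} ==> abs a' <= K ==> abs (t' - t) < d ==> abs (x'' - x') < d ==> abs (la i t' x'' a' - la i t x' a) < d ==>
   abs (a' - a) < e"
   by (rule la_modulus[OF e R(1) K0]) (rule that)
  show "EX \<rho>>0. ALL h. abs h < \<rho> --> abs (H (D + h) - H D - - a * h) <= e * abs h"
  proof (intro exI conjI allI impI)
   show "min 1 d > 0" using d(1) by simp
   fix h assume "abs h < min 1 d"
   then have h: "abs h < 1" "abs h < d" by simp_all
   have "abs (b (D + h) - b D) < e"
    by (rule d(2)[OF t R(2) bK t R(2) bK]) (use h d(1) in \<open>simp_all add: b\<close>)
   then have "abs (b (D + h) - a) * abs h <= e * abs h" unfolding bD by (intro mult_right_mono) simp_all
   then have 1: "abs (b (D + h) * h - a * h) <= e * abs h" unfolding abs_mult[symmetric] left_diff_distrib .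
   have "- (D + h) * a - l i t x a <= H (D + h)" by (rule Hle)
   then have 2: "H D - a * h <= H (D + h)" unfolding H[of D] bD by (simp add: algebra_simps)
   have "- D * b (D + h) - l i t x (b (D + h)) <= H D" by (rule Hle)
   then have 3: "H (D + h) + b (D + h) * h <= H D" unfolding H[of "D + h"] by (simp add: algebra_simps)
   show "abs (H (D + h) - H D - - a * h) <= e * abs h" using 1 2 3 by (simp add: abs_le_iff)
  qed
 qed
 then show ?thesis unfolding H_def[abs_def] .
qed

text \<open>On the junction, f is the norm of y on edge i and minus the norm on the other edges, so
  it vanishes only at the vertex; a change of edge would contradict the intermediate value
  theorem.\<close>

lemma stays_on_edge:
 fixes y :: "real => real^'n"
 assumes c: "continuous_on {t..s} y" and j: "!!\<tau>. \<tau> : {t..s} ==> y \<tau> : junction"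
  and nz: "!!\<tau>. \<tau> : {t..s} ==> y \<tau> ~= 0" and i: "y t $ i > 0" and \<tau>: "\<tau> : {t..s}"
 shows "y \<tau> $ i > 0"
proof (rule ccontr)
 assume neg: "~ y \<tau> $ i > 0"
 define f where "f \<sigma> = 2 * (y \<sigma> $ i) - (\<Sum>k\<in>UNIV. y \<sigma> $ k)" for \<sigma>
 have f: "f \<sigma> = 2 * (y \<sigma> $ i) - norm (y \<sigma>)" if "\<sigma> : {t..s}" for \<sigma>
  unfolding f_def junction_norm_sum[OF j[OF that]] ..
 have sub: "{t..\<tau>} \<subseteq> {t..s}" "t <= \<tau>" "t : {t..s}" using \<tau> by simp_all
 have "f t > 0" using f[OF sub(3)] junction_norm_nth[OF j[OF sub(3)] i] i by simp
 moreover have "f \<tau> <= 0" using f[OF \<tau>] neg norm_ge_zero[of "y \<tau>"] by linarith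
 moreover have "continuous_on {t..\<tau>} f" unfolding f_def[abs_def]
  by (intro continuous_intros continuous_on_component continuous_on_subset[OF c sub(1)])
 ultimately obtain \<sigma> where \<sigma>: "\<sigma> : {t..\<tau>}" "f \<sigma> = 0"
  using IVT2'[of f \<tau> 0 t] sub(2) by auto
 have \<sigma>s: "\<sigma> : {t..s}" using \<sigma>(1) sub(1) by blast
 have n0: "norm (y \<sigma>) > 0" using nz[OF \<sigma>s] by simp
 have "y \<sigma> $ i > 0" using f[OF \<sigma>s] \<sigma>(2) n0 by linarith
 then show False using f[OF \<sigma>s] \<sigma>(2) junction_norm_nth[OF j[OF \<sigma>s]] by simp
qed

text \<open>Any minimiser z from \<open>y s\<close> pasted to y is optimal from an earlier time,
  hence C1 across s. So the initial velocity of z is the left derivative of y at s, which does not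
  depend on z.\<close>

lemma interior_velocity:
 assumes y: "opt t y g" and t: "0 <= t" "t < s" "s < T" and pos: "!!\<tau>. \<tau> : {t..s} ==> y \<tau> $ i > 0"
 obtains a where "((%\<sigma>. y \<sigma> $ i) has_real_derivative a) (at s)"
  "!!z h. opt s z h ==> z s = y s ==> (z has_vector_derivative a *\<^sub>R axis i 1) (at s within {s..T})"
proof -
 note yp = opt_traj(2)[OF y]
 have ts: "t <= s" "s <= T" "0 <= s" "{t..s} ~= {}" "t : {t..s}" using t by simp_all
 have c: "continuous_on {t..s} (%\<tau>. y \<tau> $ i)"
  by (rule continuous_on_component[OF continuous_on_subset[OF primitive_on_continuous[OF ptrajD(1)[OF yp]]]]) (use t in simp)
 obtain \<tau>1 where \<tau>1: "\<tau>1 : {t..s}" "!!\<tau>. \<tau> : {t..s} ==> y \<tau>1 $ i <= y \<tau> $ i"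
  using continuous_attains_inf[OF compact_Icc ts(4) c] by blast
 obtain \<tau>2 where \<tau>2: "\<tau>2 : {t..s}" "!!\<tau>. \<tau> : {t..s} ==> y \<tau> $ i <= y \<tau>2 $ i"
  using continuous_attains_sup[OF compact_Icc ts(4) c] by blast
 define x0 where "x0 = y \<tau>1 $ i"
 define R where "R = y \<tau>2 $ i"
 have x0: "x0 > 0" "R >= x0" "T - s > 0" "x0 / 2 > 0" using pos[OF \<tau>1(1)] \<tau>1(2)[OF \<tau>2(1)] t by (simp_all add: x0_def R_def)
 obtain \<delta> K where \<delta>: "\<delta> > 0" "\<delta> <= T - s" "K >= 1"
  "!!t y g. opt t y g ==> 0 <= t ==> t + (T - s) <= T ==> x0 <= y t $ i ==> y t $ i <= R ==>
   EX v. el_arc i t (t + \<delta>) (x0 / 2) (R + x0) K (%s. y s $ i) v"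
  by (rule optimal_regular[OF x0(1-3), where i = i]) (rule that)
 \<comment> \<open>The \<delta> found is common to all positions taken on {t..s}; restarting at most
   \<delta>/2 before s puts s in the interior of a regular arc.\<close>
 define t1 where "t1 = max t (s - \<delta> / 2)"
 have t1: "t <= t1" "t1 < s" "s < t1 + \<delta>" "t1 : {t..s}" "0 <= t1" "t1 <= T" "t1 + (T - s) <= T" "t1 + \<delta> <= T"
  using t \<delta>(1,2) unfolding t1_def by (simp_all add: max_def split: if_splits)
 have key: "EX a. ((%\<sigma>. paste s y z \<sigma> $ i) has_real_derivative a) (at s) &
   ((%\<sigma>. y \<sigma> $ i) has_real_derivative a) (at s within {t1..s}) &
   (z has_vector_derivative a *\<^sub>R axis i 1) (at s within {s..T})" if z: "opt s z h" "z s = y s" for z h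
 proof -
  define Y where "Y = paste s y z"
  have Yo: "opt t1 Y (paste s g h)" unfolding Y_def
   by (rule opt_restrict(1)[OF opt_concat[OF y z t(1) ts(1,2)] t(1) t1(1,6)])
  have Y1: "Y \<sigma> = y \<sigma>" if "\<sigma> <= s" for \<sigma> using that by (simp add: Y_def paste_def)
  have Y2: "Y \<sigma> = z \<sigma>" if "s <= \<sigma>" for \<sigma> using that z(2) by (simp add: Y_def paste_def)
  have Yt: "Y t1 = y t1" by (rule Y1) (use t1 in simp)
  have "EX v. el_arc i t1 (t1 + \<delta>) (x0 / 2) (R + x0) K (%s. Y s $ i) v"
   by (rule \<delta>(4)[OF Yo t1(5,7)]) (unfold Yt, use \<tau>1(2)[OF t1(4)] \<tau>2(2)[OF t1(4)] in \<open>simp_all add: x0_def R_def\<close>)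
  then obtain v where v: "el_arc i t1 (t1 + \<delta>) (x0 / 2) (R + x0) K (%s. Y s $ i) v" by blast
  have s1: "s : {t1..t1 + \<delta>}" "{t1..s} \<subseteq> {t1..t1 + \<delta>}" "s : {t1..s}" using t1 by simp_all
  have dw: "((%s. Y s $ i) has_real_derivative v s) (at s within {t1..t1 + \<delta>})" by (rule el_arc_deriv[OF v s1(1)])
  then have 1: "((%s. Y s $ i) has_real_derivative v s) (at s)" using t1(2,3) by (simp add: at_within_Icc_at)
  have 2: "((%\<sigma>. y \<sigma> $ i) has_real_derivative v s) (at s within {t1..s})"
   by (rule has_field_derivative_transform_within[OF DERIV_subset[OF dw s1(2)] zero_less_one s1(3)]) (simp add: Y1)
  have "el_arc i s (t1 + \<delta>) (x0 / 2) (R + x0) K (%s. Y s $ i) v" by (rule el_arc_sub[OF v less_imp_le[OF t1(2)] order_refl])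
  then have "(Y has_vector_derivative v s *\<^sub>R axis i 1) (at s within {s..T})"
   by (rule el_arc_vel[OF ptraj_sub[OF opt_traj(2)[OF Yo] less_imp_le[OF t1(2)] order_refl] _ t1(3,8) x0(4)])
  then have 3: "(z has_vector_derivative v s *\<^sub>R axis i 1) (at s within {s..T})"
   by (rule has_vector_derivative_transform[rotated 2]) (use ts Y2 in simp_all)
  show ?thesis using 1 2 3 unfolding Y_def by blast
 qed
 \<comment> \<open>Pasting y to itself gives the two-sided derivative of y at s.\<close>
 have pyy: "paste s y y = y" by (rule ext) (simp add: paste_def)
 have ys: "opt s y g" by (rule opt_restrict(1)[OF y t(1) ts(1,2)])
 obtain a where a: "((%\<sigma>. y \<sigma> $ i) has_real_derivative a) (at s)" using key[OF ys refl] unfolding pyy by blast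
 show ?thesis
 proof (rule that[OF a])
  fix z h assume z: "opt s z h" "z s = y s"
  obtain b where b: "((%\<sigma>. y \<sigma> $ i) has_real_derivative b) (at s within {t1..s})"
   "(z has_vector_derivative b *\<^sub>R axis i 1) (at s within {s..T})" using key[OF z] by blast
  have nb: "at s within {t1..s} ~= bot" using t1(2) by (simp add: at_within_Icc_at_left)
  have "a = b" by (rule vector_derivative_unique_within[OF nb has_field_derivative_at_within[OF a, unfolded has_real_derivative_iff_has_vector_derivative]
   b(1)[unfolded has_real_derivative_iff_has_vector_derivative]])
  then show "(z has_vector_derivative a *\<^sub>R axis i 1) (at s within {s..T})" using b(2) by simp
 qed
qed

end

section \<open>Relaxed equilibria\<close>

lemma primitive_on_unique_AE_vec:
 fixes f :: "real => 'a::euclidean_space"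
 assumes 1: "primitive_on a b f g" and 2: "primitive_on a b f g'"
 shows "AE s in lebesgue. s : {a..b} --> g s = g' s"
proof -
 have "AE s in lebesgue. ALL e:Basis. s : {a..b} --> g s \<bullet> e = g' s \<bullet> e"
  by (rule AE_finite_allI[OF finite_Basis])
   (rule primitive_on_unique_AE[OF primitive_on_inner[OF 1] primitive_on_inner[OF 2]])
 then show ?thesis by eventually_elim (auto intro: euclidean_eqI)
qed

lemma absolutely_integrable_iff_lebesgue_on_Ioo:
 fixes f :: "real => 'a::euclidean_space"
 shows "f absolutely_integrable_on {t..T} \<longleftrightarrow> integrable (lebesgue_on {t<..<T}) f"
proof -
 have "f absolutely_integrable_on {t..T} \<longleftrightarrow> f absolutely_integrable_on {t<..<T}" by (rule absolutely_integrable_on_Icc_iff_Ioo)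
 also have "... \<longleftrightarrow> integrable (lebesgue_on {t<..<T}) f" unfolding set_integrable_def by (simp add: integrable_restrict_space)
 finally show ?thesis .
qed

lemma in_Lp_integrable:
 fixes g :: "real => 'a::euclidean_space"
 assumes g: "in_Lp p t T g" and p: "p > 1"
 shows "integrable (lebesgue_on {t<..<T}) g" "(%s. norm (g s) powr p) integrable_on {t..T}"
proof -
 have m: "g : borel_measurable (lebesgue_on {t<..<T})" and i: "integrable (lebesgue_on {t<..<T}) (%s. norm (g s) powr p)"
  using g unfolding in_Lp_def by blast+
 have c: "integrable (lebesgue_on {t<..<T}) (%s. 1 :: real)"
  unfolding absolutely_integrable_iff_lebesgue_on_Ioo[symmetric]
  by (rule absolutely_integrable_continuous_real) (rule continuous_on_const)
 show "integrable (lebesgue_on {t<..<T}) g"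
 proof (rule Bochner_Integration.integrable_bound[OF Bochner_Integration.integrable_add[OF c i] m])
  show "AE s in lebesgue_on {t<..<T}. norm (g s) <= norm (1 + norm (g s) powr p)"
  proof (rule AE_I2)
   show "norm (g s) <= norm (1 + norm (g s) powr p)" for s
    using le_add_powr[OF norm_ge_zero[of "g s"] zero_less_one p] by simp
  qed
 qed
 show "(%s. norm (g s) powr p) integrable_on {t..T}"
  using i unfolding absolutely_integrable_iff_lebesgue_on_Ioo[symmetric] by (simp add: absolutely_integrable_on_def)
qed

text \<open>Whichever representative the choice in \<open>wderiv\<close> picks, it is an integrable
  weak derivative and hence a density of f.\<close>

lemma primitive_on_wderiv:
 assumes t: "t < T" and f: "primitive_on t T f g"
 shows "primitive_on t T f (wderiv t T f)"
proof -
 have "integrable (lebesgue_on {t<..<T}) g & has_weak_deriv t T f g"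
  using primitive_on_abs[OF f] primitive_on_imp_weak_deriv[OF less_imp_le[OF t] f]
  unfolding absolutely_integrable_iff_lebesgue_on_Ioo by blast
 then have "integrable (lebesgue_on {t<..<T}) (wderiv t T f) & has_weak_deriv t T f (wderiv t T f)"
  unfolding wderiv_def by (rule someI[where P = "%g. integrable (lebesgue_on {t<..<T}) g & has_weak_deriv t T f g"])
 then show ?thesis using weak_deriv_imp_primitive_on[OF t primitive_on_continuous[OF f]] by blast
qed

lemma GamD:
 assumes y: "y : Gam p T t x" and t: "t < T" and p: "p > 1"
 shows "primitive_on t T y (wderiv t T y)" "(%s. norm (wderiv t T y s) powr p) integrable_on {t..T}"
  "!!s. s : {t..T} ==> y s : junction" "y t = x" "y : extensional {t..T}" "continuous_on {t..T} y"
proof -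
 show c: "continuous_on {t..T} y" and "y t = x" "y : extensional {t..T}" "!!s. s : {t..T} ==> y s : junction"
  using y unfolding Gam_def by blast+
 obtain g where g: "in_Lp p t T g" "has_weak_deriv t T y g" using y unfolding Gam_def in_W1p_def by blast
 have yg: "primitive_on t T y g" by (rule weak_deriv_imp_primitive_on[OF t c g(2) in_Lp_integrable(1)[OF g(1) p]])
 show yw: "primitive_on t T y (wderiv t T y)" by (rule primitive_on_wderiv[OF t yg])
 have "AE s in lebesgue. s : {t..T} --> norm (g s) powr p = norm (wderiv t T y s) powr p"
  using primitive_on_unique_AE_vec[OF yg yw] by eventually_elim simp
 from integral_cong_AE_lebesgue(2)[OF this] in_Lp_integrable(2)[OF g(1) p]
 show "(%s. norm (wderiv t T y s) powr p) integrable_on {t..T}" by blast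
qed

lemma GamI:
 assumes y: "primitive_on t T y g" and gp: "(%s. norm (g s) powr p) integrable_on {t..T}"
  and j: "!!s. s : {t..T} ==> y s : junction" and t: "t < T" and p: "p > 1"
 shows "restrict y {t..T} : Gam p T t (y t)"
proof -
 let ?y = "restrict y {t..T}"
 have y': "primitive_on t T ?y g" by (rule primitive_on_cong_AE[OF y negligible_empty]) simp_all
 note c = primitive_on_continuous[OF y']
 have Lp: "in_Lp p t T h" if "h absolutely_integrable_on {t..T}" "(%s. norm (h s) powr p) absolutely_integrable_on {t..T}" for h :: "real => real^'n"
  using that borel_measurable_integrable unfolding in_Lp_def absolutely_integrable_iff_lebesgue_on_Ioo by blast
 have "in_Lp p t T g" by (rule Lp[OF primitive_on_abs[OF y] nonnegative_absolutely_integrable_1[OF gp]]) simp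
 moreover have "continuous_on {t..T} (%s. norm (?y s) powr p)"
  using p by (intro continuous_on_powr' continuous_on_norm c continuous_on_const) simp_all
 then have "in_Lp p t T ?y" by (intro Lp absolutely_integrable_continuous_real c)
 ultimately have "in_W1p p t T ?y"
  unfolding in_W1p_def using primitive_on_imp_weak_deriv[OF less_imp_le[OF t] y'] by blast
 moreover have "?y ` {t..T} \<subseteq> junction" using j by auto
 moreover have "?y t = y t" using t by simp
 ultimately show ?thesis unfolding Gam_def using c restrict_extensional by blast
qed

lemma jdist_zero: "x : junction ==> jdist 0 x = norm x"
 unfolding jdist_def by simp

lemma jdist_nonneg: "0 <= jdist x y"
 unfolding jdist_def by simp

text \<open>For points of different edges, each coordinate vector is orthogonal to the other, so
  each of the two norms is at most their distance.\<close>

lemma jdist_le: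
 assumes x: "x : junction" and y: "y : junction"
 shows "jdist x y <= 2 * norm (x - y)"
proof (cases "EX i. x : edge i & y : edge i")
 case True
 then have "jdist x y = norm (x - y)" unfolding jdist_def by (rule if_P)
 then show ?thesis by simp
next
 case False
 have *: "norm x <= norm (x - y)" if x: "x : edge i" and y: "y : edge j" and ij: "i ~= j" for x y :: "real^'n" and i j
 proof -
  obtain r where r: "x = r *\<^sub>R axis i 1" "r >= 0" using x unfolding edge_def by blast
  have "y $ i = 0" using y ij unfolding edge_iff by blast
  then have "(x - y) $ i = r" using r(1) by (simp add: scaleR_axis_nth)
  moreover have "norm x = abs r" unfolding r(1) by (rule norm_scaleR_axis)
  ultimately show ?thesis using component_le_norm_cart[of "x - y" i] by simp
 qed
 obtain i j where ij: "x : edge i" "y : edge j" using x y unfolding junction_iff by blast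
 then have ne: "i ~= j" using False by blast
 have "norm x <= norm (x - y)" by (rule *[OF ij ne])
 moreover have "norm y <= norm (y - x)" by (rule *[OF ij(2,1)]) (use ne in simp)
 moreover have "jdist x y = norm x + norm y" unfolding jdist_def using False by (rule if_not_P)
 ultimately show ?thesis by (simp add: norm_minus_commute)
qed

lemma continuous_on_junction_measurable:
 fixes f :: "real^'n => real"
 assumes f: "continuous_on junction f"
 shows "f : borel_measurable (borel_of junction_top)"
proof (rule borel_measurableI)
 fix U :: "real set" assume "open U"
 then have "openin junction_top (junction \<inter> f -` U)" by (rule continuous_openin_preimage_gen[OF f])
 moreover have "space (borel_of (junction_top :: (real^'n) topology)) = junction"
  unfolding borel_of_def by (simp add: space_measure_of_conv)
 moreover have "{U :: (real^'n) set. openin junction_top U} \<subseteq> Pow junction" using openin_imp_subset by blast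
 then have "sets (borel_of (junction_top :: (real^'n) topology)) = sigma_sets junction {U. openin junction_top U}"
  unfolding borel_of_def topspace_euclidean_subtopology by (rule sets_measure_of)
 ultimately show "f -` U \<inter> space (borel_of junction_top) : sets (borel_of junction_top)"
  by (simp add: Int_commute sigma_sets.Basic)
qed

lemma jdist_lipschitz_continuous:
 fixes f :: "real^'n => real"
 assumes "!!x y. x : junction ==> y : junction ==> abs (f x - f y) <= jdist x y"
 shows "continuous_on junction f"
 unfolding continuous_on_iff dist_norm
proof (intro ballI allI impI)
 fix x :: "real^'n" and e :: real assume x: "x : junction" and e: "e > 0"
 show "EX d>0. ALL x':junction. norm (x' - x) < d --> norm (f x' - f x) < e"
 proof (intro exI[of _ "e / 2"] conjI ballI impI)
  fix y assume y: "y : junction" and n: "norm (y - x) < e / 2"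
  show "norm (f y - f x) < e" using assms[OF y x] jdist_le[OF y x] n by simp
 qed (use e in simp)
qed

lemma Gam_C_D:
 assumes y: "y : Gam_C p T C" and T: "T > 0" and p: "p > 1"
 shows "primitive_on 0 T y (wderiv 0 T y)" "(%s. norm (wderiv 0 T y s) powr p) integrable_on {0..T}"
  "!!s. s : {0..T} ==> y s : junction" "!!s. s : {0..T} ==> norm (y s) <= C"
  "integral {0..T} (%s. norm (wderiv 0 T y s) powr p) <= C powr p"
proof -
 obtain x where x: "y : Gam p T 0 x" and Linf: "Linf_norm 0 T y <= ereal C" and Lp: "Lp_norm p 0 T (wderiv 0 T y) <= C"
  using y unfolding Gam_C_def Gam_C_at_def by blast
 note G = GamD[OF x T p]
 show "primitive_on 0 T y (wderiv 0 T y)" by (rule G(1))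
 show wp: "(%s. norm (wderiv 0 T y s) powr p) integrable_on {0..T}" by (rule G(2))
 show "!!s. s : {0..T} ==> y s : junction" by (rule G(3))
 show "norm (y s) <= C" if s: "s : {0..T}" for s
 proof -
  \<comment> \<open>The excess over C vanishes a.e.; being continuous and nonnegative with integral
    zero, it vanishes everywhere.\<close>
  define h where "h s = max 0 (norm (y s) - C)" for s
  have hc: "continuous_on {0..T} h" unfolding h_def[abs_def] by (intro continuous_intros G(6))
  have "AE s in lebesgue_on {0<..<T}. ereal (norm (y s)) <= Linf_norm 0 T y" unfolding Linf_norm_def by (rule esssup_AE)
  then have "AE s in lebesgue_on {0<..<T}. norm (y s) <= C"
  proof eventually_elim
   case (elim s)
   then have "ereal (norm (y s)) <= ereal C" using Linf by (rule order_trans)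
   then show ?case by simp
  qed
  then have "AE s in lebesgue. s : {0<..<T} --> norm (y s) <= C" by (simp add: AE_restrict_space_iff)
  then have "AE s in lebesgue. s : {0<..<T} --> h s = 0" by eventually_elim (simp add: h_def)
  from integral_cong_AE_lebesgue(1)[OF this] have "integral {0<..<T} h = 0" by simp
  then have "integral {0..T} h = 0" using integral_open_interval_real[of 0 T h] by simp
  then have "h s = 0" using integral_eq_0_iff[OF hc T] s by (simp add: h_def)
  then show ?thesis by (simp add: h_def max_def split: if_splits)
 qed
 define I where "I = integral {0..T} (%s. norm (wderiv 0 T y s) powr p)"
 have I0: "I >= 0" unfolding I_def by (rule integral_nonneg[OF wp]) simp
 have "(%s. norm (wderiv 0 T y s) powr p) absolutely_integrable_on {0..T}" by (rule nonnegative_absolutely_integrable_1[OF wp]) simp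
 from lebesgue_on_Ioo_integral[OF this] have "I powr (1 / p) <= C" using Lp unfolding Lp_norm_def I_def by simp
 then have "(I powr (1 / p)) powr p <= C powr p" using p by (intro powr_mono2) simp_all
 then show "integral {0..T} (%s. norm (wderiv 0 T y s) powr p) <= C powr p"
  using I0 p by (simp add: powr_powr I_def)
qed

lemma Gam_C_equicontinuous:
 assumes T: "T > 0" and p: "p > 1" and e: "e > 0"
 obtains d where "d > 0" "!!y s t. y : Gam_C p T C ==> s : {0..T} ==> t : {0..T} ==> abs (t - s) < d ==> norm (y t - y s) < e"
proof -
 define c where "c = e / (4 * (C powr p + 1))"
 have C1: "C powr p + 1 > 0" by (simp add: add_nonneg_pos)
 have c: "c > 0" "c * C powr p <= e / 4"
 proof -
  show "c > 0" using e C1 by (simp add: c_def)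
  then have "c * C powr p <= c * (C powr p + 1)" by simp
  also have "... = e / 4" using C1 by (simp add: c_def divide_simps)
  finally show "c * C powr p <= e / 4" .
 qed
 define K where "K = c powr (1 / (1 - p))"
 have K: "K > 0" "K powr (1 - p) = c" using c(1) p by (simp_all add: K_def powr_powr)
 have *: "norm (y t - y s) < e" if y: "y : Gam_C p T C" and st: "0 <= s" "s <= t" "t <= T" "t - s < e / (4 * K)" for y :: "real => real^'n" and s t
 proof -
  note G = Gam_C_D[OF y T p]
  have i: "(%s. norm (wderiv 0 T y s) powr p) integrable_on {s..t}"
   by (rule integrable_on_subinterval[OF G(2)]) (use st in simp)
  have "norm (y t - y s) <= integral {s..t} (%x. norm (wderiv 0 T y x))"
   by (rule primitive_on_norm_diff_le[OF G(1) st(1-3)])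
  also have "... <= K * (t - s) + K powr (1 - p) * integral {s..t} (%x. norm (wderiv 0 T y x) powr p)"
   by (rule integral_norm_le_powr[OF primitive_on_integrable(1)[OF G(1) st(1,3)] i p K(1) st(2)])
  also have "... <= e / 4 + e / 4"
  proof (rule add_mono)
   show "K * (t - s) <= e / 4" using st(4) K(1) by (simp add: field_simps)
   have "integral {s..t} (%x. norm (wderiv 0 T y x) powr p) <= integral {0..T} (%x. norm (wderiv 0 T y x) powr p)"
    by (rule integral_subset_le[OF _ i G(2)]) (use st in simp_all)
   then have "c * integral {s..t} (%x. norm (wderiv 0 T y x) powr p) <= c * C powr p"
    using G(5) c(1) by (intro mult_left_mono) linarith+
   then show "K powr (1 - p) * integral {s..t} (%x. norm (wderiv 0 T y x) powr p) <= e / 4"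
    unfolding K(2) using c(2) by linarith
  qed
  also have "... < e" using e by simp
  finally show ?thesis .
 qed
 show ?thesis
 proof (rule that[of "e / (4 * K)"])
  show "e / (4 * K) > 0" using e K(1) by simp
  fix y :: "real => real^'n" and s t
  assume y: "y : Gam_C p T C" and st: "s : {0..T}" "t : {0..T}" "abs (t - s) < e / (4 * K)"
  show "norm (y t - y s) < e"
   using *[OF y, of s t] *[OF y, of t s] st by (cases "s <= t") (simp_all add: norm_minus_commute)
 qed
qed

text \<open>Evaluation at t does not increase the supremum distance, so the preimages of open sets
  are open.\<close>

lemma eval_measurable:
 fixes \<mu> :: "(real => real^'n) measure"
 assumes \<mu>: "sets \<mu> = sets (borel_of (curve_top T S))" and t: "t : {0..T}"
  and j: "!!y. y : S ==> y t : junction"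
 shows "(%y. y t) : measurable \<mu> (borel_of junction_top)" "space \<mu> \<subseteq> S"
proof -
 let ?F = "cfunspace (top_of_set {0..T}) (euclidean_metric :: (real^'n) metric)"
 let ?X = "curve_top T S"
 have sp: "space \<mu> = topspace ?X"
  using sets_eq_imp_space_eq[OF \<mu>] unfolding borel_of_def by (simp add: space_measure_of_conv)
 have tX: "topspace ?X = mspace ?F \<inter> S" unfolding curve_top_def topspace_subtopology topspace_mtopology_of ..
 show "space \<mu> \<subseteq> S" unfolding sp tX by blast
 have st: "sets \<mu> = sigma_sets (topspace ?X) {U. openin ?X U}"
  unfolding \<mu> borel_of_def by (rule sets_measure_of) (use openin_subset in blast)
 show "(%y. y t) : measurable \<mu> (borel_of junction_top)"
  unfolding borel_of_def
 proof (rule measurable_measure_of)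
  show "{U. openin junction_top U} \<subseteq> Pow (topspace junction_top)" using openin_subset by blast
  show "(%y. y t) : space \<mu> \<rightarrow> topspace junction_top" unfolding sp tX using j by simp
  fix U :: "(real^'n) set" assume "U : {U. openin junction_top U}"
  then obtain V where V: "open V" "U = junction \<inter> V" unfolding mem_Collect_eq openin_open by blast
  define W where "W = {y : mspace ?F. y t : V}"
  interpret Metric_space "mspace ?F" "mdist ?F" by (rule Metric_space_mspace_mdist)
  have "openin (mtopology_of ?F) W"
   unfolding mtopology_of_def openin_mtopology
  proof (intro conjI allI impI)
   show "W \<subseteq> mspace ?F" unfolding W_def by blast
   fix y assume y: "y : W"
   then obtain e where e: "e > 0" "ball (y t) e \<subseteq> V" using V(1) unfolding W_def open_contains_ball by blast
   show "EX r>0. mball y r \<subseteq> W"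
   proof (intro exI[of _ e] conjI e(1) subsetI)
    fix z assume "z : mball y e"
    then have z: "y : mspace ?F" "z : mspace ?F" "mdist ?F y z < e" unfolding in_mball by blast+
    have "t : topspace (top_of_set {0..T})" using t by simp
    from mdist_cfunspace_imp_mdist_le[OF z(1,2) order_refl this] z(3)
    have "dist (y t) (z t) < e" by simp
    then have "z t : V" using e(2) by (simp add: subset_iff)
    then show "z : W" unfolding W_def using z(2) by blast
   qed
  qed
  then have "openin ?X (W \<inter> S)" unfolding curve_top_def openin_subtopology by blast
  moreover have "(%y. y t) -` U \<inter> space \<mu> = W \<inter> S" unfolding sp tX V(2) W_def using j by blast
  ultimately show "(%y. y t) -` U \<inter> space \<mu> : sets \<mu>" unfolding st by (simp add: sigma_sets.Basic)
 qed
qed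

lemma integrable_bounded_prob:
 fixes f :: "'b => real"
 assumes "prob_space M" "f : borel_measurable M" "!!x. x : space M ==> abs (f x) <= B"
 shows "integrable M f"
proof -
 interpret prob_space M by (rule assms(1))
 show ?thesis by (rule integrable_const_bound[of _ B]) (use assms in \<open>auto intro: AE_I2\<close>)
qed

lemma flow_in_P1:
 fixes \<mu> :: "(real => real^'k) measure"
 assumes \<mu>: "\<mu> : P_C p T C m0" and T: "T > 0" and p: "p > 1" and t: "t : {0..T}"
 shows "flow \<mu> t : P1"
proof -
 have s: "sets \<mu> = sets (borel_of (curve_top T (Gam_C p T C)))" and pr: "prob_space \<mu>"
  using \<mu> unfolding P_C_def borel_probs_def by blast+
 have jt: "!!y :: real => real^'k. y : Gam_C p T C ==> y t : junction" by (rule Gam_C_D(3)[OF _ T p t])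
 have ev1: "(%y. y t) : measurable \<mu> (borel_of junction_top)" by (rule eval_measurable(1)[OF s t]) (rule jt)
 have ev2: "space \<mu> \<subseteq> Gam_C p T C" by (rule eval_measurable(2)[OF s t]) (rule jt)
 have b: "jdist 0 (y t) = norm (y t)" "norm (y t) <= C" if "y : space \<mu>" for y
 proof -
  have y: "y : Gam_C p T C" using ev2 that by blast
  show "jdist 0 (y t) = norm (y t)" by (rule jdist_zero[OF Gam_C_D(3)[OF y T p t]])
  show "norm (y t) <= C" by (rule Gam_C_D(4)[OF y T p t])
 qed
 have "continuous_on junction (%x :: real^'k. norm x)" by (intro continuous_intros)
 then have "continuous_on junction (%x :: real^'k. jdist 0 x)" by (rule continuous_on_eq) (simp add: jdist_zero)
 note jm = continuous_on_junction_measurable[OF this]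
 have "integrable \<mu> (%y. jdist 0 (y t))"
  by (rule integrable_bounded_prob[OF pr measurable_compose[OF ev1 jm], of C]) (simp add: b)
 then have "integrable (flow \<mu> t) (%x. jdist 0 x)" unfolding flow_def integrable_distr_eq[OF ev1 jm] .
 moreover have "prob_space (flow \<mu> t)" unfolding flow_def by (rule prob_space.prob_space_distr[OF pr ev1])
 ultimately show ?thesis unfolding P1_def borel_probs_def flow_def by simp
qed

text \<open>Both measures are images of the same \<mu>, so integrals of a 1-Lipschitz function
  differ by at most the mean of the distance from \<open>y s\<close> to \<open>y t\<close>, which is
  uniformly small by equicontinuity.\<close>

lemma flow_continuous:
 fixes \<mu> :: "(real => real^'k) measure"
 assumes \<mu>: "\<mu> : P_C p T C m0" and T: "T > 0" and p: "p > 1" and e: "e > 0"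
 obtains d where "d > 0" "!!s t. s : {0..T} ==> t : {0..T} ==> abs (t - s) < d ==> KR_dist (flow \<mu> s) (flow \<mu> t) < e"
proof -
 have se: "sets \<mu> = sets (borel_of (curve_top T (Gam_C p T C)))" and pr: "prob_space \<mu>"
  using \<mu> unfolding P_C_def borel_probs_def by blast+
 interpret prob_space \<mu> by (rule pr)
 have e4: "e / 4 > 0" using e by simp
 obtain d where d: "d > 0" "!!(y :: real => real^'k) s t. y : Gam_C p T C ==> s : {0..T} ==> t : {0..T} ==> abs (t - s) < d ==> norm (y t - y s) < e / 4"
  by (rule Gam_C_equicontinuous[OF T p e4]) (rule that)
 show ?thesis
 proof (rule that[OF d(1)])
  fix s t assume s: "s : {0..T}" and t: "t : {0..T}" and st: "abs (t - s) < d"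
  have js: "!!y :: real => real^'k. y : Gam_C p T C ==> y s : junction" by (rule Gam_C_D(3)[OF _ T p s])
  have jt: "!!y :: real => real^'k. y : Gam_C p T C ==> y t : junction" by (rule Gam_C_D(3)[OF _ T p t])
  have evs: "(%y. y s) : measurable \<mu> (borel_of junction_top)" by (rule eval_measurable(1)[OF se s]) (rule js)
  have evt: "(%y. y t) : measurable \<mu> (borel_of junction_top)" by (rule eval_measurable(1)[OF se t]) (rule jt)
  have sub: "space \<mu> \<subseteq> Gam_C p T C" by (rule eval_measurable(2)[OF se s]) (rule js)
  have "KR_dist (flow \<mu> s) (flow \<mu> t) <= e / 2"
   unfolding KR_dist_def
  proof (rule cSUP_least)
   show "{f :: real^'k => real. ALL x:junction. ALL y:junction. abs (f x - f y) <= jdist x y} ~= {}"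
   proof -
    have "(%x. 0) : {f :: real^'k => real. ALL x:junction. ALL y:junction. abs (f x - f y) <= jdist x y}"
     by (simp add: jdist_nonneg)
    then show ?thesis unfolding ex_in_conv[symmetric] by (rule exI[of _ "%x. 0"])
   qed
   fix f :: "real^'k => real" assume "f : {f. ALL x:junction. ALL y:junction. abs (f x - f y) <= jdist x y}"
   then have f: "!!x y. x : junction ==> y : junction ==> abs (f x - f y) <= jdist x y" by blast
   have fm: "f : borel_measurable (borel_of junction_top)"
    by (rule continuous_on_junction_measurable[OF jdist_lipschitz_continuous]) (rule f)
   have z: "(0 :: real^'k) : junction" using axis_in_junction[of 0] by simp
   have fb: "abs (f (y \<sigma>)) <= C + abs (f 0)" if y: "y : space \<mu>" and \<sigma>: "\<sigma> : {0..T}" for y \<sigma>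
   proof -
    have yG: "y : Gam_C p T C" using sub y by blast
    have yj: "y \<sigma> : junction" by (rule Gam_C_D(3)[OF yG T p \<sigma>])
    have "abs (f 0 - f (y \<sigma>)) <= C" using f[OF z yj] jdist_zero[OF yj] Gam_C_D(4)[OF yG T p \<sigma>] by simp
    then show ?thesis by linarith
   qed
   have ints: "integrable \<mu> (%y. f (y s))"
    by (rule integrable_bounded_prob[OF pr measurable_compose[OF evs fm]]) (rule fb[OF _ s])
   have intt: "integrable \<mu> (%y. f (y t))"
    by (rule integrable_bounded_prob[OF pr measurable_compose[OF evt fm]]) (rule fb[OF _ t])
   have "integral\<^sup>L (flow \<mu> s) f - integral\<^sup>L (flow \<mu> t) f = integral\<^sup>L \<mu> (%y. f (y s) - f (y t))"
    unfolding flow_def integral_distr[OF evs fm] integral_distr[OF evt fm]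
    by (rule Bochner_Integration.integral_diff[OF ints intt, symmetric])
   also have "... <= e / 2"
   proof (rule integral_le_const[OF Bochner_Integration.integrable_diff[OF ints intt]], rule AE_I2)
    fix y assume "y : space \<mu>"
    then have y: "y : Gam_C p T C" using sub by blast
    have j: "y s : junction" "y t : junction" by (rule Gam_C_D(3)[OF y T p s], rule Gam_C_D(3)[OF y T p t])
    have "norm (y s - y t) < e / 4" using d(2)[OF y s t st] by (simp add: norm_minus_commute)
    then show "f (y s) - f (y t) <= e / 2" using f[OF j] jdist_le[OF j] by linarith
   qed
   finally show "integral\<^sup>L (flow \<mu> s) f - integral\<^sup>L (flow \<mu> t) f <= e / 2" .
  qed
  then show "KR_dist (flow \<mu> s) (flow \<mu> t) < e" using e by linarith
 qed
qed

section \<open>Passage between the costs of the equilibrium and the control problem\<close>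

context junction_control
begin

text \<open>Members of \<open>Gam\<close> are \<open>undefined\<close> outside {t..T}, while
  trajectories and costs look at {t..T} only.\<close>

lemma traj_restrict_cost:
 assumes t: "0 <= t" "t <= T"
 shows "traj t (restrict y {t..T}) g \<longleftrightarrow> traj t y g" "cost t (restrict y {t..T}) g = cost t y g"
proof -
 have "primitive_on t T (restrict y {t..T}) g" if "primitive_on t T y g"
  by (rule primitive_on_cong_AE[OF that negligible_empty]) simp_all
 moreover have "primitive_on t T y g" if "primitive_on t T (restrict y {t..T}) g"
  by (rule primitive_on_cong_AE[OF that negligible_empty]) simp_all
 ultimately show "traj t (restrict y {t..T}) g \<longleftrightarrow> traj t y g" unfolding traj_def by auto
 have "run t T (restrict y {t..T}) g = run t T y g"
  unfolding run_def by (rule integral_cong) simp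
 moreover have "restrict y {t..T} T = y T" using t by simp
 ultimately show "cost t (restrict y {t..T}) g = cost t y g" unfolding cost_def by (simp only:)
qed

lemma Gam_traj:
 assumes y: "y : Gam p T t x" and t: "t < T"
 shows "traj t y (wderiv t T y)"
 unfolding traj_def using GamD(1-3)[OF y t p] by blast

lemma traj_Gam:
 assumes y: "traj t y g" and t: "t < T"
 shows "restrict y {t..T} : Gam p T t (y t)"
 by (rule GamI[OF trajD(1)[OF y] trajD(3)[OF y] trajD(2)[OF y] t p])

text \<open>Adding C0 makes the integrand nonnegative, and then gauge integrability implies Lebesgue
  integrability.\<close>

lemma rc_lebesgue_integral:
 assumes i: "(%s. rc s (y s) (a s)) integrable_on {t..T}" and t: "0 <= t" and j: "!!s. s : {t..T} ==> y s : junction"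
 shows "integral\<^sup>L (lebesgue_on {t..T}) (%s. rc s (y s) (a s)) = integral {t..T} (%s. rc s (y s) (a s))"
proof -
 have "(%s. rc s (y s) (a s) + C0) absolutely_integrable_on {t..T}"
 proof (rule nonnegative_absolutely_integrable_1[OF integrable_add[OF i integrable_const_ivl]])
  fix s assume s: "s : {t..T}"
  have "- C0 <= rc s (y s) (a s)" by (rule rc_lower[OF _ j[OF s]]) (use s t in simp)
  then show "0 <= rc s (y s) (a s) + C0" by simp
 qed
 moreover have "(%s. - C0) absolutely_integrable_on {t..T}"
  by (rule absolutely_integrable_continuous_real) (rule continuous_on_const)
 ultimately have "(%s. rc s (y s) (a s) + C0 + - C0) absolutely_integrable_on {t..T}" by (rule set_integral_add)
 then have "integrable (lebesgue_on {t..T}) (%s. rc s (y s) (a s))"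
  by (intro absolutely_integrable_imp_integrable) simp_all
 then show ?thesis by (rule lebesgue_integral_eq_integral) simp
qed

text \<open>On the junction the norm is the sum of the coordinates, so \<open>speed\<close> of g is
  a density of the norm of y and agrees a.e. with the weak derivative chosen in
  \<open>J_cost\<close>.\<close>

lemma J_cost_eq:
 assumes y: "traj t y g" and t: "0 <= t" "t < T"
  and rc: "!!s x a. s : {0..T} ==> running_cost L Ls (flow \<mu> s) x a = rc s x a"
  and fin: "final_cost G Gs (flow \<mu> T) (y T) = fin (y T)"
 shows "J_cost T L Ls G Gs \<mu> t y = cost t y g"
proof -
 define w where "w = wderiv t T (%s. norm (y s))"
 have "primitive_on t T (%s. \<Sum>i\<in>UNIV. y s $ i) (%s. \<Sum>i\<in>UNIV. g s $ i)"
  by (rule primitive_on_sum) (simp_all add: primitive_on_nth[OF trajD(1)[OF y]])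
 then have n: "primitive_on t T (%s. norm (y s)) (%s. \<Sum>i\<in>UNIV. g s $ i)"
  by (rule primitive_on_cong_AE[OF _ negligible_empty]) (simp_all add: junction_norm_sum[OF trajD(2)[OF y]])
 have "AE s in lebesgue. s : {t..T} --> rc s (y s) (w s) = rc s (y s) (speed (g s))"
  using primitive_on_unique_AE[OF primitive_on_wderiv[OF t(2) n] n] unfolding w_def speed_def by eventually_elim simp
 note eq = integral_cong_AE_lebesgue[OF this]
 have i: "(%s. rc s (y s) (w s)) integrable_on {t..T}"
  unfolding eq(2) by (rule ptraj_run_integrable[OF y[unfolded traj_iff_ptraj] t(1) order_refl])
 have "integral\<^sup>L (lebesgue_on {t..T}) (%s. running_cost L Ls (flow \<mu> s) (y s) (w s)) =
  integral\<^sup>L (lebesgue_on {t..T}) (%s. rc s (y s) (w s))"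
  by (rule Bochner_Integration.integral_cong) (use t rc in simp_all)
 also have "... = integral {t..T} (%s. rc s (y s) (w s))" by (rule rc_lebesgue_integral[OF i t(1) trajD(2)[OF y]])
 also have "... = run t T y g" unfolding run_def by (rule eq(1))
 finally show ?thesis unfolding J_cost_def cost_def w_def fin by simp
qed

lemma value_fun_eq:
 assumes t: "0 <= t" "t < T" and x: "x : junction"
  and rc: "!!s x a. s : {0..T} ==> running_cost L Ls (flow \<mu> s) x a = rc s x a"
  and fin: "!!x. x : junction ==> final_cost G Gs (flow \<mu> T) x = fin x"
 shows "value_fun p T L Ls G Gs \<mu> x t = val x t"
proof -
 have tT: "T : {t..T}" using t by simp
 have "J_cost T L Ls G Gs \<mu> t ` Gam p T t x = {cost t y g | y g. traj t y g & y t = x}"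
 proof (intro equalityI subsetI)
  fix c assume "c : J_cost T L Ls G Gs \<mu> t ` Gam p T t x"
  then obtain y where y: "y : Gam p T t x" "c = J_cost T L Ls G Gs \<mu> t y" by blast
  note tr = Gam_traj[OF y(1) t(2)]
  have "c = cost t y (wderiv t T y)" unfolding y(2) by (rule J_cost_eq[OF tr t rc fin[OF trajD(2)[OF tr tT]]])
  then show "c : {cost t y g | y g. traj t y g & y t = x}" using tr GamD(4)[OF y(1) t(2) p] by blast
 next
  fix c assume "c : {cost t y g | y g. traj t y g & y t = x}"
  then obtain y g where y: "traj t y g" "y t = x" "c = cost t y g" by blast
  let ?y = "restrict y {t..T}"
  have tr: "traj t ?y g" using y(1) traj_restrict_cost(1)[OF t(1) less_imp_le[OF t(2)]] by blast
  have "J_cost T L Ls G Gs \<mu> t ?y = cost t ?y g" by (rule J_cost_eq[OF tr t rc fin[OF trajD(2)[OF tr tT]]])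
  also have "... = c" unfolding y(3) by (rule traj_restrict_cost(2)[OF t(1) less_imp_le[OF t(2)]])
  finally have "c = J_cost T L Ls G Gs \<mu> t ?y" ..
  then show "c : J_cost T L Ls G Gs \<mu> t ` Gam p T t x" using traj_Gam[OF y(1) t(2)] y(2) by blast
 qed
 then show ?thesis unfolding value_fun_def val_def by simp
qed

lemma optimal_trajs_iff:
 assumes t: "0 <= t" "t < T" and x: "x : junction"
  and rc: "!!s x a. s : {0..T} ==> running_cost L Ls (flow \<mu> s) x a = rc s x a"
  and fin: "!!x. x : junction ==> final_cost G Gs (flow \<mu> T) x = fin x"
 shows "y : optimal_trajs p T L Ls G Gs \<mu> x t \<longleftrightarrow> y : extensional {t..T} & y t = x & (EX g. opt t y g)"
proof
 have tT: "T : {t..T}" "t <= T" using t by simp_all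
 have v: "value_fun p T L Ls G Gs \<mu> x t = val x t" by (rule value_fun_eq[OF t x rc fin])
 {
  assume "y : optimal_trajs p T L Ls G Gs \<mu> x t"
  then have y: "y : Gam p T t x" "J_cost T L Ls G Gs \<mu> t y = val x t" unfolding optimal_trajs_def v by blast+
  note tr = Gam_traj[OF y(1) t(2)]
  have yt: "y t = x" by (rule GamD(4)[OF y(1) t(2) p])
  have "J_cost T L Ls G Gs \<mu> t y = cost t y (wderiv t T y)" by (rule J_cost_eq[OF tr t rc fin[OF trajD(2)[OF tr tT(1)]]])
  then have "opt t y (wderiv t T y)"
   by (intro optI[OF tr _ t(1) tT(2)]) (use y(2) yt in simp)
  then show "y : extensional {t..T} & y t = x & (EX g. opt t y g)" using GamD(5)[OF y(1) t(2) p] yt by blast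
 }
 assume "y : extensional {t..T} & y t = x & (EX g. opt t y g)"
 then obtain g where y: "y : extensional {t..T}" "y t = x" "opt t y g" by blast
 note tr = opt_traj(1)[OF y(3)]
 have "restrict y {t..T} = y" by (rule extensional_restrict[OF y(1)])
 then have "y : Gam p T t x" using traj_Gam[OF tr t(2)] y(2) by simp
 moreover have "J_cost T L Ls G Gs \<mu> t y = cost t y g" by (rule J_cost_eq[OF tr t rc fin[OF trajD(2)[OF tr tT(1)]]])
 then have "J_cost T L Ls G Gs \<mu> t y = val x t" using val_opt[OF y(3)] y(2) by simp
 ultimately show "y : optimal_trajs p T L Ls G Gs \<mu> x t" unfolding optimal_trajs_def v by blast
qed

text \<open>\<open>vector_derivative\<close> has a value for every curve; regularity of minimisers
  shows that the derivative really exists and points along the edge.\<close>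

lemma init_velocities_eq:
 assumes t: "0 <= t" "t < T" and x: "x > 0"
  and rc: "!!s x a. s : {0..T} ==> running_cost L Ls (flow \<mu> s) x a = rc s x a"
  and fin: "!!x. x : junction ==> final_cost G Gs (flow \<mu> T) x = fin x"
 shows "init_velocities p T L Ls G Gs \<mu> (x *\<^sub>R axis i 1) t = vels i x t"
proof -
 have xj: "x *\<^sub>R axis i 1 : junction" by (rule axis_in_junction) (use x in simp)
 have xe: "x *\<^sub>R axis i 1 : edge j - {0} \<longleftrightarrow> j = i" for j
  unfolding edge_minus_0_iff scaleR_axis_nth using xj x by simp
 have ot: "y : optimal_trajs p T L Ls G Gs \<mu> (x *\<^sub>R axis i 1) t \<longleftrightarrow>
  y : extensional {t..T} & y t = x *\<^sub>R axis i 1 & (EX g. opt t y g)" for y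
  by (rule optimal_trajs_iff[OF t xj rc fin])
 have tT: "t <= T" "at t within {t..T} ~= bot" using t by (simp_all add: at_within_Icc_at_right)
 obtain \<delta> K where \<delta>: "\<delta> > 0" "t + \<delta> <= T" "K >= 1"
  "!!h y g. abs h <= x / 2 ==> opt t y g ==> y t = (x + h) *\<^sub>R axis i 1 ==>
   EX v. el_arc i t (t + \<delta>) (x / 4) (3 * x) K (%s. y s $ i) v"
  by (rule local_arcs[OF t x, where i = i]) (rule that)
 have vd: "vector_derivative z (at t within {t..T}) \<bullet> axis i 1 = a"
  if "(z has_vector_derivative a *\<^sub>R axis i 1) (at t within {t..T})" for z :: "real => real^'n" and a
  using vector_derivative_within[OF tT(2) that] by (simp add: inner_axis_axis)
 show ?thesis
 proof (intro equalityI subsetI)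
  fix a assume "a : init_velocities p T L Ls G Gs \<mu> (x *\<^sub>R axis i 1) t"
  then obtain z where z: "a = vector_derivative z (at t within {t..T}) \<bullet> axis i 1" "z : optimal_trajs p T L Ls G Gs \<mu> (x *\<^sub>R axis i 1) t"
   unfolding init_velocities_def xe by blast
  obtain g where g: "z t = x *\<^sub>R axis i 1" "opt t z g" using z(2) unfolding ot by blast
  obtain v where v: "el_arc i t (t + \<delta>) (x / 4) (3 * x) K (%s. z s $ i) v" using \<delta>(4)[of 0 z g] g x by auto
  have d: "(z has_vector_derivative v t *\<^sub>R axis i 1) (at t within {t..T})"
   by (rule el_arc_vel[OF opt_traj(2)[OF g(2)] v]) (use \<delta> x in simp_all)
  show "a : vels i x t" unfolding vels_def z(1) vd[OF d] using g d by blast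
 next
  fix a assume "a : vels i x t"
  then obtain y g where y: "opt t y g" "y t = x *\<^sub>R axis i 1" "(y has_vector_derivative a *\<^sub>R axis i 1) (at t within {t..T})"
   unfolding vels_def by blast
  let ?y = "restrict y {t..T}"
  have tr: "traj t ?y g" using opt_traj(1)[OF y(1)] traj_restrict_cost(1)[OF t(1) tT(1)] by blast
  have yt: "?y t = y t" using tT(1) by simp
  have "opt t ?y g"
   by (rule optI[OF tr _ t(1) tT(1)]) (use traj_restrict_cost(2)[OF t(1) tT(1), of y g] val_opt[OF y(1)] yt in simp)
  then have z: "?y : optimal_trajs p T L Ls G Gs \<mu> (x *\<^sub>R axis i 1) t" unfolding ot using yt y(2) by auto
  have "(?y has_vector_derivative a *\<^sub>R axis i 1) (at t within {t..T})"
   by (rule has_vector_derivative_transform[OF _ _ y(3)]) (use tT(1) in simp_all)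
  from vd[OF this] show "a : init_velocities p T L Ls G Gs \<mu> (x *\<^sub>R axis i 1) t"
   unfolding init_velocities_def xe using z by blast
 qed
qed

end

text \<open>The change of measure is controlled uniformly on a compact neighbourhood of (x, a), the
  change of (x, a) at the fixed measure \<open>M t\<close>.\<close>

lemma joint_continuity:
 fixes M :: "real => (real^'n) measure" and \<phi> :: "(real^'n) measure => real => real => real"
 assumes P: "!!t. t : {0..T} ==> M t : P1"
  and M: "!!t e. t : {0..T} ==> e > 0 ==> EX d>0. ALL s:{0..T}. abs (s - t) < d --> KR_dist (M t) (M s) < e"
  and c: "!!m. m : P1 ==> continuous_on ({0..} \<times> UNIV) (%(x, a). \<phi> m x a)"
  and u: "!!m K e. m : P1 ==> compact K ==> K \<subseteq> {0..} \<times> UNIV ==> e > 0 ==>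
   EX \<delta>>0. ALL m':P1. KR_dist m m' < \<delta> --> (ALL (x, a):K. abs (\<phi> m' x a - \<phi> m x a) < e)"
 shows "continuous_on ({0..T} \<times> {0..} \<times> UNIV) (%(t, x, a). \<phi> (M t) x a)"
 unfolding continuous_on_iff
proof (intro ballI allI impI)
 fix z :: "real \<times> real \<times> real" and e :: real
 assume z: "z : {0..T} \<times> {0..} \<times> UNIV" and e: "e > 0"
 obtain t x a where zz: "z = (t, x, a)" by (cases z)
 have t: "t : {0..T}" and x: "x >= 0" using z by (simp_all add: zz)
 have e2: "e / 2 > 0" using e by simp
 define K where "K = {0..x + 1} \<times> {a - 1..a + 1}"
 have K: "compact K" "K \<subseteq> {0..} \<times> UNIV" unfolding K_def by (intro compact_Times compact_Icc) auto
 obtain \<delta> where \<delta>: "\<delta> > 0" "ALL m':P1. KR_dist (M t) m' < \<delta> --> (ALL (x, a):K. abs (\<phi> m' x a - \<phi> (M t) x a) < e / 2)"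
  using u[OF P[OF t] K e2] by blast
 obtain d1 where d1: "d1 > 0" "ALL s:{0..T}. abs (s - t) < d1 --> KR_dist (M t) (M s) < \<delta>" using M[OF t \<delta>(1)] by blast
 have xa: "(x, a) : {0..} \<times> UNIV" using x by simp
 obtain d2 where d2: "d2 > 0" "ALL w:{0..} \<times> UNIV. dist w (x, a) < d2 -->
  dist (case w of (x, a) => \<phi> (M t) x a) (case (x, a) of (x, a) => \<phi> (M t) x a) < e / 2"
  using c[OF P[OF t]] xa e2 unfolding continuous_on_iff by blast
 show "EX d>0. ALL z':{0..T} \<times> {0..} \<times> UNIV. dist z' z < d -->
  dist (case z' of (t, x, a) => \<phi> (M t) x a) (case z of (t, x, a) => \<phi> (M t) x a) < e"
 proof (intro exI conjI ballI impI)
  show "min 1 (min d1 d2) > 0" using d1(1) d2(1) by simp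
  fix z' :: "real \<times> real \<times> real" assume z': "z' : {0..T} \<times> {0..} \<times> UNIV" and d: "dist z' z < min 1 (min d1 d2)"
  obtain t' x' a' where zz': "z' = (t', x', a')" by (cases z')
  have t': "t' : {0..T}" and x': "x' >= 0" using z' by (simp_all add: zz')
  have dt: "abs (t' - t) <= dist z' z" using dist_fst_le[of z' z] by (simp add: zz zz' dist_real_def)
  have dxa: "dist (x', a') (x, a) <= dist z' z" using dist_snd_le[of z' z] by (simp add: zz zz')
  have dx: "abs (x' - x) <= dist (x', a') (x, a)" using dist_fst_le[of "(x', a')" "(x, a)"] by (simp add: dist_real_def)
  have da: "abs (a' - a) <= dist (x', a') (x, a)" using dist_snd_le[of "(x', a')" "(x, a)"] by (simp add: dist_real_def)
  have "abs (x' - x) < 1" "abs (a' - a) < 1" using d dxa dx da by linarith+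
  then have "(x', a') : K" unfolding K_def using x' by (simp add: abs_less_iff)
  moreover have "KR_dist (M t) (M t') < \<delta>" using d1(2) t' dt d by simp
  ultimately have 1: "abs (\<phi> (M t') x' a' - \<phi> (M t) x' a') < e / 2" using \<delta>(2) P[OF t'] by blast
  have "dist (x', a') (x, a) < d2" using dxa d by linarith
  then have "dist (\<phi> (M t) x' a') (\<phi> (M t) x a) < e / 2" using d2(2) x' by simp
  then have 2: "abs (\<phi> (M t) x' a' - \<phi> (M t) x a) < e / 2" by (simp add: dist_real_def)
  show "dist (case z' of (t, x, a) => \<phi> (M t) x a) (case z of (t, x, a) => \<phi> (M t) x a) < e"
   unfolding zz zz' prod.case dist_real_def using 1 2 by linarith
 qed
qed

lemma continuous_on_Min_image:
 fixes f :: "'i => 'a::topological_space => real"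
 assumes "finite I" "I ~= {}" "!!i. i : I ==> continuous_on S (f i)"
 shows "continuous_on S (%t. Min ((%i. f i t) ` I))"
 using assms by (induction I rule: finite_ne_induct) (simp_all add: continuous_on_min)

lemma final_cost_edge:
 assumes "y : junction" "y $ i > 0"
 shows "final_cost G Gs m y = G i m (norm y)"
proof -
 have ind: "indicator (edge j - {0}) y = (if j = i then 1 else 0 :: real)" for j
  using edge_minus_0_iff[of y j] assms junction_nth_unique[OF assms] by (auto simp: indicator_def)
 have "indicator {0} y = (0 :: real)" using assms(2) by (auto simp: indicator_def)
 moreover have "(\<Sum>j\<in>UNIV. G j m (norm y) * (if j = i then 1 else 0)) = (\<Sum>j\<in>UNIV. if j = i then G j m (norm y) else 0)"
  by (rule sum.cong) simp_all
 ultimately show ?thesis unfolding final_cost_def ind by simp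
qed

lemma final_cost_zero: "final_cost G Gs m 0 = min (Gs m) (Min (range (%i. G i m 0)))"
 unfolding final_cost_def by simp

lemma final_cost_bounded:
 fixes G :: "'n::finite => (real^'n) measure => real => real"
 assumes G: "ALL i. Cb_into_Cb (G i)" and Gs: "Cb_into_real Gs" and m: "m : P1"
 obtains B where "!!x. x : junction ==> abs (final_cost G Gs m x) <= B"
proof -
 have "ALL i. EX B. ALL x>=0. abs (G i m x) <= B" using G m unfolding Cb_into_Cb_def by blast
 from choice[OF this] obtain B where B: "!!i x. x >= 0 ==> abs (G i m x) <= B i" by blast
 have Bi: "abs (G i m x) <= Max (range B)" if "x >= 0" for i x
  by (rule order_trans[OF B[OF that] Max_ge]) simp_all
 show ?thesis
 proof (rule that[of "abs (Gs m) + Max (range B)"])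
  fix x :: "real^'n" assume x: "x : junction"
  have M0: "Max (range B) >= 0" using Bi[of 0] abs_ge_zero order_trans by (meson order_refl)
  show "abs (final_cost G Gs m x) <= abs (Gs m) + Max (range B)"
  proof (rule junction_cases[OF x])
   assume "x = 0"
   have "Min (range (%i. G i m 0)) : range (%i. G i m 0)" by (rule Min_in) simp_all
   then obtain j where "Min (range (%i. G i m 0)) = G j m 0" by blast
   then have "abs (Min (range (%i. G i m 0))) <= Max (range B)" using Bi[OF order_refl, of j] by simp
   then show ?thesis unfolding \<open>x = 0\<close> final_cost_zero using M0 by linarith
  next
   fix i assume i: "x $ i > 0"
   show ?thesis unfolding final_cost_edge[OF x i] using Bi[OF norm_ge_zero, of i x] by linarith
  qed
 qed
qed

text \<open>At the vertex the cost is a minimum over all edges, so it can only be lower than the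
  limits along the edges. Elsewhere, nearby points lie on the same edge and the cost is
  continuous.\<close>

lemma final_cost_lsc:
 fixes G :: "'n::finite => (real^'n) measure => real => real"
 assumes G: "ALL i. Cb_into_Cb (G i)" and m: "m : P1" and x: "x : junction" and e: "e > 0"
 shows "EX d>0. ALL z:junction. norm (z - x) < d --> final_cost G Gs m x - e < final_cost G Gs m z"
proof -
 have c: "continuous_on {0..} (G i m)" for i using G m unfolding Cb_into_Cb_def by blast
 have near: "EX d>0. ALL s>=0. abs (s - r) < d --> G i m r - e < G i m s" if "r >= 0" for r i
 proof -
  have "r : {0..}" using that by simp
  then obtain d where d: "d > 0" "ALL s:{0..}. dist s r < d --> dist (G i m s) (G i m r) < e"
   using c[of i] e unfolding continuous_on_iff by blast
  have "G i m r - e < G i m s" if "s >= 0" "abs (s - r) < d" for s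
  proof -
   have "dist (G i m s) (G i m r) < e" using d(2) that by (simp add: dist_real_def)
   then show ?thesis unfolding dist_real_def by linarith
  qed
  then show ?thesis using d(1) by blast
 qed
 show ?thesis
 proof (rule junction_cases[OF x])
  assume x0: "x = 0"
  have "ALL i. EX d>0. ALL s>=0. abs (s - 0) < d --> G i m 0 - e < G i m s" using near[OF order_refl] by blast
  from choice[OF this] obtain d where d: "ALL i. d i > 0 & (ALL s>=0. abs (s - 0) < d i --> G i m 0 - e < G i m s)" by blast
  show ?thesis
  proof (intro exI[of _ "Min (range d)"] conjI ballI impI)
   show "Min (range d) > 0" using d by simp
   fix z assume z: "z : junction" "norm (z - x) < Min (range d)"
   show "final_cost G Gs m x - e < final_cost G Gs m z"
   proof (rule junction_cases[OF z(1)])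
    assume "z = 0"
    then show ?thesis using e by (simp add: x0)
   next
    fix i assume i: "z $ i > 0"
    have "Min (range d) <= d i" by (rule Min_le) simp_all
    then have "abs (norm z - 0) < d i" using z(2) x0 by simp
    then have "G i m 0 - e < G i m (norm z)" using d by simp
    moreover have "Min (range (%i. G i m 0)) <= G i m 0" by (rule Min_le) simp_all
    ultimately show ?thesis unfolding x0 final_cost_zero final_cost_edge[OF z(1) i] by linarith
   qed
  qed
 next
  fix i assume i: "x $ i > 0"
  obtain d where d: "d > 0" "ALL s>=0. abs (s - norm x) < d --> G i m (norm x) - e < G i m s" using near[OF norm_ge_zero] by blast
  show ?thesis
  proof (intro exI[of _ "min d (x $ i)"] conjI ballI impI)
   show "min d (x $ i) > 0" using d(1) i by simp
   fix z assume z: "z : junction" "norm (z - x) < min d (x $ i)"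
   have "abs ((z - x) $ i) <= norm (z - x)" by (rule component_le_norm_cart)
   then have zi: "z $ i > 0" using z(2) unfolding vector_minus_component by linarith
   have "abs (norm z - norm x) < d" using norm_triangle_ineq3[of z x] z(2) by linarith
   then show "final_cost G Gs m x - e < final_cost G Gs m z"
    unfolding final_cost_edge[OF x i] final_cost_edge[OF z(1) zi] using d(2) by simp
  qed
 qed
qed

text \<open>Once \<mu> is fixed, the measure enters the costs through time only. Continuity of the
  flow in the Kantorovich-Rubinstein distance turns continuity in the measure into continuity in
  time.\<close>

lemma equilibrium_control:
 fixes T p C :: real
  and L :: "'n::finite => (real^'n) measure => real => real => real"
  and G :: "'n => (real^'n) measure => real => real"
  and \<mu> :: "(real => real^'n) measure"
 assumes T: "T > 0" and p: "p > 1"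
  and L: "ALL i. continuous_into_C1 (L i)" and G: "ALL i. Cb_into_Cb (G i)"
  and Ls: "Cb_into_real Ls" and Gs: "Cb_into_real Gs"
  and low: "EX C0>0. (ALL i. ALL m':P1. ALL x>=0. ALL a. L i m' x a >= C0 * (abs a powr p - 1)) & (ALL m':P1. Ls m' >= - C0)"
  and bd: "ALL r>0. EX c>=0. ALL i. ALL m':P1. ALL x:{0..r}. ALL a.
      abs (d_x (L i m') x a) <= c * (abs a powr p + 1) & abs (d_a (L i m') x a) <= c * (abs a powr (p - 1) + 1)"
  and conv: "ALL i. ALL m':P1. ALL x>=0. strictly_convex (L i m' x)"
  and \<mu>: "\<mu> : P_C p T C m0"
 obtains C0 Bf c where "junction_control T p C0 Bf c (%i t. L i (flow \<mu> t)) (%i t. d_x (L i (flow \<mu> t)))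
  (%i t. d_a (L i (flow \<mu> t))) (%t. vertex_L L Ls (flow \<mu> t)) (final_cost G Gs (flow \<mu> T))"
proof -
 have P: "flow \<mu> t : P1" if "t : {0..T}" for t by (rule flow_in_P1[OF \<mu> T p that])
 have KR: "EX d>0. ALL s:{0..T}. abs (s - t) < d --> KR_dist (flow \<mu> t) (flow \<mu> s) < e" if te: "t : {0..T}" "e > 0" for t e
 proof -
  obtain d where "d > 0" "!!s t. s : {0..T} ==> t : {0..T} ==> abs (t - s) < d ==> KR_dist (flow \<mu> s) (flow \<mu> t) < e"
   by (rule flow_continuous[OF \<mu> T p te(2)]) (rule that)
  then show ?thesis using te(1) by blast
 qed
 have C1: "C1_halfplane (L i m)" if "m : P1" for i m using L that unfolding continuous_into_C1_def by blast
 have unif: "EX \<delta>>0. ALL m':P1. KR_dist m m' < \<delta> -->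
    (ALL (x, a):K. abs (L i m' x a - L i m x a) < e & abs (d_x (L i m') x a - d_x (L i m) x a) < e &
     abs (d_a (L i m') x a - d_a (L i m) x a) < e)"
  if "m : P1" "compact K" "K \<subseteq> {0..} \<times> UNIV" "e > 0" for m K e i
  using L that unfolding continuous_into_C1_def by blast
 have l_cont: "continuous_on ({0..T} \<times> {0..} \<times> UNIV) (%(t, x, a). L i (flow \<mu> t) x a)" for i
 proof (rule joint_continuity[OF P KR])
  show "continuous_on ({0..} \<times> UNIV) (%(x, a). L i m x a)" if "m : P1" for m using C1[OF that] unfolding C1_halfplane_def by blast
  show "EX \<delta>>0. ALL m':P1. KR_dist m m' < \<delta> --> (ALL (x, a):K. abs (L i m' x a - L i m x a) < e)"
   if "m : P1" "compact K" "K \<subseteq> {0..} \<times> UNIV" "e > 0" for m K e using unif[OF that, of i] by fast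
 qed
 have lx_cont: "continuous_on ({0..T} \<times> {0..} \<times> UNIV) (%(t, x, a). d_x (L i (flow \<mu> t)) x a)" for i
 proof (rule joint_continuity[OF P KR])
  show "continuous_on ({0..} \<times> UNIV) (%(x, a). d_x (L i m) x a)" if "m : P1" for m using C1[OF that] unfolding C1_halfplane_def by blast
  show "EX \<delta>>0. ALL m':P1. KR_dist m m' < \<delta> --> (ALL (x, a):K. abs (d_x (L i m') x a - d_x (L i m) x a) < e)"
   if "m : P1" "compact K" "K \<subseteq> {0..} \<times> UNIV" "e > 0" for m K e using unif[OF that, of i] by fast
 qed
 have la_cont: "continuous_on ({0..T} \<times> {0..} \<times> UNIV) (%(t, x, a). d_a (L i (flow \<mu> t)) x a)" for i
 proof (rule joint_continuity[OF P KR])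
  show "continuous_on ({0..} \<times> UNIV) (%(x, a). d_a (L i m) x a)" if "m : P1" for m using C1[OF that] unfolding C1_halfplane_def by blast
  show "EX \<delta>>0. ALL m':P1. KR_dist m m' < \<delta> --> (ALL (x, a):K. abs (d_a (L i m') x a - d_a (L i m) x a) < e)"
   if "m : P1" "compact K" "K \<subseteq> {0..} \<times> UNIV" "e > 0" for m K e using unif[OF that, of i] by fast
 qed
 obtain C0 where C0: "C0 > 0" "ALL i. ALL m':P1. ALL x>=0. ALL a. L i m' x a >= C0 * (abs a powr p - 1)" "ALL m':P1. Ls m' >= - C0"
  using low by blast
 have "ALL r. EX c. c >= 0 & (r > 0 --> (ALL i. ALL m':P1. ALL x:{0..r}. ALL a.
   abs (d_x (L i m') x a) <= c * (abs a powr p + 1) & abs (d_a (L i m') x a) <= c * (abs a powr (p - 1) + 1)))"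
 proof
  fix r :: real
  show "EX c. c >= 0 & (r > 0 --> (ALL i. ALL m':P1. ALL x:{0..r}. ALL a.
   abs (d_x (L i m') x a) <= c * (abs a powr p + 1) & abs (d_a (L i m') x a) <= c * (abs a powr (p - 1) + 1)))"
  proof (cases "r > 0")
   case True
   then show ?thesis using bd by blast
  next
   case False
   then show ?thesis by (intro exI[of _ 0]) simp
  qed
 qed
 from choice[OF this] obtain c where c: "ALL r. c r >= 0 & (r > 0 --> (ALL i. ALL m':P1. ALL x:{0..r}. ALL a.
   abs (d_x (L i m') x a) <= c r * (abs a powr p + 1) & abs (d_a (L i m') x a) <= c r * (abs a powr (p - 1) + 1)))" by blast
 have TT: "T : {0..T}" using T by simp
 obtain Bf where Bf: "!!x. x : junction ==> abs (final_cost G Gs (flow \<mu> T) x) <= Bf"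
  by (rule final_cost_bounded[OF G Gs P[OF TT]]) (rule that)
 have "junction_control T p C0 Bf c (%i t. L i (flow \<mu> t)) (%i t. d_x (L i (flow \<mu> t)))
  (%i t. d_a (L i (flow \<mu> t))) (%t. vertex_L L Ls (flow \<mu> t)) (final_cost G Gs (flow \<mu> T))"
 proof (rule junction_control.intro)
  show "T > 0" "p > 1" "C0 > 0" by (rule T p C0(1))+
  show "continuous_on ({0..T} \<times> {0..} \<times> UNIV) (%(t, x, a). L i (flow \<mu> t) x a)"
   "continuous_on ({0..T} \<times> {0..} \<times> UNIV) (%(t, x, a). d_x (L i (flow \<mu> t)) x a)"
   "continuous_on ({0..T} \<times> {0..} \<times> UNIV) (%(t, x, a). d_a (L i (flow \<mu> t)) x a)" for i
   by (rule l_cont lx_cont la_cont)+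
  show "0 <= c r" for r using c by blast
  fix i t x a assume t: "t : {0..T}"
  show "((%\<xi>. L i (flow \<mu> t) \<xi> a) has_real_derivative d_x (L i (flow \<mu> t)) x a) (at x within {0..})" if "0 <= x"
  proof -
   have "(%\<xi>. L i (flow \<mu> t) \<xi> a) differentiable (at x within {0..})"
    using C1[OF P[OF t]] that unfolding C1_halfplane_def by blast
   then show ?thesis
    unfolding vector_derivative_works d_x_def has_real_derivative_iff_has_vector_derivative .
  qed
  show "(L i (flow \<mu> t) x has_real_derivative d_a (L i (flow \<mu> t)) x a) (at a)" if "0 <= x"
   unfolding d_a_def DERIV_deriv_iff_real_differentiable
   using C1[OF P[OF t]] that unfolding C1_halfplane_def by blast
  show "C0 * (abs a powr p - 1) <= L i (flow \<mu> t) x a" if "0 <= x" using C0(2) P[OF t] that by blast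
  show "strictly_convex (L i (flow \<mu> t) x)" if "0 <= x" using conv P[OF t] that by blast
  show "abs (d_x (L i (flow \<mu> t)) x a) <= c r * (abs a powr p + 1)" if "0 < r" "x : {0..r}" for r
   using c P[OF t] that by blast
  show "abs (d_a (L i (flow \<mu> t)) x a) <= c r * (abs a powr (p - 1) + 1)" if "0 < r" "x : {0..r}" for r
   using c P[OF t] that by blast
  have Mi: "Min (range (%i. L i (flow \<mu> t) 0 0)) <= L i (flow \<mu> t) 0 0" by (rule Min_le) simp_all
  then show "vertex_L L Ls (flow \<mu> t) <= L i (flow \<mu> t) 0 0" unfolding vertex_L_def by linarith
  have "Min (range (%i. L i (flow \<mu> t) 0 0)) : range (%i. L i (flow \<mu> t) 0 0)" by (rule Min_in) simp_all
  then obtain j where j: "Min (range (%i. L i (flow \<mu> t) 0 0)) = L j (flow \<mu> t) 0 0" by blast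
  have "C0 * (abs 0 powr p - 1) <= L j (flow \<mu> t) 0 0" using C0(2) P[OF t] by blast
  moreover have "- C0 <= Ls (flow \<mu> t)" using C0(3) P[OF t] by blast
  ultimately show "- C0 <= vertex_L L Ls (flow \<mu> t)" unfolding vertex_L_def j by simp
 next
  show "continuous_on {0..T} (%t. vertex_L L Ls (flow \<mu> t))"
   unfolding vertex_L_def
  proof (intro continuous_on_min continuous_on_Min_image)
   show "continuous_on {0..T} (%t. L i (flow \<mu> t) 0 0)" for i
   proof -
    have "continuous_on {0..T} (%t. (%(t, x, a). L i (flow \<mu> t) x a) (t, 0, 0))"
     by (rule continuous_on_compose2[OF l_cont]) (auto intro!: continuous_intros)
    then show ?thesis by simp
   qed
   show "continuous_on {0..T} (%t. Ls (flow \<mu> t))"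
    unfolding continuous_on_iff dist_real_def
   proof (intro ballI allI impI)
    fix t e :: real assume t: "t : {0..T}" and e: "e > 0"
    obtain \<delta> where \<delta>: "\<delta> > 0" "ALL m':P1. KR_dist (flow \<mu> t) m' < \<delta> --> abs (Ls m' - Ls (flow \<mu> t)) < e"
     using Ls P[OF t] e unfolding Cb_into_real_def by blast
    then show "EX d>0. ALL s:{0..T}. abs (s - t) < d --> abs (Ls (flow \<mu> s) - Ls (flow \<mu> t)) < e"
     using KR[OF t \<delta>(1)] P by blast
   qed
  qed simp_all
  fix x :: "real^'n" assume x: "x : junction"
  show "- Bf <= final_cost G Gs (flow \<mu> T) x" "final_cost G Gs (flow \<mu> T) x <= Bf" using Bf[OF x] by linarith+
  show "EX d>0. ALL z:junction. norm (z - x) < d --> final_cost G Gs (flow \<mu> T) x - e < final_cost G Gs (flow \<mu> T) z" if "e > 0" for e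
   by (rule final_cost_lsc[OF G P[OF TT] x that])
 qed
 then show ?thesis by (rule that)
qed

lemma locally_semiconcave_on_cong:
 assumes w: "locally_semiconcave_on A w" and eq: "!!X. X : A ==> w' X = w X"
 shows "locally_semiconcave_on A w'"
 unfolding locally_semiconcave_on_def
proof (intro allI impI)
 fix S assume S: "compact S" "S \<subseteq> A"
 obtain \<omega> where \<omega>: "modulus \<omega>" "usc_on {0..} \<omega>" and ineq: "!!\<theta> X Y. \<theta> : {0..1} ==> closed_segment X Y \<subseteq> S ==>
  \<theta> * w X + (1 - \<theta>) * w Y - w (\<theta> *\<^sub>R X + (1 - \<theta>) *\<^sub>R Y) <= \<theta> * (1 - \<theta>) * norm (X - Y) * \<omega> (norm (X - Y))"
  using w S unfolding locally_semiconcave_on_def by meson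
 show "EX \<omega>. modulus \<omega> & usc_on {0..} \<omega> & (ALL \<theta>:{0..1}. ALL X Y. closed_segment X Y \<subseteq> S -->
  \<theta> * w' X + (1 - \<theta>) * w' Y - w' (\<theta> *\<^sub>R X + (1 - \<theta>) *\<^sub>R Y) <= \<theta> * (1 - \<theta>) * norm (X - Y) * \<omega> (norm (X - Y)))"
 proof (intro exI[of _ \<omega>] conjI \<omega> ballI allI impI)
  fix \<theta> :: real and X Y assume \<theta>: "\<theta> : {0..1}" and seg: "closed_segment X Y \<subseteq> S"
  have "\<theta> *\<^sub>R X + (1 - \<theta>) *\<^sub>R Y : closed_segment X Y"
   unfolding closed_segment_def using \<theta> by (intro CollectI exI[of _ "1 - \<theta>"]) simp
  then have "X : A" "Y : A" "\<theta> *\<^sub>R X + (1 - \<theta>) *\<^sub>R Y : A" using seg S(2) by auto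
  then show "\<theta> * w' X + (1 - \<theta>) * w' Y - w' (\<theta> *\<^sub>R X + (1 - \<theta>) *\<^sub>R Y) <= \<theta> * (1 - \<theta>) * norm (X - Y) * \<omega> (norm (X - Y))"
   using ineq[OF \<theta> seg] eq by simp
 qed
qed

lemma before_exit_time:
 assumes s: "s : {t<..<exit_time T t y}"
 shows "s < T" "!!\<tau>. \<tau> : {t..s} ==> y \<tau> ~= 0"
proof -
 define E where "E = insert T {\<tau> : {t..T}. y \<tau> = 0}"
 have bdd: "bdd_below E" by (rule bdd_belowI[of _ "min t T"]) (auto simp: E_def)
 have lower: "s < e" if "e : E" for e
  using s cInf_lower[OF that bdd] unfolding exit_time_def E_def[symmetric] by simp
 show sT: "s < T" by (rule lower) (simp add: E_def)
 show "y \<tau> ~= 0" if "\<tau> : {t..s}" for \<tau>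
 proof
  assume "y \<tau> = 0"
  then have "\<tau> : E" using that sT by (simp add: E_def)
  then show False using lower that by fastforce
 qed
qed

theorem lemma3p6:
  fixes T p C V :: real
    and L :: "'n::finite \<Rightarrow> (real^'n) measure \<Rightarrow> real \<Rightarrow> real \<Rightarrow> real"
    and G :: "'n \<Rightarrow> (real^'n) measure \<Rightarrow> real \<Rightarrow> real"
    and Ls Gs :: "(real^'n) measure \<Rightarrow> real"
    and m0 :: "(real^'n) measure"
    and \<mu> :: "(real \<Rightarrow> real^'n) measure"
    and u :: "real^'n \<Rightarrow> real \<Rightarrow> real"
    and m :: "real \<Rightarrow> (real^'n) measure"
  assumes "CARD('n) > 1" and "T > 0" and "p > 1" and "C > 0" and "V > 0"
    and "\<forall>i. continuous_into_C1 (L i)"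
    and "\<forall>i. Cb_into_Cb (G i)"
    and "Cb_into_real Ls" and "Cb_into_real Gs"
    and "\<exists>C0>0. (\<forall>i. \<forall>m'\<in>P1. \<forall>x\<ge>0. \<forall>a. L i m' x a \<ge> C0 * (\<bar>a\<bar> powr p - 1)) \<and>
                 (\<forall>m'\<in>P1. Ls m' \<ge> - C0)"
    and "\<forall>r>0. \<exists>\<omega>. modulus \<omega> \<and> (\<forall>i. \<forall>m1\<in>P1. \<forall>m2\<in>P1. \<forall>x\<in>{0..r}. \<forall>a.
           \<bar>L i m1 x a - L i m2 x a\<bar> \<le> (1 + \<bar>a\<bar> powr p) * \<omega> (KR_dist m1 m2))"
    and "\<forall>r>0. \<exists>c\<ge>0. \<forall>i. \<forall>m'\<in>P1. \<forall>x\<in>{0..r}. \<forall>a.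
           \<bar>d_x (L i m') x a\<bar> \<le> c * (\<bar>a\<bar> powr p + 1) \<and>
           \<bar>d_a (L i m') x a\<bar> \<le> c * (\<bar>a\<bar> powr (p - 1) + 1)"
    and "\<forall>i. \<forall>m'\<in>P1. \<forall>x\<ge>0. strictly_convex (L i m' x)"
    and "\<forall>i. \<forall>m'\<in>P1. C1_halfline (G i m')"
    and "m0 \<in> borel_probs junction_top" and "bounded (measure_supp junction_top m0)"
    and "\<mu> \<in> P_Lip p T C V m0"
    and "relaxed_equilibrium p T L Ls G Gs C m0 \<mu>"
    and "mild_solution p T L Ls G Gs \<mu> u m"
  shows "(\<forall>i. locally_semiconcave_on ({0<..} \<times> {0<..<T}) (\<lambda>(r, t). u (r *\<^sub>R axis i 1) t)) \<and>
    (\<forall>t\<in>{0..<T}. \<forall>i. \<forall>xb>0. \<forall>y\<in>optimal_trajs p T L Ls G Gs \<mu> (xb *\<^sub>R axis i 1) t.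
       let x = xb *\<^sub>R axis i 1;
           \<A> = init_velocities p T L Ls G Gs \<mu>;
           has_D = (\<lambda>D r s. ((\<lambda>\<rho>. u (\<rho> *\<^sub>R axis i 1) s) has_real_derivative D) (at r))
       in
         (\<forall>s\<in>{t<..<exit_time T t y}. is_singleton (\<A> (y s) s)) \<and>
         ((\<exists>D. has_D D xb t) \<longleftrightarrow> is_singleton (\<A> x t)) \<and>
         (\<forall>D. has_D D xb t \<longrightarrow>
            \<A> x t = {a. d_a (L i (m t)) xb a = - D} \<and>
            (\<exists>h. ((\<lambda>q. Hamiltonian L m i xb q t) has_real_derivative h) (at D) \<and> \<A> x t = {- h})) \<and>
         (\<forall>s\<in>{t<..<exit_time T t y}. \<exists>v.
            ((\<lambda>\<sigma>. norm (y \<sigma>)) has_real_derivative v) (at s) \<and>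
            has_D (- d_a (L i (m s)) (norm (y s)) v) (norm (y s)) s))"
proof -
 note T = assms(2) and p = assms(3)
 have \<mu>: "\<mu> : P_C p T C m0" using assms(18) unfolding relaxed_equilibrium_def by blast
 obtain C0 Bf c where jc: "junction_control T p C0 Bf c (%i t. L i (flow \<mu> t)) (%i t. d_x (L i (flow \<mu> t)))
  (%i t. d_a (L i (flow \<mu> t))) (%t. vertex_L L Ls (flow \<mu> t)) (final_cost G Gs (flow \<mu> T))"
  by (rule equilibrium_control[OF T p assms(6-10) assms(12,13) \<mu>]) (rule that)
 interpret J: junction_control T p C0 Bf c "%i t. L i (flow \<mu> t)" "%i t. d_x (L i (flow \<mu> t))"
  "%i t. d_a (L i (flow \<mu> t))" "%t. vertex_L L Ls (flow \<mu> t)" "final_cost G Gs (flow \<mu> T)"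
  by (rule jc)
 have rc: "running_cost L Ls (flow \<mu> s) x a = J.rc s x a" for s x a unfolding running_cost_def J.rc_def ..
 have m: "m s = flow \<mu> s" if "0 <= s" "s < T" for s
  using assms(19) that unfolding mild_solution_def by simp
 have u: "u (r *\<^sub>R axis i 1) s = J.val (r *\<^sub>R axis i 1) s" if "0 <= r" "0 <= s" "s < T" for r i s
 proof -
  have j: "r *\<^sub>R axis i 1 : junction" by (rule axis_in_junction[OF that(1)])
  have "u (r *\<^sub>R axis i 1) s = value_fun p T L Ls G Gs \<mu> (r *\<^sub>R axis i 1) s"
   using assms(19) j that unfolding mild_solution_def by simp
  also have "... = J.val (r *\<^sub>R axis i 1) s" by (rule J.value_fun_eq[OF that(2,3) j rc refl])
  finally show ?thesis .
 qed
 \<comment> \<open>Differentiability at r > 0 involves nearby positive arguments only, where u is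
   the value function.\<close>
 have D_iff: "((%\<rho>. u (\<rho> *\<^sub>R axis i 1) s) has_real_derivative D) (at r) \<longleftrightarrow>
  ((%\<rho>. J.val (\<rho> *\<^sub>R axis i 1) s) has_real_derivative D) (at r)" if "0 < r" "0 <= s" "s < T" for D r i s
 proof (rule DERIV_cong_ev[OF refl _ refl])
  have "\<forall>\<^sub>F \<rho> in nhds r. \<rho> : {0<..}" by (rule eventually_nhds_in_open) (use that in simp_all)
  then show "\<forall>\<^sub>F \<rho> in nhds r. u (\<rho> *\<^sub>R axis i 1) s = J.val (\<rho> *\<^sub>R axis i 1) s"
   by eventually_elim (use u that in simp)
 qed
 have vels: "init_velocities p T L Ls G Gs \<mu> (r *\<^sub>R axis i 1) s = J.vels i r s" if "0 < r" "0 <= s" "s < T" for r i s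
  by (rule J.init_velocities_eq[OF that(2,3,1) rc refl])
 have "locally_semiconcave_on ({0<..} \<times> {0<..<T}) (%(r, t). u (r *\<^sub>R axis i 1) t)" for i
  by (rule locally_semiconcave_on_cong[OF J.val_semiconcave[of i]]) (use u in auto)
 moreover have "(ALL s:{t<..<exit_time T t y}. is_singleton (init_velocities p T L Ls G Gs \<mu> (y s) s)) &
   ((EX D. ((%\<rho>. u (\<rho> *\<^sub>R axis i 1) t) has_real_derivative D) (at xb)) \<longleftrightarrow>
    is_singleton (init_velocities p T L Ls G Gs \<mu> (xb *\<^sub>R axis i 1) t)) &
   (ALL D. ((%\<rho>. u (\<rho> *\<^sub>R axis i 1) t) has_real_derivative D) (at xb) -->
    init_velocities p T L Ls G Gs \<mu> (xb *\<^sub>R axis i 1) t = {a. d_a (L i (m t)) xb a = - D} &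
    (EX h. ((%q. Hamiltonian L m i xb q t) has_real_derivative h) (at D) &
     init_velocities p T L Ls G Gs \<mu> (xb *\<^sub>R axis i 1) t = {- h})) &
   (ALL s:{t<..<exit_time T t y}. EX v. ((%\<sigma>. norm (y \<sigma>)) has_real_derivative v) (at s) &
    ((%\<rho>. u (\<rho> *\<^sub>R axis i 1) s) has_real_derivative - d_a (L i (m s)) (norm (y s)) v) (at (norm (y s))))"
  if tT: "t : {0..<T}" and x: "xb > 0" and y: "y : optimal_trajs p T L Ls G Gs \<mu> (xb *\<^sub>R axis i 1) t" for t i xb y
 proof -
  have t: "0 <= t" "t < T" using tT by simp_all
  have xj: "xb *\<^sub>R axis i 1 : junction" by (rule axis_in_junction) (use x in simp)
  obtain g where g: "y t = xb *\<^sub>R axis i 1" "J.opt t y g" using y J.optimal_trajs_iff[OF t xj rc refl] by blast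
  have yt: "y t $ i > 0" unfolding g(1) scaleR_axis_nth using x by simp
  note yp = J.opt_traj(1)[OF g(2)]
  have pos: "y \<tau> $ i > 0" if s: "s : {t<..<exit_time T t y}" and \<tau>: "\<tau> : {t..s}" for s \<tau>
  proof (rule J.stays_on_edge[of t s y])
   have sT: "{t..s} \<subseteq> {t..T}" using before_exit_time(1)[OF s] by simp
   show "continuous_on {t..s} y" by (rule continuous_on_subset[OF primitive_on_continuous[OF J.trajD(1)[OF yp]] sT])
   show "y \<tau> : junction" "y \<tau> ~= 0" if "\<tau> : {t..s}" for \<tau>
    using that sT before_exit_time(2)[OF s that] by (blast intro: J.trajD(2)[OF yp])+
  qed (rule yt \<tau>)+
  have yj: "y s : junction" if s: "s : {t<..<exit_time T t y}" for s
   by (rule J.trajD(2)[OF yp]) (use before_exit_time(1)[OF s] s in simp)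
  \<comment> \<open>Before the exit time the curve stays on edge i, so near s its norm is its i-th
    coordinate, and the derivative of that coordinate is the only initial velocity available at
    \<open>y s\<close>.\<close>
  have interior: "EX a. ((%\<sigma>. norm (y \<sigma>)) has_real_derivative a) (at s) & J.vels i (norm (y s)) s = {a} &
   norm (y s) > 0 & y s = norm (y s) *\<^sub>R axis i 1 & 0 <= s & s < T" if s: "s : {t<..<exit_time T t y}" for s
  proof -
   have sT: "t < s" "s < T" "0 <= s" "s : {t..s}" using before_exit_time(1)[OF s] s t by simp_all
   have ysi: "y s $ i > 0" by (rule pos[OF s sT(4)])
   have n: "norm (y s) = y s $ i" by (rule junction_norm_nth[OF yj[OF s] ysi])
   have ys: "y s = norm (y s) *\<^sub>R axis i 1" unfolding n by (rule junction_eq_axis[OF yj[OF s] ysi])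
   obtain a where a: "((%\<sigma>. y \<sigma> $ i) has_real_derivative a) (at s)"
    "!!z h. J.opt s z h ==> z s = y s ==> (z has_vector_derivative a *\<^sub>R axis i 1) (at s within {s..T})"
    by (rule J.interior_velocity[OF g(2) t(1) sT(1,2) pos[OF s]]) (assumption, rule that)
   have "\<forall>\<^sub>F \<sigma> in nhds s. \<sigma> : {t<..<exit_time T t y}" by (rule eventually_nhds_in_open) (use s in simp_all)
   then have "\<forall>\<^sub>F \<sigma> in nhds s. norm (y \<sigma>) = y \<sigma> $ i"
   proof eventually_elim
    case (elim \<sigma>)
    have "\<sigma> : {t..\<sigma>}" using elim by simp
    then show ?case by (rule junction_norm_nth[OF yj[OF elim] pos[OF elim]])
   qed
   from DERIV_cong_ev[OF refl this refl] a(1) have "((%\<sigma>. norm (y \<sigma>)) has_real_derivative a) (at s)" by blast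
   moreover have "J.vels i (norm (y s)) s = {a}"
   proof -
    have "b = a" if b: "b : J.vels i (norm (y s)) s" for b
    proof -
     obtain z h where z: "J.opt s z h" "z s = norm (y s) *\<^sub>R axis i 1" "(z has_vector_derivative b *\<^sub>R axis i 1) (at s within {s..T})"
      using b unfolding J.vels_def by blast
     have "z s = y s" using z(2) ys by simp
     from J.axis_vel_unique[OF z(3) a(2)[OF z(1) this] sT(2)] show ?thesis .
    qed
    moreover have "J.vels i (norm (y s)) s ~= {}" by (rule J.vels_nonempty[OF sT(3,2)]) (use n ysi in simp)
    ultimately show ?thesis by blast
   qed
   moreover have "norm (y s) > 0" using n ysi by simp
   ultimately show ?thesis using ys sT(2,3) by blast
  qed
  have "is_singleton (init_velocities p T L Ls G Gs \<mu> (y s) s)" if s: "s : {t<..<exit_time T t y}" for s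
  proof -
   obtain a where a: "J.vels i (norm (y s)) s = {a}" "norm (y s) > 0" "y s = norm (y s) *\<^sub>R axis i 1" "0 <= s" "s < T"
    using interior[OF s] by blast
   have "init_velocities p T L Ls G Gs \<mu> (y s) s = {a}" using vels[OF a(2,4,5), of i] a(1,3) by simp
   then show ?thesis unfolding is_singleton_def by blast
  qed
  moreover have "(EX D. ((%\<rho>. u (\<rho> *\<^sub>R axis i 1) t) has_real_derivative D) (at xb)) \<longleftrightarrow>
   is_singleton (init_velocities p T L Ls G Gs \<mu> (xb *\<^sub>R axis i 1) t)"
   unfolding D_iff[OF x t] vels[OF x t] is_singleton_def
   using J.vels_eq_if_differentiable(2)[OF t x] J.differentiable_if_vels_singleton[OF t x] by blast
  moreover have "init_velocities p T L Ls G Gs \<mu> (xb *\<^sub>R axis i 1) t = {a. d_a (L i (m t)) xb a = - D} &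
    (EX h. ((%q. Hamiltonian L m i xb q t) has_real_derivative h) (at D) &
     init_velocities p T L Ls G Gs \<mu> (xb *\<^sub>R axis i 1) t = {- h})"
   if D: "((%\<rho>. u (\<rho> *\<^sub>R axis i 1) t) has_real_derivative D) (at xb)" for D
  proof -
   note D' = D[unfolded D_iff[OF x t]]
   note ve = J.vels_eq_if_differentiable[OF t x D']
   obtain a where a: "J.vels i xb t = {a}" using ve(2) by blast
   have la: "d_a (L i (flow \<mu> t)) xb a = - D" using ve(1) a by blast
   have t': "t : {0..T}" "xb >= 0" using t x by simp_all
   have "((%q. Hamiltonian L m i xb q t) has_real_derivative - a) (at D)"
    using J.hamiltonian_deriv[OF t' la] unfolding Hamiltonian_def m[OF t] .
   moreover have "init_velocities p T L Ls G Gs \<mu> (xb *\<^sub>R axis i 1) t = {- (- a)}" unfolding vels[OF x t] a by simp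
   ultimately show ?thesis unfolding vels[OF x t] m[OF t] using ve(1) by blast
  qed
  moreover have "EX v. ((%\<sigma>. norm (y \<sigma>)) has_real_derivative v) (at s) &
    ((%\<rho>. u (\<rho> *\<^sub>R axis i 1) s) has_real_derivative - d_a (L i (m s)) (norm (y s)) v) (at (norm (y s)))"
   if s: "s : {t<..<exit_time T t y}" for s
  proof -
   obtain a where a: "((%\<sigma>. norm (y \<sigma>)) has_real_derivative a) (at s)" "J.vels i (norm (y s)) s = {a}" "norm (y s) > 0" "0 <= s" "s < T"
    using interior[OF s] by blast
   from J.differentiable_if_vels_singleton[OF a(4,5,3,2)] a(1)
   show ?thesis unfolding D_iff[OF a(3-5)] m[OF a(4,5)] by blast
  qed
  ultimately show ?thesis by blast
 qed
 ultimately show ?thesis unfolding Let_def by blast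
qed

end
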